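(* Let $W$ be a finite irreducible Coxeter group with Coxeter number $h$, and fix a Coxeter element $c$ of $W$. The forward orbit of $c^{-1}$ under $\mathsf{Pop}_T(\cdot,c)$ is \[O_{\mathsf{Pop}_T}(c^{-1})=\{c^{-1},c^{-2},\ldots,c^{-(h-1)},e\}.\] The element $c^{-1}$ has no preimages under $\mathsf{Pop}_T(\cdot,c)$. Moreover, if $2\le i\le h-1$, then the only preimage of $c^{-i}$ under $\mathsf{Pop}_T(\cdot,c)$ is $c^{-(i-1)}$.
   Context: $W$ has set of simple reflections $S$, set of reflections $T=\{wsw^{-1}: s\in S,\ w\in W\}$, and Coxeter number $h$ (its largest fundamental degree). For $w\in W$, $\ell_T(w)$ is the minimum number of reflections whose product is $w$. The absolute order is defined by $v\le_T w$ iff $\ell_T(wv^{-1})=\ell_T(w)-\ell_T(v)$. A Coxeter element is a regular element of $W$ (an element having an eigenvector, in the geometric representation, lying on no reflecting hyperplane) of order $h$. The noncrossing partition lattice $\mathrm{NC}(W,c)$ is the interval $[e,c]$ in the absolute order; it is a lattice, and joins $\bigvee$ are taken in it. The noncrossing projection is $\pi_T(w,c)=\bigvee_{t\in T,\ t\le_T w} t$ (join in $\mathrm{NC}(W,c)$; the empty join is $e$), and the Coxeter pop-tsack torsing operator is $\mathsf{Pop}_T(w,c)=w\,\pi_T(w,c)^{-1}$. For a map $f:X\to X$, the forward orbit of $x$ is $O_f(x)=\{x,f(x),f^2(x),\ldots\}$. *)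

theory Defs
  imports
    Complex_Main
    "HOL-Library.Poly_Mapping"
    "HOL-Algebra.Lattice"
    "HOL-Algebra.Multiplicative_Group"
    "HOL-Algebra.Generated_Groups"
begin

section \<open>Coxeter systems\<close>

definition word_prod :: "('a, 'b) monoid_scheme \<Rightarrow> 'a list \<Rightarrow> 'a"
  where "word_prod G ws = foldr (\<lambda>x y. x \<otimes>\<^bsub>G\<^esub> y) ws \<one>\<^bsub>G\<^esub>"

text \<open>
  The congruence on words over \<open>S\<close> generated by the relations \<open>(s t)\<^sup>m = 1\<close>, where \<open>m\<close> is
  the order of \<open>s t\<close> in \<open>G\<close>. For \<open>s = t\<close> this is \<open>s s = 1\<close>, so that no formal inverses of the
  generators are needed. If \<open>s t\<close> has infinite order, then \<open>group.ord\<close> is \<open>0\<close> and the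
  relation is void.
\<close>

inductive coxeter_congruence ::
    "('a, 'b) monoid_scheme \<Rightarrow> 'a set \<Rightarrow> 'a list \<Rightarrow> 'a list \<Rightarrow> bool"
  for G :: "('a, 'b) monoid_scheme" and S :: "'a set"
  where
    relation: "\<lbrakk>s \<in> S; t \<in> S; us \<in> lists S; vs \<in> lists S\<rbrakk> \<Longrightarrow>
      coxeter_congruence G S
        (us @ concat (replicate (group.ord G (s \<otimes>\<^bsub>G\<^esub> t)) [s, t]) @ vs) (us @ vs)"
  | reflexive: "us \<in> lists S \<Longrightarrow> coxeter_congruence G S us us"
  | symmetric: "coxeter_congruence G S us vs \<Longrightarrow> coxeter_congruence G S vs us"
  | transitive: "\<lbrakk>coxeter_congruence G S us vs; coxeter_congruence G S vs ws\<rbrakk> \<Longrightarrow>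
      coxeter_congruence G S us ws"

text \<open>
  The last assumption says that \<open>G\<close> is presented by the generators \<open>S\<close> and the relations
  \<open>(s t)\<^sup>m = 1\<close>: every word representing the identity is trivial modulo these relations.
\<close>

locale coxeter_system = group G for G (structure) +
  fixes S :: "'a set"
  assumes simple_in_carrier: "S \<subseteq> carrier G"
    and simple_order: "s \<in> S \<Longrightarrow> ord s = 2"
    and simple_generate: "generate G S = carrier G"
    and presentation: "\<lbrakk>ws \<in> lists S; word_prod G ws = \<one>\<rbrakk> \<Longrightarrow> coxeter_congruence G S ws []"

text \<open>
  Irreducibility is connectedness of the (nonempty) Coxeter diagram, in which distinct \<open>s\<close>
  and \<open>t\<close> are adjacent iff \<open>s t\<close> does not have order 2.
\<close>

definition diagram_edges :: "('a, 'b) monoid_scheme \<Rightarrow> 'a set \<Rightarrow> ('a \<times> 'a) set"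
  where "diagram_edges G S =
    {(s, t). s \<in> S \<and> t \<in> S \<and> s \<noteq> t \<and> group.ord G (s \<otimes>\<^bsub>G\<^esub> t) \<noteq> 2}"

locale finite_irreducible_coxeter_system = coxeter_system +
  assumes finite_group: "finite (carrier G)"
    and rank_pos: "S \<noteq> {}"
    and diagram_connected: "\<lbrakk>s \<in> S; t \<in> S\<rbrakk> \<Longrightarrow> (s, t) \<in> (diagram_edges G S)\<^sup>*"

definition reflections :: "('a, 'b) monoid_scheme \<Rightarrow> 'a set \<Rightarrow> 'a set"
  where "reflections G S = {w \<otimes>\<^bsub>G\<^esub> s \<otimes>\<^bsub>G\<^esub> inv\<^bsub>G\<^esub> w | w s. w \<in> carrier G \<and> s \<in> S}"


section \<open>The geometric representation\<close>

text \<open>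
  A vector is given by its coordinates with respect to the basis of simple roots, which is
  indexed by \<open>S\<close>. The scalars are left polymorphic: \<^typ>\<open>real\<close> gives the geometric
  representation and \<^typ>\<open>complex\<close> its complexification.
\<close>

definition geom_space :: "'a set \<Rightarrow> ('a \<Rightarrow> 'k::real_normed_field) set"
  where "geom_space S = {v. \<forall>s. s \<notin> S \<longrightarrow> v s = 0}"

text \<open>If \<open>s t\<close> has infinite order, this evaluates to \<open>- cos 0 = - 1\<close>, the usual convention.\<close>

definition root_form :: "('a, 'b) monoid_scheme \<Rightarrow> 'a \<Rightarrow> 'a \<Rightarrow> real"
  where "root_form G s t = - cos (pi / real (group.ord G (s \<otimes>\<^bsub>G\<^esub> t)))"

text \<open>The map \<open>v \<mapsto> v - 2 B(\<alpha>\<^sub>s, v) \<alpha>\<^sub>s\<close>.\<close>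

definition simple_action ::
    "('a, 'b) monoid_scheme \<Rightarrow> 'a set \<Rightarrow> 'a \<Rightarrow> ('a \<Rightarrow> 'k::real_normed_field) \<Rightarrow> 'a \<Rightarrow> 'k"
  where "simple_action G S s v =
    v (s := v s - 2 * (\<Sum>t\<in>S. of_real (root_form G s t) * v t))"

text \<open>
  The homomorphism extending \<^const>\<open>simple_action\<close>. The maps attached to the generators
  satisfy the defining relations of \<open>G\<close>, so the choice of the word does not matter.
\<close>

definition geom_action ::
    "('a, 'b) monoid_scheme \<Rightarrow> 'a set \<Rightarrow> 'a \<Rightarrow> ('a \<Rightarrow> 'k::real_normed_field) \<Rightarrow> 'a \<Rightarrow> 'k"
  where "geom_action G S w =
    foldr (simple_action G S) (SOME ws. ws \<in> lists S \<and> word_prod G ws = w)"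

definition reflecting_hyperplane ::
    "('a, 'b) monoid_scheme \<Rightarrow> 'a set \<Rightarrow> 'a \<Rightarrow> ('a \<Rightarrow> 'k::real_normed_field) set"
  where "reflecting_hyperplane G S t = {v \<in> geom_space S. geom_action G S t v = v}"

text \<open>
  Eigenvectors are taken in the complexification: a Coxeter element of rank at least 2 need
  not have any real eigenvector.
\<close>

definition regular_element :: "('a, 'b) monoid_scheme \<Rightarrow> 'a set \<Rightarrow> 'a \<Rightarrow> bool"
  where "regular_element G S w \<longleftrightarrow> w \<in> carrier G \<and>
    (\<exists>(v :: 'a \<Rightarrow> complex) \<in> geom_space S. \<exists>z.
       v \<noteq> (\<lambda>_. 0) \<and> geom_action G S w v = (\<lambda>s. z * v s) \<and>
       (\<forall>t\<in>reflections G S. v \<notin> reflecting_hyperplane G S t))"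


section \<open>Fundamental degrees and the Coxeter number\<close>

text \<open>
  A polynomial in variables indexed by \<open>'i\<close> is a finitely supported map from monomials
  \<open>'i \<Rightarrow>\<^sub>0 nat\<close> to coefficients.
\<close>

type_synonym ('i, 'c) mpoly = "('i \<Rightarrow>\<^sub>0 nat) \<Rightarrow>\<^sub>0 'c"

definition mpolys_in :: "'i set \<Rightarrow> ('i, 'c::zero) mpoly set"
  where "mpolys_in I = {p. \<forall>m\<in>Poly_Mapping.keys p. Poly_Mapping.keys m \<subseteq> I}"

definition homogeneous :: "nat \<Rightarrow> ('i, 'c::zero) mpoly \<Rightarrow> bool"
  where "homogeneous d p \<longleftrightarrow> (\<forall>m\<in>Poly_Mapping.keys p. (\<Sum>i\<in>Poly_Mapping.keys m. Poly_Mapping.lookup m i) = d)"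

text \<open>Evaluation at \<open>x\<close>, with coefficients mapped into the target ring by \<open>\<phi>\<close>.\<close>

definition mpoly_eval :: "('c \<Rightarrow> 'r) \<Rightarrow> ('i, 'c::zero) mpoly \<Rightarrow> ('i \<Rightarrow> 'r::comm_semiring_1) \<Rightarrow> 'r"
  where "mpoly_eval \<phi> p x = (\<Sum>m\<in>Poly_Mapping.keys p. \<phi> (Poly_Mapping.lookup p m) * (\<Prod>i\<in>Poly_Mapping.keys m. x i ^ Poly_Mapping.lookup m i))"

definition mpoly_subst ::
    "('i, 'c) mpoly \<Rightarrow> ('i \<Rightarrow> ('j, 'c) mpoly) \<Rightarrow> ('j, 'c::comm_semiring_1) mpoly"
  where "mpoly_subst p f = mpoly_eval (Poly_Mapping.single 0) p f"

definition invariant_ring :: "('a, 'b) monoid_scheme \<Rightarrow> 'a set \<Rightarrow> ('a, real) mpoly set"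
  where "invariant_ring G S = {p \<in> mpolys_in S.
    \<forall>w\<in>carrier G. \<forall>v\<in>geom_space S. mpoly_eval id p (geom_action G S w v) = mpoly_eval id p v}"

text \<open>
  \<open>f 0, \<dots>, f (n - 1)\<close>, with \<open>n = card S\<close> the rank, are homogeneous of degrees
  \<open>d 0, \<dots>, d (n - 1)\<close>, algebraically independent, and generate the algebra of invariants.
\<close>

definition basic_invariants ::
    "('a, 'b) monoid_scheme \<Rightarrow> 'a set \<Rightarrow> (nat \<Rightarrow> ('a, real) mpoly) \<Rightarrow> (nat \<Rightarrow> nat) \<Rightarrow> bool"
  where "basic_invariants G S f d \<longleftrightarrow>
    (\<forall>i<card S. f i \<in> invariant_ring G S \<and> homogeneous (d i) (f i)) \<and>
    (\<forall>p\<in>mpolys_in {..<card S}. mpoly_subst p f = 0 \<longrightarrow> p = 0) \<and>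
    invariant_ring G S = {mpoly_subst p f | p. p \<in> mpolys_in {..<card S}}"

text \<open>
  A relation rather than a function: that basic invariants exist and that their degrees are
  unique are theorems (Chevalley).
\<close>

definition is_coxeter_number :: "('a, 'b) monoid_scheme \<Rightarrow> 'a set \<Rightarrow> nat \<Rightarrow> bool"
  where "is_coxeter_number G S h \<longleftrightarrow>
    (\<exists>f d. basic_invariants G S f d \<and> h = Max (d ` {..<card S}))"

text \<open>Here \<open>h\<close> is to be the Coxeter number.\<close>

definition coxeter_element :: "('a, 'b) monoid_scheme \<Rightarrow> 'a set \<Rightarrow> nat \<Rightarrow> 'a \<Rightarrow> bool"
  where "coxeter_element G S h c \<longleftrightarrow> regular_element G S c \<and> group.ord G c = h"


section \<open>Absolute order and noncrossing partitions\<close>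

definition abs_length :: "('a, 'b) monoid_scheme \<Rightarrow> 'a set \<Rightarrow> 'a \<Rightarrow> nat"
  where "abs_length G S w =
    (LEAST k. \<exists>ts\<in>lists (reflections G S). length ts = k \<and> word_prod G ts = w)"

definition abs_le :: "('a, 'b) monoid_scheme \<Rightarrow> 'a set \<Rightarrow> 'a \<Rightarrow> 'a \<Rightarrow> bool"
  where "abs_le G S v w \<longleftrightarrow>
    int (abs_length G S (w \<otimes>\<^bsub>G\<^esub> inv\<^bsub>G\<^esub> v)) = int (abs_length G S w) - int (abs_length G S v)"

definition NC :: "('a, 'b) monoid_scheme \<Rightarrow> 'a set \<Rightarrow> 'a \<Rightarrow> 'a gorder"
  where "NC G S c =
    \<lparr>carrier = {w \<in> carrier G. abs_le G S \<one>\<^bsub>G\<^esub> w \<and> abs_le G S w c},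
     eq = (=), le = abs_le G S\<rparr>"

definition nc_proj :: "('a, 'b) monoid_scheme \<Rightarrow> 'a set \<Rightarrow> 'a \<Rightarrow> 'a \<Rightarrow> 'a"
  where "nc_proj G S w c = \<Squnion>\<^bsub>NC G S c\<^esub>{t \<in> reflections G S. abs_le G S t w}"

definition Pop :: "('a, 'b) monoid_scheme \<Rightarrow> 'a set \<Rightarrow> 'a \<Rightarrow> 'a \<Rightarrow> 'a"
  where "Pop G S w c = w \<otimes>\<^bsub>G\<^esub> inv\<^bsub>G\<^esub> (nc_proj G S w c)"

definition forward_orbit :: "('x \<Rightarrow> 'x) \<Rightarrow> 'x \<Rightarrow> 'x set"
  where "forward_orbit f x = {(f ^^ n) x | n. True}"

end

theory Submission
  imports Defs "HOL-Library.Function_Algebras" "HOL-Number_Theory.Cong" "Jordan_Normal_Form.Determinant"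
begin

text \<open>
  The geometric representation \<open>V\<close> turns the absolute order into linear algebra: \<open>\<ell>\<^sub>T(w)\<close> is the
  codimension of the fixed space (Carter), and \<open>t \<le>\<^sub>T w\<close> iff the root of \<open>t\<close> lies in the moved space
  of \<open>w\<close>. Let \<open>v\<close> be the regular eigenvector of \<open>c\<close>.

  If \<open>w\<close> is a nontrivial power of \<open>c\<close>, its projection \<open>\<pi>\<close> commutes with \<open>c\<close>. The eigenspace of \<open>v\<close> is a
  line, so \<open>\<pi>\<close> scales \<open>v\<close>, not trivially; hence \<open>v\<close> lies in the moved space of \<open>\<pi>\<close>, and \<open>\<pi> \<le>\<^sub>T c\<close>
  forces \<open>\<pi> v = c v\<close>. Since \<open>v\<close> has trivial stabilizer, \<open>\<pi> = c\<close>. Conversely, if \<open>w \<pi>\<^sup>-\<^sup>1 = c\<^sup>-\<^sup>i\<close> for the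
  projection \<open>\<pi>\<close> of \<open>w\<close>, then \<open>Fix \<pi> \<subseteq> Fix c\<^sup>-\<^sup>i\<close>, so \<open>\<pi>\<close> lies above every reflection below \<open>c\<^sup>-\<^sup>i\<close> and
  therefore \<open>\<pi> = c\<close>.

  The facts on \<open>v\<close> are Springer's: the differentials at \<open>v\<close> of the basic invariants are a basis of the
  dual space, in which \<open>c\<close> is diagonal with eigenvalues \<open>z\<^sup>d\<^sup>-\<^sup>1\<close>, \<open>d\<close> running over the degrees. They also
  give \<open>2 |T| \<le> n h\<close>.

  That joins exist is proved without classification. A Galois conjugate of \<open>V\<close> makes the eigenvalue of
  \<open>v\<close> equal to \<open>exp(2 \<pi> \<i> / h)\<close>. The bound on \<open>|T|\<close> then shows that the form
  \<open>E(x, y) = \<langle>(1 - c)\<^sup>-\<^sup>1 x, y\<rangle>\<close> has the sign pattern dictated by the angles between the projections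
  of the roots to the Coxeter plane spanned by \<open>v\<close>. By sweeping these angles, the roots in the moved space of
  a noncrossing element are reached from its last root downwards, and any two such systems of roots intersect
  in another one.
\<close>

section \<open>Dimension of finitely spanned subspaces\<close>

text \<open>Two obstacles shape the proof. The hypothesis says only that \<open>c\<close> is regular
  of order \<open>h\<close>, not that it is a product of the simple reflections, so its eigenvalue
  may be any primitive \<open>h\<close>-th root of unity and the usual picture of the Coxeter plane
  is not at hand in the given representation. Since the absolute order lives in the group alone, the
  lattice question may be settled in any suitable reflection representation; this is why Carter's
  theory is developed in an abstract locale and instantiated twice. The lattice argument is modelled
  on hereditary categories: \<open>E\<close> plays the Euler form, roots are indecomposable objects
  up to shift, \<open>-c\<close> is the inverse Serre functor, noncrossing elements are thick
  subcategories, a half plane of roots is a heart, and a meet is the intersection of two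
  subcategories. The numerical input that replaces the category is that a sector of angle
  \<open>2 pi / h\<close> holds at most \<open>n\<close> roots; it is then a basis dual under
  \<open>E\<close> to the simple roots.\<close>

lemma dim_mono_finite_span:
  fixes A B :: "'v::real_vector set"
  assumes "A \<subseteq> B" and "finite F" and "B \<subseteq> span F"
  shows "dim A \<le> dim B"
proof -
  obtain C where C: "C \<subseteq> B" "independent C" "B \<subseteq> span C" "card C = dim B"
    using basis_exists by blast
  have "finite C" using independent_span_bound[OF assms(2) C(2)] C(1) assms(3) by blast
  then show ?thesis using dim_le_card[of A C] C assms(1) by auto
qed

text \<open>In a general real vector space \<open>dim\<close> is 0 on a space without a finite
  basis, so comparisons of dimensions carry a finite spanning set along.\<close>

lemma dim_less_finite_span:
  fixes A B :: "'v::real_vector set"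
  assumes "subspace A" and "A \<subseteq> B" and "x \<in> B" and "x \<notin> A" and "finite F" and "B \<subseteq> span F"
  shows "dim A + 1 \<le> dim B"
proof -
  obtain C where C: "C \<subseteq> A" "independent C" "A \<subseteq> span C" "card C = dim A"
    using basis_exists by blast
  obtain D where D: "D \<subseteq> B" "independent D" "B \<subseteq> span D" "card D = dim B"
    using basis_exists by blast
  have fD: "finite D" using independent_span_bound[OF assms(5) D(2)] D(1) assms(6) by blast
  have "span C \<subseteq> A" using C(1) assms(1) by (simp add: span_minimal)
  then have x: "x \<notin> span C" using assms(4) by blast
  then have "independent (insert x C)" using C(2) by (simp add: independent_insertI)
  moreover have "insert x C \<subseteq> span D" using C(1) D(3) assms(2,3) by blast
  ultimately have "finite (insert x C) \<and> card (insert x C) \<le> card D"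
    by (rule independent_span_bound[OF fD])
  moreover have "x \<notin> C" using x span_base by blast
  ultimately show ?thesis using C(4) D(4) by auto
qed

lemma dim_le_kernel_functional:
  fixes A :: "'v::real_vector set" and f :: "'v \<Rightarrow> real"
  assumes "subspace A" and "finite F" and "A \<subseteq> span F"
    and add: "\<And>x y. f (x + y) = f x + f y" and scale: "\<And>a x. f (a *\<^sub>R x) = a * f x"
  shows "dim A \<le> dim {x \<in> A. f x = 0} + 1"
proof (cases "\<forall>x\<in>A. f x = 0")
  case True
  then have "{x \<in> A. f x = 0} = A" by auto
  then show ?thesis by simp
next
  case False
  then obtain a where a: "a \<in> A" "f a \<noteq> 0" by blast
  let ?K = "{x \<in> A. f x = 0}"
  obtain C where C: "C \<subseteq> ?K" "independent C" "?K \<subseteq> span C" "card C = dim ?K"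
    using basis_exists by blast
  have fC: "finite C" using independent_span_bound[OF assms(2) C(2)] C(1) assms(3) by blast
  have "A \<subseteq> span (insert a C)"
  proof
    fix x assume x: "x \<in> A"
    let ?y = "x + (- (f x / f a)) *\<^sub>R a"
    have "?y \<in> A" using x a assms(1) by (intro subspace_add subspace_scale)
    moreover have "f ?y = 0" unfolding add scale using a by simp
    ultimately have "?y \<in> span C" using C(3) by auto
    then have "?y \<in> span (insert a C)" using span_mono[of C "insert a C"] by auto
    then have "?y + (f x / f a) *\<^sub>R a \<in> span (insert a C)"
      by (rule span_add[OF _ span_scale[OF span_base]]) simp
    moreover have "?y + (f x / f a) *\<^sub>R a = x" by simp
    ultimately show "x \<in> span (insert a C)" by metis
  qed
  then have "dim A \<le> card (insert a C)" using fC by (intro dim_le_card) auto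
  then show ?thesis using C(4) fC card_insert_le_m1[of "card C + 1" C a] by (simp add: card_insert_if split: if_splits)
qed

context group
begin

lemma word_prod_Nil: "word_prod G [] = \<one>" by (simp add: word_prod_def)
lemma word_prod_Cons: "word_prod G (x # xs) = x \<otimes> word_prod G xs" by (simp add: word_prod_def)
lemma word_prod_closed: "xs \<in> lists (carrier G) \<Longrightarrow> word_prod G xs \<in> carrier G"
  by (induction xs) (auto simp: word_prod_Nil word_prod_Cons)
lemma word_prod_append: "xs \<in> lists (carrier G) \<Longrightarrow> ys \<in> lists (carrier G) \<Longrightarrow>
   word_prod G (xs @ ys) = word_prod G xs \<otimes> word_prod G ys"
  by (induction xs) (auto simp: word_prod_Nil word_prod_Cons m_assoc word_prod_closed)

end

section \<open>Finite groups generated by reflections\<close>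

text \<open>What Carter's theory uses of a reflection representation; the geometric representation
  and its Galois conjugates are both instances. \<open>steinberg\<close> puts the fixed space of a
  nontrivial element inside some reflecting hyperplane.\<close>

locale refl_rep = group G for G (structure) +
  fixes S :: "'a set" and V :: "'v::real_vector set" and act :: "'a \<Rightarrow> 'v \<Rightarrow> 'v"
    and ip :: "'v \<Rightarrow> 'v \<Rightarrow> real"
  assumes fin: "finite (carrier G)" and S_sub: "S \<subseteq> carrier G"
    and V_subspace: "subspace V" and V_fin: "\<exists>B. finite B \<and> V \<subseteq> span B"
    and act_add: "g \<in> carrier G \<Longrightarrow> act g (x + y) = act g x + act g y"
    and act_scale: "g \<in> carrier G \<Longrightarrow> act g (a *\<^sub>R x) = a *\<^sub>R act g x"
    and act_V: "g \<in> carrier G \<Longrightarrow> x \<in> V \<Longrightarrow> act g x \<in> V"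
    and act_mult: "g \<in> carrier G \<Longrightarrow> k \<in> carrier G \<Longrightarrow> act (g \<otimes> k) x = act g (act k x)"
    and act_one: "act \<one> x = x"
    and ip_add: "ip (x + y) z = ip x z + ip y z" and ip_scale: "ip (a *\<^sub>R x) z = a * ip x z"
    and ip_sym: "ip x y = ip y x" and ip_pos: "x \<in> V \<Longrightarrow> x \<noteq> 0 \<Longrightarrow> ip x x > 0"
    and ip_act: "g \<in> carrier G \<Longrightarrow> ip (act g x) (act g y) = ip x y"
    and reflects: "t \<in> reflections G S \<Longrightarrow>
      \<exists>r\<in>V. r \<noteq> 0 \<and> act t r = - r \<and> (\<forall>x\<in>V. \<exists>a. act t x = x + a *\<^sub>R r)"
    and steinberg: "w \<in> carrier G \<Longrightarrow> w \<noteq> \<one> \<Longrightarrow>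
      \<exists>t\<in>reflections G S. \<forall>x\<in>V. act w x = x \<longrightarrow> act t x = x"
begin

abbreviation T where "T \<equiv> reflections G S"
abbreviation L where "L \<equiv> abs_length G S"

definition "Fx w = {x \<in> V. act w x = x}"
text \<open>The moved space. \<open>Mv_iff\<close> identifies it with the image of
  \<open>w - 1\<close>; written as an orthogonal complement, it visibly reverses inclusions of fixed
  spaces.\<close>

definition "Mv w = {y \<in> V. \<forall>f\<in>Fx w. ip y f = 0}"
text \<open>Roots are scaled to norm 2, so that the reflection formula has no denominator. Every
  reflection has exactly the two roots \<open>r\<close> and \<open>- r\<close>.\<close>

definition "isroot t r \<longleftrightarrow> t \<in> T \<and> r \<in> V \<and> ip r r = 2 \<and> (\<forall>x\<in>V. act t x = x - ip x r *\<^sub>R r)"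

lemma ip_add_right: "ip z (x + y) = ip z x + ip z y" by (metis ip_add ip_sym)
lemma ip_scale_right: "ip z (a *\<^sub>R x) = a * ip z x" by (metis ip_scale ip_sym)
lemma ip_minus: "ip (- x) z = - ip x z" using ip_scale[of "-1" x z] by simp
lemma ip_minus_right: "ip z (- x) = - ip z x" by (metis ip_minus ip_sym)
lemma ip_diff: "ip (x - y) z = ip x z - ip y z" using ip_add[of x "- y" z] by (simp add: ip_minus)
lemma ip_diff_right: "ip z (x - y) = ip z x - ip z y" by (metis ip_diff ip_sym)
lemma ip_zero: "ip 0 z = 0" using ip_scale[of 0 0 z] by simp
lemma ip_zero_right: "ip z 0 = 0" by (metis ip_zero ip_sym)
lemma ip_sum: "ip (\<Sum>i\<in>A. f i) z = (\<Sum>i\<in>A. ip (f i) z)"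
  by (induction A rule: infinite_finite_induct) (auto simp: ip_zero ip_add)
lemma ip_sum_right: "ip z (\<Sum>i\<in>A. f i) = (\<Sum>i\<in>A. ip z (f i))"
  by (induction A rule: infinite_finite_induct) (auto simp: ip_zero_right ip_add_right)

lemmas ip_simps = ip_add ip_add_right ip_scale ip_scale_right ip_minus ip_minus_right ip_diff ip_diff_right
  ip_zero ip_zero_right

lemma act_minus: "g \<in> carrier G \<Longrightarrow> act g (- x) = - act g x" using act_scale[of g "-1" x] by simp
lemma act_diff: "g \<in> carrier G \<Longrightarrow> act g (x - y) = act g x - act g y"
  using act_add[of g x "- y"] by (simp add: act_minus)
lemma act_zero: "g \<in> carrier G \<Longrightarrow> act g 0 = 0" using act_scale[of g 0 0] by simp
lemma act_sum: "g \<in> carrier G \<Longrightarrow> act g (\<Sum>i\<in>A. f i) = (\<Sum>i\<in>A. act g (f i))"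
  by (induction A rule: infinite_finite_induct) (auto simp: act_zero act_add)

lemmas act_simps = act_add act_scale act_minus act_diff act_zero

lemma act_inv_act: "g \<in> carrier G \<Longrightarrow> act (inv g) (act g x) = x"
  using act_mult[of "inv g" g x] by (simp add: act_one)
lemma act_act_inv: "g \<in> carrier G \<Longrightarrow> act g (act (inv g) x) = x"
  using act_mult[of g "inv g" x] by (simp add: act_one)
lemma ip_act_left: "g \<in> carrier G \<Longrightarrow> ip (act g x) y = ip x (act (inv g) y)"
  using ip_act[of g x "act (inv g) y"] by (simp add: act_act_inv)
lemma ip_act_right: "g \<in> carrier G \<Longrightarrow> ip x (act g y) = ip (act (inv g) x) y"
  using ip_act[of g "act (inv g) x" y] by (simp add: act_act_inv)

lemma V_0: "0 \<in> V" using V_subspace by (rule subspace_0)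
lemma V_add: "x \<in> V \<Longrightarrow> y \<in> V \<Longrightarrow> x + y \<in> V" using V_subspace by (rule subspace_add)
lemma V_diff: "x \<in> V \<Longrightarrow> y \<in> V \<Longrightarrow> x - y \<in> V" using V_subspace by (rule subspace_diff)
lemma V_scale: "x \<in> V \<Longrightarrow> a *\<^sub>R x \<in> V" using V_subspace by (rule subspace_scale)
lemma V_minus: "x \<in> V \<Longrightarrow> - x \<in> V" using V_subspace by (rule subspace_neg)
lemma V_sum: "(\<And>i. i \<in> A \<Longrightarrow> f i \<in> V) \<Longrightarrow> (\<Sum>i\<in>A. f i) \<in> V" using V_subspace by (rule subspace_sum)

lemmas V_intros = V_0 V_add V_diff V_scale V_minus V_sum

lemma ip_nondeg: "x \<in> V \<Longrightarrow> ip x x = 0 \<Longrightarrow> x = 0" using ip_pos by force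
lemma ip_ext: "x \<in> V \<Longrightarrow> y \<in> V \<Longrightarrow> (\<And>z. z \<in> V \<Longrightarrow> ip z x = ip z y) \<Longrightarrow> x = y"
  using ip_nondeg[of "x - y"] V_diff[of x y] by (simp add: ip_diff_right)

lemma T_carrier: "t \<in> T \<Longrightarrow> t \<in> carrier G"
  using S_sub by (auto simp: reflections_def)

lemma finite_T: "finite T"
  using fin T_carrier by (meson finite_subset subsetI)

lemma T_conj: assumes "g \<in> carrier G" "t \<in> T" shows "g \<otimes> t \<otimes> inv g \<in> T"
proof -
  obtain w s where ws: "t = w \<otimes> s \<otimes> inv w" "w \<in> carrier G" "s \<in> S"
    using assms(2) by (auto simp: reflections_def)
  have "g \<otimes> t \<otimes> inv g = (g \<otimes> w) \<otimes> s \<otimes> inv (g \<otimes> w)"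
    using assms(1) ws S_sub by (auto simp: m_assoc inv_mult_group)
  then show ?thesis using assms(1) ws by (auto simp: reflections_def)
qed

lemma faithful: assumes "w \<in> carrier G" "\<And>x. x \<in> V \<Longrightarrow> act w x = x" shows "w = \<one>"
proof (rule ccontr)
  assume "w \<noteq> \<one>"
  then obtain t where t: "t \<in> T" "\<forall>x\<in>V. act t x = x" using steinberg assms by metis
  then obtain r where r: "r \<in> V" "r \<noteq> 0" "act t r = - r" using reflects by blast
  then have "r = - r" using t by metis
  then have "2 *\<^sub>R r = 0" by (metis add.right_inverse scaleR_2)
  then show False using r by simp
qed

lemma act_inject: assumes "g \<in> carrier G" "k \<in> carrier G" "\<And>x. x \<in> V \<Longrightarrow> act g x = act k x" shows "g = k"
proof -
  have "inv k \<otimes> g = \<one>"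
    by (rule faithful) (use assms in \<open>auto simp: act_mult act_inv_act\<close>)
  then have "k \<otimes> (inv k \<otimes> g) = k \<otimes> \<one>" by simp
  then show ?thesis using assms by (simp flip: m_assoc)
qed

lemma root_exists: assumes "t \<in> T" shows "\<exists>r. isroot t r"
proof -
  obtain r where r: "r \<in> V" "r \<noteq> 0" "act t r = - r" "\<forall>x\<in>V. \<exists>a. act t x = x + a *\<^sub>R r"
    using reflects[OF assms] by blast
  define k where "k = sqrt (2 / ip r r)"
  have p: "ip r r > 0" using r ip_pos by blast
  have kk: "k * k * ip r r = 2" unfolding k_def using p by (simp add: power2_eq_square[symmetric])
  have tc: "t \<in> carrier G" using assms T_carrier by blast
  have k0: "k \<noteq> 0" using kk by auto
  have "act t x = x - ip x (k *\<^sub>R r) *\<^sub>R (k *\<^sub>R r)" if x: "x \<in> V" for x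
  proof -
    obtain a where a: "act t x = x + a *\<^sub>R r" using r x by blast
    have "ip (act t x) r = - ip (act t x) (act t r)" using r by (simp add: ip_simps)
    then have "ip x r + a * ip r r = - ip x r" using ip_act[OF tc, of x r] a by (simp add: ip_simps)
    then have "a * ip r r = - 2 * ip x r" by simp
    then have "a * ip r r = - (k * k * ip x r) * ip r r" using kk by (simp add: algebra_simps)
    then have "a = - (k * k * ip x r)" using p by (subst (asm) mult_cancel_right) simp
    then show ?thesis using a by (simp add: ip_simps algebra_simps)
  qed
  then have "isroot t (k *\<^sub>R r)"
    using r kk assms unfolding isroot_def by (auto simp: ip_simps algebra_simps intro: V_intros)
  then show ?thesis by blast
qed

lemma rootD: assumes "isroot t r"
  shows "t \<in> T" "t \<in> carrier G" "r \<in> V" "ip r r = 2" "x \<in> V \<Longrightarrow> act t x = x - ip x r *\<^sub>R r" "r \<noteq> 0"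
  using assms T_carrier by (auto simp: isroot_def ip_zero)

lemma root_neg: "isroot t r \<Longrightarrow> act t r = - r"
  using rootD(5)[of t r r] rootD(3,4)[of t r] by (simp add: scaleR_2)

lemma root_uminus: "isroot t r \<Longrightarrow> isroot t (- r)"
  unfolding isroot_def by (auto simp: ip_simps intro: V_intros)

lemma root_conj: assumes "isroot t r" "g \<in> carrier G" shows "isroot (g \<otimes> t \<otimes> inv g) (act g r)"
proof -
  note R = rootD[OF assms(1)]
  have "act (g \<otimes> t \<otimes> inv g) x = x - ip x (act g r) *\<^sub>R act g r" if "x \<in> V" for x
    using that R assms(2)
    by (simp add: act_mult act_V act_simps act_act_inv ip_act_right)
  then show ?thesis
    using R assms(2) T_conj by (auto simp: isroot_def ip_act act_V)
qed

lemma root_pm: assumes "isroot t r" "isroot t q" shows "q = r \<or> q = - r"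
proof -
  note R = rootD[OF assms(1)] and Q = rootD[OF assms(2)]
  have "- q = q - ip q r *\<^sub>R r" using root_neg[OF assms(2)] R(5)[OF Q(3)] by metis
  then have e: "2 *\<^sub>R q = ip q r *\<^sub>R r" by (simp add: scaleR_2 algebra_simps)
  then have "ip (2 *\<^sub>R q) (2 *\<^sub>R q) = ip (ip q r *\<^sub>R r) (ip q r *\<^sub>R r)" by metis
  then have "8 = 2 * (ip q r * ip q r)" using R Q by (simp add: ip_simps algebra_simps)
  then have "(ip q r - 2) * (ip q r + 2) = 0" by (simp add: algebra_simps)
  then have "ip q r = 2 \<or> ip q r = -2" by auto
  then show ?thesis
  proof
    assume "ip q r = 2"
    then show ?thesis using e by simp
  next
    assume "ip q r = -2"
    then have "2 *\<^sub>R q = 2 *\<^sub>R (- r)" using e by simp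
    then show ?thesis using scaleR_left_imp_eq[of 2 q "- r"] by simp
  qed
qed

lemma root_inj: "isroot t r \<Longrightarrow> isroot u r \<Longrightarrow> t = u"
  using rootD(2,5) act_inject by metis

lemma T_square: assumes "t \<in> T" shows "t \<otimes> t = \<one>" "inv t = t"
proof -
  obtain r where r: "isroot t r" using root_exists assms by blast
  note R = rootD[OF r]
  show "t \<otimes> t = \<one>"
  proof (rule faithful)
    fix x assume "x \<in> V"
    then show "act (t \<otimes> t) x = x"
      using R root_neg[OF r] by (simp add: act_mult act_V act_simps)
  qed (use R in auto)
  then show "inv t = t" using R(2) inv_equality by blast
qed

section \<open>Fixed spaces and moved spaces\<close>

lemma Fx_subspace: "w \<in> carrier G \<Longrightarrow> subspace (Fx w)"
  unfolding Fx_def subspace_def by (auto simp: V_intros act_simps)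

lemma Mv_subspace: "subspace (Mv w)"
  unfolding Mv_def subspace_def by (auto simp: V_intros ip_simps)

lemma Fx_inv: "w \<in> carrier G \<Longrightarrow> Fx (inv w) = Fx w"
  unfolding Fx_def by (metis act_act_inv act_inv_act)

lemma Mv_diff: assumes "w \<in> carrier G" "x \<in> V" shows "act w x - x \<in> Mv w"
proof -
  have "ip (act w x - x) f = 0" if "f \<in> Fx w" for f
  proof -
    have "act (inv w) f = f" using that Fx_inv[OF assms(1)] unfolding Fx_def by blast
    then show ?thesis using ip_act_left[OF assms(1), of x f] by (simp add: ip_diff)
  qed
  then show ?thesis using assms by (simp add: Mv_def V_diff act_V)
qed

text \<open>If $w$ has order $m$ and $y \perp \mathrm{Fix}(w)$, then $\sum_{i<m} w^i y = 0$, and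
  $x = \frac1m\sum_{i<m} i\, w^i y$ satisfies $wx - x = y$.\<close>

lemma Mv_exists: assumes "w \<in> carrier G" "y \<in> Mv w" shows "\<exists>x\<in>V. act w x - x = y"
proof -
  define m where "m = Coset.order G"
  have m: "m > 0" "w [^] m = \<one>" unfolding m_def using assms fin
    by (auto simp: order_gt_0_iff_finite pow_order_eq_1)
  define a where "a i = act (w [^] i) y" for i :: nat
  have yV: "y \<in> V" using assms by (simp add: Mv_def)
  have aV: "a i \<in> V" for i unfolding a_def using assms yV by (simp add: act_V)
  have aS: "act w (a i) = a (Suc i)" for i
  proof -
    have "w \<otimes> w [^] i = w [^] Suc i" using assms(1) by (metis nat_pow_Suc2)
    then show ?thesis unfolding a_def using assms(1) by (simp flip: act_mult)
  qed
  have am: "a m = y" "a 0 = y" unfolding a_def using m by (auto simp: act_one)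
  define s where "s = (\<Sum>i<m. a i)"
  have shift: "(\<Sum>i<m. a (Suc i)) = s"
    unfolding s_def using sum.lessThan_Suc_shift[of a m] am by (simp add: ac_simps)
  have sV: "s \<in> V" unfolding s_def by (intro V_sum aV)
  have sF: "act w s = s" using shift unfolding s_def using assms(1) by (simp add: act_sum aS)
  have pw: "act (w [^] i) s = s" for i :: nat
    by (induction i) (use assms(1) sF in \<open>auto simp: act_one act_mult\<close>)
  have "ip (a i) s = ip y s" for i
    unfolding a_def using ip_act[of "w [^] i" y s] assms(1) pw by simp
  moreover have "ip y s = 0" using assms(2) sF sV by (auto simp: Mv_def Fx_def)
  ultimately have "ip s s = 0" by (subst s_def) (simp add: ip_sum)
  then have s0: "s = 0" using sV ip_nondeg by blast
  define x where "x = (1 / real m) *\<^sub>R (\<Sum>i<m. real i *\<^sub>R a i)"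
  have tel: "(\<Sum>i<k. real i *\<^sub>R (a (Suc i) - a i)) = real k *\<^sub>R a k - (\<Sum>i<k. a (Suc i))" for k
    by (induction k) (auto simp: algebra_simps)
  have "act w x - x = (1 / real m) *\<^sub>R (\<Sum>i<m. real i *\<^sub>R (a (Suc i) - a i))"
    unfolding x_def using assms(1)
    by (simp add: act_scale act_sum aS scaleR_diff_right sum_subtractf)
  also have "\<dots> = y" unfolding tel shift s0 am using m by simp
  finally show ?thesis unfolding x_def by (intro bexI) (auto intro!: V_intros aV)
qed

lemma Mv_iff: "w \<in> carrier G \<Longrightarrow> y \<in> Mv w \<longleftrightarrow> (\<exists>x\<in>V. y = act w x - x)"
  using Mv_diff Mv_exists by metis

lemma Mv_V: "y \<in> Mv w \<Longrightarrow> y \<in> V" by (simp add: Mv_def)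

lemma Fx_iff_perp: assumes "w \<in> carrier G" "x \<in> V" shows "x \<in> Fx w \<longleftrightarrow> (\<forall>y\<in>Mv w. ip x y = 0)"
proof
  assume "x \<in> Fx w" then show "\<forall>y\<in>Mv w. ip x y = 0" using ip_sym by (auto simp: Mv_def)
next
  assume a: "\<forall>y\<in>Mv w. ip x y = 0"
  have "ip z (act (inv w) x - x) = 0" if "z \<in> V" for z
  proof -
    have "ip (act w z - z) x = 0" using a Mv_diff[OF assms(1) that] ip_sym by metis
    then show ?thesis using ip_act_left[OF assms(1), of z x] by (simp add: ip_simps)
  qed
  then have "act (inv w) x - x = 0" using assms by (intro ip_ext) (auto simp: ip_simps act_V intro: V_intros)
  then show "x \<in> Fx w" using assms Fx_inv[of w] by (auto simp: Fx_def)
qed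

lemma Mv_one: "Mv \<one> = {0}"
  using Mv_iff[of \<one>] V_0 by (auto simp: act_one)

lemma root_Mv_refl: assumes "isroot t r" shows "r \<in> Mv t"
proof -
  have "ip r f = 0" if "f \<in> Fx t" for f
  proof -
    have "ip f r *\<^sub>R r = 0" using that rootD(5)[OF assms, of f] by (simp add: Fx_def)
    then show ?thesis using rootD(6)[OF assms] ip_sym[of f r] by simp
  qed
  then show ?thesis using rootD[OF assms] by (auto simp: Mv_def)
qed

section \<open>Reflection length\<close>

lemma lists_T: "ts \<in> lists T \<Longrightarrow> ts \<in> lists (carrier G)" using T_carrier by auto

lemma dim_Fx_le: assumes "w \<in> carrier G" shows "dim (Fx w) \<le> dim V"
  using V_fin dim_mono_finite_span[of "Fx w" V] by (auto simp: Fx_def)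

lemma Fx_mult_root: assumes "isroot t r" "w \<in> carrier G" shows "{x \<in> Fx w. ip x r = 0} \<subseteq> Fx (t \<otimes> w)"
  using assms rootD[OF assms(1)] by (auto simp: Fx_def act_mult)

lemma dim_Fx_mult: assumes "t \<in> T" "w \<in> carrier G" shows "dim (Fx w) \<le> dim (Fx (t \<otimes> w)) + 1"
proof -
  obtain r where r: "isroot t r" using root_exists assms by blast
  obtain B where B: "finite B" "V \<subseteq> span B" using V_fin by blast
  have "dim (Fx w) \<le> dim {x \<in> Fx w. ip x r = 0} + 1"
    using B by (intro dim_le_kernel_functional[where F = B] Fx_subspace assms) (auto simp: Fx_def ip_simps)
  also have "dim {x \<in> Fx w. ip x r = 0} \<le> dim (Fx (t \<otimes> w))"
    using Fx_mult_root[OF r assms(2)] B by (intro dim_mono_finite_span[where F = B]) (auto simp: Fx_def)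
  finally show ?thesis by simp
qed

text \<open>If $r = wx - x$ is a root, then its reflection exchanges $x$ and $wx$.\<close>

lemma dim_Fx_gain: assumes "isroot t r" "w \<in> carrier G" "r \<in> Mv w"
  shows "dim (Fx (t \<otimes> w)) = dim (Fx w) + 1" "Fx w \<subseteq> Fx (t \<otimes> w)"
proof -
  note R = rootD[OF assms(1)]
  obtain x where x: "x \<in> V" "act w x - x = r" using Mv_exists assms by blast
  then have wx: "act w x = x + r" by (simp add: algebra_simps)
  have "ip (x + r) (x + r) = ip x x" using ip_act[OF assms(2), of x x] wx by simp
  then have "2 * ip x r + 2 = 0" using R(4) ip_sym[of r x] by (simp add: ip_simps)
  then have xr: "ip x r = -1" by simp
  have "act (t \<otimes> w) x = x" using R x wx xr assms(2)
    by (simp add: act_mult V_add ip_simps scaleR_2)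
  then have xF: "x \<in> Fx (t \<otimes> w)" "x \<notin> Fx w" using x wx R(6) by (auto simp: Fx_def)
  show sub: "Fx w \<subseteq> Fx (t \<otimes> w)" using assms(3) Fx_mult_root[OF assms(1,2)] by (auto simp: Mv_def ip_sym)
  obtain B where B: "finite B" "V \<subseteq> span B" using V_fin by blast
  have "dim (Fx w) + 1 \<le> dim (Fx (t \<otimes> w))"
    using xF sub B by (intro dim_less_finite_span[where F = B and x = x] Fx_subspace assms) (auto simp: Fx_def)
  moreover have "dim (Fx (t \<otimes> w)) \<le> dim (Fx (t \<otimes> (t \<otimes> w))) + 1" using dim_Fx_mult R(1,2) assms(2) by blast
  moreover have "t \<otimes> (t \<otimes> w) = w" using R(1,2) assms(2) T_square(1) by (simp flip: m_assoc)
  ultimately show "dim (Fx (t \<otimes> w)) = dim (Fx w) + 1" by simp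
qed

lemma exists_root_Mv: assumes "w \<in> carrier G" "w \<noteq> \<one>" shows "\<exists>t r. isroot t r \<and> r \<in> Mv w"
proof -
  obtain t where t: "t \<in> T" "\<forall>x\<in>V. act w x = x \<longrightarrow> act t x = x" using steinberg assms by blast
  obtain r where r: "isroot t r" using root_exists t by blast
  have "ip r x = 0" if "x \<in> Fx w" for x
    using that t rootD[OF r] by (auto simp: Fx_def ip_sym)
  then show ?thesis using r rootD[OF r] by (auto simp: Mv_def)
qed

text \<open>Steinberg's theorem puts a root into the moved space of \<open>w\<close>; multiplying by
  its reflection enlarges the fixed space by one dimension, and the induction continues from
  there.\<close>

lemma word_of_codim: "w \<in> carrier G \<Longrightarrow> \<exists>ts\<in>lists T. length ts = dim V - dim (Fx w) \<and> word_prod G ts = w"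
proof (induction "dim V - dim (Fx w)" arbitrary: w rule: less_induct)
  case less
  show ?case
  proof (cases "w = \<one>")
    case True
    have "Fx \<one> = V" by (auto simp: Fx_def act_one)
    then show ?thesis using True by (intro bexI[of _ "[]"]) (auto simp: word_prod_Nil)
  next
    case False
    then obtain t r where r: "isroot t r" "r \<in> Mv w" using exists_root_Mv less.prems by blast
    note R = rootD[OF r(1)]
    have d: "dim (Fx (t \<otimes> w)) = dim (Fx w) + 1" using dim_Fx_gain r less.prems by blast
    have "dim (Fx (t \<otimes> w)) \<le> dim V" using dim_Fx_le R less.prems by blast
    then obtain ts where ts: "ts \<in> lists T" "length ts = dim V - dim (Fx (t \<otimes> w))" "word_prod G ts = t \<otimes> w"
    proof -
      have "dim V - dim (Fx (t \<otimes> w)) < dim V - dim (Fx w)" using d \<open>dim (Fx (t \<otimes> w)) \<le> dim V\<close> by simp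
      then show ?thesis using less.hyps[of "t \<otimes> w"] R(2) less.prems that by blast
    qed
    have "t \<otimes> (t \<otimes> w) = w" using R(1,2) less.prems T_square(1) by (simp flip: m_assoc)
    then show ?thesis using ts d R \<open>dim (Fx (t \<otimes> w)) \<le> dim V\<close>
      by (intro bexI[of _ "t # ts"]) (auto simp: word_prod_Cons)
  qed
qed

text \<open>A further reflection costs at most one dimension of the fixed space, namely what its
  hyperplane cuts off.\<close>

lemma codim_le_word: "ts \<in> lists T \<Longrightarrow> dim V \<le> dim (Fx (word_prod G ts)) + length ts"
proof (induction ts)
  case Nil
  have "Fx \<one> = V" by (auto simp: Fx_def act_one)
  then show ?case by (simp add: word_prod_Nil)
next
  case (Cons t ts)
  then have t: "t \<in> T" and ts: "word_prod G ts \<in> carrier G" using word_prod_closed lists_T by auto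
  show ?case using Cons dim_Fx_mult[OF t ts] by (auto simp: word_prod_Cons)
qed

theorem carter: assumes "w \<in> carrier G" shows "L w = dim V - dim (Fx w)"
  unfolding abs_length_def
proof (rule Least_equality)
  show "\<exists>ts\<in>lists T. length ts = dim V - dim (Fx w) \<and> word_prod G ts = w" using word_of_codim assms by blast
  fix k assume "\<exists>ts\<in>lists T. length ts = k \<and> word_prod G ts = w"
  then obtain ts where "ts \<in> lists T" "length ts = k" "word_prod G ts = w" by blast
  then show "dim V - dim (Fx w) \<le> k" using codim_le_word[of ts] by simp
qed

lemma L_word: assumes "w \<in> carrier G" shows "\<exists>ts\<in>lists T. length ts = L w \<and> word_prod G ts = w"
  using word_of_codim carter assms by metis

lemma L_le: assumes "ts \<in> lists T" shows "L (word_prod G ts) \<le> length ts"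
  using codim_le_word[OF assms] carter[OF word_prod_closed[OF lists_T[OF assms]]] by simp

lemma L_mult: assumes "g \<in> carrier G" "k \<in> carrier G" shows "L (g \<otimes> k) \<le> L g + L k"
proof -
  obtain a b where "a \<in> lists T" "length a = L g" "word_prod G a = g" "b \<in> lists T" "length b = L k" "word_prod G b = k"
    using L_word[OF assms(1)] L_word[OF assms(2)] by blast
  then show ?thesis using L_le[of "a @ b"] word_prod_append[OF lists_T lists_T, of a b] by simp
qed

lemma L_conj_le: assumes "g \<in> carrier G" "w \<in> carrier G" shows "L (g \<otimes> w \<otimes> inv g) \<le> L w"
proof -
  have *: "word_prod G (map (\<lambda>t. g \<otimes> t \<otimes> inv g) a) = g \<otimes> word_prod G a \<otimes> inv g"
    if "a \<in> lists (carrier G)" for a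
    using that
  proof (induction a)
    case Nil then show ?case using assms by (simp add: word_prod_Nil)
  next
    case (Cons x xs)
    then have "x \<in> carrier G" "word_prod G xs \<in> carrier G" using word_prod_closed by auto
    moreover have "inv g \<otimes> (g \<otimes> (word_prod G xs \<otimes> inv g)) = word_prod G xs \<otimes> inv g"
      using calculation assms by (simp flip: m_assoc)
    ultimately show ?case using Cons assms by (simp add: word_prod_Cons m_assoc)
  qed
  obtain a where a: "a \<in> lists T" "length a = L w" "word_prod G a = w" using L_word assms by metis
  have "map (\<lambda>t. g \<otimes> t \<otimes> inv g) a \<in> lists T" using a assms T_conj by auto
  then show ?thesis using L_le[of "map (\<lambda>t. g \<otimes> t \<otimes> inv g) a"] * a lists_T by auto
qed

lemma L_conj: assumes "g \<in> carrier G" "w \<in> carrier G" shows "L (g \<otimes> w \<otimes> inv g) = L w"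
proof (rule antisym)
  have "w = inv g \<otimes> (g \<otimes> w \<otimes> inv g) \<otimes> inv (inv g)"
    using assms by (simp add: m_assoc) (simp flip: m_assoc)
  then show "L w \<le> L (g \<otimes> w \<otimes> inv g)" using L_conj_le[of "inv g" "g \<otimes> w \<otimes> inv g"] assms by simp
qed (rule L_conj_le[OF assms])

lemma L_comm: assumes "g \<in> carrier G" "k \<in> carrier G" shows "L (g \<otimes> k) = L (k \<otimes> g)"
proof -
  have "inv g \<otimes> (g \<otimes> k) \<otimes> inv (inv g) = k \<otimes> g" using assms by (simp flip: m_assoc)
  then show ?thesis using L_conj[of "inv g" "g \<otimes> k"] assms by simp
qed

lemma L_one: "L \<one> = 0"
  using L_le[of "[]"] by (simp add: word_prod_Nil)

lemma L_zero: assumes "w \<in> carrier G" "L w = 0" shows "w = \<one>"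
  using L_word[OF assms(1)] assms(2) by (auto simp: word_prod_Nil)

lemma L_refl: assumes "t \<in> T" shows "L t = 1"
proof -
  obtain r where r: "isroot t r" using root_exists[OF assms] by blast
  have "t \<noteq> \<one>"
  proof
    assume "t = \<one>"
    then have "ip r r = - ip r r" using root_neg[OF r] act_one ip_minus by metis
    then show False using rootD(4)[OF r] by simp
  qed
  moreover have "L t \<le> 1" using L_le[of "[t]"] assms T_carrier by (auto simp: word_prod_Cons word_prod_Nil)
  ultimately show ?thesis using L_zero T_carrier assms by (metis le_neq_implies_less less_one)
qed

text \<open>For the converse: the fixed spaces of \<open>w\<close> and \<open>t w\<close> agree
  inside the hyperplane of \<open>t\<close>. If \<open>r\<close> is not moved by \<open>w\<close>,
  this hyperplane cuts the fixed space of \<open>w\<close> properly, so \<open>t w\<close> cannot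
  have the larger fixed space.\<close>

lemma L_mult_root_iff: assumes "isroot t r" "w \<in> carrier G"
  shows "r \<in> Mv w \<longleftrightarrow> L (t \<otimes> w) + 1 = L w"
proof
  note R = rootD[OF assms(1)]
  assume "r \<in> Mv w"
  then show "L (t \<otimes> w) + 1 = L w"
    using dim_Fx_gain[OF assms] dim_Fx_le[of "t \<otimes> w"] R assms(2) by (simp add: carter)
next
  note R = rootD[OF assms(1)]
  obtain B where B: "finite B" "V \<subseteq> span B" using V_fin by blast
  assume a: "L (t \<otimes> w) + 1 = L w"
  show "r \<in> Mv w"
  proof (rule ccontr)
    assume "r \<notin> Mv w"
    then obtain x where x: "x \<in> Fx w" "ip x r \<noteq> 0" using R ip_sym by (auto simp: Mv_def)
    let ?A = "{x \<in> Fx w. ip x r = 0}"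
    have sub: "{x \<in> Fx (t \<otimes> w). ip x r = 0} \<subseteq> ?A"
    proof
      fix y assume "y \<in> {x \<in> Fx (t \<otimes> w). ip x r = 0}"
      then have y: "y \<in> Fx (t \<otimes> w)" "ip y r = 0" by auto
      have "y \<in> Fx (t \<otimes> (t \<otimes> w))" using Fx_mult_root[OF assms(1), of "t \<otimes> w"] y R assms(2) by auto
      moreover have "t \<otimes> (t \<otimes> w) = w" using R(1,2) assms(2) T_square(1) by (simp flip: m_assoc)
      ultimately show "y \<in> ?A" using y by simp
    qed
    have sA: "subspace ?A" using Fx_subspace[OF assms(2)] unfolding subspace_def by (auto simp: ip_simps)
    have "dim (Fx (t \<otimes> w)) \<le> dim {x \<in> Fx (t \<otimes> w). ip x r = 0} + 1"
      using B R assms(2) by (intro dim_le_kernel_functional[where F = B] Fx_subspace) (auto simp: Fx_def ip_simps)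
    also have "dim {x \<in> Fx (t \<otimes> w). ip x r = 0} \<le> dim ?A"
      using sub B by (intro dim_mono_finite_span[where F = B]) (auto simp: Fx_def)
    also have "dim ?A + 1 \<le> dim (Fx w)"
      using x B sA by (intro dim_less_finite_span[where F = B and x = x]) (auto simp: Fx_def)
    finally show False using a R assms(2) by (auto simp: carter)
  qed
qed

lemma abs_le_root_iff: assumes "isroot t r" "w \<in> carrier G"
  shows "abs_le G S t w \<longleftrightarrow> r \<in> Mv w"
proof -
  note R = rootD[OF assms(1)]
  have "L (w \<otimes> inv t) = L (t \<otimes> w)" using R assms(2) T_square(2) L_comm by metis
  then show ?thesis using L_mult_root_iff[OF assms] L_refl[OF R(1)] by (auto simp: abs_le_def)
qed

text \<open>The dual form of the fact that a moved space is spanned by the roots in it: strip off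
  one reflection at a time, moved spaces only shrinking. It lets the reflections below an element
  control its fixed space.\<close>

lemma Fx_eq_perp_reflections:
  assumes "w \<in> carrier G" "x \<in> V" "\<And>t r. isroot t r \<Longrightarrow> r \<in> Mv w \<Longrightarrow> ip x r = 0"
  shows "x \<in> Fx w"
  using assms
proof (induction "L w" arbitrary: w rule: less_induct)
  case less
  show ?case
  proof (cases "w = \<one>")
    case True then show ?thesis using less.prems by (auto simp: Fx_def act_one)
  next
    case False
    then obtain t r where r: "isroot t r" "r \<in> Mv w" using exists_root_Mv[OF less.prems(1)] by blast
    note R = rootD[OF r(1)]
    have "L (t \<otimes> w) < L w" using L_mult_root_iff[of t r w] r less.prems by auto
    moreover have "Mv (t \<otimes> w) \<subseteq> Mv w" using dim_Fx_gain(2)[OF r(1) _ r(2)] less.prems(1) by (auto simp: Mv_def)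
    ultimately have "x \<in> Fx (t \<otimes> w)"
      using less.prems(1,2) R(2) by (intro less.hyps) (auto intro: less.prems(3))
    then have "act t (act w x) = x" using R less.prems by (auto simp: Fx_def act_mult)
    then have "act w x = act t x" using R(2) act_inv_act[of t "act w x"] T_square(2)[OF R(1)] by simp
    then have "act w x = x - ip x r *\<^sub>R r" using R(5)[OF less.prems(2)] by simp
    then show ?thesis using less.prems(2) less.prems(3)[OF r] by (simp add: Fx_def)
  qed
qed

lemma abs_le_antisym: assumes "u \<in> carrier G" "w \<in> carrier G" "abs_le G S u w" "abs_le G S w u" shows "u = w"
proof -
  have "L (w \<otimes> inv u) = 0" using assms by (auto simp: abs_le_def)
  then have "w \<otimes> inv u = \<one>" using L_zero assms by simp
  then have "w \<otimes> inv u \<otimes> u = \<one> \<otimes> u" by simp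
  then show ?thesis using assms by (simp add: m_assoc)
qed

end

section \<open>Representations of a Coxeter group\<close>

instantiation "fun" :: (type, real_vector) real_vector
begin
definition "scaleR a f = (\<lambda>x. a *\<^sub>R f x)"
instance
  by standard (auto simp: scaleR_fun_def fun_eq_iff scaleR_add_right scaleR_add_left)
end

lemma scaleR_fun_apply [simp]: "(a *\<^sub>R f) x = a *\<^sub>R f x"
  by (simp add: scaleR_fun_def)

text \<open>A real vector space is no finite union of proper subspaces. In the induction a point
  that avoids the earlier kernels is moved along a direction that leaves the new one; each map
  forbids at most one step length.\<close>

lemma exists_avoiding_kernels:
  fixes D :: "'i \<Rightarrow> 'v::real_vector \<Rightarrow> 'w::real_vector"
  assumes "finite X" and U: "subspace U"
    and add: "\<And>i x y. i \<in> X \<Longrightarrow> D i (x + y) = D i x + D i y"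
    and scale: "\<And>i a x. i \<in> X \<Longrightarrow> D i (a *\<^sub>R x) = a *\<^sub>R D i x"
    and ex: "\<And>i. i \<in> X \<Longrightarrow> \<exists>x\<in>U. D i x \<noteq> 0"
  shows "\<exists>p\<in>U. \<forall>i\<in>X. D i p \<noteq> 0"
  using assms(1) add scale ex
proof (induction X rule: finite_induct)
  case empty
  then show ?case using subspace_0[OF U] by blast
next
  case (insert i X)
  then obtain p where p: "p \<in> U" "\<forall>k\<in>X. D k p \<noteq> 0" by auto
  obtain x where x: "x \<in> U" "D i x \<noteq> 0" using insert.prems(3) by blast
  define bad where "bad k = {e::real. D k (p + e *\<^sub>R x) = 0}" for k
  have fin: "finite (bad k)" if k: "k \<in> insert i X" for k
  proof -
    have e: "D k (p + e *\<^sub>R x) = D k p + e *\<^sub>R D k x" for e using insert.prems(1,2) k by simp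
    show ?thesis
    proof (cases "D k x = 0")
      case True
      then have "D k p \<noteq> 0" using k p(2) x(2) by auto
      then have "bad k = {}" using True by (auto simp: bad_def e)
      then show ?thesis by simp
    next
      case False
      have "a = b" if "a \<in> bad k" "b \<in> bad k" for a b
      proof -
        have "D k p + a *\<^sub>R D k x = D k p + b *\<^sub>R D k x" using that by (simp add: bad_def e)
        then show ?thesis using False by simp
      qed
      then have "bad k = {} \<or> (\<exists>a. bad k = {a})" by blast
      then show ?thesis by auto
    qed
  qed
  then have "finite (\<Union>k\<in>insert i X. bad k)" using insert.hyps(1) by simp
  then obtain e where "e \<notin> (\<Union>k\<in>insert i X. bad k)"
    using infinite_UNIV_char_0[where 'a = real] ex_new_if_finite by blast
  then show ?case using p(1) x(1) U
    by (intro bexI[of _ "p + e *\<^sub>R x"] subspace_add subspace_scale) (auto simp: bad_def)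
qed

text \<open>For \<open>j = 1\<close> this is the form of the geometric representation; the
  automorphism that raises roots of unity to the power \<open>j\<close> turns it into the form for
  \<open>j\<close>.\<close>

definition jform :: "('a, 'b) monoid_scheme \<Rightarrow> nat \<Rightarrow> 'a \<Rightarrow> 'a \<Rightarrow> real"
  where "jform G j s t = - cos (real j * pi / real (group.ord G (s \<otimes>\<^bsub>G\<^esub> t)))"

definition lform :: "('a \<Rightarrow> 'a \<Rightarrow> real) \<Rightarrow> 'a set \<Rightarrow> 'a \<Rightarrow> ('a \<Rightarrow> 'k::real_normed_field) \<Rightarrow> 'k"
  where "lform B S s v = (\<Sum>t\<in>S. of_real (B s t) * v t)"

definition sact :: "('a \<Rightarrow> 'a \<Rightarrow> real) \<Rightarrow> 'a set \<Rightarrow> 'a \<Rightarrow> ('a \<Rightarrow> 'k::real_normed_field) \<Rightarrow> 'a \<Rightarrow> 'k"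
  where "sact B S s v = v (s := v s - 2 * lform B S s v)"

definition wact :: "('a \<Rightarrow> 'a \<Rightarrow> real) \<Rightarrow> 'a set \<Rightarrow> 'a list \<Rightarrow> ('a \<Rightarrow> 'k::real_normed_field) \<Rightarrow> 'a \<Rightarrow> 'k"
  where "wact B S ws = foldr (sact B S) ws"

text \<open>The word is chosen by the same \<open>SOME\<close> term as in
  \<open>geom_action\<close>, so the two agree for \<open>j = 1\<close> by unfolding, before
  independence of the word is known.\<close>

definition gact :: "('a, 'b) monoid_scheme \<Rightarrow> ('a \<Rightarrow> 'a \<Rightarrow> real) \<Rightarrow> 'a set \<Rightarrow> 'a \<Rightarrow> ('a \<Rightarrow> 'k::real_normed_field) \<Rightarrow> 'a \<Rightarrow> 'k"
  where "gact G B S w = wact B S (SOME ws. ws \<in> lists S \<and> word_prod G ws = w)"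

text \<open>The simple root of \<open>s\<close>, as a coordinate vector.\<close>

definition al :: "'a \<Rightarrow> 'a \<Rightarrow> 'k::real_normed_field"
  where "al s t = (if t = s then 1 else 0)"

lemma geom_action_eq_gact:
  "geom_action G S = (gact G (jform G 1) S :: 'a \<Rightarrow> ('a \<Rightarrow> 'k::real_normed_field) \<Rightarrow> 'a \<Rightarrow> 'k)"
proof -
  have "simple_action G S = (sact (jform G 1) S :: 'a \<Rightarrow> ('a \<Rightarrow> 'k::real_normed_field) \<Rightarrow> 'a \<Rightarrow> 'k)"
    by (intro ext) (simp add: simple_action_def sact_def lform_def jform_def root_form_def)
  then show ?thesis by (intro ext) (simp add: geom_action_def gact_def wact_def)
qed

lemma sact_apply: "sact B S s v t = v t - 2 * lform B S s v * al s t"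
  by (simp add: sact_def al_def)

lemma lform_add: "lform B S s (x + y) = lform B S s x + lform B S s y"
  by (simp add: lform_def distrib_left sum.distrib)
lemma lform_mult: "lform B S s (\<lambda>t. z * x t) = z * lform B S s x"
  by (simp add: lform_def sum_distrib_left mult.left_commute)
lemma sact_add: "sact B S s (x + y) = sact B S s x + sact B S s y"
  by (rule ext) (simp add: sact_apply lform_add algebra_simps)
lemma sact_mult: "sact B S s (\<lambda>t. z * x t) = (\<lambda>t. z * sact B S s x t)"
  by (rule ext) (simp add: sact_apply lform_mult algebra_simps)

lemma wact_add: "wact B S ws (x + y) = wact B S ws x + wact B S ws y"
  unfolding wact_def by (induction ws) (simp_all only: foldr.simps id_apply o_apply sact_add)
lemma wact_mult: "wact B S ws (\<lambda>t. z * x t) = (\<lambda>t. z * wact B S ws x t)"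
  by (induction ws) (auto simp: wact_def sact_mult)
lemma wact_append: "wact B S (us @ vs) x = wact B S us (wact B S vs x)"
  by (simp add: wact_def)

lemma gact_add: "gact G B S w (x + y) = gact G B S w x + gact G B S w y"
  by (simp add: gact_def wact_add)
lemma gact_mult_scalar: "gact G B S w (\<lambda>t. z * x t) = (\<lambda>t. z * gact G B S w x t)"
  by (simp add: gact_def wact_mult)
lemma gact_scaleR: "gact G B S w (a *\<^sub>R x) = a *\<^sub>R gact G B S w x"
proof -
  have "gact G B S w (\<lambda>t. of_real a * x t) = (\<lambda>t. of_real a * gact G B S w x t)" by (rule gact_mult_scalar)
  then show ?thesis by (simp add: scaleR_fun_def scaleR_conv_of_real)
qed
lemma gact_zero: "gact G B S w 0 = 0" using gact_scaleR[of G B S w 0 0] by simp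
lemma gact_minus: "gact G B S w (- x) = - gact G B S w x" using gact_scaleR[of G B S w "-1" x] by simp
lemma gact_sum: "gact G B S w (\<Sum>i\<in>A. f i) = (\<Sum>i\<in>A. gact G B S w (f i))"
  by (induction A rule: infinite_finite_induct)
    (simp_all only: sum.infinite sum.empty sum.insert gact_zero gact_add not_False_eq_True)

lemma sum_fun_apply: "(\<Sum>i\<in>A. f i) x = (\<Sum>i\<in>A. f i x)"
  by (induction A rule: infinite_finite_induct) auto

lemma geom_space_subspace: "subspace (geom_space S :: ('a \<Rightarrow> 'k::real_normed_field) set)"
  by (auto simp: subspace_def geom_space_def)

lemma sact_geom: "s \<in> S \<Longrightarrow> x \<in> geom_space S \<Longrightarrow> sact B S s x \<in> geom_space S"
  by (auto simp: geom_space_def sact_def)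

lemma wact_geom: "ws \<in> lists S \<Longrightarrow> x \<in> geom_space S \<Longrightarrow> wact B S ws x \<in> geom_space S"
  by (induction ws) (auto simp: wact_def sact_geom)

lemma al_geom: "s \<in> S \<Longrightarrow> al s \<in> geom_space S"
  by (auto simp: geom_space_def al_def)

abbreviation emb :: "('a \<Rightarrow> real) \<Rightarrow> 'a \<Rightarrow> complex" where "emb v \<equiv> (\<lambda>s. complex_of_real (v s))"

lemma emb_inject: "emb x = emb y \<longleftrightarrow> x = y" by (auto simp: fun_eq_iff)
lemma lform_emb: "lform B S s (emb v) = of_real (lform B S s v)" by (simp add: lform_def)
lemma sact_emb: "sact B S s (emb v) = emb (sact B S s v)"
  by (auto simp: sact_def lform_emb fun_eq_iff)
lemma wact_emb: "wact B S ws (emb v) = emb (wact B S ws v)"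
  by (induction ws) (auto simp: wact_def sact_emb)
lemma gact_emb: "gact G B S w (emb v) = emb (gact G B S w v)"
  by (simp add: gact_def wact_emb)

lemma vec_eq_sum_al: assumes "finite S" "x \<in> geom_space S"
  shows "x = (\<lambda>t. \<Sum>s\<in>S. x s * al s t)"
proof
  fix t
  have "(\<Sum>s\<in>S. x s * al s t) = (\<Sum>s\<in>S. if t = s then x s else 0)" by (intro sum.cong) (auto simp: al_def)
  then show "x t = (\<Sum>s\<in>S. x s * al s t)" using assms by (auto simp: geom_space_def)
qed

text \<open>Oddness of \<open>j\<close> gives simple roots the norm 1 under the twisted form;
  coprimality to the orders makes the eigenvalues in \<open>dihedral_relation\<close> different from
  1, so that the dihedral relations survive the twist.\<close>

locale coxeter_rep = coxeter_system G S for G (structure) and S +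
  fixes j :: nat
  assumes finite_carrier: "finite (carrier G)" and odd_j: "odd j"
    and coprime_j: "s \<in> S \<Longrightarrow> t \<in> S \<Longrightarrow> coprime j (ord (s \<otimes> t))"
begin

abbreviation "B \<equiv> jform G j"
abbreviation "act \<equiv> gact G B S"

lemma finite_S: "finite S" using finite_carrier simple_in_carrier finite_subset by blast
lemma S_carrier: "s \<in> S \<Longrightarrow> s \<in> carrier G" using simple_in_carrier by blast
lemma lists_S: "ws \<in> lists S \<Longrightarrow> ws \<in> lists (carrier G)" using simple_in_carrier by auto
lemma word_S_closed: "ws \<in> lists S \<Longrightarrow> word_prod G ws \<in> carrier G" using word_prod_closed lists_S by blast

lemma S_square: assumes "s \<in> S" shows "s \<otimes> s = \<one>" "inv s = s"
proof -
  have "s [^] (2::nat) = \<one>" using pow_ord_eq_1[of s] S_carrier[OF assms] simple_order[OF assms] by simp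
  then show "s \<otimes> s = \<one>" using S_carrier[OF assms] by (simp add: numeral_2_eq_2)
  then show "inv s = s" using S_carrier[OF assms] inv_equality by blast
qed

lemma ord_swap: assumes "s \<in> S" "t \<in> S" shows "ord (t \<otimes> s) = ord (s \<otimes> t)"
proof -
  have "inv (s \<otimes> t) = t \<otimes> s" using assms S_carrier S_square(2) by (simp add: inv_mult_group)
  then show ?thesis using ord_inv[of "s \<otimes> t"] assms S_carrier by simp
qed

lemma ord_pos': "w \<in> carrier G \<Longrightarrow> ord w > 0" using ord_ge_1[OF finite_carrier] by force

lemma ord_ge_2: assumes "s \<in> S" "t \<in> S" "s \<noteq> t" shows "ord (s \<otimes> t) \<ge> 2"
proof -
  have "ord (s \<otimes> t) \<noteq> 1"
  proof
    assume "ord (s \<otimes> t) = 1"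
    then have "s \<otimes> t = \<one>" using ord_eq_1[of "s \<otimes> t"] assms S_carrier by simp
    then have "inv t = s" using assms S_carrier by (simp add: inv_equality)
    then show False using S_square(2) assms by simp
  qed
  then show ?thesis using ord_pos'[of "s \<otimes> t"] assms S_carrier by fastforce
qed

lemma B_sym: "s \<in> S \<Longrightarrow> t \<in> S \<Longrightarrow> B s t = B t s" by (simp add: jform_def ord_swap)

lemma B_self: "s \<in> S \<Longrightarrow> B s s = 1"
  using odd_j by (simp add: jform_def S_square cos_npi)

lemma lform_al: "t \<in> S \<Longrightarrow> lform B S s (al t) = of_real (B s t)"
proof -
  assume t: "t \<in> S"
  have "lform B S s (al t) = (\<Sum>u\<in>S. if u = t then of_real (B s u) else 0)"
    unfolding lform_def al_def by (intro sum.cong) auto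
  then show ?thesis using t finite_S by simp
qed

lemma sact_sact: fixes x :: "'a \<Rightarrow> 'k::real_normed_field" assumes "s \<in> S" shows "sact B S s (sact B S s x) = x"
proof -
  have e: "sact B S s x = x + (\<lambda>t. (- 2 * lform B S s x) * al s t)" for x :: "'a \<Rightarrow> 'k::real_normed_field"
    by (rule ext) (simp add: sact_apply)
  have "lform B S s (sact B S s x) = - lform B S s x"
    unfolding e lform_add lform_mult using assms by (simp add: lform_al B_self)
  then show ?thesis by (intro ext) (simp add: sact_apply)
qed

text \<open>The functionals \<open>q + \<kappa> p\<close>, where \<open>\<kappa> = exp (\<plusminus> \<i> \<theta>)\<close>, are eigenvectors for the action of
  \<open>s t\<close> on the span of \<open>p = B(\<alpha>\<^sub>s, \<cdot>)\<close> and \<open>q = B(\<alpha>\<^sub>t, \<cdot>)\<close>, with eigenvalue \<open>\<kappa>\<^sup>-\<^sup>2 \<noteq> 1\<close>.\<close>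

lemma dihedral_relation:
  fixes x :: "'a \<Rightarrow> complex"
  assumes s: "s \<in> S" and t: "t \<in> S"
  shows "((sact B S s \<circ> sact B S t) ^^ ord (s \<otimes> t)) x = x"
proof (cases "s = t")
  case True
  then have "ord (s \<otimes> t) = 1" using S_square t by simp
  then show ?thesis using True s by (simp add: sact_sact)
next
  case False
  define m where "m = ord (s \<otimes> t)"
  define th where "th = real j * pi / real m"
  have m2: "m \<ge> 2" using ord_ge_2 s t False by (simp add: m_def)
  have Bst: "B s t = - cos th" "B t s = - cos th" using ord_swap[OF s t] by (simp_all add: jform_def th_def m_def)
  define y where "y k = ((sact B S s \<circ> sact B S t) ^^ k) x" for k
  define p q where "p k = lform B S s (y k)" and "q k = lform B S t (y k)" for k
  define C where "C = complex_of_real (cos th)"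
  have e: "sact B S s x = x + (\<lambda>t. (- 2 * lform B S s x) * al s t)" for x :: "'a \<Rightarrow> complex" and s
    by (rule ext) (simp add: sact_apply)
  have y1: "y (Suc k) = y k + (\<lambda>u. (- 2 * q k) * al t u) + (\<lambda>u. (- 2 * (p k + 2 * q k * C)) * al s u)" for k
  proof -
    have "y (Suc k) = sact B S s (sact B S t (y k))" by (simp add: y_def)
    moreover have "lform B S s (sact B S t (y k)) = p k + 2 * q k * C"
      unfolding e lform_add lform_mult using t by (simp add: lform_al Bst p_def q_def C_def)
    ultimately show ?thesis using e[of s "sact B S t (y k)"] e[of t "y k"] by (simp only: q_def)
  qed
  have p1: "p (Suc k) = - p k - 2 * q k * C" for k
    unfolding p_def y1 lform_add lform_mult using s t
    by (simp add: lform_al B_self Bst flip: p_def) (simp add: C_def algebra_simps)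
  have q1: "q (Suc k) = - q k + 2 * C * (p k + 2 * q k * C)" for k
    unfolding q_def[of "Suc k"] y1 lform_add lform_mult using s t
    by (simp add: lform_al B_self Bst flip: q_def) (simp add: C_def algebra_simps)
  \<comment> \<open>A full period of a geometric progression with ratio \<open>r \<noteq> 1\<close>
    sums to 0. The two values \<open>cis th\<close> and \<open>cis (- th)\<close> of
    \<open>ka\<close> then give two independent equations for the sums of \<open>p\<close> and of
    \<open>q\<close>.\<close>
  have key: "(\<Sum>k<m. q k) + ka * (\<Sum>k<m. p k) = 0"
    if ka: "ka * ka - 2 * C * ka + 1 = 0" "ka ^ 2 \<noteq> 1" "(ka ^ 2) ^ m = 1" for ka
  proof -
    have k0: "ka \<noteq> 0" using ka(1) by auto
    define r where "r = inverse (ka ^ 2)"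
    have C2: "2 * C = (ka * ka + 1) / ka" using ka(1) k0 by (simp add: field_simps)
    have step: "q (Suc k) + ka * p (Suc k) = r * (q k + ka * p k)" for k
    proof -
      have "q (Suc k) + ka * p (Suc k) = - q k + (2 * C) * p k + (2 * C) * (2 * C) * q k - ka * p k - ka * (2 * C) * q k"
        by (simp add: p1 q1 algebra_simps)
      also have "\<dots> = r * (q k + ka * p k)"
        unfolding C2 r_def using k0 by (simp add: field_simps power2_eq_square)
      finally show ?thesis .
    qed
    have pw: "q k + ka * p k = r ^ k * (q 0 + ka * p 0)" for k
      by (induction k) (simp_all add: step)
    have "(\<Sum>k<m. q k) + ka * (\<Sum>k<m. p k) = (\<Sum>k<m. q k + ka * p k)"
      by (simp add: sum.distrib sum_distrib_left)
    also have "\<dots> = (\<Sum>k<m. r ^ k * (q 0 + ka * p 0))" by (intro sum.cong refl pw)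
    also have "\<dots> = (\<Sum>k<m. r ^ k) * (q 0 + ka * p 0)" by (simp only: sum_distrib_right)
    also have "(\<Sum>k<m. r ^ k) = 0"
    proof -
      have "r \<noteq> 1" using ka(2) by (simp add: r_def)
      moreover have "r ^ m = 1" using ka(3) by (simp add: r_def power_inverse)
      ultimately show ?thesis by (simp add: sum_gp_strict)
    qed
    finally show ?thesis by simp
  qed
  have mth: "real m * th = real j * pi" using m2 by (simp add: th_def)
  have roots: "cis e * cis e - 2 * C * cis e + 1 = 0" "cis e ^ 2 \<noteq> 1" "(cis e ^ 2) ^ m = 1"
    if "e = th \<or> e = - th" for e
  proof -
    have "2 * C = cis e + cis (- e)" using that by (auto simp: C_def complex_eq_iff)
    then show "cis e * cis e - 2 * C * cis e + 1 = 0" by (simp add: algebra_simps cis_mult)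
    have d: "(cis e ^ 2) ^ m = cis (real (2 * m) * e)" by (simp add: DeMoivre mult_ac flip: power_mult)
    have a: "real (2 * m) * th = 2 * pi * real j" using mth by (simp add: mult_ac)
    have "real (2 * m) * e = 2 * pi * of_int (int j) \<or> real (2 * m) * e = 2 * pi * of_int (- int j)"
    proof (cases "e = th")
      case True then show ?thesis using a by simp
    next
      case False
      then have "e = - th" using that by simp
      then have "real (2 * m) * e = - (real (2 * m) * th)" by (simp only: mult_minus_right)
      then have "real (2 * m) * e = 2 * pi * of_int (- int j)" unfolding a by simp
      then show ?thesis by blast
    qed
    then obtain n :: int where "real (2 * m) * e = 2 * pi * of_int n" by blast
    then show "(cis e ^ 2) ^ m = 1" unfolding d by (simp only: cis_multiple_2pi Ints_of_int)
    show "cis e ^ 2 \<noteq> 1"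
    proof
      assume "cis e ^ 2 = 1"
      then have "cis (2 * e) = cis 0" by (simp add: DeMoivre)
      then have "sin (2 * e) = sin 0 \<and> cos (2 * e) = cos 0" by (simp add: complex_eq_iff)
      then obtain n :: int where n: "2 * e = 2 * pi * n" using sin_cos_eq_iff[of "2 * e" 0] by auto
      then have en: "e = pi * n" by simp
      have "pi * real j = pi * (real m * n) \<or> pi * real j = pi * (- (real m * n))"
      proof (cases "e = th")
        case True
        then have "real j * pi = real m * (pi * n)" using mth en by metis
        then show ?thesis by (simp only: mult_ac) simp
      next
        case False
        then have "th = pi * (- n)" using that en by simp
        then have "real j * pi = real m * (pi * (- n))" using mth by metis
        then have "pi * real j = pi * (- (real m * n))" by (simp only: of_int_minus mult_minus_right mult_ac)
        then show ?thesis by blast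
      qed
      then have "real j = real m * n \<or> real j = - (real m * n)" using pi_neq_zero by (simp only: mult_cancel_left) blast
      then have "int j = int m * n \<or> int j = - (int m * n)"
        by (metis (no_types, opaque_lifting) of_int_eq_iff of_int_minus of_int_mult of_int_of_nat_eq)
      then have "int m dvd int j" by (metis dvd_minus_iff dvd_triv_left)
      then have "m dvd j" by (simp only: int_dvd_int_iff)
      moreover have "coprime j m" using coprime_j s t by (simp add: m_def)
      ultimately show False using m2 coprime_common_divisor[of j m m] by simp
    qed
  qed
  have a: "(\<Sum>k<m. q k) + cis th * (\<Sum>k<m. p k) = 0" "(\<Sum>k<m. q k) + cis (- th) * (\<Sum>k<m. p k) = 0"
    using key[OF roots[of th]] key[OF roots[of "- th"]] by auto
  have ne: "cis th \<noteq> cis (- th)"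
  proof
    assume "cis th = cis (- th)"
    then have "cis th ^ 2 = cis th * cis (- th)" by (simp add: power2_eq_square)
    then show False using roots(2)[of th] by (simp add: cis_mult)
  qed
  have "(cis th - cis (- th)) * (\<Sum>k<m. p k) =
    ((\<Sum>k<m. q k) + cis th * (\<Sum>k<m. p k)) - ((\<Sum>k<m. q k) + cis (- th) * (\<Sum>k<m. p k))"
    by (simp only: left_diff_distrib add_diff_cancel_left)
  also have "\<dots> = 0" unfolding a by simp
  finally have "(cis th - cis (- th)) * (\<Sum>k<m. p k) = 0" .
  then have P0: "(\<Sum>k<m. p k) = 0" using ne by simp
  then have Q0: "(\<Sum>k<m. q k) = 0" using a(1) by simp
  \<comment> \<open>Every step changes \<open>y\<close> only along the two simple roots, by amounts
    linear in \<open>p k\<close> and \<open>q k\<close>, so the vanishing of both sums brings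
    \<open>y m\<close> back to \<open>x\<close>.\<close>
  have "y n u = x u + (- 2 * (\<Sum>k<n. q k)) * al t u + (- 2 * ((\<Sum>k<n. p k) + 2 * (\<Sum>k<n. q k) * C)) * al s u" for n u
  proof (induction n)
    case 0 then show ?case by (simp add: y_def)
  next
    case (Suc n)
    have "y (Suc n) u = y n u + (- 2 * q n) * al t u + (- 2 * (p n + 2 * q n * C)) * al s u"
      using y1[of n] by (simp add: fun_eq_iff)
    then show ?case using Suc by (simp add: algebra_simps)
  qed
  then have "y m = x" using P0 Q0 by (intro ext) simp
  then show ?thesis by (simp add: y_def m_def)
qed

lemma wact_replicate: "wact B S (concat (replicate n [s, t])) x = ((sact B S s \<circ> sact B S t) ^^ n) x"
  by (induction n) (auto simp: wact_def)

lemma wact_congruence: "coxeter_congruence G S us vs \<Longrightarrow> wact B S us x = wact B S vs x" for x :: "'a \<Rightarrow> complex"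
proof (induction arbitrary: x rule: coxeter_congruence.induct)
  case (relation s t us vs)
  then show ?case by (simp add: wact_append wact_replicate dihedral_relation)
qed auto

lemma wact_rev: "ws \<in> lists S \<Longrightarrow> wact B S (rev ws) (wact B S ws x) = x"
  by (induction ws) (auto simp: wact_def sact_sact)

lemma word_prod_rev: "ws \<in> lists S \<Longrightarrow> word_prod G (rev ws) = inv (word_prod G ws)"
proof (induction ws)
  case Nil then show ?case by (simp add: word_prod_Nil)
next
  case (Cons s ws)
  have c: "s \<in> carrier G" "word_prod G ws \<in> carrier G" "rev ws \<in> lists (carrier G)" "[s] \<in> lists (carrier G)"
    using Cons.prems S_carrier word_S_closed lists_S by auto
  then show ?case using Cons S_square(2)[of s] word_prod_append[OF c(3,4)]
    by (simp add: word_prod_Cons word_prod_Nil inv_mult_group)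
qed

text \<open>Here the presentation enters: \<open>us\<close> followed by the reversed
  \<open>vs\<close> represents the identity, and reversal inverts a word of involutions.\<close>

lemma wact_eq: fixes x :: "'a \<Rightarrow> complex" assumes "us \<in> lists S" "vs \<in> lists S" "word_prod G us = word_prod G vs"
  shows "wact B S us x = wact B S vs x"
proof -
  have "rev vs \<in> lists S" using assms(2) by auto
  then have "word_prod G (us @ rev vs) = \<one>"
    using assms word_prod_append[of us "rev vs"] lists_S word_prod_rev word_S_closed by simp
  then have "coxeter_congruence G S (us @ rev vs) []" using assms \<open>rev vs \<in> lists S\<close> by (intro presentation) auto
  then have "wact B S us (wact B S (rev vs) (wact B S vs x)) = wact B S vs x"
    using wact_congruence[of "us @ rev vs" "[]" "wact B S vs x"] by (simp add: wact_append) (simp add: wact_def)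
  then show ?thesis by (simp only: wact_rev[OF assms(2)])
qed

lemma word_exists: assumes "w \<in> carrier G" shows "\<exists>ws\<in>lists S. word_prod G ws = w"
proof -
  have "w \<in> generate G S" using assms simple_generate by simp
  then show ?thesis
  proof (induction rule: generate.induct)
    case one then show ?case by (intro bexI[of _ "[]"]) (auto simp: word_prod_Nil)
  next
    case (incl s) then show ?case using S_carrier by (intro bexI[of _ "[s]"]) (auto simp: word_prod_Nil word_prod_Cons)
  next
    case (inv s) then show ?case using S_carrier S_square by (intro bexI[of _ "[s]"]) (auto simp: word_prod_Nil word_prod_Cons)
  next
    case (eng a b)
    then obtain us vs where "us \<in> lists S" "vs \<in> lists S" "word_prod G us = a" "word_prod G vs = b" by blast
    then show ?case using word_prod_append[of us vs] lists_S by (intro bexI[of _ "us @ vs"]) auto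
  qed
qed

lemma some_word: assumes "w \<in> carrier G"
  shows "(SOME ws. ws \<in> lists S \<and> word_prod G ws = w) \<in> lists S"
    "word_prod G (SOME ws. ws \<in> lists S \<and> word_prod G ws = w) = w"
  using someI_ex[of "\<lambda>ws. ws \<in> lists S \<and> word_prod G ws = w"] word_exists[OF assms] by blast+

lemma act_word: "ws \<in> lists S \<Longrightarrow> act (word_prod G ws) x = wact B S ws x" for x :: "'a \<Rightarrow> complex"
  unfolding gact_def using some_word[OF word_S_closed] by (intro wact_eq) auto

lemma act_one: "act \<one> x = x" for x :: "'a \<Rightarrow> complex"
  using act_word[of "[]" x] by (simp add: word_prod_Nil) (simp add: wact_def)

lemma act_mult: fixes x :: "'a \<Rightarrow> complex" assumes "g \<in> carrier G" "k \<in> carrier G" shows "act (g \<otimes> k) x = act g (act k x)"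
proof -
  obtain us vs where w: "us \<in> lists S" "vs \<in> lists S" "word_prod G us = g" "word_prod G vs = k"
    using word_exists assms by metis
  then have "act (g \<otimes> k) x = wact B S (us @ vs) x"
    using act_word[of "us @ vs" x] word_prod_append[of us vs] lists_S by auto
  then show ?thesis using w act_word[of us] act_word[of vs] by (simp add: wact_append)
qed

lemma act_simple: "s \<in> S \<Longrightarrow> act s x = sact B S s x" for x :: "'a \<Rightarrow> complex"
  using act_word[of "[s]" x] S_carrier by (simp add: word_prod_Cons word_prod_Nil) (simp add: wact_def)

text \<open>The dihedral relation was proved with complex scalars, where eigenvectors exist; real
  vectors inherit its consequences through \<open>emb\<close>.\<close>

lemma act_one_real: "act \<one> x = x" for x :: "'a \<Rightarrow> real"
  using act_one[of "emb x"] by (simp add: gact_emb emb_inject del: of_real_eq_iff)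

lemma act_mult_real: "g \<in> carrier G \<Longrightarrow> k \<in> carrier G \<Longrightarrow> act (g \<otimes> k) x = act g (act k x)" for x :: "'a \<Rightarrow> real"
  using act_mult[of g k "emb x"] by (simp add: gact_emb emb_inject del: of_real_eq_iff)

lemma act_simple_real: "s \<in> S \<Longrightarrow> act s x = sact B S s x" for x :: "'a \<Rightarrow> real"
  using act_simple[of s "emb x"] by (simp add: gact_emb sact_emb emb_inject del: of_real_eq_iff)

lemma act_geom: "g \<in> carrier G \<Longrightarrow> x \<in> geom_space S \<Longrightarrow> act g x \<in> geom_space S"
  unfolding gact_def using some_word by (intro wact_geom) auto

lemma act_al: "s \<in> S \<Longrightarrow> act s (al s) = - (al s :: 'a \<Rightarrow> real)"
  by (rule ext) (simp add: act_simple_real sact_apply lform_al B_self)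

definition "bform x y = (\<Sum>s\<in>S. x s * lform B S s y)"

lemma bform_sym: "bform x y = bform y x" for x y :: "'a \<Rightarrow> 'k::real_normed_field"
proof -
  have "bform x y = (\<Sum>s\<in>S. \<Sum>t\<in>S. x s * (of_real (B s t) * y t))" by (simp add: bform_def lform_def sum_distrib_left)
  also have "\<dots> = (\<Sum>t\<in>S. \<Sum>s\<in>S. y t * (of_real (B t s) * x s))"
    by (subst sum.swap) (intro sum.cong refl, simp add: B_sym)
  finally show ?thesis by (simp add: bform_def lform_def sum_distrib_left)
qed

lemma bform_al: "s \<in> S \<Longrightarrow> bform (al s) y = lform B S s y"
proof -
  assume s: "s \<in> S"
  have "bform (al s) y = (\<Sum>t\<in>S. if t = s then lform B S t y else 0)" unfolding bform_def al_def by (intro sum.cong) auto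
  then show ?thesis using s finite_S by simp
qed

lemma bform_add: "bform (x + y) z = bform x z + bform y z" by (simp add: bform_def distrib_right sum.distrib)
lemma bform_mult: "bform (\<lambda>t. a * x t) z = a * bform x z" by (simp add: bform_def sum_distrib_left mult.assoc)

lemma bform_sact: fixes x y :: "'a \<Rightarrow> 'k::real_normed_field" assumes "s \<in> S" shows "bform (sact B S s x) (sact B S s y) = bform x y"
proof -
  have e: "sact B S s x = x + (\<lambda>t. (- 2 * lform B S s x) * al s t)" for x :: "'a \<Rightarrow> 'k"
    by (rule ext) (simp add: sact_apply)
  have r: "bform x (y + z) = bform x y + bform x z" "bform x (\<lambda>t. a * y t) = a * bform x y" for x y z :: "'a \<Rightarrow> 'k" and a
    using bform_add bform_mult bform_sym by metis+
  show ?thesis unfolding e bform_add bform_mult r bform_al[OF assms] lform_add lform_mult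
    using assms bform_sym[of x "al s"] bform_al[OF assms, of x] by (simp add: lform_al B_self algebra_simps)
qed

lemma bform_act: fixes x y :: "'a \<Rightarrow> 'k::real_normed_field" assumes "g \<in> carrier G" shows "bform (act g x) (act g y) = bform x y"
proof -
  have "ws \<in> lists S \<Longrightarrow> bform (wact B S ws x) (wact B S ws y) = bform x y" for ws
    by (induction ws) (auto simp: wact_def bform_sact)
  then show ?thesis unfolding gact_def using some_word(1)[OF assms] by blast
qed

end

section \<open>Faithfulness of the geometric representation\<close>

context coxeter_rep
begin

section \<open>Word length in the simple generators and alternating words\<close>

definition "len w = (LEAST n. \<exists>ws\<in>lists S. length ws = n \<and> word_prod G ws = w)"

lemma len_word: assumes "w \<in> carrier G" shows "\<exists>ws\<in>lists S. length ws = len w \<and> word_prod G ws = w"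
  unfolding len_def by (rule LeastI_ex) (use word_exists[OF assms] in blast)

lemma len_le: "ws \<in> lists S \<Longrightarrow> len (word_prod G ws) \<le> length ws"
  unfolding len_def by (rule Least_le) blast

text \<open>Every relator has even length. This is the sign character, and it excludes
  \<open>len (w s) = len w\<close>.\<close>

lemma congruence_parity: "coxeter_congruence G S us vs \<Longrightarrow> even (length us) \<longleftrightarrow> even (length vs)"
proof (induction rule: coxeter_congruence.induct)
  case (relation s t us vs)
  have "length (concat (replicate n [s, t])) = 2 * n" for n by (induction n) auto
  then show ?case by simp
qed auto

lemma word_parity: assumes "us \<in> lists S" "vs \<in> lists S" "word_prod G us = word_prod G vs"
  shows "even (length us) \<longleftrightarrow> even (length vs)"
proof -
  have r: "rev vs \<in> lists S" using assms(2) by auto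
  have "word_prod G (us @ rev vs) = \<one>"
    using assms word_prod_append[OF lists_S lists_S, of us "rev vs"] r word_prod_rev[OF assms(2)] word_S_closed[OF assms(2)] by simp
  then have "coxeter_congruence G S (us @ rev vs) []" using assms(1) r by (intro presentation) auto
  from congruence_parity[OF this] show ?thesis by simp
qed

lemma len_mult_word: assumes "v \<in> carrier G" "ws \<in> lists S" shows "len (v \<otimes> word_prod G ws) \<le> len v + length ws"
proof -
  obtain us where us: "us \<in> lists S" "length us = len v" "word_prod G us = v" using len_word[OF assms(1)] by blast
  have "word_prod G (us @ ws) = v \<otimes> word_prod G ws" using word_prod_append[OF lists_S lists_S, of us ws] us assms by simp
  then show ?thesis using len_le[of "us @ ws"] us assms by simp
qed

lemma len_mult_simple: assumes "w \<in> carrier G" "s \<in> S"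
  shows "len (w \<otimes> s) \<le> len w + 1" "len w \<le> len (w \<otimes> s) + 1" "len (w \<otimes> s) \<noteq> len w"
proof -
  have sc: "s \<in> carrier G" using S_carrier assms by blast
  have w1: "word_prod G [s] = s" using sc by (simp add: word_prod_Cons word_prod_Nil)
  show "len (w \<otimes> s) \<le> len w + 1" using len_mult_word[OF assms(1), of "[s]"] assms w1 by simp
  have "w \<otimes> s \<otimes> s = w" using assms sc S_square(1) by (simp add: m_assoc)
  then show "len w \<le> len (w \<otimes> s) + 1" using len_mult_word[of "w \<otimes> s" "[s]"] assms sc w1 by simp
  obtain us where us: "us \<in> lists S" "length us = len w" "word_prod G us = w" using len_word[OF assms(1)] by blast
  obtain vs where vs: "vs \<in> lists S" "length vs = len (w \<otimes> s)" "word_prod G vs = w \<otimes> s"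
    using len_word[of "w \<otimes> s"] assms sc by blast
  have "us @ [s] \<in> lists S" "word_prod G (us @ [s]) = word_prod G vs"
    using us vs assms word_prod_append[OF lists_S lists_S, of us "[s]"] w1 by auto
  then have "even (length (us @ [s])) \<longleftrightarrow> even (length vs)" using word_parity vs(1) by blast
  then show "len (w \<otimes> s) \<noteq> len w" using us(2) vs(2) by auto
qed

lemma right_descent: assumes "w \<in> carrier G" "w \<noteq> \<one>" shows "\<exists>s\<in>S. len (w \<otimes> s) < len w"
proof -
  obtain us where us: "us \<in> lists S" "length us = len w" "word_prod G us = w" using len_word[OF assms(1)] by blast
  have "us \<noteq> []" using us(3) assms(2) by (auto simp: word_prod_Nil)
  then obtain vs s where e: "us = vs @ [s]" by (metis rev_exhaust)
  have V: "vs \<in> lists S" "s \<in> S" "s \<in> carrier G" using us(1) e S_carrier by auto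
  have vc: "word_prod G vs \<in> carrier G" using word_S_closed V by blast
  have "w = word_prod G vs \<otimes> s"
    using us(3) e word_prod_append[OF lists_S lists_S, of vs "[s]"] V by (simp add: word_prod_Cons word_prod_Nil)
  then have "w \<otimes> s = word_prod G vs" using V vc S_square(1) by (simp add: m_assoc)
  then show ?thesis using len_le[OF V(1)] us(2) e V(2) by (intro bexI[of _ s]) auto
qed

text \<open>The alternating word with \<open>k\<close> letters whose last letter is
  \<open>t\<close>. It grows on the left, so its action on \<open>al s\<close> can be followed
  letter by letter.\<close>

fun alt :: "'a \<Rightarrow> 'a \<Rightarrow> nat \<Rightarrow> 'a list" where
  "alt s t 0 = []"
| "alt s t (Suc k) = (if even k then t else s) # alt s t k"

lemma alt_lists: "s \<in> S \<Longrightarrow> t \<in> S \<Longrightarrow> alt s t k \<in> lists S" by (induction k) auto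
lemma length_alt: "length (alt s t k) = k" by (induction k) auto

lemma alt_closed: "s \<in> S \<Longrightarrow> t \<in> S \<Longrightarrow> word_prod G (alt s t k) \<in> carrier G"
  using alt_lists word_S_closed by blast

lemma alt_even: assumes "s \<in> S" "t \<in> S" shows "word_prod G (alt s t (2 * i)) = (s \<otimes> t) [^] i"
proof (induction i)
  case 0 then show ?case by (simp add: word_prod_Nil)
next
  case (Suc i)
  have c: "s \<in> carrier G" "t \<in> carrier G" using assms S_carrier by auto
  have "word_prod G (alt s t (2 * Suc i)) = s \<otimes> (t \<otimes> (s \<otimes> t) [^] i)"
    using Suc by (simp add: word_prod_Cons)
  also have "\<dots> = (s \<otimes> t) \<otimes> (s \<otimes> t) [^] i" using c by (simp add: m_assoc)
  also have "\<dots> = (s \<otimes> t) [^] Suc i" by (rule nat_pow_Suc2[symmetric]) (use c in simp)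
  finally show ?case .
qed

text \<open>The braid relation: \<open>(s t)^m = 1\<close> is split into two halves, with a middle
  letter if \<open>m\<close> is odd.\<close>

lemma alt_braid: assumes s: "s \<in> S" "t \<in> S"
  shows "word_prod G (alt s t (ord (s \<otimes> t))) = word_prod G (alt t s (ord (s \<otimes> t)))"
proof -
  define m where "m = ord (s \<otimes> t)"
  have c: "s \<in> carrier G" "t \<in> carrier G" "s \<otimes> t \<in> carrier G" using s S_carrier by auto
  have inv: "t \<otimes> s = inv (s \<otimes> t)" using s c S_square(2) by (simp add: inv_mult_group)
  have one: "(s \<otimes> t) [^] m = \<one>" using c by (simp add: m_def)
  have uniq: "x = inv y" if "x \<in> carrier G" "y \<in> carrier G" "x \<otimes> y = \<one>" for x y
    using that inv_equality by metis
  show ?thesis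
  proof (cases "even m")
    case True
    then obtain i where i: "m = 2 * i" by blast
    have "(s \<otimes> t) [^] i \<otimes> (s \<otimes> t) [^] i = \<one>" using one c by (simp add: i nat_pow_mult mult_2)
    then have "(s \<otimes> t) [^] i = inv ((s \<otimes> t) [^] i)" using uniq c by simp
    moreover have "(t \<otimes> s) [^] i = inv ((s \<otimes> t) [^] i)" unfolding inv using c by (simp add: nat_pow_inv)
    ultimately show ?thesis unfolding m_def[symmetric] i using alt_even s by simp
  next
    case False
    then obtain i where "m = 2 * i + 1" by (rule oddE)
    then have i: "m = Suc (2 * i)" by simp
    define x where "x = (s \<otimes> t) [^] i"
    have xc: "x \<in> carrier G" using c by (simp add: x_def)
    have "(s \<otimes> t) \<otimes> (x \<otimes> x) = (s \<otimes> t) [^] m"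
      unfolding i x_def nat_pow_Suc2[OF c(3)] using c by (simp only: nat_pow_mult mult_2)
    then have "(s \<otimes> (t \<otimes> x)) \<otimes> x = \<one>" using one xc c by (simp add: m_assoc)
    then have "s \<otimes> (t \<otimes> x) = inv x" using uniq xc c by simp
    then have "s \<otimes> (s \<otimes> (t \<otimes> x)) = s \<otimes> inv x" by simp
    then have "t \<otimes> x = s \<otimes> inv x" using S_square(1)[OF s(1)] xc c by (simp flip: m_assoc)
    moreover have "word_prod G (alt s t m) = t \<otimes> x" using alt_even[OF s, of i] by (simp add: i word_prod_Cons x_def)
    moreover have "word_prod G (alt t s m) = s \<otimes> inv x"
      using alt_even[OF s(2,1), of i] c by (simp add: i word_prod_Cons x_def inv nat_pow_inv)
    ultimately show ?thesis by (simp add: m_def)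
  qed
qed

lemma alt_cancel: assumes s: "s \<in> S" "t \<in> S"
  shows "\<exists>ws\<in>lists S. length ws = k \<and> word_prod G ws = word_prod G (alt t s (Suc k)) \<otimes> s"
proof (induction k)
  case 0
  show ?case using s S_carrier S_square(1) by (intro bexI[of _ "[]"]) (auto simp: word_prod_Cons word_prod_Nil)
next
  case (Suc k)
  then obtain ws where ws: "ws \<in> lists S" "length ws = k" "word_prod G ws = word_prod G (alt t s (Suc k)) \<otimes> s" by blast
  define r where "r = (if even (Suc k) then s else t)"
  have r: "r \<in> S" "r \<in> carrier G" "s \<in> carrier G" using s S_carrier by (auto simp: r_def)
  have "alt t s (Suc (Suc k)) = r # alt t s (Suc k)" by (simp add: r_def)
  then have "word_prod G (alt t s (Suc (Suc k))) \<otimes> s = r \<otimes> (word_prod G (alt t s (Suc k)) \<otimes> s)"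
    using r alt_closed[OF s(2,1), of "Suc k"] by (simp only: word_prod_Cons m_assoc)
  then show ?case using ws r by (intro bexI[of _ "r # ws"]) (auto simp: word_prod_Cons simp del: alt.simps)
qed

text \<open>Once the alternating word has reached length \<open>ord (s t)\<close>, the braid
  relation rewrites it so that it ends in \<open>s\<close>, and a final \<open>s\<close> cancels. In
  \<open>tits\<close> this bounds the length of the dihedral tail.\<close>

lemma alt_long_cancel: assumes s: "s \<in> S" "t \<in> S" and k: "k \<ge> ord (s \<otimes> t)"
  shows "\<exists>ws\<in>lists S. Suc (length ws) = k \<and> word_prod G ws = word_prod G (alt s t k) \<otimes> s"
  using k
proof (induction k rule: dec_induct)
  case base
  obtain m where m: "ord (s \<otimes> t) = Suc m" using ord_pos'[of "s \<otimes> t"] s S_carrier by (metis m_closed gr0_implies_Suc)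
  then show ?case using alt_cancel[OF s, of m] alt_braid[OF s] by simp
next
  case (step k)
  then obtain ws where ws: "ws \<in> lists S" "Suc (length ws) = k" "word_prod G ws = word_prod G (alt s t k) \<otimes> s" by blast
  define r where "r = (if even k then t else s)"
  have r: "r \<in> S" "r \<in> carrier G" "s \<in> carrier G" using s S_carrier by (auto simp: r_def)
  have "alt s t (Suc k) = r # alt s t k" by (simp add: r_def)
  then have "word_prod G (alt s t (Suc k)) \<otimes> s = r \<otimes> (word_prod G (alt s t k) \<otimes> s)"
    using r alt_closed[OF s, of k] by (simp only: word_prod_Cons m_assoc)
  then show ?case using ws r by (intro bexI[of _ "r # ws"]) (auto simp: word_prod_Cons simp del: alt.simps)
qed

end

section \<open>Signs of roots and Steinberg's theorem\<close>

locale geom_rep = coxeter_rep + assumes j1: "j = 1"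
begin

lemma sact_al: assumes "s \<in> S" "t \<in> S"
  shows "sact B S s (al t) u = al t u - 2 * B s t * al s u"
  using assms by (simp add: sact_apply lform_al)

text \<open>The coefficients are Chebyshev values obeying
  \<open>sin ((k+2) th) + sin (k th) = 2 cos th sin ((k+1) th)\<close>. They are nonnegative as long
  as \<open>k\<close> is less than the order of \<open>s t\<close>.\<close>

lemma alt_act: assumes s: "s \<in> S" "t \<in> S" "s \<noteq> t"
  defines "th \<equiv> pi / real (ord (s \<otimes> t))"
  shows "act (word_prod G (alt s t k)) (al s) u =
    (sin (real (Suc k) * th) * (if even k then al s u else al t u) + sin (real k * th) * (if even k then al t u else al s u)) / sin th"
proof (induction k arbitrary: u)
  case 0
  have "sin th > 0" using ord_ge_2[OF s] by (intro sin_gt_zero) (auto simp: th_def field_simps)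
  then show ?case by (simp add: word_prod_Nil act_one_real)
next
  case (Suc k)
  define r q where "r = (if even k then t else s)" and "q = (if even k then s else t)"
  have rS: "r \<in> S" "q \<in> S" "r \<in> carrier G" using s S_carrier by (auto simp: r_def q_def)
  have Brq: "B r q = - cos th" using ord_swap[OF s(1,2)] by (auto simp: r_def q_def jform_def th_def j1)
  have s0: "sin th > 0" using ord_ge_2[OF s] by (intro sin_gt_zero) (auto simp: th_def field_simps)
  define y where "y = act (word_prod G (alt s t k)) (al s :: 'a \<Rightarrow> real)"
  have y: "y = (\<lambda>u. (sin (real (Suc k) * th) / sin th) * al q u) + (\<lambda>u. (sin (real k * th) / sin th) * al r u)"
    by (rule ext) (simp only: y_def Suc plus_fun_apply, simp add: q_def r_def add_divide_distrib)
  have "act (word_prod G (alt s t (Suc k))) (al s) = sact B S r y"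
    using rS alt_closed[OF s(1,2), of k] by (simp add: word_prod_Cons act_mult_real act_simple_real y_def r_def[symmetric] del: of_nat_Suc)
  also have "\<dots> = (\<lambda>u. (sin (real (Suc k) * th) / sin th) * sact B S r (al q) u) + (\<lambda>u. (sin (real k * th) / sin th) * sact B S r (al r) u)"
    unfolding y by (simp only: sact_add sact_mult)
  finally have 1: "act (word_prod G (alt s t (Suc k))) (al s) u =
     (sin (real (Suc k) * th) / sin th) * (al q u + 2 * cos th * al r u) + (sin (real k * th) / sin th) * (- al r u)"
    using rS by (simp only: plus_fun_apply sact_al Brq B_self) (simp add: algebra_simps)
  have "sin (real (Suc (Suc k)) * th) + sin (real k * th) = 2 * cos th * sin (real (Suc k) * th)"
  proof -
    have "real (Suc (Suc k)) * th = real (Suc k) * th + th" "real k * th = real (Suc k) * th - th" by (simp_all add: algebra_simps)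
    then have "sin (real (Suc (Suc k)) * th) + sin (real k * th) = 2 * (sin (real (Suc k) * th) * cos th)"
      by (simp only: sin_add sin_diff)
    then show ?thesis by (simp only: mult_ac)
  qed
  then have 2: "sin (real (Suc (Suc k)) * th) = 2 * cos th * sin (real (Suc k) * th) - sin (real k * th)"
    by (simp only: eq_diff_eq)
  have "act (word_prod G (alt s t (Suc k))) (al s) u =
     (sin (real (Suc (Suc k)) * th) * al r u + sin (real (Suc k) * th) * al q u) / sin th"
  proof -
    have "(a / z) * (x + 2 * c * y) + (d / z) * (- y) = ((2 * c * a - d) * y + a * x) / z" for a d x y c z :: real
      by (cases "z = 0") (simp_all add: divide_simps, simp add: algebra_simps)
    then show ?thesis unfolding 1 2 .
  qed
  then show ?case by (simp add: r_def q_def del: of_nat_Suc alt.simps)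
qed

definition "nonneg v \<longleftrightarrow> (\<forall>u. v u \<ge> (0::real))"

text \<open>Tits' argument: split off the longest reduced tail of \<open>w\<close> in the dihedral
  group of \<open>s\<close> and a right descent \<open>t\<close>. The remaining \<open>v\<close> is
  lengthened by \<open>s\<close> and by \<open>t\<close>, so induction applies to it, while the tail
  sends \<open>al s\<close> to a nonnegative combination of \<open>al s\<close> and
  \<open>al t\<close>.\<close>

lemma tits: assumes "w \<in> carrier G" "s \<in> S" "len (w \<otimes> s) > len w" shows "nonneg (act w (al s))"
  using assms
proof (induction "len w" arbitrary: w s rule: less_induct)
  case less
  note w = less.prems(1) and s = less.prems(2) and ls = less.prems(3)
  show ?case
  proof (cases "w = \<one>")
    case True then show ?thesis by (simp add: nonneg_def act_one_real al_def)
  next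
    case False
    obtain t where t: "t \<in> S" "len (w \<otimes> t) < len w" using right_descent[OF w False] by blast
    have st: "s \<noteq> t" using t ls by auto
    have c: "s \<in> carrier G" "t \<in> carrier G" using s t S_carrier by auto
    define a where "a k = word_prod G (alt s t k)" for k
    have ac: "a k \<in> carrier G" for k using alt_closed s t by (simp add: a_def)
    \<comment> \<open>The possible lengths of a tail alternating in \<open>s\<close> and
      \<open>t\<close> for which lengths add up; the descent \<open>t\<close> puts 1 into
      \<open>K\<close>.\<close>
    define K where "K = {k. \<exists>v\<in>carrier G. w = v \<otimes> a k \<and> len w = len v + k}"
    have K1: "1 \<in> K"
    proof -
      have "w = (w \<otimes> t) \<otimes> a 1" using w c S_square(1)[OF t(1)] by (simp add: a_def word_prod_Cons word_prod_Nil m_assoc)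
      moreover have "len w = len (w \<otimes> t) + 1" using t len_mult_simple(2)[OF w t(1)] by simp
      ultimately show ?thesis using w c unfolding K_def by blast
    qed
    have fK: "finite K" by (rule finite_subset[of _ "{..len w}"]) (auto simp: K_def)
    define k where "k = Max K"
    have kK: "k \<in> K" "k \<ge> 1" "Suc k \<notin> K"
      using Max_in[OF fK] Max_ge[OF fK] K1 by (auto simp: k_def) (metis Suc_n_not_le_n)
    obtain v where v: "v \<in> carrier G" "w = v \<otimes> a k" "len w = len v + k" using kK(1) by (auto simp: K_def)
    define r r' where "r = (if even k then t else s)" and "r' = (if even k then s else t)"
    have rS: "r \<in> S" "r' \<in> S" "r \<in> carrier G" "r' \<in> carrier G" using s t S_carrier by (auto simp: r_def r'_def)
    have aS: "a (Suc k) = r \<otimes> a k" by (simp add: a_def r_def word_prod_Cons)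
    obtain l where l: "k = Suc l" using kK(2) by (metis Suc_le_D One_nat_def)
    have al: "a k = r' \<otimes> a l" by (simp add: a_def l r'_def word_prod_Cons)
    \<comment> \<open>Otherwise the tail could be prolonged by \<open>r\<close>, against the
      maximality of \<open>k\<close>.\<close>
    have up1: "len (v \<otimes> r) > len v"
    proof (rule ccontr)
      assume "\<not> len (v \<otimes> r) > len v"
      then have "len v = len (v \<otimes> r) + 1" using len_mult_simple[OF v(1) rS(1)] by linarith
      moreover have "w = (v \<otimes> r) \<otimes> a (Suc k)"
      proof -
        have "(v \<otimes> r) \<otimes> a (Suc k) = v \<otimes> ((r \<otimes> r) \<otimes> a k)" unfolding aS using v(1) rS ac[of k] by (simp add: m_assoc)
        then show ?thesis using S_square(1)[OF rS(1)] ac[of k] v(2) by simp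
      qed
      ultimately have "Suc k \<in> K" using v(1,3) rS unfolding K_def by (intro CollectI bexI[of _ "v \<otimes> r"]) auto
      then show False using kK(3) by simp
    qed
    \<comment> \<open>Otherwise the first letter of the tail could be absorbed into
      \<open>v\<close>, making \<open>w\<close> shorter than \<open>len w\<close>.\<close>
    have up2: "len (v \<otimes> r') > len v"
    proof (rule ccontr)
      assume "\<not> len (v \<otimes> r') > len v"
      then have 1: "len v = len (v \<otimes> r') + 1" using len_mult_simple[OF v(1) rS(2)] by linarith
      have "w = (v \<otimes> r') \<otimes> a l" using v(1,2) rS ac[of l] by (simp add: al m_assoc)
      moreover have "len ((v \<otimes> r') \<otimes> a l) \<le> len (v \<otimes> r') + l"
        using len_mult_word[of "v \<otimes> r'" "alt s t l"] v(1) rS alt_lists[OF s t(1)] by (simp add: a_def length_alt)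
      ultimately show False using 1 v(3) l by simp
    qed
    have up: "len (v \<otimes> s) > len v" "len (v \<otimes> t) > len v" using up1 up2 by (auto simp: r_def r'_def split: if_splits)
    have lv: "len v < len w" using v(3) kK(2) by simp
    have n1: "nonneg (act v (al s))" "nonneg (act v (al t))" using less.hyps[OF lv v(1)] s t up by auto
    define m where "m = ord (s \<otimes> t)"
    \<comment> \<open>A tail of full length could absorb \<open>s\<close>, and \<open>w s\<close>
      would not be longer than \<open>w\<close>.\<close>
    have km: "k < m"
    proof (rule ccontr)
      assume "\<not> k < m"
      then obtain ws where ws: "ws \<in> lists S" "Suc (length ws) = k" "word_prod G ws = word_prod G (alt s t k) \<otimes> s"
        using alt_long_cancel[OF s t(1), of k] by (auto simp: m_def)
      have "w \<otimes> s = v \<otimes> word_prod G ws" using v ws(3) ac[of k] c by (simp add: a_def m_assoc)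
      then have "len (w \<otimes> s) \<le> len v + length ws" using len_mult_word[OF v(1) ws(1)] by simp
      then show False using ls v(3) ws(2) by simp
    qed
    define th where "th = pi / real m"
    have m2: "m \<ge> 2" using ord_ge_2[OF s t(1) st] by (simp add: m_def)
    have s0: "sin th > 0" using m2 by (intro sin_gt_zero) (auto simp: th_def field_simps)
    have sn: "sin (real i * th) \<ge> 0" if "i \<le> m" for i
      using that m2 by (intro sin_ge_zero) (auto simp: th_def field_simps)
    define p q where "p = sin (real (Suc k) * th) / sin th" and "q = sin (real k * th) / sin th"
    have pq: "p \<ge> 0" "q \<ge> 0" using sn[of "Suc k"] sn[of k] km s0 by (auto simp: p_def q_def simp del: of_nat_Suc)
    define e d where "e = (if even k then s else t)" and "d = (if even k then t else s)"
    have "act (a k) (al s) = (\<lambda>u. p * al e u) + (\<lambda>u. q * al d u)"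
      using alt_act[OF s t(1) st, of k] unfolding a_def p_def q_def e_def d_def th_def m_def
      by (intro ext) (simp add: add_divide_distrib del: of_nat_Suc)
    then have "act w (al s) = act v ((\<lambda>u. p * al e u) + (\<lambda>u. q * al d u))"
      using act_mult_real[OF v(1) ac[of k], of "al s"] v(2) by simp
    then have "act w (al s) = (\<lambda>u. p * act v (al e) u) + (\<lambda>u. q * act v (al d) u)"
      by (simp only: gact_add gact_mult_scalar)
    moreover have "nonneg (act v (al e))" "nonneg (act v (al d))" using n1 by (auto simp: e_def d_def)
    ultimately show ?thesis using pq by (simp add: nonneg_def)
  qed
qed

lemma negative_simple: assumes "w \<in> carrier G" "w \<noteq> \<one>" shows "\<exists>s\<in>S. nonneg (- act w (al s))"
proof -
  obtain s where s: "s \<in> S" "len (w \<otimes> s) < len w" using right_descent[OF assms] by blast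
  have c: "s \<in> carrier G" using s S_carrier by blast
  have ws: "w \<otimes> s \<otimes> s = w" using assms c S_square(1)[OF s(1)] by (simp add: m_assoc)
  have n: "nonneg (act (w \<otimes> s) (al s))" using assms c s ws by (intro tits) auto
  have "act (w \<otimes> s) (al s) = act w (- (al s :: 'a \<Rightarrow> real))" by (simp only: act_mult_real[OF assms(1) c] act_al[OF s(1)])
  also have "\<dots> = - act w (al s)" by (rule gact_minus)
  finally show ?thesis using n s(1) by metis
qed

lemma act_inv_act_real: "g \<in> carrier G \<Longrightarrow> act (inv g) (act g x) = x" for x :: "'a \<Rightarrow> real"
  using act_mult_real[of "inv g" g x] by (simp add: act_one_real)

text \<open>If no reflection fixes \<open>p\<close>, the point of its orbit with the largest
  coordinate sum lies strictly inside the dominant chamber. A conjugate of \<open>w\<close> fixes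
  that point but sends some simple root to a nonpositive combination, which contradicts invariance
  of the pairing.\<close>

lemma fixed_regular: assumes w: "w \<in> carrier G" "w \<noteq> \<one>" and p: "p \<in> geom_space S" "act w p = p"
  shows "\<exists>t\<in>reflections G S. act t p = (p :: 'a \<Rightarrow> real)"
proof (rule ccontr)
  assume not: "\<not> ?thesis"
  define ph where "ph x = (\<Sum>s\<in>S. x s)" for x :: "'a \<Rightarrow> real"
  define X where "X = (\<lambda>k. ph (act k p)) ` carrier G"
  have X: "finite X" "X \<noteq> {}" using finite_carrier one_closed by (auto simp: X_def)
  obtain g where g0: "g \<in> carrier G" "Max X = ph (act g p)" using Max_in[OF X] by (auto simp: X_def)
  have g: "g \<in> carrier G" "\<And>k. k \<in> carrier G \<Longrightarrow> ph (act k p) \<le> ph (act g p)"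
    using g0 Max_ge[OF X(1)] by (auto simp: X_def)
  define q where "q = act g p"
  have gp: "act (inv g) q = p" using act_inv_act_real[OF g(1)] by (simp add: q_def)
  \<comment> \<open>Applying \<open>s\<close> lowers the coordinate sum by twice
    \<open>lform B S s q\<close>, so maximality makes this number nonnegative; it is 0 only if a
    conjugate of \<open>s\<close> fixes \<open>p\<close>.\<close>
  have pos: "lform B S s q > 0" if s: "s \<in> S" for s
  proof -
    have c: "s \<in> carrier G" using s S_carrier by blast
    have sq: "act s q = sact B S s q" using act_simple_real[OF s] .
    have "ph (act (s \<otimes> g) p) \<le> ph q" using g c by (simp add: q_def)
    moreover have "act (s \<otimes> g) p = sact B S s q" using act_mult_real[OF c g(1)] sq by (simp add: q_def)
    moreover have "ph (sact B S s q) = ph q - 2 * lform B S s q"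
    proof -
      have "(\<Sum>t\<in>S. al s t) = (1::real)" using s finite_S by (simp add: al_def)
      then show ?thesis by (simp add: ph_def sact_apply sum_subtractf flip: sum_distrib_left)
    qed
    ultimately have "lform B S s q \<ge> 0" by simp
    moreover have "lform B S s q \<noteq> 0"
    proof
      assume "lform B S s q = 0"
      then have "act s q = q" unfolding sq by (intro ext) (simp add: sact_apply)
      then have "act (inv g \<otimes> s \<otimes> inv (inv g)) p = p"
        using act_mult_real g(1) c gp by (simp add: q_def)
      moreover have "inv g \<otimes> s \<otimes> inv (inv g) \<in> reflections G S"
        unfolding reflections_def using g(1) s by blast
      ultimately show False using not by blast
    qed
    ultimately show ?thesis by simp
  qed
  define w' where "w' = g \<otimes> w \<otimes> inv g"
  have wc: "w' \<in> carrier G" using w g by (simp add: w'_def)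
  have "w' \<noteq> \<one>"
  proof
    assume "w' = \<one>"
    then have "inv g \<otimes> (g \<otimes> w \<otimes> inv g) \<otimes> g = \<one>" using g by (simp add: w'_def)
    moreover have "inv g \<otimes> (g \<otimes> w \<otimes> inv g) \<otimes> g = w" using g w by (simp add: m_assoc) (simp flip: m_assoc)
    ultimately show False using w(2) by simp
  qed
  then obtain s where s: "s \<in> S" "nonneg (- act w' (al s))" using negative_simple[OF wc] by blast
  have w'q: "act w' q = q" using act_mult_real g(1) w(1) gp p(2) by (simp add: w'_def q_def)
  have "bform (act w' (al s)) q = bform (al s) q" using bform_act[OF wc, of "al s" q] w'q by simp
  also have "\<dots> = lform B S s q" using bform_al[OF s(1)] .
  finally have "bform (act w' (al s)) q > 0" using pos[OF s(1)] by simp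
  moreover have "bform (act w' (al s)) q \<le> 0"
    unfolding bform_def using s(2) pos by (intro sum_nonpos mult_nonpos_nonneg) (auto simp: nonneg_def less_imp_le)
  ultimately show False by simp
qed

lemma finite_reflections: "finite (reflections G S)"
  using finite_carrier by (rule finite_subset[rotated]) (auto simp: reflections_def S_carrier)

text \<open>If every reflection moved some vector fixed by \<open>w\<close>, a generic vector fixed
  by \<open>w\<close> would be moved by all reflections, contrary to
  \<open>fixed_regular\<close>.\<close>

theorem steinberg_geom: assumes w: "w \<in> carrier G" "w \<noteq> \<one>"
  shows "\<exists>t\<in>reflections G S. \<forall>x\<in>geom_space S. act w x = x \<longrightarrow> act t x = (x :: 'a \<Rightarrow> real)"
proof (rule ccontr)
  assume not: "\<not> ?thesis"
  define U where "U = {x \<in> geom_space S. act w x = (x :: 'a \<Rightarrow> real)}"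
  have U: "subspace U"
    unfolding U_def using geom_space_subspace[of S, where 'k = real]
    by (auto simp: subspace_def gact_zero gact_add gact_scaleR)
  have "\<exists>p\<in>U. \<forall>t\<in>reflections G S. act t p - p \<noteq> 0"
  proof (rule exists_avoiding_kernels[OF finite_reflections U])
    fix t assume "t \<in> reflections G S"
    then obtain x where "x \<in> geom_space S" "act w x = x" "act t x \<noteq> (x :: 'a \<Rightarrow> real)" using not by blast
    then show "\<exists>x\<in>U. act t x - x \<noteq> 0" by (auto simp: U_def)
  qed (simp_all only: gact_add gact_scaleR scaleR_diff_right add_diff_add)
  then show False using fixed_regular[OF w] by (auto simp: U_def)
qed

end

section \<open>The averaged inner product\<close>

lemma span_al: assumes "finite S" shows "(geom_space S :: ('a \<Rightarrow> real) set) \<subseteq> span (al ` S)"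
proof
  fix x :: "'a \<Rightarrow> real" assume x: "x \<in> geom_space S"
  have "x = (\<Sum>s\<in>S. x s *\<^sub>R al s)"
  proof
    fix t
    have "x t = (\<Sum>s\<in>S. x s * al s t)" using vec_eq_sum_al[OF assms x] by (rule fun_cong)
    then show "x t = (\<Sum>s\<in>S. x s *\<^sub>R al s) t" by (simp add: sum_fun_apply)
  qed
  also have "\<dots> \<in> span (al ` S)" by (intro span_sum span_scale span_base) auto
  finally show "x \<in> span (al ` S)" .
qed

lemma dim_geom_space: assumes "finite S" shows "dim (geom_space S :: ('a \<Rightarrow> real) set) = card S"
proof -
  have inj: "inj_on (al :: 'a \<Rightarrow> 'a \<Rightarrow> real) S" by (rule inj_onI) (metis al_def zero_neq_one)
  have "independent (al ` S :: ('a \<Rightarrow> real) set)"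
  proof (rule independent_if_scalars_zero)
    fix k :: "('a \<Rightarrow> real) \<Rightarrow> real" and x :: "'a \<Rightarrow> real" assume a: "(\<Sum>x\<in>al ` S. k x *\<^sub>R x) = 0" "x \<in> al ` S"
    then obtain s where s: "s \<in> S" "x = al s" by blast
    have "(\<Sum>t\<in>S. k (al t) *\<^sub>R (al t :: 'a \<Rightarrow> real)) = 0" using a(1) by (simp add: sum.reindex[OF inj])
    then have "(\<Sum>t\<in>S. k (al t) *\<^sub>R (al t :: 'a \<Rightarrow> real)) s = 0" by (simp only: zero_fun_apply)
    moreover have "(\<Sum>t\<in>S. k (al t) *\<^sub>R (al t :: 'a \<Rightarrow> real)) s = (\<Sum>t\<in>S. if t = s then k (al t) else 0)"
      unfolding sum_fun_apply by (intro sum.cong) (auto simp: al_def)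
    ultimately have "(\<Sum>t\<in>S. if t = s then k (al t) else 0) = 0" by simp
    then show "k x = 0" using s assms by simp
  qed (use assms in simp)
  moreover have "(al ` S :: ('a \<Rightarrow> real) set) \<subseteq> geom_space S" by (rule image_subsetI) (rule al_geom)
  ultimately have "card (al ` S :: ('a \<Rightarrow> real) set) = dim (geom_space S :: ('a \<Rightarrow> real) set)"
    using basis_card_eq_dim[OF _ span_al[OF assms]] by simp
  then show ?thesis using card_image[OF inj] by simp
qed

context coxeter_rep
begin

text \<open>Averaging gives an invariant inner product for all twisted forms alike; positivity comes
  from the summand of the identity.\<close>

definition aip :: "('a \<Rightarrow> real) \<Rightarrow> ('a \<Rightarrow> real) \<Rightarrow> real"
  where "aip x y = (\<Sum>g\<in>carrier G. \<Sum>s\<in>S. act g x s * act g y s)"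

lemma aip_act: assumes k: "k \<in> carrier G" shows "aip (act k x) (act k y) = aip x y"
proof -
  have bij: "bij_betw (\<lambda>g. g \<otimes> k) (carrier G) (carrier G)"
    by (rule bij_betwI[where g = "\<lambda>g. g \<otimes> inv k"]) (use k in \<open>auto simp: m_assoc\<close>)
  have "aip (act k x) (act k y) = (\<Sum>g\<in>carrier G. \<Sum>s\<in>S. act (g \<otimes> k) x s * act (g \<otimes> k) y s)"
    unfolding aip_def using k by (intro sum.cong refl) (simp add: act_mult_real)
  also have "\<dots> = aip x y" unfolding aip_def
    by (rule sum.reindex_bij_betw[OF bij, of "\<lambda>g. \<Sum>s\<in>S. act g x s * act g y s"])
  finally show ?thesis .
qed

text \<open>Steinberg's theorem stays a hypothesis because its two proofs differ: through chambers
  for the geometric representation, by Galois transfer for the conjugates.\<close>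

lemma refl_rep_aip:
  assumes st: "\<And>w. w \<in> carrier G \<Longrightarrow> w \<noteq> \<one> \<Longrightarrow>
    \<exists>t\<in>reflections G S. \<forall>x\<in>geom_space S. act w x = x \<longrightarrow> act t x = (x :: 'a \<Rightarrow> real)"
  shows "refl_rep G S (geom_space S) act aip"
proof unfold_locales
  show "finite (carrier G)" by (rule finite_carrier)
  show "S \<subseteq> carrier G" by (rule simple_in_carrier)
  show "subspace (geom_space S :: ('a \<Rightarrow> real) set)" by (rule geom_space_subspace)
  show "\<exists>B. finite B \<and> (geom_space S :: ('a \<Rightarrow> real) set) \<subseteq> span B"
    by (rule exI[of _ "al ` S"], rule conjI[OF finite_imageI[OF finite_S] span_al[OF finite_S]])
  fix g k :: 'a and x y z :: "'a \<Rightarrow> real" and a :: real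
  show "act g (x + y) = act g x + act g y" by (rule gact_add)
  show "act g (a *\<^sub>R x) = a *\<^sub>R act g x" by (rule gact_scaleR)
  show "act \<one> x = x" by (rule act_one_real)
  show "g \<in> carrier G \<Longrightarrow> x \<in> geom_space S \<Longrightarrow> act g x \<in> geom_space S" by (rule act_geom)
  show "g \<in> carrier G \<Longrightarrow> k \<in> carrier G \<Longrightarrow> act (g \<otimes> k) x = act g (act k x)" by (rule act_mult_real)
  show "aip (x + y) z = aip x z + aip y z"
    by (simp add: aip_def gact_add distrib_right sum.distrib)
  show "aip (a *\<^sub>R x) z = a * aip x z"
    by (simp add: aip_def gact_scaleR sum_distrib_left mult.assoc)
  show "aip x y = aip y x" by (simp add: aip_def mult.commute)
  show "g \<in> carrier G \<Longrightarrow> aip (act g x) (act g y) = aip x y" by (rule aip_act)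
  show "0 < aip x x" if x: "x \<in> geom_space S" "x \<noteq> 0"
  proof -
    obtain s where s: "s \<in> S" "x s \<noteq> 0" using x by (auto simp: geom_space_def fun_eq_iff)
    have "0 < (\<Sum>s\<in>S. act \<one> x s * act \<one> x s)"
      using s finite_S by (intro sum_pos2[of S s]) (auto simp: act_one_real zero_less_mult_iff)
    then show ?thesis unfolding aip_def
      by (intro sum_pos2[of "carrier G" \<one>]) (auto simp: finite_carrier intro: sum_nonneg)
  qed
  show "\<exists>r\<in>(geom_space S :: ('a \<Rightarrow> real) set). r \<noteq> 0 \<and> act t r = - r \<and> (\<forall>x\<in>geom_space S. \<exists>a. act t x = x + a *\<^sub>R r)"
    if t: "t \<in> reflections G S" for t
  proof -
    obtain w s where ws: "t = w \<otimes> s \<otimes> inv w" "w \<in> carrier G" "s \<in> S" using t by (auto simp: reflections_def)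
    have sc: "s \<in> carrier G" using ws S_carrier by blast
    define r where "r = act w (al s :: 'a \<Rightarrow> real)"
    have iw: "act (inv w) (act w x) = x" "act w (act (inv w) x) = x" for x :: "'a \<Rightarrow> real"
      using act_mult_real[of "inv w" w x] act_mult_real[of w "inv w" x] ws(2) by (simp_all add: act_one_real)
    have tx: "act t x = act w (act s (act (inv w) x))" for x :: "'a \<Rightarrow> real"
      unfolding ws(1) using ws(2) sc by (simp only: act_mult_real m_closed inv_closed)
    have "act t r = act w (- (al s :: 'a \<Rightarrow> real))" unfolding tx r_def iw act_al[OF ws(3)] ..
    also have "\<dots> = - r" unfolding r_def by (rule gact_minus)
    finally have 1: "act t r = - r" .
    have 2: "act t x = x + (- 2 * lform B S s (act (inv w) x)) *\<^sub>R r" for x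
    proof -
      have "act s (act (inv w) x) = act (inv w) x + (- 2 * lform B S s (act (inv w) x)) *\<^sub>R al s"
        by (rule ext) (simp add: act_simple_real[OF ws(3)] sact_apply)
      then show ?thesis unfolding tx r_def by (simp only: gact_add gact_scaleR iw)
    qed
    have 3: "r \<noteq> 0"
    proof
      assume "r = 0"
      then have "act (inv w) r = 0" by (simp only: gact_zero)
      then have "(al s :: 'a \<Rightarrow> real) = 0" unfolding r_def iw .
      then have "(al s :: 'a \<Rightarrow> real) s = 0" by simp
      then show False by (simp add: al_def)
    qed
    have 4: "r \<in> geom_space S" unfolding r_def by (rule act_geom[OF ws(2) al_geom[OF ws(3)]])
    have "\<forall>x\<in>geom_space S. \<exists>a. act t x = x + a *\<^sub>R r" by (intro ballI exI) (rule 2)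
    with 3 1 have "r \<noteq> 0 \<and> act t r = - r \<and> (\<forall>x\<in>geom_space S. \<exists>a. act t x = x + a *\<^sub>R r)" by (intro conjI)
    then show ?thesis by (rule bexI[OF _ 4])
  qed
  show "\<exists>t\<in>reflections G S. \<forall>x\<in>geom_space S. act w x = x \<longrightarrow> act t x = (x :: 'a \<Rightarrow> real)"
    if "w \<in> carrier G" "w \<noteq> \<one>" for w by (rule st[OF that])
qed

end

section \<open>Polynomial functions\<close>

abbreviation mev :: "('i, real) mpoly \<Rightarrow> ('i \<Rightarrow> complex) \<Rightarrow> complex"
  where "mev \<equiv> mpoly_eval complex_of_real"

definition mon :: "('i \<Rightarrow>\<^sub>0 nat) \<Rightarrow> ('i \<Rightarrow> 'r::comm_semiring_1) \<Rightarrow> 'r"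
  where "mon m x = (\<Prod>i\<in>Poly_Mapping.keys m. x i ^ Poly_Mapping.lookup m i)"

lemma mon_eq: assumes "finite I" "Poly_Mapping.keys m \<subseteq> I"
  shows "mon m x = (\<Prod>i\<in>I. x i ^ Poly_Mapping.lookup m i)"
  unfolding mon_def by (rule prod.mono_neutral_left) (use assms in \<open>auto simp: in_keys_iff\<close>)

lemma mon_add: "mon (m + n) x = mon m x * mon n x"
proof -
  let ?I = "Poly_Mapping.keys m \<union> Poly_Mapping.keys n"
  have "Poly_Mapping.keys (m + n) \<subseteq> ?I" by (rule Poly_Mapping.keys_add)
  then show ?thesis
    by (simp add: mon_eq[of ?I] lookup_add power_add prod.distrib)
qed

lemma mev_eq: assumes "finite K" "Poly_Mapping.keys p \<subseteq> K"
  shows "mev p x = (\<Sum>m\<in>K. of_real (Poly_Mapping.lookup p m) * mon m x)"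
  unfolding mpoly_eval_def mon_def[symmetric]
  by (rule sum.mono_neutral_left) (use assms in \<open>auto simp: in_keys_iff\<close>)

lemma mev_0: "mev 0 x = 0" by (simp add: mpoly_eval_def)

lemma mev_add: "mev (p + q) x = mev p x + mev q x"
proof -
  let ?K = "Poly_Mapping.keys p \<union> Poly_Mapping.keys q"
  have f: "finite ?K" by simp
  have k: "Poly_Mapping.keys p \<subseteq> ?K" "Poly_Mapping.keys q \<subseteq> ?K" "Poly_Mapping.keys (p + q) \<subseteq> ?K"
    using Poly_Mapping.keys_add[of p q] by auto
  show ?thesis unfolding mev_eq[OF f k(1)] mev_eq[OF f k(2)] mev_eq[OF f k(3)]
    by (simp add: lookup_add distrib_right sum.distrib)
qed

lemma mev_sum: "mev (\<Sum>i\<in>A. p i) x = (\<Sum>i\<in>A. mev (p i) x)"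
  by (induction A rule: infinite_finite_induct) (auto simp: mev_0 mev_add)

lemma mev_single: "mev (Poly_Mapping.single m a) x = of_real a * mon m x"
  using mev_eq[of "{m}" "Poly_Mapping.single m a" x] by auto

lemma sum_singles: "(\<Sum>m\<in>Poly_Mapping.keys p. Poly_Mapping.single m (Poly_Mapping.lookup p m)) = p"
  for p :: "'x \<Rightarrow>\<^sub>0 'y::comm_monoid_add"
proof (rule poly_mapping_eqI)
  fix k
  have "Poly_Mapping.lookup (\<Sum>m\<in>Poly_Mapping.keys p. Poly_Mapping.single m (Poly_Mapping.lookup p m)) k =
    (\<Sum>m\<in>Poly_Mapping.keys p. if m = k then Poly_Mapping.lookup p m else 0)"
    by (simp add: lookup_sum lookup_single when_def)
  also have "\<dots> = Poly_Mapping.lookup p k" by (simp add: in_keys_iff)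
  finally show "Poly_Mapping.lookup (\<Sum>m\<in>Poly_Mapping.keys p. Poly_Mapping.single m (Poly_Mapping.lookup p m)) k = Poly_Mapping.lookup p k" .
qed

lemma mev_mult: "mev (p * q) x = mev p x * mev q x"
proof -
  let ?s = "\<lambda>p m. Poly_Mapping.single m (Poly_Mapping.lookup p m)"
  have "mev (p * q) x = mev ((\<Sum>m\<in>Poly_Mapping.keys p. ?s p m) * (\<Sum>n\<in>Poly_Mapping.keys q. ?s q n)) x"
    by (simp only: sum_singles)
  also have "\<dots> = (\<Sum>m\<in>Poly_Mapping.keys p. \<Sum>n\<in>Poly_Mapping.keys q. mev (?s p m * ?s q n) x)"
    by (simp only: sum_product mev_sum)
  also have "\<dots> = (\<Sum>m\<in>Poly_Mapping.keys p. \<Sum>n\<in>Poly_Mapping.keys q. mev (?s p m) x * mev (?s q n) x)"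
    by (simp add: mult_single mev_single mon_add mult_ac)
  also have "\<dots> = mev (\<Sum>m\<in>Poly_Mapping.keys p. ?s p m) x * mev (\<Sum>n\<in>Poly_Mapping.keys q. ?s q n) x"
    by (simp only: sum_product mev_sum)
  finally show ?thesis by (simp only: sum_singles)
qed

lemma mev_const: "mev (Poly_Mapping.single 0 a) x = of_real a"
  by (simp add: mev_single mon_def)
lemma mev_1: "mev 1 x = 1" using mev_const[of 1 x] by (simp only: single_one of_real_1)
lemma mev_prod: "mev (\<Prod>i\<in>A. p i) x = (\<Prod>i\<in>A. mev (p i) x)"
  by (induction A rule: infinite_finite_induct) (auto simp: mev_1 mev_mult)
lemma mev_power: "mev (p ^ n) x = mev p x ^ n"
  by (induction n) (auto simp: mev_1 mev_mult)

lemma mev_subst: "mev (mpoly_subst P f) x = mev P (\<lambda>i. mev (f i) x)"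
  unfolding mpoly_subst_def mpoly_eval_def[of "Poly_Mapping.single 0"]
  by (simp only: mev_sum mev_mult mev_prod mev_power mev_const) (simp add: mpoly_eval_def)

lemma mev_emb: "mev p (emb x) = of_real (mpoly_eval id p x)"
  by (simp add: mpoly_eval_def)

lemma mpolys_in_add: "p \<in> mpolys_in S \<Longrightarrow> q \<in> mpolys_in S \<Longrightarrow> p + q \<in> mpolys_in S"
  unfolding mpolys_in_def using Poly_Mapping.keys_add[of p q] by blast

lemma mpolys_in_mult: assumes "p \<in> mpolys_in S" "q \<in> mpolys_in S" shows "p * q \<in> mpolys_in S"
  unfolding mpolys_in_def
proof (intro CollectI ballI)
  fix m assume "m \<in> Poly_Mapping.keys (p * q)"
  then obtain a b where ab: "m = a + b" "a \<in> Poly_Mapping.keys p" "b \<in> Poly_Mapping.keys q"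
    using Poly_Mapping.keys_mult[of p q] by blast
  have "Poly_Mapping.keys a \<subseteq> S" "Poly_Mapping.keys b \<subseteq> S" using assms ab(2,3) by (auto simp: mpolys_in_def)
  then show "Poly_Mapping.keys m \<subseteq> S" unfolding ab(1) using Poly_Mapping.keys_add[of a b] by blast
qed

section \<open>Real, complex and homogeneous polynomial functions\<close>

definition rpf :: "'a set \<Rightarrow> (('a \<Rightarrow> complex) \<Rightarrow> complex) \<Rightarrow> bool"
  where "rpf S F \<longleftrightarrow> (\<exists>p\<in>mpolys_in S. \<forall>x. F x = mev p x)"

lemma rpf_const: "rpf S (\<lambda>x. of_real a)"
  unfolding rpf_def by (intro bexI[of _ "Poly_Mapping.single 0 a"]) (auto simp: mev_const mpolys_in_def)
lemma rpf_coord: "s \<in> S \<Longrightarrow> rpf S (\<lambda>x. x s)"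
  unfolding rpf_def
  by (intro bexI[of _ "Poly_Mapping.single (Poly_Mapping.single s 1) 1"]) (auto simp: mev_single mon_def mpolys_in_def)
lemma rpf_add: assumes "rpf S F" "rpf S H" shows "rpf S (\<lambda>x. F x + H x)"
proof -
  obtain p q where "p \<in> mpolys_in S" "\<forall>x. F x = mev p x" "q \<in> mpolys_in S" "\<forall>x. H x = mev q x"
    using assms unfolding rpf_def by blast
  then show ?thesis unfolding rpf_def by (intro bexI[of _ "p + q"]) (simp_all add: mev_add mpolys_in_add)
qed
lemma rpf_mult: assumes "rpf S F" "rpf S H" shows "rpf S (\<lambda>x. F x * H x)"
proof -
  obtain p q where "p \<in> mpolys_in S" "\<forall>x. F x = mev p x" "q \<in> mpolys_in S" "\<forall>x. H x = mev q x"
    using assms unfolding rpf_def by blast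
  then show ?thesis unfolding rpf_def by (intro bexI[of _ "p * q"]) (simp_all add: mev_mult mpolys_in_mult)
qed

text \<open>The ring of invariants has real coefficients, so a complex polynomial is kept as a pair
  of real ones, to each of which generation by the basic invariants applies.\<close>

definition cpf :: "'a set \<Rightarrow> (('a \<Rightarrow> complex) \<Rightarrow> complex) \<Rightarrow> bool"
  where "cpf S F \<longleftrightarrow> (\<exists>F1 F2. rpf S F1 \<and> rpf S F2 \<and> F = (\<lambda>x. F1 x + \<i> * F2 x))"

lemma rpf_minus: "rpf S F \<Longrightarrow> rpf S (\<lambda>x. - F x)"
  using rpf_mult[OF rpf_const[of S "-1"], of F] by simp

lemma cpf_const: "cpf S (\<lambda>x. a)"
  unfolding cpf_def
  by (intro exI[of _ "\<lambda>x. of_real (Re a)"] exI[of _ "\<lambda>x. of_real (Im a)"]) (auto simp: rpf_const complex_eq_iff)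
lemma cpf_coord: assumes "s \<in> S" shows "cpf S (\<lambda>x. x s)"
  unfolding cpf_def using rpf_coord[OF assms] rpf_const[of S 0] by (intro exI[of _ "\<lambda>x. x s"] exI[of _ "\<lambda>x. 0"]) auto
lemma cpf_add: assumes "cpf S F" "cpf S H" shows "cpf S (\<lambda>x. F x + H x)"
proof -
  obtain F1 F2 H1 H2 where "rpf S F1" "rpf S F2" "F = (\<lambda>x. F1 x + \<i> * F2 x)"
    "rpf S H1" "rpf S H2" "H = (\<lambda>x. H1 x + \<i> * H2 x)" using assms unfolding cpf_def by blast
  then show ?thesis unfolding cpf_def
    by (intro exI[of _ "\<lambda>x. F1 x + H1 x"] exI[of _ "\<lambda>x. F2 x + H2 x"]) (auto intro: rpf_add simp: algebra_simps)
qed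
lemma cpf_mult: assumes "cpf S F" "cpf S H" shows "cpf S (\<lambda>x. F x * H x)"
proof -
  obtain F1 F2 H1 H2 where a: "rpf S F1" "rpf S F2" "F = (\<lambda>x. F1 x + \<i> * F2 x)"
    "rpf S H1" "rpf S H2" "H = (\<lambda>x. H1 x + \<i> * H2 x)" using assms unfolding cpf_def by blast
  have "rpf S (\<lambda>x. F1 x * H1 x + - (F2 x * H2 x))"
    by (rule rpf_add[OF rpf_mult[OF a(1,4)] rpf_minus[OF rpf_mult[OF a(2,5)]]])
  moreover have "rpf S (\<lambda>x. F1 x * H2 x + F2 x * H1 x)"
    by (rule rpf_add[OF rpf_mult[OF a(1,5)] rpf_mult[OF a(2,4)]])
  moreover have "(\<lambda>x. F x * H x) = (\<lambda>x. (F1 x * H1 x + - (F2 x * H2 x)) + \<i> * (F1 x * H2 x + F2 x * H1 x))"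
    using a by (auto simp: algebra_simps)
  ultimately show ?thesis unfolding cpf_def by blast
qed
lemma cpf_sum: "(\<And>i. i \<in> A \<Longrightarrow> cpf S (F i)) \<Longrightarrow> cpf S (\<lambda>x. \<Sum>i\<in>A. F i x)"
  by (induction A rule: infinite_finite_induct) (auto intro: cpf_const cpf_add)
lemma cpf_poly: "cpf S F \<Longrightarrow> cpf S (\<lambda>x. poly r (F x))"
  by (induction r) (auto intro: cpf_const cpf_add cpf_mult)

text \<open>An inductive closure, so that scaling, restriction to lines and differentiation are
  proved by rule induction. The zero function has every degree.\<close>

inductive hpf :: "'a set \<Rightarrow> nat \<Rightarrow> (('a \<Rightarrow> complex) \<Rightarrow> complex) \<Rightarrow> bool" for S where
  hpf_zero: "hpf S d (\<lambda>x. 0)"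
| hpf_const: "hpf S 0 (\<lambda>x. a)"
| hpf_coord: "s \<in> S \<Longrightarrow> hpf S 1 (\<lambda>x. x s)"
| hpf_add: "hpf S d F \<Longrightarrow> hpf S d H \<Longrightarrow> hpf S d (\<lambda>x. F x + H x)"
| hpf_mult: "hpf S d F \<Longrightarrow> hpf S e H \<Longrightarrow> hpf S (d + e) (\<lambda>x. F x * H x)"

lemma hpf_sum: "(\<And>i. i \<in> A \<Longrightarrow> hpf S d (F i)) \<Longrightarrow> hpf S d (\<lambda>x. \<Sum>i\<in>A. F i x)"
  by (induction A rule: infinite_finite_induct) (auto intro: hpf_zero hpf_add)

lemma hpf_cmult: "hpf S d F \<Longrightarrow> hpf S d (\<lambda>x. a * F x)"
  using hpf_mult[OF hpf_const, of S d F a] by simp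

lemma hpf_power: "s \<in> S \<Longrightarrow> hpf S n (\<lambda>x. x s ^ n)"
proof (induction n)
  case 0 show ?case using hpf_const[of S 1] by simp
next
  case (Suc n) then show ?case using hpf_mult[OF hpf_coord[of s S], of n "\<lambda>x. x s ^ n"] by simp
qed

lemma hpf_prod: "(\<And>i. i \<in> A \<Longrightarrow> hpf S (d i) (F i)) \<Longrightarrow> hpf S (\<Sum>i\<in>A. d i) (\<lambda>x. \<Prod>i\<in>A. F i x)"
proof (induction A rule: infinite_finite_induct)
  case (insert i A)
  then show ?case using hpf_mult[of S "d i" "F i" "\<Sum>i\<in>A. d i" "\<lambda>x. \<Prod>i\<in>A. F i x"] by simp
qed (auto intro: hpf_const)

lemma hpf_mev: assumes "p \<in> mpolys_in S" "homogeneous d p" shows "hpf S d (mev p)"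
proof -
  have "hpf S d (\<lambda>x. of_real (Poly_Mapping.lookup p m) * (\<Prod>i\<in>Poly_Mapping.keys m. x i ^ Poly_Mapping.lookup m i))"
    if m: "m \<in> Poly_Mapping.keys p" for m
  proof -
    have "hpf S (\<Sum>i\<in>Poly_Mapping.keys m. Poly_Mapping.lookup m i) (\<lambda>x. \<Prod>i\<in>Poly_Mapping.keys m. x i ^ Poly_Mapping.lookup m i)"
      using assms(1) m by (intro hpf_prod hpf_power) (auto simp: mpolys_in_def)
    moreover have "(\<Sum>i\<in>Poly_Mapping.keys m. Poly_Mapping.lookup m i) = d" using assms(2) m by (simp add: homogeneous_def)
    ultimately show ?thesis by (intro hpf_cmult) simp
  qed
  then have "hpf S d (\<lambda>x. \<Sum>m\<in>Poly_Mapping.keys p. of_real (Poly_Mapping.lookup p m) * (\<Prod>i\<in>Poly_Mapping.keys m. x i ^ Poly_Mapping.lookup m i))"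
    by (rule hpf_sum)
  moreover have "mev p = (\<lambda>x. \<Sum>m\<in>Poly_Mapping.keys p. of_real (Poly_Mapping.lookup p m) * (\<Prod>i\<in>Poly_Mapping.keys m. x i ^ Poly_Mapping.lookup m i))"
    by (rule ext) (simp add: mpoly_eval_def)
  ultimately show ?thesis by simp
qed

lemma hpf_scale: "hpf S d F \<Longrightarrow> F (\<lambda>s. z * x s) = z ^ d * F x"
  by (induction rule: hpf.induct) (auto simp: algebra_simps power_add)

definition line :: "('a \<Rightarrow> complex) \<Rightarrow> ('a \<Rightarrow> complex) \<Rightarrow> complex \<Rightarrow> 'a \<Rightarrow> complex"
  where "line x y t = (\<lambda>s. x s + t * y s)"

lemma hpf_line: "hpf S d F \<Longrightarrow> \<exists>q. degree q \<le> d \<and> (\<forall>t. F (line x y t) = poly q t)"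
proof (induction rule: hpf.induct)
  case (hpf_zero d) show ?case by (intro exI[of _ 0]) simp
next
  case (hpf_const a) show ?case by (intro exI[of _ "[:a:]"]) simp
next
  case (hpf_coord s) show ?case by (intro exI[of _ "[:x s, y s:]"]) (auto simp: line_def)
next
  case (hpf_add d F H)
  then obtain p q where "degree p \<le> d" "\<forall>t. F (line x y t) = poly p t" "degree q \<le> d" "\<forall>t. H (line x y t) = poly q t" by blast
  then show ?case by (intro exI[of _ "p + q"]) (auto intro: degree_add_le)
next
  case (hpf_mult d F e H)
  then obtain p q where pq: "degree p \<le> d" "\<forall>t. F (line x y t) = poly p t" "degree q \<le> e" "\<forall>t. H (line x y t) = poly q t" by blast
  have "degree (p * q) \<le> d + e" using degree_mult_le[of p q] pq by linarith
  then show ?case using pq by (intro exI[of _ "p * q"]) auto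
qed

text \<open>The gradient, with its degree. As \<open>d - 1\<close> is truncated subtraction, degree
  0 needs the separate clause that the gradient vanishes; otherwise the product rule would lose
  track of the degree.\<close>

lemma hpf_derivative:
  assumes "finite S" "hpf S d F"
  shows "\<exists>D. (\<forall>s. hpf S (d - 1) (D s)) \<and> (d = 0 \<longrightarrow> (\<forall>s x. D s x = 0)) \<and>
    (\<forall>x y. ((\<lambda>t. F (line x y t)) has_field_derivative (\<Sum>s\<in>S. D s x * y s)) (at 0))"
  using assms(2)
proof (induction rule: hpf.induct)
  case (hpf_zero d) show ?case by (intro exI[of _ "\<lambda>s x. 0"]) (auto intro: hpf.hpf_zero)
next
  case (hpf_const a) show ?case by (intro exI[of _ "\<lambda>s x. 0"]) (auto intro: hpf.hpf_zero)
next
  case (hpf_coord u)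
  have "((\<lambda>t. line x y t u) has_field_derivative (\<Sum>s\<in>S. (if s = u then 1 else 0) * y s)) (at 0)" for x y
  proof -
    have "(\<Sum>s\<in>S. (if s = u then 1 else 0) * y s) = (\<Sum>s\<in>S. if s = u then y s else 0)" by (intro sum.cong) auto
    also have "\<dots> = y u" using hpf_coord assms(1) by simp
    finally have e: "(\<Sum>s\<in>S. (if s = u then 1 else 0) * y s) = y u" .
    show ?thesis unfolding e line_def by (auto intro!: derivative_eq_intros)
  qed
  then show ?case by (intro exI[of _ "\<lambda>s x. if s = u then 1 else 0"]) (auto intro: hpf.hpf_const)
next
  case (hpf_add d F H)
  then obtain D1 D2 where D: "\<forall>s. hpf S (d - 1) (D1 s)" "d = 0 \<longrightarrow> (\<forall>s x. D1 s x = 0)"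
     "\<forall>x y. ((\<lambda>t. F (line x y t)) has_field_derivative (\<Sum>s\<in>S. D1 s x * y s)) (at 0)"
     "\<forall>s. hpf S (d - 1) (D2 s)" "d = 0 \<longrightarrow> (\<forall>s x. D2 s x = 0)"
     "\<forall>x y. ((\<lambda>t. H (line x y t)) has_field_derivative (\<Sum>s\<in>S. D2 s x * y s)) (at 0)" by blast
  have "((\<lambda>t. F (line x y t) + H (line x y t)) has_field_derivative (\<Sum>s\<in>S. (D1 s x + D2 s x) * y s)) (at 0)" for x y
    using DERIV_add[OF D(3)[rule_format] D(6)[rule_format], of x y x y] by (simp add: distrib_right sum.distrib)
  then show ?case using D by (intro exI[of _ "\<lambda>s x. D1 s x + D2 s x"]) (auto intro: hpf.hpf_add)
next
  case (hpf_mult d F e H)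
  then obtain D1 D2 where D: "\<forall>s. hpf S (d - 1) (D1 s)" "d = 0 \<longrightarrow> (\<forall>s x. D1 s x = 0)"
     "\<forall>x y. ((\<lambda>t. F (line x y t)) has_field_derivative (\<Sum>s\<in>S. D1 s x * y s)) (at 0)"
     "\<forall>s. hpf S (e - 1) (D2 s)" "e = 0 \<longrightarrow> (\<forall>s x. D2 s x = 0)"
     "\<forall>x y. ((\<lambda>t. H (line x y t)) has_field_derivative (\<Sum>s\<in>S. D2 s x * y s)) (at 0)" by blast
  define D' where "D' s x = D1 s x * H x + F x * D2 s x" for s x
  have "((\<lambda>t. F (line x y t) * H (line x y t)) has_field_derivative (\<Sum>s\<in>S. D' s x * y s)) (at 0)" for x y
  proof -
    have "(\<Sum>s\<in>S. D' s x * y s) = (\<Sum>s\<in>S. D1 s x * y s) * H x + (\<Sum>s\<in>S. D2 s x * y s) * F x"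
      unfolding D'_def sum_distrib_right sum.distrib[symmetric] by (intro sum.cong refl) (simp add: algebra_simps)
    moreover have "line x y 0 = x" by (simp add: line_def)
    ultimately show ?thesis
      using DERIV_mult[OF D(3)[rule_format, of x y] D(6)[rule_format, of x y]] by simp
  qed
  moreover have "hpf S (d + e - 1) (\<lambda>x. D' s x)" for s
  proof -
    have 1: "hpf S (d + e - 1) (\<lambda>x. D1 s x * H x)"
    proof (cases "d = 0")
      case True then show ?thesis using D(2) hpf.hpf_zero by simp
    next
      case False then show ?thesis using hpf.hpf_mult[OF D(1)[rule_format, of s] hpf_mult(2)] by simp
    qed
    have 2: "hpf S (d + e - 1) (\<lambda>x. F x * D2 s x)"
    proof (cases "e = 0")
      case True then show ?thesis using D(5) hpf.hpf_zero by simp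
    next
      case False then show ?thesis using hpf.hpf_mult[OF hpf_mult(1) D(4)[rule_format, of s]] by simp
    qed
    show ?thesis unfolding D'_def by (rule hpf.hpf_add[OF 1 2])
  qed
  moreover have "d + e = 0 \<longrightarrow> (\<forall>s x. D' s x = 0)" using D(2,5) by (simp add: D'_def)
  ultimately show ?case by blast
qed

text \<open>Serves invariants of degree 0 and 1, which are to be excluded, and the gradient of an
  invariant of degree 2, which is linear.\<close>

lemma hpf_low: "hpf S d F \<Longrightarrow> (d = 0 \<longrightarrow> (\<exists>a. \<forall>x. F x = a)) \<and>
    (d = 1 \<longrightarrow> (\<forall>x y. F (\<lambda>s. x s + y s) = F x + F y))"
proof (induction rule: hpf.induct)
  case (hpf_add d F H)
  then show ?case by (auto simp: algebra_simps)
next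
  case (hpf_mult d F e H)
  show ?case
  proof (intro conjI impI)
    assume "d + e = 0" then show "\<exists>a. \<forall>x. F x * H x = a" using hpf_mult.IH by auto
  next
    assume "d + e = 1"
    then consider "d = 0" "e = 1" | "d = 1" "e = 0" by linarith
    then show "\<forall>x y. F (\<lambda>s. x s + y s) * H (\<lambda>s. x s + y s) = F x * H x + F y * H y"
    proof cases
      case 1 then show ?thesis using hpf_mult.IH by (auto simp: distrib_left)
    next
      case 2 then show ?thesis using hpf_mult.IH by (auto simp: distrib_right)
    qed
  qed
qed auto

text \<open>Of the chain rule only this is kept: the coefficients \<open>a\<close> do not depend on
  the direction \<open>y\<close>, so the differential of a polynomial in the \<open>F i\<close> is a
  combination of theirs.\<close>

lemma mev_chain:
  fixes F :: "'i \<Rightarrow> ('s \<Rightarrow> complex) \<Rightarrow> complex" and P :: "('i, real) mpoly"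
  assumes F: "\<And>i. i \<in> I \<Longrightarrow> \<forall>y. ((\<lambda>t. F i (line v y t)) has_field_derivative phi i y) (at 0)"
    and I: "finite I" and P: "P \<in> mpolys_in I"
  shows "\<exists>a. \<forall>y. ((\<lambda>t. mev P (\<lambda>i. F i (line v y t))) has_field_derivative (\<Sum>i\<in>I. a i * phi i y)) (at 0)"
proof -
  define ch where "ch H \<longleftrightarrow> (\<exists>a. \<forall>y. ((\<lambda>t. H (line v y t)) has_field_derivative (\<Sum>i\<in>I. a i * phi i y)) (at 0))" for H :: "('s \<Rightarrow> complex) \<Rightarrow> complex"
  have const: "ch (\<lambda>x. k)" for k unfolding ch_def by (intro exI[of _ "\<lambda>i. 0"]) simp
  have gen: "ch (F i)" if i: "i \<in> I" for i
  proof -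
    have "(\<Sum>k\<in>I. (if k = i then 1 else 0) * phi k y) = (\<Sum>k\<in>I. if k = i then phi k y else 0)" for y by (intro sum.cong) auto
    then have "(\<Sum>k\<in>I. (if k = i then 1 else 0) * phi k y) = phi i y" for y using i I by simp
    then show ?thesis unfolding ch_def using F[OF i] by (intro exI[of _ "\<lambda>k. if k = i then 1 else 0"]) simp
  qed
  have add: "ch (\<lambda>x. H x + K x)" if HK: "ch H" "ch K" for H K
  proof -
    obtain a b where "\<forall>y. ((\<lambda>t. H (line v y t)) has_field_derivative (\<Sum>i\<in>I. a i * phi i y)) (at 0)"
      "\<forall>y. ((\<lambda>t. K (line v y t)) has_field_derivative (\<Sum>i\<in>I. b i * phi i y)) (at 0)" using HK unfolding ch_def by blast
    then have "((\<lambda>t. H (line v y t) + K (line v y t)) has_field_derivative (\<Sum>i\<in>I. (a i + b i) * phi i y)) (at 0)" for y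
      using DERIV_add[of "\<lambda>t. H (line v y t)" "\<Sum>i\<in>I. a i * phi i y" 0 UNIV "\<lambda>t. K (line v y t)" "\<Sum>i\<in>I. b i * phi i y"]
      by (simp add: distrib_right sum.distrib)
    then show ?thesis unfolding ch_def by (intro exI[of _ "\<lambda>i. a i + b i"]) simp
  qed
  have l0: "line v y 0 = v" for y by (simp add: line_def)
  have mult: "ch (\<lambda>x. H x * K x)" if HK: "ch H" "ch K" for H K
  proof -
    obtain a b where ab: "\<forall>y. ((\<lambda>t. H (line v y t)) has_field_derivative (\<Sum>i\<in>I. a i * phi i y)) (at 0)"
      "\<forall>y. ((\<lambda>t. K (line v y t)) has_field_derivative (\<Sum>i\<in>I. b i * phi i y)) (at 0)" using HK unfolding ch_def by blast
    have "((\<lambda>t. H (line v y t) * K (line v y t)) has_field_derivative (\<Sum>i\<in>I. (a i * K v + H v * b i) * phi i y)) (at 0)" for y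
    proof -
      have "(\<Sum>i\<in>I. (a i * K v + H v * b i) * phi i y) = (\<Sum>i\<in>I. a i * phi i y) * K v + (\<Sum>i\<in>I. b i * phi i y) * H v"
        unfolding sum_distrib_right sum.distrib[symmetric] by (intro sum.cong refl) (simp add: algebra_simps)
      then show ?thesis
        using DERIV_mult[OF ab(1)[rule_format, of y] ab(2)[rule_format, of y]] by (simp add: l0)
    qed
    then show ?thesis unfolding ch_def by (intro exI[of _ "\<lambda>i. a i * K v + H v * b i"]) simp
  qed
  have pow: "ch (\<lambda>x. H x ^ n)" if "ch H" for H n
    by (induction n) (use that in \<open>auto intro: const mult\<close>)
  have prod: "(\<And>i. i \<in> A \<Longrightarrow> ch (H i)) \<Longrightarrow> ch (\<lambda>x. \<Prod>i\<in>A. H i x)" for A and H :: "'i \<Rightarrow> ('s \<Rightarrow> complex) \<Rightarrow> complex"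
    by (induction A rule: infinite_finite_induct) (auto intro: const mult)
  have sum: "(\<And>i. i \<in> A \<Longrightarrow> ch (H i)) \<Longrightarrow> ch (\<lambda>x. \<Sum>i\<in>A. H i x)" for A and H :: "('i \<Rightarrow>\<^sub>0 nat) \<Rightarrow> ('s \<Rightarrow> complex) \<Rightarrow> complex"
    by (induction A rule: infinite_finite_induct) (auto intro: const add)
  have "ch (\<lambda>x. mev P (\<lambda>i. F i x))"
    unfolding mpoly_eval_def using P by (intro sum mult const prod pow gen) (auto simp: mpolys_in_def)
  then show ?thesis unfolding ch_def .
qed

section \<open>Springer theory of the Coxeter element\<close>

lemma gact_Re: "Re (gact G B S w x s) = gact G B S w (\<lambda>s. Re (x s)) s"
proof -
  have l: "Re (lform B S s x) = lform B S s (\<lambda>s. Re (x s))" for x s by (simp add: lform_def Re_sum)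
  have "(\<lambda>s. Re (sact B S u x s)) = sact B S u (\<lambda>s. Re (x s))" for u x by (auto simp: sact_def l fun_eq_iff)
  then have "(\<lambda>s. Re (wact B S ws x s)) = wact B S ws (\<lambda>s. Re (x s))" for ws by (induction ws) (auto simp: wact_def)
  then show ?thesis by (simp add: gact_def fun_eq_iff)
qed

lemma gact_cnj: "gact G B S w (\<lambda>s. cnj (x s)) = (\<lambda>s. cnj (gact G B S w x s))"
proof -
  have l: "lform B S s (\<lambda>s. cnj (x s)) = cnj (lform B S s x)" for x s by (simp add: lform_def)
  have "sact B S u (\<lambda>s. cnj (x s)) = (\<lambda>s. cnj (sact B S u x s))" for u x by (auto simp: sact_def l fun_eq_iff)
  then have "wact B S ws (\<lambda>s. cnj (x s)) = (\<lambda>s. cnj (wact B S ws x s))" for ws by (induction ws) (auto simp: wact_def)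
  then show ?thesis by (simp add: gact_def)
qed

lemma gact_Im: "Im (gact G B S w x s) = gact G B S w (\<lambda>s. Im (x s)) s"
proof -
  have "Im (gact G B S w x s) = Re (gact G B S w (\<lambda>s. - \<i> * x s) s)" by (simp only: gact_mult_scalar) simp
  then show ?thesis by (simp add: gact_Re)
qed

lemma line_eq: "line x y t = x + (\<lambda>s. t * y s)" by (simp add: line_def fun_eq_iff)

lemma gact_line: "gact G B S w (line x y t) = line (gact G B S w x) (gact G B S w y) t"
  by (simp only: line_eq gact_add gact_mult_scalar)

lemma line_geom: "x \<in> geom_space S \<Longrightarrow> y \<in> geom_space S \<Longrightarrow> line x y t \<in> geom_space S"
  by (simp add: geom_space_def line_def)

lemma gact_expand: assumes "finite S" "x \<in> geom_space S"
  shows "gact G B S w x u = (\<Sum>t\<in>S. x t * gact G B S w (al t) u)"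
proof -
  have 1: "x = (\<Sum>t\<in>S. (\<lambda>u. x t * al t u))"
  proof
    fix u show "x u = (\<Sum>t\<in>S. (\<lambda>u. x t * al t u)) u"
      by (subst sum_fun_apply) (rule fun_cong[OF vec_eq_sum_al[OF assms]])
  qed
  have "gact G B S w x u = gact G B S w (\<Sum>t\<in>S. (\<lambda>u. x t * al t u)) u"
    by (rule arg_cong[OF 1, of "\<lambda>x. gact G B S w x u"])
  also have "\<dots> = (\<Sum>t\<in>S. x t * gact G B S w (al t) u)"
    by (simp only: gact_sum gact_mult_scalar sum_fun_apply)
  finally show ?thesis .
qed

lemma poly_eq_of_real: fixes p q :: "complex poly"
  assumes "\<And>t::real. poly p (of_real t) = poly q (of_real t)" shows "p = q"
proof (rule ccontr)
  assume "p \<noteq> q"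
  then have "finite {x. poly (p - q) x = 0}" by (intro poly_roots_finite) simp
  moreover have "range complex_of_real \<subseteq> {x. poly (p - q) x = 0}" using assms by auto
  ultimately have "finite (range complex_of_real)" by (rule finite_subset[rotated])
  then show False using finite_imageD[of complex_of_real UNIV] infinite_UNIV_char_0[where 'a = real]
    by (auto simp: inj_on_def)
qed

locale springer = geom_rep +
  fixes f :: "nat \<Rightarrow> ('a, real) mpoly" and d :: "nat \<Rightarrow> nat" and h :: nat and c :: 'a
    and v :: "'a \<Rightarrow> complex" and z :: complex
  assumes rank_pos: "S \<noteq> {}"
    and connected: "s \<in> S \<Longrightarrow> t \<in> S \<Longrightarrow> (s, t) \<in> (diagram_edges G S)\<^sup>*"
    and basic: "basic_invariants G S f d" and h_Max: "h = Max (d ` {..<card S})"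
    and c_in: "c \<in> carrier G" and ord_c: "ord c = h"
    and v_geom: "v \<in> geom_space S" and v_nz: "v \<noteq> (\<lambda>s. 0)" and c_v: "act c v = (\<lambda>s. z * v s)"
    and v_regular: "t \<in> reflections G S \<Longrightarrow> act t v \<noteq> v"
begin

abbreviation "n \<equiv> card S"

section \<open>The regular eigenvector and the differentials of the basic invariants\<close>

lemma stabilizer: assumes w: "w \<in> carrier G" "act w v = v" shows "w = \<one>"
proof (rule ccontr)
  assume "w \<noteq> \<one>"
  then obtain t where t: "t \<in> reflections G S" "\<forall>x\<in>geom_space S. act w x = x \<longrightarrow> act t x = (x :: 'a \<Rightarrow> real)"
    using steinberg_geom w(1) by blast
  have g: "(\<lambda>s. Re (v s)) \<in> geom_space S" "(\<lambda>s. Im (v s)) \<in> geom_space S" using v_geom by (auto simp: geom_space_def)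
  have "act w (\<lambda>s. Re (v s)) = (\<lambda>s. Re (v s))" by (rule ext) (simp only: gact_Re[symmetric] w(2))
  then have 1: "act t (\<lambda>s. Re (v s)) = (\<lambda>s. Re (v s))" by (rule mp[OF t(2)[THEN bspec, OF g(1)]])
  have "act w (\<lambda>s. Im (v s)) = (\<lambda>s. Im (v s))" by (rule ext) (simp only: gact_Im[symmetric] w(2))
  then have 2: "act t (\<lambda>s. Im (v s)) = (\<lambda>s. Im (v s))" by (rule mp[OF t(2)[THEN bspec, OF g(2)]])
  have "act t v = v" by (rule ext, rule complex_eqI) (simp_all only: gact_Re gact_Im 1 2)
  then show False using v_regular t(1) by blast
qed

lemma act_pow: "act (c [^] k) v = (\<lambda>s. z ^ k * v s)"
proof (induction k)
  case 0 show ?case by (simp add: act_one)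
next
  case (Suc k)
  have "act (c [^] Suc k) v = act (c [^] k) (act c v)" using c_in by (simp add: act_mult)
  also have "\<dots> = (\<lambda>s. z * act (c [^] k) v s)" by (simp only: c_v gact_mult_scalar)
  finally show ?case by (simp add: Suc mult_ac)
qed

text \<open>Powers of \<open>c\<close> scale \<open>v\<close> by powers of \<open>z\<close>, and
  \<open>v\<close> has trivial stabilizer; so \<open>z\<close> inherits the order of
  \<open>c\<close>. Which primitive root it is remains open.\<close>

lemma z_pow: "z ^ k = 1 \<longleftrightarrow> h dvd k"
proof
  assume "z ^ k = 1"
  then have "act (c [^] k) v = v" by (simp add: act_pow)
  then have "c [^] k = \<one>" using stabilizer c_in by simp
  then show "h dvd k" using pow_eq_id c_in ord_c by simp
next
  assume "h dvd k"
  then have "c [^] k = \<one>" using pow_eq_id c_in ord_c by simp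
  then have e: "(\<lambda>s. z ^ k * v s) = v" using act_pow[of k] by (simp only: act_one)
  obtain s where "v s \<noteq> 0" using v_nz by auto
  then show "z ^ k = 1" using fun_cong[OF e, of s] by simp
qed

lemma z_nz: "z \<noteq> 0"
proof
  assume "z = 0"
  then have "z ^ h = 0" using ord_pos'[OF c_in] ord_c by (simp add: zero_power)
  moreover have "z ^ h = 1" using z_pow[of h] by (simp only: dvd_refl)
  ultimately show False by (metis zero_neq_one)
qed

lemma f_inv: assumes "i < n" shows "f i \<in> mpolys_in S" "homogeneous (d i) (f i)"
  "w \<in> carrier G \<Longrightarrow> x \<in> geom_space S \<Longrightarrow> mpoly_eval id (f i) (act w x) = mpoly_eval id (f i) x"
  using assms basic unfolding basic_invariants_def invariant_ring_def
  by (auto simp: geom_action_eq_gact j1)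

lemma f_hpf: "i < n \<Longrightarrow> hpf S (d i) (mev (f i))" using f_inv(1,2) by (intro hpf_mev)

text \<open>Invariance is given at real points only. Along the line through the real and imaginary
  parts of \<open>x\<close> both sides are polynomials in the parameter that agree at real values,
  hence also at \<open>\<i>\<close>.\<close>

lemma f_inv_complex: assumes i: "i < n" and w: "w \<in> carrier G" and x: "x \<in> geom_space S"
  shows "mev (f i) (act w x) = mev (f i) x"
proof -
  define a b where "a s = Re (x s)" and "b s = Im (x s)" for s
  have ab: "a \<in> geom_space S" "b \<in> geom_space S" using x by (auto simp: geom_space_def a_def b_def)
  have xe: "x = line (emb a) (emb b) \<i>" by (auto simp: line_def a_def b_def complex_eq_iff)
  obtain p where p: "\<And>t. mev (f i) (line (emb a) (emb b) t) = poly p t" using hpf_line[OF f_hpf[OF i]] by blast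
  obtain q where q: "\<And>t. mev (f i) (line (emb (act w a)) (emb (act w b)) t) = poly q t" using hpf_line[OF f_hpf[OF i]] by blast
  have "poly q (of_real t) = poly p (of_real t)" for t
  proof -
    have g: "(\<lambda>s. a s + t * b s) \<in> geom_space S" using ab by (simp add: geom_space_def)
    have l: "line (emb (act w a)) (emb (act w b)) (of_real t) = emb (act w (\<lambda>s. a s + t * b s))"
      using gact_line[of G B S w "emb a" "emb b" "of_real t"] gact_emb[of G B S w "\<lambda>s. a s + t * b s"]
      by (simp add: gact_emb line_def)
    have l': "line (emb a) (emb b) (of_real t) = emb (\<lambda>s. a s + t * b s)" by (simp add: line_def)
    show ?thesis unfolding p[symmetric] q[symmetric] l l' mev_emb f_inv(3)[OF i w g] ..
  qed
  then have "q = p" by (rule poly_eq_of_real)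
  then have "mev (f i) (line (emb (act w a)) (emb (act w b)) \<i>) = mev (f i) x" unfolding xe p q by simp
  moreover have "line (emb (act w a)) (emb (act w b)) \<i> = act w x" unfolding xe gact_line gact_emb ..
  ultimately show ?thesis by simp
qed

definition D where "D i = (SOME D. (\<forall>s. hpf S (d i - 1) (D s)) \<and> (d i = 0 \<longrightarrow> (\<forall>s x. D s x = 0)) \<and>
    (\<forall>x y. ((\<lambda>t. mev (f i) (line x y t)) has_field_derivative (\<Sum>s\<in>S. D s x * y s)) (at 0)))"

text \<open>The differential of \<open>f i\<close> at \<open>x\<close> in the direction
  \<open>y\<close>.\<close>

definition phi where "phi i x y = (\<Sum>s\<in>S. D i s x * y s)"

lemma D_props: assumes "i < n"
  shows "hpf S (d i - 1) (D i s)" "d i = 0 \<Longrightarrow> D i s x = 0"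
    "((\<lambda>t. mev (f i) (line x y t)) has_field_derivative phi i x y) (at 0)"
proof -
  have "(\<forall>s. hpf S (d i - 1) (D i s)) \<and> (d i = 0 \<longrightarrow> (\<forall>s x. D i s x = 0)) \<and>
    (\<forall>x y. ((\<lambda>t. mev (f i) (line x y t)) has_field_derivative (\<Sum>s\<in>S. D i s x * y s)) (at 0))"
    unfolding D_def by (rule someI_ex[OF hpf_derivative[OF finite_S f_hpf[OF assms]]])
  then show "hpf S (d i - 1) (D i s)" "d i = 0 \<Longrightarrow> D i s x = 0"
    "((\<lambda>t. mev (f i) (line x y t)) has_field_derivative phi i x y) (at 0)" unfolding phi_def by blast+
qed

lemma phi_add: "phi i x (\<lambda>s. y s + y' s) = phi i x y + phi i x y'" by (simp add: phi_def distrib_left sum.distrib)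
lemma phi_scale: "phi i x (\<lambda>s. a * y s) = a * phi i x y" by (simp add: phi_def sum_distrib_left mult_ac)

lemma phi_al: "s \<in> S \<Longrightarrow> phi i x (al s) = D i s x"
proof -
  assume s: "s \<in> S"
  have "phi i x (al s) = (\<Sum>u\<in>S. if u = s then D i u x else 0)" unfolding phi_def al_def by (intro sum.cong) auto
  then show ?thesis using s finite_S by simp
qed

lemma phi_act: assumes "i < n" "w \<in> carrier G" "x \<in> geom_space S" "y \<in> geom_space S"
  shows "phi i (act w x) (act w y) = phi i x y"
proof (rule DERIV_unique)
  show "((\<lambda>t. mev (f i) (line x y t)) has_field_derivative phi i x y) (at 0)" by (rule D_props(3)[OF assms(1)])
  have "(\<lambda>t. mev (f i) (line (act w x) (act w y) t)) = (\<lambda>t. mev (f i) (line x y t))"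
    using f_inv_complex[OF assms(1,2) line_geom[OF assms(3,4)]] by (simp only: gact_line)
  then show "((\<lambda>t. mev (f i) (line x y t)) has_field_derivative phi i (act w x) (act w y)) (at 0)"
    using D_props(3)[OF assms(1), of "act w x" "act w y"] by simp
qed

text \<open>Invariance moves the base point to \<open>c v = z v\<close>, and homogeneity of the
  gradient extracts the power of \<open>z\<close>. So each differential at \<open>v\<close> is an
  eigenvector for the dual action of \<open>c\<close>.\<close>

lemma phi_c: assumes "i < n" "y \<in> geom_space S" shows "phi i v y = z ^ (d i - 1) * phi i v (act c y)"
proof -
  have "phi i v y = phi i (\<lambda>s. z * v s) (act c y)" using phi_act[OF assms(1) c_in v_geom assms(2)] by (simp only: c_v)
  also have "\<dots> = z ^ (d i - 1) * phi i v (act c y)"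
    unfolding phi_def hpf_scale[OF D_props(1)[OF assms(1)]] by (simp add: sum_distrib_left mult_ac)
  finally show ?thesis .
qed

text \<open>An invariant whose differential at \<open>v\<close> is the coordinate \<open>s\<close>: the average of
  \<open>(x s - v s) r(l(x))\<close> over the group, where the polynomial \<open>r\<close> has value 1 at \<open>l(v)\<close> and double
  zeros at the points \<open>l(w v)\<close> for \<open>w \<noteq> 1\<close>.\<close>

lemma span_phi: assumes s: "s \<in> S"
  shows "\<exists>a. \<forall>y\<in>geom_space S. y s = (\<Sum>i<n. a i * phi i v y)"
proof -
  define dl where "dl u y = (\<Sum>t\<in>S. u t * y t)" for u y :: "'a \<Rightarrow> complex"
  \<comment> \<open>A linear form separating \<open>v\<close> from the rest of its orbit, which
    exists because the stabilizer is trivial.\<close>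
  have "\<exists>u\<in>UNIV. \<forall>w\<in>carrier G - {\<one>}. dl u (act w v - v) \<noteq> 0"
  proof (rule exists_avoiding_kernels)
    fix w assume w: "w \<in> carrier G - {\<one>}"
    then have "act w v \<noteq> v" using stabilizer by blast
    then obtain t where t: "act w v t \<noteq> v t" by blast
    have tS: "t \<in> S"
    proof (rule ccontr)
      assume "t \<notin> S"
      then show False using t v_geom act_geom[of w v] w by (auto simp: geom_space_def)
    qed
    have "dl (al t) y = y t" for y
    proof -
      have "dl (al t) y = (\<Sum>u\<in>S. if u = t then y u else 0)" unfolding dl_def al_def by (intro sum.cong) auto
      then show ?thesis using tS finite_S by simp
    qed
    then show "\<exists>u\<in>UNIV. dl u (act w v - v) \<noteq> 0" using t by (intro bexI[of _ "al t"]) auto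
  qed (auto simp: finite_carrier dl_def distrib_right sum.distrib scaleR_sum_right)
  then obtain u where u: "\<And>w. w \<in> carrier G \<Longrightarrow> w \<noteq> \<one> \<Longrightarrow> dl u (act w v - v) \<noteq> 0" by blast
  \<comment> \<open>Matrix entries in place of \<open>act\<close>, so that \<open>g\<close> is a
    polynomial in the coordinates over \<open>S\<close> at every argument, also outside
    \<open>geom_space S\<close>.\<close>
  define M where "M w t x = (\<Sum>r\<in>S. x r * act w (al r) t)" for w t and x :: "'a \<Rightarrow> complex"
  define l where "l w x = (\<Sum>t\<in>S. u t * M w t x)" for w x
  have M_act: "M w t x = act w x t" if "x \<in> geom_space S" for w t x
    unfolding M_def by (rule gact_expand[OF finite_S that, symmetric])
  have M_line: "M w t (line x y k) = M w t x + k * M w t y" for w t x y k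
    by (simp add: M_def line_def sum.distrib distrib_right sum_distrib_left mult_ac)
  have l_line: "l w (line x y k) = l w x + k * l w y" for w x y k
    by (simp add: l_def M_line sum.distrib distrib_left sum_distrib_left mult_ac)
  have lne: "l w v \<noteq> l \<one> v" if "w \<in> carrier G" "w \<noteq> \<one>" for w
  proof -
    have "l w v - l \<one> v = dl u (act w v - v)"
      by (simp add: l_def dl_def M_act[OF v_geom] act_one right_diff_distrib sum_subtractf)
    then show ?thesis using u[OF that] by auto
  qed
  define q where "q = (\<Prod>w\<in>carrier G - {\<one>}. [:- l w v, 1:])"
  \<comment> \<open>The square gives double zeros at the other orbit points; the scalar gives value
    1 at \<open>v\<close>.\<close>
  define r where "r = smult (inverse (poly (q * q) (l \<one> v))) (q * q)"
  have q1: "poly q (l \<one> v) \<noteq> 0" using lne[symmetric] finite_carrier by (simp add: q_def poly_prod)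
  have q0: "poly q (l w v) = 0" if "w \<in> carrier G" "w \<noteq> \<one>" for w
    unfolding q_def poly_prod using that finite_carrier by (intro prod_zero) auto
  have r1: "poly r (l \<one> v) = 1" using q1 by (simp add: r_def field_simps)
  have r0: "poly r (l w v) = 0" "poly (pderiv r) (l w v) = 0" if "w \<in> carrier G" "w \<noteq> \<one>" for w
    using q0[OF that] by (simp_all add: r_def pderiv_smult pderiv_mult)
  define g where "g x = (\<Sum>w\<in>carrier G. (M w s x + - v s) * poly r (l w x))" for x
  have cg: "cpf S g"
  proof -
    have "cpf S (M w t)" for w t unfolding M_def by (intro cpf_sum cpf_mult cpf_coord cpf_const)
    then show ?thesis unfolding g_def l_def by (intro cpf_sum cpf_mult cpf_add cpf_const cpf_poly)
  qed
  have g_inv: "g (act k x) = g x" if k: "k \<in> carrier G" and x: "x \<in> geom_space S" for k x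
  proof -
    have bij: "bij_betw (\<lambda>w. w \<otimes> k) (carrier G) (carrier G)"
      by (rule bij_betwI[where g = "\<lambda>w. w \<otimes> inv k"]) (use k in \<open>auto simp: m_assoc\<close>)
    have "M w t (act k x) = M (w \<otimes> k) t x" if "w \<in> carrier G" for w t
      unfolding M_act[OF x] M_act[OF act_geom[OF k x]] act_mult[OF that k] ..
    then have "g (act k x) = (\<Sum>w\<in>carrier G. (M (w \<otimes> k) s x + - v s) * poly r (l (w \<otimes> k) x))"
      unfolding g_def l_def by (intro sum.cong refl) simp
    also have "\<dots> = g x" unfolding g_def by (rule sum.reindex_bij_betw[OF bij, of "\<lambda>w. (M w s x + - v s) * poly r (l w x)"])
    finally show ?thesis .
  qed
  have g_deriv: "((\<lambda>k. g (line v y k)) has_field_derivative y s) (at 0)" if y: "y \<in> geom_space S" for y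
  proof -
    define T where "T w = M w s y * poly r (l w v) + poly (pderiv r) (l w v) * l w y * (M w s v + - v s)" for w
    have "((\<lambda>k. (M w s v + k * M w s y + - v s) * poly r (l w v + k * l w y)) has_field_derivative T w) (at 0)" for w
    proof -
      have 1: "((\<lambda>k. M w s v + k * M w s y + - v s) has_field_derivative M w s y) (at 0)"
        by (auto intro!: derivative_eq_intros)
      have "((\<lambda>k. l w v + k * l w y) has_field_derivative l w y) (at 0)"
        by (auto intro!: derivative_eq_intros)
      then have 2: "((\<lambda>k. poly r (l w v + k * l w y)) has_field_derivative poly (pderiv r) (l w v) * l w y) (at 0)"
        using DERIV_chain2[of "poly r" "poly (pderiv r) (l w v)" "\<lambda>k. l w v + k * l w y" 0 "l w y" UNIV] poly_DERIV[of r "l w v"]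
        by simp
      show ?thesis using DERIV_mult[OF 1 2] by (simp add: T_def)
    qed
    then have "((\<lambda>k. g (line v y k)) has_field_derivative (\<Sum>w\<in>carrier G. T w)) (at 0)"
      unfolding g_def M_line l_line by (intro DERIV_sum)
    \<comment> \<open>For \<open>w \<noteq> 1\<close> both \<open>r\<close> and its derivative
      vanish at \<open>l w v\<close>. For the identity the factor \<open>x s - v s\<close> vanishes
      at \<open>v\<close>, so only its own derivative \<open>y s\<close> is left.\<close>
    moreover have "(\<Sum>w\<in>carrier G. T w) = (\<Sum>w\<in>carrier G. if w = \<one> then y s else 0)"
    proof (intro sum.cong refl)
      fix w assume w: "w \<in> carrier G"
      show "T w = (if w = \<one> then y s else 0)"
      proof (cases "w = \<one>")
        case True
        then show ?thesis by (simp add: T_def r1 M_act[OF y] M_act[OF v_geom] act_one)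
      next
        case False
        then show ?thesis by (simp add: T_def r0[OF w False])
      qed
    qed
    ultimately show ?thesis using finite_carrier by simp
  qed
  obtain p1 p2 where p: "p1 \<in> mpolys_in S" "p2 \<in> mpolys_in S" "\<And>x. g x = mev p1 x + \<i> * mev p2 x"
    using cg unfolding cpf_def rpf_def by (metis (no_types, lifting))
  have inv: "mpoly_eval id p1 (act w x) = mpoly_eval id p1 x \<and> mpoly_eval id p2 (act w x) = mpoly_eval id p2 x"
    if w: "w \<in> carrier G" and x: "x \<in> geom_space S" for w x
  proof -
    have "emb x \<in> geom_space S" using x by (simp add: geom_space_def)
    then have "g (emb (act w x)) = g (emb x)" using g_inv[OF w, of "emb x"] by (simp only: gact_emb)
    then show ?thesis unfolding p(3) mev_emb by (simp add: complex_eq_iff)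
  qed
  have "p1 \<in> invariant_ring G S" "p2 \<in> invariant_ring G S"
    unfolding invariant_ring_def geom_action_eq_gact j1[symmetric] using p(1,2) inv by blast+
  then obtain P1 P2 where P: "p1 = mpoly_subst P1 f" "p2 = mpoly_subst P2 f" "P1 \<in> mpolys_in {..<n}" "P2 \<in> mpolys_in {..<n}"
    using basic unfolding basic_invariants_def by blast
  have D: "i \<in> {..<n} \<Longrightarrow> \<forall>y. ((\<lambda>t. mev (f i) (line v y t)) has_field_derivative phi i v y) (at 0)" for i
    using D_props(3) by simp
  obtain a1 where a1: "\<And>y. ((\<lambda>t. mev p1 (line v y t)) has_field_derivative (\<Sum>i<n. a1 i * phi i v y)) (at 0)"
    using mev_chain[where F = "\<lambda>i. mev (f i)" and phi = "\<lambda>i. phi i v", OF D finite_lessThan P(3)] unfolding P(1) mev_subst by blast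
  obtain a2 where a2: "\<And>y. ((\<lambda>t. mev p2 (line v y t)) has_field_derivative (\<Sum>i<n. a2 i * phi i v y)) (at 0)"
    using mev_chain[where F = "\<lambda>i. mev (f i)" and phi = "\<lambda>i. phi i v", OF D finite_lessThan P(4)] unfolding P(2) mev_subst by blast
  have "y s = (\<Sum>i<n. (a1 i + \<i> * a2 i) * phi i v y)" if y: "y \<in> geom_space S" for y
  proof -
    have "((\<lambda>t. g (line v y t)) has_field_derivative (\<Sum>i<n. a1 i * phi i v y) + \<i> * (\<Sum>i<n. a2 i * phi i v y)) (at 0)"
      unfolding p(3) by (intro DERIV_add DERIV_cmult a1 a2)
    then have "y s = (\<Sum>i<n. a1 i * phi i v y) + \<i> * (\<Sum>i<n. a2 i * phi i v y)"
      by (rule DERIV_unique[OF g_deriv[OF y]])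
    then show ?thesis by (simp add: distrib_right sum.distrib sum_distrib_left mult.assoc)
  qed
  then show ?thesis by (intro exI[of _ "\<lambda>i. a1 i + \<i> * a2 i"]) simp
qed

lemma phi_inj: assumes "y \<in> geom_space S" "\<And>i. i < n \<Longrightarrow> phi i v y = 0" shows "y = (\<lambda>s. 0)"
proof
  fix s show "y s = 0"
  proof (cases "s \<in> S")
    case True
    then obtain a where "y s = (\<Sum>i<n. a i * phi i v y)" using span_phi[OF True] assms(1) by blast
    then show ?thesis using assms(2) by simp
  qed (use assms(1) in \<open>simp add: geom_space_def\<close>)
qed

text \<open>By \<open>span_phi\<close> the \<open>n\<close> coordinates are combinations of the
  \<open>n\<close> differentials, so the Jacobian at \<open>v\<close> has a left inverse, whose
  columns form the basis dual to the differentials.\<close>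

lemma dual_basis_det: assumes e: "bij_betw e {..<n} S"
  shows "det (mat n n (\<lambda>(i, k). D i (e k) v)) \<noteq> 0"
    "\<exists>Y. (\<forall>k<n. Y k \<in> geom_space S) \<and> (\<forall>i<n. \<forall>k<n. phi i v (Y k) = (if i = k then 1 else 0))"
proof -
  obtain a where a: "\<And>s y. s \<in> S \<Longrightarrow> y \<in> geom_space S \<Longrightarrow> y s = (\<Sum>i<n. a s i * phi i v y)"
    using bchoice[of S "\<lambda>s a. \<forall>y\<in>geom_space S. y s = (\<Sum>i<n. a i * phi i v y)"] span_phi by blast
  have eS: "e k \<in> S" if "k < n" for k using e that by (auto simp: bij_betw_def)
  have einj: "e k = e m \<longleftrightarrow> k = m" if "k < n" "m < n" for k m using e that by (auto simp: bij_betw_def inj_on_def)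
  define A where "A = mat n n (\<lambda>(m, i). a (e m) i)"
  define J where "J = mat n n (\<lambda>(i, k). D i (e k) v)"
  have AJ: "A * J = 1\<^sub>m n"
  proof (rule eq_matI)
    fix m k assume "m < dim_row (1\<^sub>m n :: complex mat)" "k < dim_col (1\<^sub>m n :: complex mat)"
    then have mk: "m < n" "k < n" by auto
    have "(A * J) $$ (m, k) = (\<Sum>i<n. a (e m) i * phi i v (al (e k)))"
      using mk phi_al[OF eS[OF mk(2)]] by (simp add: A_def J_def scalar_prod_def atLeast0LessThan)
    also have "\<dots> = al (e k) (e m)" by (rule a[symmetric, OF eS[OF mk(1)] al_geom[OF eS[OF mk(2)]]])
    also have "\<dots> = 1\<^sub>m n $$ (m, k)" using mk einj by (simp add: al_def)
    finally show "(A * J) $$ (m, k) = 1\<^sub>m n $$ (m, k)" .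
  qed (auto simp: A_def J_def)
  have AJc: "A \<in> carrier_mat n n" "J \<in> carrier_mat n n" by (auto simp: A_def J_def)
  have "det A * det J = 1" using det_mult[OF AJc] AJ by simp
  then show "det (mat n n (\<lambda>(i, k). D i (e k) v)) \<noteq> 0" unfolding J_def[symmetric] by auto
  have JA: "J * A = 1\<^sub>m n" by (rule mat_mult_left_right_inverse[OF AJc AJ])
  define Y where "Y m s = (if s \<in> S then a s m else 0)" for m s
  have "phi i v (Y m) = (if i = m then 1 else 0)" if im: "i < n" "m < n" for i m
  proof -
    have "phi i v (Y m) = (\<Sum>s\<in>S. D i s v * a s m)" unfolding phi_def Y_def by (intro sum.cong) auto
    also have "\<dots> = (\<Sum>k<n. D i (e k) v * a (e k) m)" by (rule sum.reindex_bij_betw[OF e, symmetric])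
    also have "\<dots> = (J * A) $$ (i, m)" using im by (simp add: A_def J_def scalar_prod_def atLeast0LessThan)
    finally show ?thesis using im by (simp add: JA)
  qed
  moreover have "Y m \<in> geom_space S" for m by (simp add: geom_space_def Y_def)
  ultimately show "\<exists>Y. (\<forall>k<n. Y k \<in> geom_space S) \<and> (\<forall>i<n. \<forall>k<n. phi i v (Y k) = (if i = k then 1 else 0))" by blast
qed

lemma enum: "\<exists>e. bij_betw e {..<n} S" using ex_bij_betw_nat_finite[OF finite_S] by (simp add: atLeast0LessThan)

lemma dual_basis: "\<exists>Y. (\<forall>k<n. Y k \<in> geom_space S) \<and> (\<forall>i<n. \<forall>k<n. phi i v (Y k) = (if i = k then 1 else 0))"
  using enum dual_basis_det(2) by blast

lemma phi_nz: assumes i: "i < n" shows "\<exists>s\<in>S. phi i v (al s) \<noteq> 0"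
proof (rule ccontr)
  assume a: "\<not> (\<exists>s\<in>S. phi i v (al s) \<noteq> 0)"
  then have "D i s v = 0" if "s \<in> S" for s using phi_al[OF that] that by metis
  then have "phi i v y = 0" for y by (simp add: phi_def)
  then show False using dual_basis i by (metis zero_neq_one)
qed

lemma act_al_complex: "s \<in> S \<Longrightarrow> act s (al s) = (\<lambda>t. - 1 * (al s t :: complex))"
  by (rule ext) (simp add: act_simple sact_apply lform_al B_self)

text \<open>A constant has zero differential. A linear invariant vanishes at every simple root,
  because \<open>s\<close> negates it, and so has zero differential too; but no differential at
  \<open>v\<close> is zero.\<close>

lemma d_ge_2: assumes i: "i < n" shows "d i \<ge> 2"
proof (rule ccontr)
  assume "\<not> d i \<ge> 2"
  then consider "d i = 0" | "d i = 1" by linarith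
  then have "phi i v (al s) = 0" if s: "s \<in> S" for s
  proof cases
    case 1 then show ?thesis using D_props(2)[OF i] phi_al[OF s] by simp
  next
    case 2
    let ?F = "mev (f i)"
    have F: "hpf S 1 ?F" using f_hpf[OF i] 2 by simp
    have sc: "?F (\<lambda>u. k * x u) = k * ?F x" for k x using hpf_scale[OF F] by simp
    have "?F (al s) = - ?F (al s)"
      using f_inv_complex[OF i S_carrier[OF s] al_geom[OF s]] unfolding act_al_complex[OF s] sc by simp
    then have 0: "?F (al s) = 0" by simp
    have "?F (line v (al s) k) = ?F v" for k
      using hpf_low[OF F] unfolding line_def by (simp add: sc 0)
    then have "((\<lambda>t. ?F v) has_field_derivative phi i v (al s)) (at 0)" using D_props(3)[OF i, of v "al s"] by simp
    then show ?thesis using DERIV_unique[OF DERIV_const] by metis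
  qed
  then show False using phi_nz[OF i] by blast
qed

lemma d_le_h: "i < n \<Longrightarrow> d i \<le> h" unfolding h_Max by (rule Max_ge) auto

lemma n_pos: "n > 0" using rank_pos finite_S by (simp add: card_gt_0_iff)

lemma h_ge_2: "h \<ge> 2" using d_ge_2[OF n_pos] d_le_h[OF n_pos] by linarith

end

lemma (in geom_rep) B_adjacent: assumes "(s, t) \<in> diagram_edges G S" shows "B s t \<noteq> 0"
proof -
  have st: "s \<in> S" "t \<in> S" "s \<noteq> t" "ord (s \<otimes> t) \<noteq> 2" using assms by (auto simp: diagram_edges_def)
  then have m: "ord (s \<otimes> t) \<ge> 3" using ord_ge_2[of s t] by linarith
  define th where "th = pi / real (ord (s \<otimes> t))"
  have "th \<le> pi / 3" unfolding th_def using m by (intro divide_left_mono) auto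
  moreover have "0 \<le> th" by (simp add: th_def)
  ultimately have "0 \<le> th" "th < pi / 2" using pi_gt_zero by linarith+
  then have "cos th > 0" by (intro cos_gt_zero_pi) auto
  then show ?thesis by (simp add: jform_def j1 th_def)
qed

section \<open>Degrees and eigenvalues of the Coxeter element\<close>

context springer
begin

text \<open>On a vector fixed by \<open>c\<close> each differential is multiplied by
  \<open>z ^ (d i - 1)\<close>, which differs from 1 because \<open>0 < d i - 1 < h\<close>.\<close>

lemma fix_c: assumes y: "y \<in> geom_space S" "act c y = (y :: 'a \<Rightarrow> complex)" shows "y = (\<lambda>s. 0)"
proof (rule phi_inj[OF y(1)])
  fix i assume i: "i < n"
  have "\<not> h dvd d i - 1" using d_ge_2[OF i] d_le_h[OF i] by (auto dest: dvd_imp_le)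
  then have "z ^ (d i - 1) \<noteq> 1" using z_pow by blast
  moreover have "phi i v y = z ^ (d i - 1) * phi i v y" using phi_c[OF i y(1)] y(2) by simp
  ultimately show "phi i v y = 0" by simp
qed

text \<open>Invariance under \<open>s\<close> determines \<open>phi i (al s)\<close> up to a scalar
  \<open>k s\<close>, likewise in the other argument; comparing the two at adjacent \<open>s\<close>
  and \<open>t\<close> gives \<open>k s = k t\<close>. Here irreducibility enters.\<close>

lemma quadratic_form: assumes i: "i < n" "d i = 2"
  shows "\<exists>k. \<forall>x\<in>geom_space S. \<forall>y. phi i x y = k * bform y x"
proof -
  have D1: "hpf S 1 (D i s)" for s using D_props(1)[OF i(1), of s] i(2) by simp
  have addL: "phi i (x + x') y = phi i x y + phi i x' y" for x x' y
  proof -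
    have "D i s (x + x') = D i s x + D i s x'" for s using hpf_low[OF D1[of s]] by (simp add: plus_fun_def)
    then show ?thesis by (simp add: phi_def distrib_right sum.distrib)
  qed
  have scL: "phi i (\<lambda>s. a * x s) y = a * phi i x y" for a x y
    unfolding phi_def hpf_scale[OF D1] by (simp add: sum_distrib_left mult_ac)
  have addR: "phi i x (y + y') = phi i x y + phi i x y'" for x y y' using phi_add by (simp add: plus_fun_def)
  have e: "act s x = x + (\<lambda>t. (- 2 * lform B S s x) * al s t)" if "s \<in> S" for s and x :: "'a \<Rightarrow> complex"
    by (rule ext) (simp add: act_simple[OF that] sact_apply)
  define k where "k s = phi i (al s) (al s)" for s
  have left: "phi i (al s) y = lform B S s y * k s" if s: "s \<in> S" and y: "y \<in> geom_space S" for s y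
  proof -
    have "phi i (al s) y = phi i (\<lambda>t. - 1 * al s t) (y + (\<lambda>t. (- 2 * lform B S s y) * al s t))"
      using phi_act[OF i(1) S_carrier[OF s] al_geom[OF s] y] by (simp only: act_al_complex[OF s] e[OF s, of y])
    also have "\<dots> = - (phi i (al s) y - 2 * lform B S s y * k s)"
      unfolding scL addR phi_scale k_def by simp
    finally show ?thesis by (simp add: field_simps)
  qed
  have right: "phi i y (al s) = lform B S s y * k s" if s: "s \<in> S" and y: "y \<in> geom_space S" for s y
  proof -
    have "phi i y (al s) = phi i (y + (\<lambda>t. (- 2 * lform B S s y) * al s t)) (\<lambda>t. - 1 * al s t)"
      using phi_act[OF i(1) S_carrier[OF s] y al_geom[OF s]] by (simp only: act_al_complex[OF s] e[OF s, of y])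
    also have "\<dots> = - (phi i y (al s) - 2 * lform B S s y * k s)"
      unfolding scL addL phi_scale k_def by simp
    finally show ?thesis by (simp add: field_simps)
  qed
  have adj: "k s = k t" if st: "(s, t) \<in> diagram_edges G S" for s t
  proof -
    have S: "s \<in> S" "t \<in> S" using st by (auto simp: diagram_edges_def)
    have "of_real (B s t) * k s = of_real (B s t) * k t"
      using left[OF S(1) al_geom[OF S(2)]] right[OF S(2) al_geom[OF S(1)]] S by (auto simp: lform_al B_sym)
    then show ?thesis using B_adjacent[OF st] by simp
  qed
  obtain s0 where s0: "s0 \<in> S" using rank_pos by blast
  have k: "k s = k s0" if "s \<in> S" for s
    using connected[OF that s0]
  proof (induction rule: converse_rtrancl_induct)
    case (step x y) then show ?case using adj by simp
  qed simp
  have "phi i x y = k s0 * bform y x" if x: "x \<in> geom_space S" for x y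
  proof -
    have "phi i x y = (\<Sum>s\<in>S. y s * (lform B S s x * k s0))"
      unfolding phi_def using phi_al[of _ i x] right[OF _ x] k by (intro sum.cong refl) (metis mult.commute)
    then show ?thesis by (simp add: bform_def sum_distrib_left mult_ac)
  qed
  then show ?thesis by blast
qed

lemma unique_degree_2: assumes i: "i < n" "d i = 2" and k: "k < n" "d k = 2" shows "i = k"
proof (rule ccontr)
  assume ne: "i \<noteq> k"
  obtain Y where Y: "\<And>k. k < n \<Longrightarrow> Y k \<in> geom_space S"
    "\<And>i k. i < n \<Longrightarrow> k < n \<Longrightarrow> phi i v (Y k) = (if i = k then 1 else 0)" using dual_basis by blast
  obtain p where p: "\<And>y. phi i v y = p * bform y v" using quadratic_form[OF i] v_geom by blast
  obtain q where q: "\<And>y. phi k v y = q * bform y v" using quadratic_form[OF k] v_geom by blast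
  have "p * bform (Y i) v = 1" "q * bform (Y i) v = 0" "q * bform (Y k) v = 1"
    using Y(2)[OF i(1) i(1)] Y(2)[OF k(1) i(1)] Y(2)[OF k(1) k(1)] ne unfolding p q by auto
  then show False by auto
qed

lemma z_cnj: "z * cnj z = 1"
proof -
  have "z ^ h = 1" using z_pow[of h] by (simp only: dvd_refl)
  then have "norm z ^ h = 1" by (metis norm_power norm_one)
  then have "norm z = 1" using h_ge_2 power_eq_imp_eq_base[of "norm z" h 1] by simp
  then show ?thesis by (simp add: complex_norm_square[symmetric])
qed

text \<open>The differentials are applied to the complex conjugate of \<open>y\<close>. There they
  pick up \<open>z ^ (d i - 2)\<close> and so vanish unless \<open>d i = 2\<close>, which happens
  for one index only. Applied to \<open>y\<close> itself they would pick up \<open>z ^ d i\<close>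
  and lead to the multiplicity of the degree \<open>h\<close> instead.\<close>

lemma eigenspace: assumes y: "y \<in> geom_space S" "act c y = (\<lambda>s. z * y s)" shows "\<exists>a. y = (\<lambda>s. a * v s)"
proof -
  have cg: "(\<lambda>s. cnj (x s)) \<in> geom_space S" if "x \<in> geom_space S" for x using that by (simp add: geom_space_def)
  have 0: "phi i v (\<lambda>s. cnj (x s)) = 0"
    if i: "i < n" "d i \<noteq> 2" and x: "x \<in> geom_space S" "act c x = (\<lambda>s. z * x s)" for i x
  proof -
    have "act c (\<lambda>s. cnj (x s)) = (\<lambda>s. cnj z * cnj (x s))" unfolding gact_cnj x(2) by simp
    then have "phi i v (\<lambda>s. cnj (x s)) = z ^ (d i - 1) * (cnj z * phi i v (\<lambda>s. cnj (x s)))"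
      using phi_c[OF i(1) cg[OF x(1)]] by (simp only: phi_scale)
    moreover have "z ^ (d i - 1) * cnj z = z ^ (d i - 2)"
    proof -
      have "d i - 1 = Suc (d i - 2)" using d_ge_2[OF i(1)] by linarith
      then have "z ^ (d i - 1) * cnj z = z ^ (d i - 2) * (z * cnj z)" by (simp only: power_Suc mult_ac)
      then show ?thesis by (simp only: z_cnj mult_1_right)
    qed
    moreover have "z ^ (d i - 2) \<noteq> 1"
    proof -
      have "\<not> h dvd d i - 2" using i(2) d_ge_2[OF i(1)] d_le_h[OF i(1)] by (auto dest: dvd_imp_le)
      then show ?thesis using z_pow by blast
    qed
    ultimately show ?thesis by (metis mult.assoc mult_cancel_right1)
  qed
  have "(\<lambda>s. cnj (v s)) \<noteq> (\<lambda>s. 0)" using v_nz by (auto simp: fun_eq_iff)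
  then obtain k where k: "k < n" "phi k v (\<lambda>s. cnj (v s)) \<noteq> 0" using phi_inj[OF cg[OF v_geom]] by blast
  have dk: "d k = 2" using 0[OF k(1) _ v_geom c_v] k(2) by blast
  define a where "a = phi k v (\<lambda>s. cnj (y s)) / phi k v (\<lambda>s. cnj (v s))"
  have "(\<lambda>s. cnj (y s) + (- a) * cnj (v s)) = (\<lambda>s. 0)"
  proof (rule phi_inj)
    show "(\<lambda>s. cnj (y s) + (- a) * cnj (v s)) \<in> geom_space S" using y(1) v_geom by (simp add: geom_space_def)
    fix i assume i: "i < n"
    show "phi i v (\<lambda>s. cnj (y s) + (- a) * cnj (v s)) = 0"
    proof (cases "i = k")
      case True then show ?thesis unfolding phi_add phi_scale using k(2) by (simp add: a_def)
    next
      case False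
      then have "d i \<noteq> 2" using unique_degree_2[OF i _ k(1) dk] by blast
      then show ?thesis unfolding phi_add phi_scale using 0[OF i _ y] 0[OF i _ v_geom c_v] by simp
    qed
  qed
  then have "cnj (y s) = a * cnj (v s)" for s by (simp add: fun_eq_iff)
  then have "y s = cnj a * v s" for s by (metis complex_cnj_cnj complex_cnj_mult)
  then show ?thesis by blast
qed

text \<open>Since \<open>c\<close> is real, conjugation permutes its eigenvalues, which pairs the
  degrees: \<open>(d i - 1) + (d (p i) - 1)\<close> is divisible by \<open>h\<close> and lies
  strictly between 0 and \<open>2 h\<close>, hence equals \<open>h\<close>.\<close>

lemma sum_degrees: "2 * (\<Sum>i<n. d i - 1) = n * h"
proof -
  obtain Y where Y: "\<And>k. k < n \<Longrightarrow> Y k \<in> geom_space S"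
    "\<And>i k. i < n \<Longrightarrow> k < n \<Longrightarrow> phi i v (Y k) = (if i = k then 1 else 0)" using dual_basis by blast
  have cY: "Y k s = z ^ (d k - 1) * act c (Y k) s" if k: "k < n" for k s
  proof -
    have "(\<lambda>s. Y k s + (- (z ^ (d k - 1))) * act c (Y k) s) = (\<lambda>s. 0)"
    proof (rule phi_inj)
      show "(\<lambda>s. Y k s + (- (z ^ (d k - 1))) * act c (Y k) s) \<in> geom_space S"
        using Y(1)[OF k] act_geom[OF c_in Y(1)[OF k]] by (simp add: geom_space_def)
      fix i assume i: "i < n"
      have p: "phi i v (Y k) = z ^ (d i - 1) * phi i v (act c (Y k))" by (rule phi_c[OF i Y(1)[OF k]])
      show "phi i v (\<lambda>s. Y k s + (- (z ^ (d k - 1))) * act c (Y k) s) = 0"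
      proof (cases "i = k")
        case True then show ?thesis unfolding phi_add phi_scale using p by simp
      next
        case False
        then have "phi i v (Y k) = 0" using Y(2)[OF i k] by simp
        then show ?thesis unfolding phi_add phi_scale using p z_nz by simp
      qed
    qed
    then show ?thesis by (simp add: fun_eq_iff)
  qed
  \<comment> \<open>Up to conjugating its entries, the matrix of complex conjugation in the basis
    \<open>Y\<close>. It is invertible because conjugation is injective.\<close>
  define M where "M = mat n n (\<lambda>(i, k). cnj (phi i v (\<lambda>s. cnj (Y k s))))"
  have Mc: "M \<in> carrier_mat n n" by (simp add: M_def)
  have phi_sum: "phi i x (\<lambda>s. \<Sum>k<n. a k * y k s) = (\<Sum>k<n. a k * phi i x (y k))" for i x a y
    unfolding phi_def sum_distrib_left by (subst sum.swap) (simp add: mult_ac)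
  have "det M \<noteq> 0"
  proof
    assume "det M = 0"
    then obtain x where x: "x \<in> carrier_vec n" "x \<noteq> 0\<^sub>v n" "M *\<^sub>v x = 0\<^sub>v n"
      using det_0_iff_vec_prod_zero_field[OF Mc] by blast
    define y where "y s = (\<Sum>k<n. cnj (x $ k) * cnj (Y k s))" for s
    have "y = (\<lambda>s. 0)"
    proof (rule phi_inj)
      show "y \<in> geom_space S" using Y(1) by (simp add: y_def geom_space_def)
      fix i assume i: "i < n"
      have "(\<Sum>k<n. cnj (phi i v (\<lambda>s. cnj (Y k s))) * x $ k) = (M *\<^sub>v x) $ i"
        using i x(1) by (simp add: M_def scalar_prod_def atLeast0LessThan)
      then have "cnj (\<Sum>k<n. cnj (phi i v (\<lambda>s. cnj (Y k s))) * x $ k) = 0" using i by (simp add: x(3))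
      then show "phi i v y = 0" unfolding y_def phi_sum by (simp add: mult.commute)
    qed
    then have "cnj (y s) = 0" for s by simp
    then have "(\<Sum>k<n. x $ k * Y k s) = 0" for s by (simp add: y_def)
    then have z: "phi i v (\<lambda>s. \<Sum>k<n. x $ k * Y k s) = 0" for i by (simp add: phi_def)
    have "x $ i = 0" if i: "i < n" for i
    proof -
      have "(\<Sum>k<n. x $ k * phi i v (Y k)) = (\<Sum>k<n. if k = i then x $ k else 0)"
        using Y(2)[OF i] by (intro sum.cong) auto
      then show ?thesis using z[of i] i unfolding phi_sum by simp
    qed
    then have "x = 0\<^sub>v n" using x(1) by (intro eq_vecI) auto
    then show False using x(2) by simp
  qed
  \<comment> \<open>A nonzero term of the Leibniz formula supplies a permutation along which all
    entries of \<open>M\<close> are nonzero.\<close>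
  then have "(\<Sum>p\<in>{p. p permutes {0..<n}}. signof p * (\<Prod>i = 0..<n. M $$ (i, p i))) \<noteq> 0"
    unfolding det_def'[OF Mc] .
  then obtain p where p: "p permutes {0..<n}" "signof p * (\<Prod>i = 0..<n. M $$ (i, p i)) \<noteq> 0"
    using sum.not_neutral_contains_not_neutral by blast
  have deg: "(d i - 1) + (d (p i) - 1) = h" if i: "i < n" for i
  proof -
    have pi: "p i < n" using permutes_in_image[OF p(1), of i] i by simp
    let ?y = "\<lambda>s. cnj (Y (p i) s)"
    have yg: "?y \<in> geom_space S" using Y(1)[OF pi] by (simp add: geom_space_def)
    have "M $$ (i, p i) \<noteq> 0" using p(2) i by auto
    then have nz: "phi i v ?y \<noteq> 0" using i pi by (simp add: M_def)
    have 1: "phi i v ?y = z ^ (d i - 1) * phi i v (act c ?y)" by (rule phi_c[OF i yg])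
    have "?y = (\<lambda>s. cnj z ^ (d (p i) - 1) * act c ?y s)"
    proof
      fix s
      have "cnj (Y (p i) s) = cnj (z ^ (d (p i) - 1) * act c (Y (p i)) s)" by (rule arg_cong[OF cY[OF pi]])
      then show "cnj (Y (p i) s) = cnj z ^ (d (p i) - 1) * act c ?y s" unfolding gact_cnj by simp
    qed
    then have "phi i v ?y = phi i v (\<lambda>s. cnj z ^ (d (p i) - 1) * act c ?y s)" by (rule arg_cong)
    then have 2: "phi i v ?y = cnj z ^ (d (p i) - 1) * phi i v (act c ?y)" unfolding phi_scale .
    have "z ^ (d i - 1) = cnj z ^ (d (p i) - 1)" using 1 2 nz by auto
    then have "z ^ ((d i - 1) + (d (p i) - 1)) = (z * cnj z) ^ (d (p i) - 1)"
      by (simp add: power_add power_mult_distrib mult.commute)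
    then have "z ^ ((d i - 1) + (d (p i) - 1)) = 1" by (simp only: z_cnj power_one)
    then have dv: "h dvd (d i - 1) + (d (p i) - 1)" using z_pow by blast
    then obtain q where q: "(d i - 1) + (d (p i) - 1) = h * q" by (rule dvdE)
    have "0 < (d i - 1) + (d (p i) - 1)" "(d i - 1) + (d (p i) - 1) < h * 2"
      using d_ge_2[OF i] d_ge_2[OF pi] d_le_h[OF i] d_le_h[OF pi] by linarith+
    then have "q = 1" unfolding q by auto
    then show ?thesis using q by simp
  qed
  have "(\<Sum>i\<in>{0..<n}. d (p i) - 1) = (\<Sum>i\<in>{0..<n}. d i - 1)"
    using sum.permute[OF p(1), of "\<lambda>i. d i - 1"] by (simp add: o_def)
  moreover have "(\<Sum>i\<in>{0..<n}. (d i - 1) + (d (p i) - 1)) = (\<Sum>i\<in>{0..<n}. h)" using deg by (intro sum.cong) auto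
  ultimately show ?thesis by (simp add: sum.distrib atLeast0LessThan)
qed

section \<open>The number of reflections\<close>

lemma reflection_form: assumes t: "t \<in> reflections G S"
  shows "\<exists>r\<in>geom_space S. r \<noteq> (\<lambda>s. 0) \<and> act t r = (\<lambda>s. - 1 * (r s :: complex)) \<and>
    (\<forall>x. act t x = (\<lambda>s. x s - 2 * bform r x * r s))"
proof -
  obtain w s where ws: "t = w \<otimes> s \<otimes> inv w" "w \<in> carrier G" "s \<in> S" using t by (auto simp: reflections_def)
  have sc: "s \<in> carrier G" using ws S_carrier by blast
  define r where "r = act w (al s :: 'a \<Rightarrow> complex)"
  have iw: "act (inv w) (act w x) = x" "act w (act (inv w) x) = x" for x :: "'a \<Rightarrow> complex"
    using act_mult[of "inv w" w x] act_mult[of w "inv w" x] ws(2) by (simp_all add: act_one)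
  have tx: "act t x = act w (act s (act (inv w) x))" for x :: "'a \<Rightarrow> complex"
    unfolding ws(1) using ws(2) sc by (simp only: act_mult m_closed inv_closed)
  have 1: "act t r = (\<lambda>s. - 1 * r s)" unfolding tx r_def iw act_al_complex[OF ws(3)] gact_mult_scalar ..
  have 2: "act t x = (\<lambda>s. x s - 2 * bform r x * r s)" for x
  proof -
    have b: "bform r x = lform B S s (act (inv w) x)"
      using bform_act[OF ws(2), of "al s" "act (inv w) x"] unfolding iw bform_al[OF ws(3)] r_def .
    have "act s (act (inv w) x) = act (inv w) x + (\<lambda>u. (- 2 * bform r x) * al s u)"
      unfolding b by (rule ext) (simp add: act_simple[OF ws(3)] sact_apply)
    then have "act t x = x + (\<lambda>u. (- 2 * bform r x) * r u)" unfolding tx r_def by (simp only: gact_add gact_mult_scalar iw)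
    then show ?thesis by (simp add: fun_eq_iff)
  qed
  have 3: "r \<noteq> (\<lambda>s. 0)"
  proof
    assume "r = (\<lambda>s. 0)"
    then have r0: "r = (\<lambda>u. 0 * r u)" by simp
    have "act (inv w) r = (\<lambda>u. 0 * act (inv w) r u)"
      by (rule trans[OF arg_cong[OF r0, of "act (inv w)"] gact_mult_scalar])
    then have "(al s :: 'a \<Rightarrow> complex) = (\<lambda>u. 0 * al s u)" unfolding r_def iw .
    from fun_cong[OF this, of s] show False by (simp add: al_def)
  qed
  have "r \<in> geom_space S" unfolding r_def by (rule act_geom[OF ws(2) al_geom[OF ws(3)]])
  then show ?thesis using 1 2 3 by blast
qed

lemma reflection_eq: assumes t: "t \<in> reflections G S" "u \<in> reflections G S"
    and fx: "\<And>x. x \<in> geom_space S \<Longrightarrow> act t x = x \<longleftrightarrow> act u x = (x :: 'a \<Rightarrow> real)"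
  shows "t = u"
proof -
  interpret R: refl_rep G S "geom_space S" act aip by (rule refl_rep_aip[OF steinberg_geom])
  have c: "t \<in> carrier G" "u \<in> carrier G" using t R.T_carrier by auto
  have "R.Fx t = R.Fx u" using fx by (auto simp: R.Fx_def)
  then have M: "R.Mv t = R.Mv u" by (simp add: R.Mv_def)
  obtain r q where rq: "R.isroot t r" "R.isroot u q" using R.root_exists t by blast
  have "abs_le G S t u" using R.abs_le_root_iff[OF rq(1) c(2)] R.root_Mv_refl[OF rq(1)] M by simp
  moreover have "abs_le G S u t" using R.abs_le_root_iff[OF rq(2) c(1)] R.root_Mv_refl[OF rq(2)] M by simp
  ultimately show ?thesis using R.abs_le_antisym c by blast
qed

text \<open>The Jacobian of the basic invariants vanishes on every reflecting hyperplane, but not at \<open>v\<close>. A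
  generic line through \<open>v\<close> meets the hyperplanes in distinct points.\<close>

lemma card_reflections_le: "card (reflections G S) \<le> (\<Sum>i<n. d i - 1)"
proof -
  let ?T = "reflections G S"
  obtain e where e: "bij_betw e {..<n} S" using enum by blast
  have eS: "e k \<in> S" if "k < n" for k using e that by (auto simp: bij_betw_def)
  define r where "r t = (SOME r. r \<in> geom_space S \<and> r \<noteq> (\<lambda>s. 0) \<and> act t r = (\<lambda>s. - 1 * (r s :: complex)) \<and>
    (\<forall>x. act t x = (\<lambda>s. x s - 2 * bform r x * r s)))" for t
  have r: "r t \<in> geom_space S" "r t \<noteq> (\<lambda>s. 0)" "act t (r t) = (\<lambda>s. - 1 * r t s)"
    "act t x = (\<lambda>s. x s - 2 * bform (r t) x * r t s)" if t: "t \<in> ?T" for t x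
  proof -
    have "r t \<in> geom_space S \<and> r t \<noteq> (\<lambda>s. 0) \<and> act t (r t) = (\<lambda>s. - 1 * r t s) \<and>
      (\<forall>x. act t x = (\<lambda>s. x s - 2 * bform (r t) x * r t s))"
      unfolding r_def by (rule someI_ex[OF reflection_form[OF t, unfolded Bex_def]])
    then show "r t \<in> geom_space S" "r t \<noteq> (\<lambda>s. 0)" "act t (r t) = (\<lambda>s. - 1 * r t s)"
      "act t x = (\<lambda>s. x s - 2 * bform (r t) x * r t s)" by blast+
  qed
  define lf where "lf t x = bform (r t) x" for t and x :: "'a \<Rightarrow> complex"
  have lf_add: "lf t (x + y) = lf t x + lf t y" for t x y unfolding lf_def by (metis bform_sym bform_add)
  have lf_mult: "lf t (\<lambda>s. a * x s) = a * lf t x" for t a x unfolding lf_def by (metis bform_sym bform_mult)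
  have fixed: "act t x = x \<longleftrightarrow> lf t x = 0" if t: "t \<in> ?T" for t x
  proof
    assume "act t x = x"
    then have "(\<lambda>s. x s - 2 * bform (r t) x * r t s) = x" by (simp only: r(4)[OF t])
    moreover obtain s where "r t s \<noteq> 0" using r(2)[OF t] by auto
    ultimately show "lf t x = 0" using fun_cong[of _ x s] by (fastforce simp: lf_def)
  next
    assume "lf t x = 0"
    then show "act t x = x" unfolding r(4)[OF t] lf_def by simp
  qed
  have lfv: "lf t v \<noteq> 0" if "t \<in> ?T" for t using fixed[OF that] v_regular[OF that] by blast
  \<comment> \<open>The direction \<open>b\<close> of the line has to avoid two things: being
    parallel to a hyperplane (the case \<open>t = u\<close>), and making the line meet the
    hyperplanes of \<open>t\<close> and \<open>u\<close> at the same parameter.\<close>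
  define X where "X = (\<lambda>(t, u) b. if t = u then lf t b else lf t v * lf u b - lf u v * lf t b)"
  have "\<exists>b\<in>geom_space S. \<forall>i\<in>?T \<times> ?T. X i b \<noteq> 0"
  proof (rule exists_avoiding_kernels)
    fix i assume "i \<in> ?T \<times> ?T"
    then obtain t u where i: "i = (t, u)" "t \<in> ?T" "u \<in> ?T" by blast
    show "\<exists>b\<in>geom_space S. X i b \<noteq> 0"
    proof (cases "t = u")
      case True then show ?thesis using lfv[OF i(2)] v_geom by (auto simp: X_def i(1))
    next
      case False
      show ?thesis
      proof (rule ccontr)
        assume "\<not> (\<exists>b\<in>geom_space S. X i b \<noteq> 0)"
        then have eq: "lf t v * lf u b = lf u v * lf t b" if "b \<in> geom_space S" for b
          using that False by (auto simp: X_def i(1))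
        have "t = u"
        proof (rule reflection_eq[OF i(2,3)])
          fix x :: "'a \<Rightarrow> real" assume "x \<in> geom_space S"
          then have "emb x \<in> geom_space S" by (simp add: geom_space_def)
          then have "lf t (emb x) = 0 \<longleftrightarrow> lf u (emb x) = 0" using eq[of "emb x"] lfv[OF i(2)] lfv[OF i(3)] by auto
          then have "act t (emb x) = emb x \<longleftrightarrow> act u (emb x) = emb x" using fixed i(2,3) by simp
          then show "act t x = x \<longleftrightarrow> act u x = x" unfolding gact_emb emb_inject .
        qed
        then show False using False by simp
      qed
    qed
  next
    fix i x y assume "i \<in> ?T \<times> ?T"
    show "X i (x + y) = X i x + X i y" by (auto simp: X_def lf_add algebra_simps split: prod.split)
  next
    fix i a x assume "i \<in> ?T \<times> ?T"
    have "lf t (a *\<^sub>R x) = of_real a * lf t x" for t using lf_mult[of t "of_real a" x] by (simp add: scaleR_fun_def scaleR_conv_of_real)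
    then show "X i (a *\<^sub>R x) = a *\<^sub>R X i x" by (auto simp: X_def scaleR_conv_of_real algebra_simps split: prod.split)
  qed (auto simp: finite_reflections geom_space_subspace)
  then obtain b where b: "b \<in> geom_space S" "\<And>i. i \<in> ?T \<times> ?T \<Longrightarrow> X i b \<noteq> 0" by blast
  have bt: "lf t b \<noteq> 0" if "t \<in> ?T" for t using b(2)[of "(t, t)"] that by (simp add: X_def)
  have btu: "lf t v * lf u b \<noteq> lf u v * lf t b" if "t \<in> ?T" "u \<in> ?T" "t \<noteq> u" for t u
    using b(2)[of "(t, u)"] that by (simp add: X_def)
  \<comment> \<open>The parameter at which the line meets the hyperplane of
    \<open>t\<close>.\<close>
  define tau where "tau t = - lf t v / lf t b" for t
  have inj: "inj_on tau ?T"
  proof (rule inj_onI, rule ccontr)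
    fix t u assume a: "t \<in> ?T" "u \<in> ?T" "tau t = tau u" "t \<noteq> u"
    then show False using btu[OF a(1,2,4)] bt[OF a(1)] bt[OF a(2)] by (simp add: tau_def field_simps)
  qed
  obtain Q where Q: "\<And>i k. i < n \<Longrightarrow> degree (Q i k) \<le> d i - 1"
    "\<And>i k x. i < n \<Longrightarrow> D i (e k) (line v b x) = poly (Q i k) x"
  proof -
    have "\<forall>i k. \<exists>q. i < n \<longrightarrow> degree q \<le> d i - 1 \<and> (\<forall>x. D i (e k) (line v b x) = poly q x)"
      using hpf_line[OF D_props(1)] by blast
    then obtain Q where "\<forall>i k. i < n \<longrightarrow> degree (Q i k) \<le> d i - 1 \<and> (\<forall>x. D i (e k) (line v b x) = poly (Q i k) x)"
      by metis
    then show ?thesis by (intro that[of Q]) auto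
  qed
  define J where "J x = mat n n (\<lambda>(i, k). D i (e k) (line v b x))" for x
  have Jc: "J x \<in> carrier_mat n n" for x by (simp add: J_def)
  \<comment> \<open>The Jacobian determinant along the line; its degree is at most the sum of the
    degrees of the gradients.\<close>
  define q where "q = (\<Sum>p\<in>{p. p permutes {0..<n}}. smult (signof p) (\<Prod>i = 0..<n. Q i (p i)))"
  have qJ: "poly q x = det (J x)" for x
  proof -
    have "(\<Prod>i = 0..<n. poly (Q i (p i)) x) = (\<Prod>i = 0..<n. J x $$ (i, p i))" if "p permutes {0..<n}" for p
    proof (intro prod.cong refl)
      fix i assume "i \<in> {0..<n}"
      then have "i < n" "p i < n" using permutes_in_image[OF that, of i] by auto
      then show "poly (Q i (p i)) x = J x $$ (i, p i)" by (simp add: J_def Q(2))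
    qed
    then show ?thesis unfolding q_def det_def'[OF Jc] poly_sum by (intro sum.cong refl) (simp add: poly_prod)
  qed
  have deg: "degree q \<le> (\<Sum>i<n. d i - 1)"
  proof -
    have "degree (\<Prod>i = 0..<n. Q i (p i)) \<le> (\<Sum>i<n. d i - 1)" for p
    proof -
      have "degree (\<Prod>i = 0..<n. Q i (p i)) \<le> (\<Sum>i = 0..<n. degree (Q i (p i)))"
        using degree_prod_sum_le[of "{0..<n}" "\<lambda>i. Q i (p i)"] by (simp add: o_def)
      also have "\<dots> \<le> (\<Sum>i = 0..<n. d i - 1)" by (intro sum_mono Q(1)) simp
      finally show ?thesis by (simp add: atLeast0LessThan)
    qed
    then show ?thesis unfolding q_def
      by (intro degree_sum_le) (auto intro: order_trans[OF degree_smult_le] simp: finite_permutations)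
  qed
  have "line v b 0 = v" by (simp add: line_def)
  then have "poly q 0 \<noteq> 0" unfolding qJ J_def using dual_basis_det(1)[OF e] by simp
  then have q0: "q \<noteq> 0" by auto
  have root: "poly q (tau t) = 0" if t: "t \<in> ?T" for t
  proof -
    define x where "x = line v b (tau t)"
    have tc: "t \<in> carrier G" using t S_carrier by (auto simp: reflections_def)
    have xg: "x \<in> geom_space S" unfolding x_def by (rule line_geom[OF v_geom b(1)])
    have "lf t x = 0" unfolding x_def line_eq lf_add lf_mult tau_def using bt[OF t] by simp
    then have tx: "act t x = x" using fixed[OF t] by blast
    \<comment> \<open>The reflection \<open>t\<close> fixes \<open>x\<close> and negates
      \<open>r t\<close>, so by invariance the value is its own negative.\<close>
    have z: "phi i x (r t) = 0" if i: "i < n" for i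
      using phi_act[OF i tc xg r(1)[OF t]] unfolding tx r(3)[OF t] phi_scale by simp
    have "J (tau t) *\<^sub>v vec n (\<lambda>k. r t (e k)) = 0\<^sub>v n"
    proof (rule eq_vecI)
      fix i assume "i < dim_vec (0\<^sub>v n :: complex vec)"
      then have i: "i < n" by simp
      have "(J (tau t) *\<^sub>v vec n (\<lambda>k. r t (e k))) $ i = (\<Sum>k<n. D i (e k) x * r t (e k))"
        using i by (simp add: J_def x_def scalar_prod_def atLeast0LessThan)
      also have "\<dots> = phi i x (r t)" unfolding phi_def by (rule sum.reindex_bij_betw[OF e])
      finally show "(J (tau t) *\<^sub>v vec n (\<lambda>k. r t (e k))) $ i = 0\<^sub>v n $ i" using z[OF i] i by simp
    qed (simp add: J_def)
    moreover have "vec n (\<lambda>k. r t (e k)) \<noteq> 0\<^sub>v n"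
    proof
      assume a: "vec n (\<lambda>k. r t (e k)) = 0\<^sub>v n"
      have "r t (e k) = 0" if "k < n" for k using arg_cong[OF a, of "\<lambda>x. x $ k"] that by simp
      then have "r t s = 0" if "s \<in> S" for s using e that unfolding bij_betw_def by (metis imageE lessThan_iff)
      then have "r t = (\<lambda>s. 0)" using r(1)[OF t] by (auto simp: geom_space_def)
      then show False using r(2)[OF t] by simp
    qed
    ultimately show ?thesis unfolding qJ det_0_iff_vec_prod_zero_field[OF Jc] by (intro exI[of _ "vec n (\<lambda>k. r t (e k))"]) auto
  qed
  have "card ?T = card (tau ` ?T)" by (rule card_image[OF inj, symmetric])
  also have "\<dots> \<le> card {x. poly q x = 0}" using root by (intro card_mono poly_roots_finite q0) auto
  also have "\<dots> \<le> degree q" by (rule card_poly_roots_bound[OF q0])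
  finally show ?thesis using deg by linarith
qed

lemma card_reflections_bound: "2 * card (reflections G S) \<le> n * h"
  using card_reflections_le sum_degrees by linarith

end

section \<open>Positive systems\<close>

context refl_rep
begin

definition "Phi = {r. \<exists>t. isroot t r}"
definition "rt r = (THE t. isroot t r)"

lemma isroot_rt: assumes "r \<in> Phi" shows "isroot (rt r) r"
proof -
  obtain t where t: "isroot t r" using assms by (auto simp: Phi_def)
  then have "rt r = t" unfolding rt_def using root_inj by blast
  then show ?thesis using t by simp
qed

lemma PhiI: "isroot t r \<Longrightarrow> r \<in> Phi" by (auto simp: Phi_def)

lemma Phi_V: "r \<in> Phi \<Longrightarrow> r \<in> V" using isroot_rt rootD(3) by blast
lemma Phi_norm: "r \<in> Phi \<Longrightarrow> ip r r = 2" using isroot_rt rootD(4) by blast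
lemma Phi_nonzero: "r \<in> Phi \<Longrightarrow> r \<noteq> 0" using isroot_rt rootD(6) by blast
lemma Phi_uminus: "r \<in> Phi \<Longrightarrow> - r \<in> Phi" using isroot_rt root_uminus PhiI by blast
lemma Phi_act: "r \<in> Phi \<Longrightarrow> g \<in> carrier G \<Longrightarrow> act g r \<in> Phi" using isroot_rt root_conj PhiI by blast
lemma rt_carrier: "r \<in> Phi \<Longrightarrow> rt r \<in> carrier G" using isroot_rt rootD(2) by blast
lemma rt_act: "r \<in> Phi \<Longrightarrow> x \<in> V \<Longrightarrow> act (rt r) x = x - ip x r *\<^sub>R r" using isroot_rt rootD(5) by blast
lemma rt_act2: "r \<in> Phi \<Longrightarrow> act (rt r) (act (rt r) x) = x"
  using T_square(2)[OF rootD(1)[OF isroot_rt]] act_inv_act[OF rt_carrier] by metis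

lemma finite_card_Phi: "finite Phi \<and> card Phi \<le> 2 * card T"
proof -
  define f where "f t = (SOME r. isroot t r)" for t
  have f: "isroot t (f t)" if "t \<in> T" for t
    unfolding f_def using root_exists[OF that] by (rule someI_ex)
  have "Phi \<subseteq> (\<Union>t\<in>T. {f t, - f t})"
  proof
    fix r assume r: "r \<in> Phi"
    note R = isroot_rt[OF r]
    show "r \<in> (\<Union>t\<in>T. {f t, - f t})" using root_pm[OF f[OF rootD(1)[OF R]] R] rootD(1)[OF R] by blast
  qed
  then have sub: "Phi \<subseteq> (\<Union>t\<in>T. {f t, - f t})" .
  have fU: "finite (\<Union>t\<in>T. {f t, - f t})" using finite_T by auto
  have "card Phi \<le> card (\<Union>t\<in>T. {f t, - f t})" using card_mono[OF fU sub] .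
  also have "\<dots> \<le> (\<Sum>t\<in>T. card {f t, - f t})" using finite_T by (rule card_UN_le)
  also have "\<dots> \<le> (\<Sum>t\<in>T. 2)" by (intro sum_mono) (auto simp: card_insert_if)
  finally show ?thesis using finite_subset[OF sub fU] by simp
qed

lemma finite_Phi: "finite Phi" using finite_card_Phi by blast

lemma Phi_ip_less_2: assumes "r \<in> Phi" "b \<in> Phi" "r \<noteq> b" shows "ip r b < 2"
proof -
  have "ip (r - b) (r - b) > 0" using assms Phi_V by (intro ip_pos V_diff) auto
  then show ?thesis using assms Phi_norm ip_sym[of b r] by (simp add: ip_simps)
qed

definition "PM p M = {r \<in> Phi. r \<in> M \<and> ip p r > 0}"

lemma finite_PM: "finite (PM p M)" using finite_Phi by (auto simp: PM_def)

end

text \<open>Positive roots within a subspace: \<open>M\<close> will be all of \<open>V\<close> or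
  the moved space of a noncrossing element, for which no simple system is available
  beforehand.\<close>

locale posys = refl_rep +
  fixes p and M
  assumes p_V: "p \<in> V" and M_sub: "subspace M" and M_V: "M \<subseteq> V"
    and p_reg: "r \<in> Phi \<Longrightarrow> r \<in> M \<Longrightarrow> ip p r \<noteq> 0"
begin

definition "Iv w = {b \<in> PM p M. ip p (act w b) < 0}"
text \<open>Simplicity in its working form, that the reflection permutes the other positive
  roots.\<close>

definition "simple b \<longleftrightarrow> b \<in> PM p M \<and> (\<forall>r\<in>PM p M. r \<noteq> b \<longrightarrow> act (rt b) r \<in> PM p M)"

lemma M_act: assumes "w \<in> carrier G" "Mv w \<subseteq> M" "x \<in> M" shows "act w x \<in> M"
proof -
  have "act w x - x \<in> M" using Mv_diff[OF assms(1)] assms M_V by blast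
  then have "(act w x - x) + x \<in> M" using assms(3) M_sub by (rule_tac subspace_add)
  then show ?thesis by simp
qed

lemma Mv_mult: assumes "w \<in> carrier G" "g \<in> carrier G" "Mv w \<subseteq> M" "Mv g \<subseteq> M" shows "Mv (w \<otimes> g) \<subseteq> M"
proof
  fix y assume "y \<in> Mv (w \<otimes> g)"
  then obtain x where x: "x \<in> V" "y = act (w \<otimes> g) x - x" using Mv_iff[of "w \<otimes> g"] assms by auto
  have "y = (act w (act g x) - act g x) + (act g x - x)" using x assms by (simp add: act_mult)
  moreover have "act w (act g x) - act g x \<in> M" using Mv_diff[OF assms(1), of "act g x"] assms x act_V by auto
  moreover have "act g x - x \<in> M" using Mv_diff[OF assms(2), of x] assms x by auto
  ultimately show "y \<in> M" using M_sub subspace_add by metis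
qed

lemma Mv_rt: assumes "r \<in> Phi" "r \<in> M" shows "Mv (rt r) \<subseteq> M"
proof
  fix y assume "y \<in> Mv (rt r)"
  then obtain x where x: "x \<in> V" "y = act (rt r) x - x" using Mv_iff[OF rt_carrier[OF assms(1)]] by auto
  then have "y = (- ip x r) *\<^sub>R r" using rt_act[OF assms(1)] by simp
  then show "y \<in> M" using assms(2) M_sub subspace_scale by metis
qed

lemma neg_PM: "r \<in> Phi \<Longrightarrow> r \<in> M \<Longrightarrow> r \<notin> PM p M \<Longrightarrow> - r \<in> PM p M"
  using p_reg[of r] Phi_uminus subspace_neg[OF M_sub, of r] by (auto simp: PM_def ip_simps)

lemma PM_D: "r \<in> PM p M \<Longrightarrow> r \<in> Phi \<and> r \<in> M \<and> ip p r > 0 \<and> r \<in> V"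
  using Phi_V by (auto simp: PM_def)

text \<open>Along the segment from $p$ to $w^{-1}p$ the first wall that is met is simple; among the
  walls met at the same time the one of smallest height is chosen.\<close>

lemma simple_inversion_exists:
  assumes w: "w \<in> carrier G" "Mv w \<subseteq> M" and ne: "Iv w \<noteq> {}"
  shows "\<exists>b\<in>Iv w. simple b"
proof -
  \<comment> \<open>The value of \<open>w\<close> inverse applied to \<open>p\<close> at
    \<open>r\<close> is \<open>- n r\<close>, so the segment meets the wall of \<open>r\<close> at
    the parameter \<open>q / (1 + q)\<close>, which increases with \<open>q = q r\<close>.\<close>
  define n where "n r = - ip p (act w r)" for r
  define q where "q r = ip p r / n r" for r
  have fI: "finite (Iv w)" unfolding Iv_def using finite_PM by auto
  define A where "A = {b \<in> Iv w. q b = Min (q ` Iv w)}"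
  have "Min (q ` Iv w) \<in> q ` Iv w" using fI ne by auto
  then have Ane: "A \<noteq> {}" unfolding A_def by force
  have fA: "finite A" using fI by (auto simp: A_def)
  obtain b where b: "b \<in> A" "\<And>a. a \<in> A \<Longrightarrow> ip p b \<le> ip p a"
  proof -
    have "Min (ip p ` A) \<in> ip p ` A" using fA Ane by auto
    then show ?thesis using that fA by (metis (no_types, lifting) Min_le finite_imageI image_eqI image_iff)
  qed
  have qmin: "q b \<le> q a" if "a \<in> Iv w" for a using b(1) that fI by (auto simp: A_def)
  have bI: "b \<in> Iv w" using b(1) by (simp add: A_def)
  then have bP: "b \<in> Phi" "b \<in> M" "ip p b > 0" "n b > 0" "b \<in> PM p M"
    using Phi_V by (auto simp: Iv_def PM_def n_def)
  have bV: "b \<in> V" using bP Phi_V by blast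
  have "act (rt b) r \<in> PM p M" if r: "r \<in> PM p M" "r \<noteq> b" for r
  proof (rule ccontr)
    assume not: "act (rt b) r \<notin> PM p M"
    note rP = PM_D[OF r(1)]
    have inPhi: "act (rt b) r \<in> Phi" "act (rt b) r \<in> M"
      using rP bP Phi_act rt_carrier M_act[OF rt_carrier Mv_rt] by auto
    define s where "s = - act (rt b) r"
    have s: "s \<in> PM p M" using neg_PM[OF inPhi not] by (simp add: s_def)
    define k where "k = ip r b"
    have se: "s = k *\<^sub>R b - r" using rt_act[OF bP(1)] rP by (simp add: s_def k_def)
    have ps: "ip p r + ip p s = k * ip p b" by (simp add: se ip_simps)
    have ns: "n r + n s = k * n b" using w by (simp add: n_def se ip_simps act_simps)
    have p0: "ip p r > 0" "ip p s > 0" using r s by (auto simp: PM_def)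
    have "k * ip p b > 0" using ps p0 by linarith
    then have k0: "k > 0" using bP(3) by (simp add: zero_less_mult_iff)
    have k2: "k < 2" unfolding k_def using Phi_ip_less_2 rP bP r(2) by auto
    have I: "x \<in> Iv w" if "x \<in> PM p M" "n x > 0" for x using that by (auto simp: Iv_def n_def)
    \<comment> \<open>If \<open>r\<close> or \<open>s\<close> were not an inversion, the wall of the
      other one would be met strictly before that of \<open>b\<close>.\<close>
    have one: False if x: "x \<in> PM p M" "ip p x < k * ip p b" "n x \<ge> k * n b" for x
    proof -
      have nx: "n x > 0" using x(3) k0 bP(4) by (smt (verit) mult_pos_pos)
      have "q b \<le> q x" using qmin I x nx by blast
      then have "ip p b * n x \<le> ip p x * n b" using nx bP(4) by (simp add: q_def field_simps)
      moreover have "ip p b * (k * n b) \<le> ip p b * n x" using x(3) bP(3) by simp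
      moreover have "ip p x * n b < (k * ip p b) * n b" using x(2) bP(4) by simp
      ultimately show False by (simp add: algebra_simps)
    qed
    have nr: "n r > 0"
    proof (rule ccontr)
      assume "\<not> n r > 0" then show False using one[of s] s ps p0 ns by simp
    qed
    have nsp: "n s > 0"
    proof (rule ccontr)
      assume "\<not> n s > 0" then show False using one[of r] r ps p0 ns by simp
    qed
    have rs: "r \<in> Iv w" "s \<in> Iv w" using I r s nr nsp by auto
    have "q b * n r \<le> ip p r" "q b * n s \<le> ip p s"
      using qmin[OF rs(1)] qmin[OF rs(2)] nr nsp by (auto simp: q_def field_simps)
    moreover have "q b * n r + q b * n s = ip p r + ip p s"
    proof -
      have "q b * n r + q b * n s = q b * (k * n b)" using ns by (simp flip: distrib_left)
      also have "\<dots> = k * ip p b" using bP(4) by (simp add: q_def)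
      finally show ?thesis using ps by simp
    qed
    ultimately have "q b * n r = ip p r" "q b * n s = ip p s" by linarith+
    \<comment> \<open>The three walls are met together, so the minimal height of \<open>b\<close>
      yields \<open>2 ip p b \<le> k ip p b\<close>, whereas \<open>k < 2\<close>.\<close>
    then have "q r = q b" "q s = q b" using nr nsp by (auto simp: q_def field_simps)
    then have "r \<in> A" "s \<in> A" using rs bI b(1) by (auto simp: A_def)
    then have "ip p b \<le> ip p r" "ip p b \<le> ip p s" using b(2) by auto
    then have "2 * ip p b \<le> k * ip p b" using ps by linarith
    then show False using k2 bP(3) by simp
  qed
  then have "simple b" using bP by (simp add: simple_def)
  then show ?thesis using bI by blast
qed

text \<open>If \<open>w\<close> preserves the positive system, the sum of \<open>p\<close> over the
  powers of \<open>w\<close> is fixed by \<open>w\<close> and positive on all positive roots; but a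
  root in the moved space of \<open>w\<close> is orthogonal to it.\<close>

lemma no_inversions: assumes w: "w \<in> carrier G" "Mv w \<subseteq> M" and e: "Iv w = {}" shows "w = \<one>"
proof (rule ccontr)
  assume "w \<noteq> \<one>"
  then obtain t r where r: "isroot t r" "r \<in> Mv w" using exists_root_Mv w by blast
  have step: "act w a \<in> PM p M" if a: "a \<in> PM p M" for a
  proof -
    have aa: "act w a \<in> Phi" "act w a \<in> M" using PM_D[OF a] w Phi_act M_act by auto
    moreover have "\<not> ip p (act w a) < 0" using e a by (auto simp: Iv_def)
    ultimately show ?thesis using p_reg[OF aa] by (auto simp: PM_def)
  qed
  have pw: "act (w [^] i) a \<in> PM p M" if "a \<in> PM p M" for a and i :: nat
  proof (induction i)
    case 0 then show ?case using that by (simp add: act_one)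
  next
    case (Suc i)
    have "w [^] Suc i = w \<otimes> w [^] i" using w(1) nat_pow_Suc2 by metis
    then show ?case using step[OF Suc] w(1) by (simp add: act_mult)
  qed
  define m where "m = Coset.order G"
  have m: "m > 0" "w [^] m = \<one>" unfolding m_def using w fin
    by (auto simp: order_gt_0_iff_finite pow_order_eq_1)
  define a where "a i = act (inv (w [^] i)) p" for i :: nat
  define P where "P = (\<Sum>i<m. a i)"
  have am: "a m = a 0" unfolding a_def using m by simp
  have aS: "act (inv w) (a i) = a (Suc i)" for i
    unfolding a_def using w(1) by (simp add: inv_mult_group act_mult)
  have "act (inv w) P = (\<Sum>i<m. a (Suc i))" unfolding P_def using w(1) by (simp add: act_sum aS)
  also have "\<dots> = P" unfolding P_def using sum.lessThan_Suc_shift[of a m] am by (simp add: ac_simps)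
  finally have "P \<in> Fx (inv w)"
    unfolding Fx_def P_def a_def using w(1) p_V by (auto intro!: V_sum act_V)
  then have PF: "P \<in> Fx w" using Fx_inv w(1) by blast
  have pos: "ip P s > 0" if "s \<in> PM p M" for s
  proof -
    have "ip P s = (\<Sum>i<m. ip p (act (w [^] i) s))"
      unfolding P_def a_def using w(1) by (simp add: ip_sum ip_act_left)
    also have "\<dots> > 0" using m pw[OF that] by (intro sum_pos) (auto simp: PM_def)
    finally show ?thesis .
  qed
  have "ip r P = 0" using r(2) PF by (auto simp: Mv_def)
  then have "ip P r = 0" "ip P (- r) = 0" by (simp_all add: ip_sym[of P] ip_simps)
  moreover have "r \<in> PM p M \<or> - r \<in> PM p M" using neg_PM PhiI[OF r(1)] r(2) w(2) by blast
  ultimately show False using pos by fastforce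
qed

text \<open>Peel off a simple inversion \<open>b\<close>: the inversions of \<open>w\<close> other
  than \<open>b\<close> are those of \<open>w (rt b)\<close>, moved by \<open>rt b\<close>. The root
  \<open>al b\<close> is the simple root used at that stage, as in the classical formula for the
  inversions of a reduced word.\<close>

lemma inversion_expansion:
  assumes "w \<in> carrier G" "Mv w \<subseteq> M"
  shows "\<exists>al. (\<forall>b\<in>Iv w. simple (al b)) \<and> (\<forall>f\<in>V. f - act (inv w) f = (\<Sum>b\<in>Iv w. ip f (al b) *\<^sub>R b))"
  using assms
proof (induction "card (Iv w)" arbitrary: w rule: less_induct)
  case less
  note w = less.prems
  show ?case
  proof (cases "Iv w = {}")
    case True
    then have "w = \<one>" using no_inversions w by blast
    then show ?thesis using True by (simp add: act_one)
  next
    case False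
    then obtain b where b: "b \<in> Iv w" "simple b" using simple_inversion_exists w by blast
    have bP: "b \<in> PM p M" "b \<in> Phi" "b \<in> M" "b \<in> V" "ip p b > 0"
      using b(2) PM_D by (auto simp: simple_def)
    let ?t = "rt b"
    have t: "?t \<in> carrier G" "Mv ?t \<subseteq> M" "?t \<in> T"
      using rt_carrier Mv_rt bP rootD(1)[OF isroot_rt] by auto
    let ?w = "w \<otimes> ?t"
    have w': "?w \<in> carrier G" "Mv ?w \<subseteq> M" using w t Mv_mult by auto
    have tb: "act ?t b = - b" using root_neg isroot_rt bP(2) by blast
    have inj: "inj_on (act ?t) X" for X by (metis inj_onI rt_act2 bP(2))
    have Iw: "Iv w = insert b (act ?t ` Iv ?w)" and nb: "b \<notin> act ?t ` Iv ?w"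
    proof -
      have *: "act ?t r \<in> Iv w \<and> act ?t r \<noteq> b" if "r \<in> Iv ?w" for r
      proof -
        have r: "r \<in> PM p M" "ip p (act w (act ?t r)) < 0" using that w t by (auto simp: Iv_def act_mult)
        have "r \<noteq> b"
        proof
          assume "r = b"
          then have "ip p (act w b) > 0" using r(2) tb w by (simp add: act_simps ip_simps)
          then show False using b(1) by (simp add: Iv_def)
        qed
        then have "act ?t r \<in> PM p M" using b(2) r(1) by (simp add: simple_def)
        moreover have "act ?t r \<noteq> b"
        proof
          assume "act ?t r = b"
          then have "r = - b" using rt_act2[OF bP(2), of r] tb by simp
          then show False using r(1) bP(5) by (simp add: PM_def ip_simps)
        qed
        ultimately show ?thesis using r(2) by (simp add: Iv_def)
      qed
      show "b \<notin> act ?t ` Iv ?w"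
      proof
        assume "b \<in> act ?t ` Iv ?w"
        then obtain r where "b = act ?t r" "r \<in> Iv ?w" by (rule imageE)
        then show False using *[of r] by simp
      qed
      have "r \<in> act ?t ` Iv ?w" if r: "r \<in> Iv w" "r \<noteq> b" for r
      proof -
        have "act ?t r \<in> PM p M" using b(2) r by (simp add: simple_def Iv_def)
        then have "act ?t r \<in> Iv ?w" using r(1) w t bP(2) by (simp add: Iv_def act_mult rt_act2)
        then show ?thesis using rt_act2[OF bP(2), of r] by (metis image_eqI)
      qed
      then show "Iv w = insert b (act ?t ` Iv ?w)" using * b(1) by (intro equalityI subsetI) auto
    qed
    have fI: "finite (Iv v)" for v unfolding Iv_def using finite_PM by auto
    have "card (Iv w) = Suc (card (Iv ?w))"
      unfolding Iw using nb fI card_image[OF inj, of "Iv ?w"] by simp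
    then obtain al where al: "\<forall>b\<in>Iv ?w. simple (al b)"
      "\<forall>f\<in>V. f - act (inv ?w) f = (\<Sum>b\<in>Iv ?w. ip f (al b) *\<^sub>R b)"
      using less.hyps[OF _ w'] by auto
    define al' where "al' r = (if r = b then b else al (act ?t r))" for r
    have s: "\<forall>r\<in>Iv w. simple (al' r)"
      unfolding Iw using al(1) b(2) bP(2) by (auto simp: al'_def rt_act2)
    have "f - act (inv w) f = (\<Sum>r\<in>Iv w. ip f (al' r) *\<^sub>R r)" if f: "f \<in> V" for f
    proof -
      have iw: "inv w = ?t \<otimes> inv ?w"
        using w t T_square(2)[OF t(3)] by (simp add: inv_mult_group flip: m_assoc) (simp add: T_square(1)[OF t(3)])
      have "(\<Sum>r\<in>Iv w. ip f (al' r) *\<^sub>R r) = ip f b *\<^sub>R b + (\<Sum>r\<in>act ?t ` Iv ?w. ip f (al' r) *\<^sub>R r)"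
        unfolding Iw using nb fI by (simp add: al'_def)
      also have "(\<Sum>r\<in>act ?t ` Iv ?w. ip f (al' r) *\<^sub>R r) = (\<Sum>r\<in>Iv ?w. ip f (al' (act ?t r)) *\<^sub>R act ?t r)"
        by (simp add: sum.reindex[OF inj])
      also have "\<dots> = (\<Sum>r\<in>Iv ?w. ip f (al r) *\<^sub>R act ?t r)"
      proof (intro sum.cong refl)
        fix r assume "r \<in> Iv ?w"
        then have "act ?t r \<in> act ?t ` Iv ?w" by (rule imageI)
        then have "act ?t r \<noteq> b" using nb by metis
        then show "ip f (al' (act ?t r)) *\<^sub>R act ?t r = ip f (al r) *\<^sub>R act ?t r"
          using bP(2) by (simp add: al'_def rt_act2)
      qed
      also have "\<dots> = act ?t (f - act (inv ?w) f)" using al(2) f t by (simp add: act_sum act_simps)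
      also have "ip f b *\<^sub>R b + \<dots> = f - act (inv w) f"
        unfolding iw using f t w' rt_act[OF bP(2) f] by (simp add: act_simps act_mult)
      finally show ?thesis by simp
    qed
    then show ?thesis using s by blast
  qed
qed

text \<open>The expansion for the reflection of \<open>r\<close> reads
  \<open>ip f r r = \<Sum> ip f (al b) b\<close>. Pairing it with \<open>p\<close> moves
  \<open>f\<close> to one side and leaves \<open>r\<close> as a combination of the
  \<open>al b\<close> with coefficients \<open>ip p b / ip p r\<close>.\<close>

lemma positive_combination:
  assumes "r \<in> PM p M"
  shows "\<exists>k al. (\<forall>b\<in>Iv (rt r). k b \<ge> 0 \<and> simple (al b)) \<and> r = (\<Sum>b\<in>Iv (rt r). k b *\<^sub>R al b)"
proof -
  note R = PM_D[OF assms]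
  have t: "rt r \<in> carrier G" "Mv (rt r) \<subseteq> M" "inv (rt r) = rt r"
    using R rt_carrier Mv_rt T_square(2)[OF rootD(1)[OF isroot_rt]] by auto
  obtain al where al: "\<forall>b\<in>Iv (rt r). simple (al b)"
     "\<forall>f\<in>V. f - act (inv (rt r)) f = (\<Sum>b\<in>Iv (rt r). ip f (al b) *\<^sub>R b)"
    using inversion_expansion t by blast
  define k where "k b = ip p b / ip p r" for b
  have aV: "al b \<in> V" if "b \<in> Iv (rt r)" for b using al(1) that PM_D by (auto simp: simple_def)
  have "r = (\<Sum>b\<in>Iv (rt r). k b *\<^sub>R al b)"
  proof (rule ip_ext)
    fix f assume f: "f \<in> V"
    have "ip f r *\<^sub>R r = (\<Sum>b\<in>Iv (rt r). ip f (al b) *\<^sub>R b)"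
      using al(2) f t(3) rt_act[of r f] R by auto
    then have "ip (ip f r *\<^sub>R r) p = ip (\<Sum>b\<in>Iv (rt r). ip f (al b) *\<^sub>R b) p" by simp
    then have "ip f r * ip p r = (\<Sum>b\<in>Iv (rt r). ip f (al b) * ip p b)"
      by (simp add: ip_sum ip_scale ip_sym[of _ p] del: ip_sum_right) (simp add: ip_sum_right ip_scale_right)
    then have "ip f r = (\<Sum>b\<in>Iv (rt r). ip f (al b) * ip p b) / ip p r" using R by (simp add: field_simps)
    also have "\<dots> = ip f (\<Sum>b\<in>Iv (rt r). k b *\<^sub>R al b)"
      by (simp add: ip_sum_right ip_simps k_def sum_divide_distrib mult.commute)
    finally show "ip f r = ip f (\<Sum>b\<in>Iv (rt r). k b *\<^sub>R al b)" .
  qed (use R aV in \<open>auto intro!: V_sum V_scale\<close>)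
  moreover have "\<forall>b\<in>Iv (rt r). k b \<ge> 0" using R by (auto simp: Iv_def PM_def k_def)
  ultimately show ?thesis using al(1) by (intro exI[of _ k] exI[of _ al]) simp
qed

text \<open>If \<open>k = ip a b\<close> were positive, positivity of \<open>b - k a\<close> and
  \<open>a - k b\<close> would give \<open>k < 1\<close>. Reflecting \<open>b - k a\<close> in
  \<open>b\<close> gives \<open>- (1 - k k) b - k a\<close>, which should be positive and is
  negative.\<close>

lemma simple_obtuse: assumes a: "simple a" and b: "simple b" and ne: "a \<noteq> b" shows "ip a b \<le> 0"
proof (rule ccontr)
  assume "\<not> ip a b \<le> 0"
  then have k: "ip a b > 0" by simp
  define k where "k = ip a b"
  have k0: "k > 0" using k by (simp add: k_def)
  have A: "a \<in> PM p M" "a \<in> Phi" "a \<in> V" "ip p a > 0" using PM_D a by (auto simp: simple_def)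
  have B: "b \<in> PM p M" "b \<in> Phi" "b \<in> V" "ip p b > 0" using PM_D b by (auto simp: simple_def)
  have ab: "act (rt a) b \<in> PM p M" using a B ne by (auto simp: simple_def)
  have ba: "act (rt b) a \<in> PM p M" using b A ne by (auto simp: simple_def)
  have e1: "act (rt a) b = b - k *\<^sub>R a" using rt_act[OF A(2) B(3)] ip_sym[of a b] by (simp add: k_def)
  have e2: "act (rt b) a = a - k *\<^sub>R b" using rt_act[OF B(2) A(3)] by (simp add: k_def)
  have i1: "ip p b > k * ip p a" using ab e1 by (simp add: PM_def ip_simps)
  have i2: "ip p a > k * ip p b" using ba e2 by (simp add: PM_def ip_simps)
  have k1: "k < 1"
  proof (rule ccontr)
    assume "\<not> k < 1"
    then have "ip p a \<le> k * ip p a" "ip p b \<le> k * ip p b" using A B by simp_all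
    then show False using i1 i2 by linarith
  qed
  have "act (rt a) b \<noteq> b" using e1 k0 Phi_nonzero[OF A(2)] by simp
  then have "act (rt b) (act (rt a) b) \<in> PM p M" using b ab by (auto simp: simple_def)
  moreover have "act (rt b) (act (rt a) b) = - ((1 - k * k) *\<^sub>R b) - k *\<^sub>R a"
    unfolding e1 using rt_act[OF B(2), of "b - k *\<^sub>R a"] A B Phi_norm[OF B(2)]
    by (simp add: V_intros ip_simps algebra_simps k_def[symmetric] scaleR_2)
  ultimately have "0 < - ((1 - k * k) * ip p b) - k * ip p a" by (simp add: PM_def ip_simps)
  moreover have "k * k < 1" using k0 k1 mult_strict_mono[of k 1 k 1] by simp
  then have "(1 - k * k) * ip p b > 0" using B by simp
  moreover have "k * ip p a > 0" using k0 A by simp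
  ultimately show False by linarith
qed

end

section \<open>Noncrossing partitions and the Euler form\<close>

locale refl_coxeter = refl_rep +
  fixes c assumes c_in: "c \<in> carrier G" and c_fix: "Fx c = {0}"
begin

definition "NCs = {u \<in> carrier G. abs_le G S u c}"
definition "Ai y = (SOME x. x \<in> V \<and> x - act c x = y)"
text \<open>A counterpart of the Euler form of a quiver: its symmetrization is \<open>ip\<close>
  (\<open>E_sum_swap\<close>), it is 1 on every root (\<open>E_self\<close>), and it carries the
  dependence on \<open>c\<close>.\<close>

definition "E x y = ip (Ai x) y"

lemma Mv_c: "Mv c = V" unfolding Mv_def c_fix by (auto simp: ip_simps)

lemma Ai: assumes "y \<in> V" shows "Ai y \<in> V" "Ai y - act c (Ai y) = y"
proof -
  obtain x where x: "x \<in> V" "act c x - x = y" using Mv_exists[OF c_in, of y] assms Mv_c by auto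
  have "- x \<in> V \<and> - x - act c (- x) = y" using x c_in by (simp add: V_minus act_simps)
  then have "Ai y \<in> V \<and> Ai y - act c (Ai y) = y" unfolding Ai_def by (rule someI)
  then show "Ai y \<in> V" "Ai y - act c (Ai y) = y" by auto
qed

lemma c_inj: assumes "x \<in> V" "y \<in> V" "x - act c x = y - act c y" shows "x = y"
proof -
  have "act c (x - y) = x - y" using assms(3) c_in by (simp add: act_simps algebra_simps)
  then have "x - y \<in> Fx c" using assms by (simp add: Fx_def V_diff)
  then show ?thesis by (simp add: c_fix)
qed

lemma Ai_eq: assumes "x \<in> V" shows "Ai (x - act c x) = x"
  using c_inj[of "Ai (x - act c x)" x] Ai[of "x - act c x"] assms c_in by (simp add: V_diff act_V)

lemma Ai_add: assumes "x \<in> V" "y \<in> V" shows "Ai (x + y) = Ai x + Ai y"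
proof -
  have "Ai x + Ai y - act c (Ai x + Ai y) = (Ai x - act c (Ai x)) + (Ai y - act c (Ai y))"
    using c_in by (simp add: act_simps)
  also have "\<dots> = x + y" using Ai(2) assms by simp
  finally show ?thesis using Ai_eq[of "Ai x + Ai y"] Ai(1) assms by (simp add: V_add)
qed

lemma Ai_scale: assumes "x \<in> V" shows "Ai (a *\<^sub>R x) = a *\<^sub>R Ai x"
proof -
  have "a *\<^sub>R Ai x - act c (a *\<^sub>R Ai x) = a *\<^sub>R (Ai x - act c (Ai x))"
    using c_in by (simp add: act_simps scaleR_diff_right)
  also have "\<dots> = a *\<^sub>R x" using Ai(2) assms by simp
  finally show ?thesis using Ai_eq[of "a *\<^sub>R Ai x"] Ai(1) assms by (simp add: V_scale)
qed

lemma Ai_sum: assumes "\<And>i. i \<in> A \<Longrightarrow> f i \<in> V" shows "Ai (\<Sum>i\<in>A. f i) = (\<Sum>i\<in>A. Ai (f i))"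
  using assms
proof (induction A rule: infinite_finite_induct)
  case (insert x F)
  then show ?case using Ai_add[of "f x" "sum f F"] V_sum[of F f] by simp
qed (use Ai_scale[OF V_0, of 0] in auto)

lemma E_add: "x \<in> V \<Longrightarrow> y \<in> V \<Longrightarrow> E (x + y) z = E x z + E y z" by (simp add: E_def Ai_add ip_simps)
lemma E_scale: "x \<in> V \<Longrightarrow> E (a *\<^sub>R x) z = a * E x z" by (simp add: E_def Ai_scale ip_simps)
lemma E_minus: "x \<in> V \<Longrightarrow> E (- x) z = - E x z" using E_scale[of x "-1" z] by simp
lemma E_diff: "x \<in> V \<Longrightarrow> y \<in> V \<Longrightarrow> E (x - y) z = E x z - E y z"
  using E_add[of x "- y" z] by (simp add: E_minus V_minus)
lemma E_add_right: "E z (x + y) = E z x + E z y" by (simp add: E_def ip_simps)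
lemma E_scale_right: "E z (a *\<^sub>R x) = a * E z x" by (simp add: E_def ip_simps)
lemma E_minus_right: "E z (- x) = - E z x" by (simp add: E_def ip_simps)
lemma E_diff_right: "E z (x - y) = E z x - E z y" by (simp add: E_def ip_simps)

lemmas E_simps = E_add E_scale E_minus E_diff E_add_right E_scale_right E_minus_right E_diff_right

lemma E_sum_swap: assumes "x \<in> V" "y \<in> V" shows "E x y + E y x = ip x y"
proof -
  define a b where "a = Ai x" and "b = Ai y"
  have x: "x = a - act c a" and y: "y = b - act c b" using Ai(2) assms by (simp_all add: a_def b_def)
  have "E x y + E y x = ip a (b - act c b) + ip b (a - act c a)"
    unfolding E_def a_def b_def using Ai(2) assms by simp
  moreover have "ip x y = ip (a - act c a) (b - act c b)" using x y by simp
  moreover have "ip (a - act c a) (b - act c b) = ip a b - ip a (act c b) - ip (act c a) b + ip (act c a) (act c b)"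
    by (simp add: ip_simps)
  moreover have "ip a (b - act c b) + ip b (a - act c a) = ip a b - ip a (act c b) + ip b a - ip b (act c a)"
    by (simp add: ip_simps)
  ultimately show ?thesis using ip_act[OF c_in, of a b] ip_sym[of "act c a" b] ip_sym[of b a]
    by linarith
qed

lemma E_self: "r \<in> Phi \<Longrightarrow> E r r = 1"
  using E_sum_swap[of r r] Phi_V Phi_norm by simp

lemma ip_act_c: assumes "x \<in> V" "r \<in> V" shows "ip (act c x) r = E r (act c x - x)"
proof -
  define y where "y = x - act c x"
  have yV: "y \<in> V" using assms c_in by (simp add: y_def V_diff act_V)
  have "Ai y = x" using Ai_eq assms by (simp add: y_def)
  then have "E y r = ip x r" by (simp add: E_def)
  then have "E r y = ip y r - ip x r" using E_sum_swap[OF yV assms(2)] by simp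
  then have "E r (- y) = ip x r - ip y r" by (simp add: E_simps)
  then show ?thesis by (simp add: y_def ip_simps)
qed

text \<open>The property by which an element below \<open>c\<close> is determined by its moved
  space: on every vector whose displacement under \<open>c\<close> lies in that space it acts as
  \<open>c\<close>.\<close>

definition "agree u \<longleftrightarrow> (\<forall>x\<in>V. act c x - x \<in> Mv u \<longrightarrow> act u x = act c x)"

text \<open>Removing a reflection from below adds one vector \<open>x0\<close> to the fixed space.
  Pairing with \<open>x0\<close> is \<open>- E r\<close>, so the new moved space is the part of the
  old one that \<open>E r\<close> kills.\<close>

lemma agree_down:
  assumes u: "u \<in> carrier G" "agree u" and r: "isroot t r" "r \<in> Mv u"
  shows "Mv (t \<otimes> u) = {y \<in> Mv u. E r y = 0}" "agree (t \<otimes> u)"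
proof -
  note R = rootD[OF r(1)]
  \<comment> \<open>The vector that \<open>c\<close>, and hence \<open>u\<close>, displaces by
    \<open>r\<close>. As \<open>E r r = 1\<close>, the reflection \<open>t\<close> brings it
    back.\<close>
  define x0 where "x0 = - Ai r"
  have x0V: "x0 \<in> V" unfolding x0_def using Ai(1) R by (simp add: V_minus)
  have cx0: "act c x0 - x0 = r" unfolding x0_def using Ai(2)[OF R(3)] c_in by (simp add: act_simps)
  then have ux0: "act u x0 = x0 + r" using u(2) x0V r(2) by (auto simp: agree_def)
  have x0r: "ip x0 y = - E r y" for y by (simp add: x0_def E_def ip_simps)
  have "act t (x0 + r) = x0"
    using R(5)[of "x0 + r"] R x0V x0r[of r] E_self[OF PhiI[OF r(1)]] by (simp add: V_add ip_simps)
  then have x0F: "x0 \<in> Fx (t \<otimes> u)" using x0V R u ux0 by (simp add: Fx_def act_mult)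
  have FF: "Fx u \<subseteq> Fx (t \<otimes> u)" using dim_Fx_gain(2)[OF r(1) u(1) r(2)] .
  show M: "Mv (t \<otimes> u) = {y \<in> Mv u. E r y = 0}"
  proof (intro equalityI subsetI)
    fix y assume y: "y \<in> Mv (t \<otimes> u)"
    then have "y \<in> Mv u" using FF by (auto simp: Mv_def)
    moreover have "ip y x0 = 0" using y x0F by (auto simp: Mv_def)
    then have "E r y = 0" using x0r[of y] ip_sym[of y x0] by simp
    ultimately show "y \<in> {y \<in> Mv u. E r y = 0}" by simp
  next
    fix y assume y: "y \<in> {y \<in> Mv u. E r y = 0}"
    have "ip y x = 0" if x: "x \<in> Fx (t \<otimes> u)" for x
    proof -
      have xV: "x \<in> V" and "act t (act u x) = x" using x R u by (auto simp: Fx_def act_mult)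
      then have "act u x = act t x"
        using act_inv_act[OF R(2), of "act u x"] T_square(2)[OF R(1)] by simp
      then have ux: "act u x - x = (- ip x r) *\<^sub>R r" using R(5)[OF xV] by simp
      define a where "a = - ip x r"
      have "act u (x - a *\<^sub>R x0) = x - a *\<^sub>R x0"
        using u(1) ux ux0 by (simp add: act_simps a_def algebra_simps)
      then have "x - a *\<^sub>R x0 \<in> Fx u" using xV x0V by (simp add: Fx_def V_intros)
      then have "ip y (x - a *\<^sub>R x0) = 0" using y by (auto simp: Mv_def)
      moreover have "ip y x0 = 0" using x0r[of y] y ip_sym[of y x0] by simp
      ultimately show ?thesis by (simp add: ip_simps)
    qed
    then show "y \<in> Mv (t \<otimes> u)" using y by (auto simp: Mv_def)
  qed
  show "agree (t \<otimes> u)"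
    unfolding agree_def
  proof (intro ballI impI)
    fix x assume x: "x \<in> V" "act c x - x \<in> Mv (t \<otimes> u)"
    then have a: "act c x - x \<in> Mv u" "E r (act c x - x) = 0" using M by auto
    then have "act u x = act c x" using u(2) x(1) by (auto simp: agree_def)
    moreover have "ip (act c x) r = 0" using ip_act_c[OF x(1) R(3)] a(2) by simp
    then have "act t (act c x) = act c x" using R(5)[of "act c x"] x(1) c_in by (simp add: act_V)
    ultimately show "act (t \<otimes> u) x = act c x" using R(2) u(1) by (simp add: act_mult)
  qed
qed

lemma agree_c: "agree c" by (auto simp: agree_def)

section \<open>Climbing and descending below \<open>c\<close>\<close>

lemma NCs_iff: "u \<in> NCs \<longleftrightarrow> u \<in> carrier G \<and> L (c \<otimes> inv u) + L u = L c"
  unfolding NCs_def abs_le_def by auto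

lemma L_c_le: assumes "u \<in> carrier G" shows "L c \<le> L (c \<otimes> inv u) + L u"
  using L_mult[of "c \<otimes> inv u" u] assms c_in by (simp add: m_assoc)

lemma NCs_down: assumes u: "u \<in> NCs" and r: "isroot t r" "r \<in> Mv u" shows "t \<otimes> u \<in> NCs"
proof -
  note R = rootD[OF r(1)]
  have uc: "u \<in> carrier G" "L (c \<otimes> inv u) + L u = L c" using u NCs_iff by auto
  have "c \<otimes> inv (t \<otimes> u) = (c \<otimes> inv u) \<otimes> t"
    using uc R c_in T_square(2)[OF R(1)] by (simp add: inv_mult_group m_assoc)
  then have "L (c \<otimes> inv (t \<otimes> u)) \<le> L (c \<otimes> inv u) + 1"
    using L_mult[of "c \<otimes> inv u" t] uc R c_in L_refl[OF R(1)] by simp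
  moreover have "L (t \<otimes> u) + 1 = L u" using L_mult_root_iff[OF r(1) uc(1)] r(2) by blast
  moreover have "L c \<le> L (c \<otimes> inv (t \<otimes> u)) + L (t \<otimes> u)" using L_c_le R uc by simp
  ultimately show ?thesis using uc R NCs_iff by simp
qed

lemma NCs_up:
  assumes u: "u \<in> NCs" and r: "isroot t r" "r \<in> Mv (c \<otimes> inv u)"
  shows "t \<otimes> u \<in> NCs" "L (t \<otimes> u) = L u + 1" "r \<in> Mv (t \<otimes> u)"
proof -
  note R = rootD[OF r(1)]
  have uc: "u \<in> carrier G" "L (c \<otimes> inv u) + L u = L c" using u NCs_iff by auto
  have "c \<otimes> inv (t \<otimes> u) = (c \<otimes> inv u) \<otimes> t"
    using uc R c_in T_square(2)[OF R(1)] by (simp add: inv_mult_group m_assoc)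
  then have 1: "L (c \<otimes> inv (t \<otimes> u)) = L (t \<otimes> (c \<otimes> inv u))"
    using L_comm[of "c \<otimes> inv u" t] uc R c_in by simp
  have 2: "L (t \<otimes> (c \<otimes> inv u)) + 1 = L (c \<otimes> inv u)"
    using L_mult_root_iff[OF r(1), of "c \<otimes> inv u"] r(2) uc c_in by simp
  have 3: "L c \<le> L (c \<otimes> inv (t \<otimes> u)) + L (t \<otimes> u)" using L_c_le R uc by simp
  have 4: "L (t \<otimes> u) \<le> L u + 1" using L_mult[of t u] R uc L_refl[OF R(1)] by simp
  show 5: "L (t \<otimes> u) = L u + 1" using 1 2 3 4 uc by linarith
  show "t \<otimes> u \<in> NCs" using 1 2 5 uc R NCs_iff by simp
  have "t \<otimes> (t \<otimes> u) = u" using R(1,2) uc T_square(1) by (simp flip: m_assoc)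
  then show "r \<in> Mv (t \<otimes> u)" using L_mult_root_iff[OF r(1), of "t \<otimes> u"] R uc 5 by simp
qed

text \<open>Induction downwards from \<open>c\<close>, where the property is trivial: any other
  \<open>u\<close> has an upper neighbour \<open>t u\<close>, from which \<open>agree_down\<close>
  descends to \<open>u\<close> again.\<close>

lemma NCs_agree: "u \<in> NCs \<Longrightarrow> agree u"
proof (induction "L (c \<otimes> inv u)" arbitrary: u rule: less_induct)
  case less
  have uc: "u \<in> carrier G" "L (c \<otimes> inv u) + L u = L c" using less.prems NCs_iff by auto
  show ?case
  proof (cases "c \<otimes> inv u = \<one>")
    case True
    then have "c \<otimes> inv u \<otimes> u = u" using uc by simp
    then have "c = u" using uc c_in by (simp add: m_assoc)
    then show ?thesis using agree_c by simp
  next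
    case False
    have ci: "c \<otimes> inv u \<in> carrier G" using uc c_in by simp
    obtain t r where r: "isroot t r" "r \<in> Mv (c \<otimes> inv u)" using exists_root_Mv[OF ci False] by blast
    note R = rootD[OF r(1)]
    note U = NCs_up[OF less.prems r]
    have "L (c \<otimes> inv (t \<otimes> u)) < L (c \<otimes> inv u)" using U(1,2) uc NCs_iff by simp
    then have "agree (t \<otimes> u)" using less.hyps U(1) by blast
    then have "agree (t \<otimes> (t \<otimes> u))" using agree_down(2)[OF _ _ r(1) U(3)] R uc by simp
    moreover have "t \<otimes> (t \<otimes> u) = u" using R(1,2) uc T_square(1) by (simp flip: m_assoc)
    ultimately show ?thesis by simp
  qed
qed

lemma NCs_carrier: "u \<in> NCs \<Longrightarrow> u \<in> carrier G" by (simp add: NCs_def)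

lemma Mv_down: "u \<in> NCs \<Longrightarrow> isroot t r \<Longrightarrow> r \<in> Mv u \<Longrightarrow> Mv (t \<otimes> u) = {y \<in> Mv u. E r y = 0}"
  using agree_down(1) NCs_agree NCs_carrier by blast

text \<open>The converse of \<open>Mv_down\<close>, by which meets are rebuilt: a root
  \<open>r\<close> for which \<open>E r\<close> kills the moved space can be adjoined. The condition
  puts \<open>r\<close> into the moved space of the complement \<open>c (inv u)\<close>.\<close>

lemma NCs_insert:
  assumes u: "u \<in> NCs" and r: "isroot t r" "\<And>y. y \<in> Mv u \<Longrightarrow> E r y = 0"
  shows "t \<otimes> u \<in> NCs" "r \<in> Mv (t \<otimes> u)" "Mv u = {y \<in> Mv (t \<otimes> u). E r y = 0}"
proof -
  note R = rootD[OF r(1)] and uc = NCs_carrier[OF u]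
  have "ip r f = 0" if f: "f \<in> Fx (c \<otimes> inv u)" for f
  proof -
    define x where "x = act (inv u) f"
    have fV: "f \<in> V" and cf: "act c x = f" using f uc c_in by (auto simp: Fx_def x_def act_mult)
    have xV: "x \<in> V" using fV uc by (simp add: x_def act_V)
    have "act u x = f" using uc by (simp add: x_def act_act_inv)
    then have "act c x - x \<in> Mv u" using cf Mv_diff[OF uc xV] by simp
    then have "ip (act c x) r = 0" using ip_act_c[OF xV R(3)] r(2) by simp
    then show ?thesis using cf ip_sym[of r f] by simp
  qed
  then have "r \<in> Mv (c \<otimes> inv u)" using R by (simp add: Mv_def)
  note U = NCs_up[OF u r(1) this]
  show "t \<otimes> u \<in> NCs" "r \<in> Mv (t \<otimes> u)" using U by auto
  have "t \<otimes> (t \<otimes> u) = u" using R(1,2) uc T_square(1) by (simp flip: m_assoc)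
  then show "Mv u = {y \<in> Mv (t \<otimes> u). E r y = 0}" using Mv_down[OF U(1) r(1) U(3)] by simp
qed

text \<open>Strip the same reflection from \<open>u\<close> and \<open>v\<close>: inclusion of moved
  spaces persists because both are cut by the same \<open>E r\<close>, and the quotient
  \<open>v (inv u)\<close> changes only by conjugation.\<close>

lemma NCs_le: assumes "u \<in> NCs" "v \<in> NCs" "Mv u \<subseteq> Mv v" shows "abs_le G S u v"
  using assms
proof (induction "L u" arbitrary: u v rule: less_induct)
  case less
  note uc = NCs_carrier[OF less.prems(1)] and vc = NCs_carrier[OF less.prems(2)]
  show ?case
  proof (cases "u = \<one>")
    case True then show ?thesis using vc by (simp add: abs_le_def L_one)
  next
    case False
    obtain t r where r: "isroot t r" "r \<in> Mv u" using exists_root_Mv[OF uc False] by blast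
    note R = rootD[OF r(1)]
    have rv: "r \<in> Mv v" using r(2) less.prems(3) by blast
    have Lu: "L (t \<otimes> u) + 1 = L u" using L_mult_root_iff[OF r(1) uc] r(2) by blast
    have Lv: "L (t \<otimes> v) + 1 = L v" using L_mult_root_iff[OF r(1) vc] rv by blast
    have "abs_le G S (t \<otimes> u) (t \<otimes> v)"
    proof (rule less.hyps)
      show "Mv (t \<otimes> u) \<subseteq> Mv (t \<otimes> v)"
        using Mv_down[OF less.prems(1) r] Mv_down[OF less.prems(2) r(1) rv] less.prems(3) by auto
    qed (use Lu NCs_down less.prems r rv in auto)
    moreover have "(t \<otimes> v) \<otimes> inv (t \<otimes> u) = t \<otimes> (v \<otimes> inv u) \<otimes> inv t"
      using R uc vc by (simp add: inv_mult_group m_assoc)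
    moreover have "L (t \<otimes> (v \<otimes> inv u) \<otimes> inv t) = L (v \<otimes> inv u)" using L_conj R uc vc by simp
    ultimately show ?thesis using Lu Lv unfolding abs_le_def by simp
  qed
qed

lemma act_Ai: assumes "u \<in> NCs" "x \<in> Mv u" shows "act u (Ai x) = Ai x - x"
proof -
  have xV: "x \<in> V" using assms(2) by (simp add: Mv_def)
  have "act c (Ai x) = Ai x - x" using Ai(2)[OF xV] by (simp add: algebra_simps)
  moreover have "act c (Ai x) - Ai x \<in> Mv u"
    using assms(2) Mv_subspace[of u] calculation by (simp add: subspace_neg)
  ultimately show ?thesis using NCs_agree[OF assms(1)] Ai(1)[OF xV] by (auto simp: agree_def)
qed

text \<open>Serre duality inside the subcategory of \<open>u\<close>, with \<open>- u\<close> as the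
  inverse Serre functor. Apply \<open>u\<close> to both arguments of
  \<open>ip (Ai y) x\<close>.\<close>

lemma serre: assumes u: "u \<in> NCs" and x: "x \<in> Mv u" "y \<in> Mv u" shows "E y x = - E (act u x) y"
proof -
  have V: "x \<in> V" "y \<in> V" using x by (auto simp: Mv_def)
  note uc = NCs_carrier[OF u]
  have "E y x = ip (act u (Ai y)) (act u x)" by (simp add: E_def ip_act[OF uc])
  also have "\<dots> = E y (act u x) - ip y (act u x)" by (simp add: act_Ai[OF u x(2)] E_def ip_simps)
  also have "\<dots> = - E (act u x) y" using E_sum_swap[of y "act u x"] V uc act_V by simp
  finally show ?thesis .
qed

lemma ip_eq_E: assumes u: "u \<in> NCs" and x: "x \<in> Mv u" shows "ip x f = E x (f - act (inv u) f)"
  using act_Ai[OF u x] ip_act_left[OF NCs_carrier[OF u], of "Ai x" f] by (simp add: E_def ip_simps)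

lemma one_NCs: "\<one> \<in> NCs" using c_in by (simp add: NCs_iff L_one)
lemma c_NCs: "c \<in> NCs" using c_in by (simp add: NCs_iff L_one)

text \<open>For finite \<open>X\<close> the closed cone generated by \<open>X\<close>, as a bidual:
  membership is tested against functionals, and no coefficients have to be carried through
  projections.\<close>

definition "Cs X = {x \<in> V. \<forall>f\<in>V. (\<forall>r\<in>X. ip f r \<ge> 0) \<longrightarrow> ip f x \<ge> 0}"

lemma Cs_D: "x \<in> Cs X \<Longrightarrow> f \<in> V \<Longrightarrow> (\<And>r. r \<in> X \<Longrightarrow> ip f r \<ge> 0) \<Longrightarrow> ip f x \<ge> 0"
  by (auto simp: Cs_def)

text \<open>The roots $\iota$ with $-u\iota$ positive play the role of injective objects: for dominant
  $f$, the vector $f - u^{-1}f$ is a nonnegative combination of them.\<close>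

lemma in_cone_by_injectives:
  assumes u: "u \<in> NCs" and p: "p \<in> V" "\<And>r. r \<in> Phi \<Longrightarrow> r \<in> Mv u \<Longrightarrow> ip p r \<noteq> 0"
    and x: "x \<in> Mv u" "\<And>i. i \<in> PM p (Mv u) \<Longrightarrow> - act u i \<in> PM p (Mv u) \<Longrightarrow> E x i \<ge> 0"
  shows "x \<in> Cs (PM p (Mv u))"
proof -
  interpret P: posys G S V act ip p "Mv u"
    by unfold_locales (use p Mv_subspace Mv_V in auto)
  note uc = NCs_carrier[OF u]
  obtain al where al: "\<forall>b\<in>P.Iv u. P.simple (al b)"
    "\<forall>f\<in>V. f - act (inv u) f = (\<Sum>b\<in>P.Iv u. ip f (al b) *\<^sub>R b)"
    using P.inversion_expansion[OF uc] by blast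
  have "ip f x \<ge> 0" if f: "f \<in> V" "\<forall>r\<in>PM p (Mv u). ip f r \<ge> 0" for f
  proof -
    have "ip f x = E x (f - act (inv u) f)" using ip_eq_E[OF u x(1)] ip_sym[of f x] by simp
    also have "\<dots> = (\<Sum>b\<in>P.Iv u. ip f (al b) * E x b)" using al(2) f(1) by (simp add: E_def ip_sum_right ip_simps)
    also have "\<dots> \<ge> 0"
    proof (intro sum_nonneg mult_nonneg_nonneg)
      fix b assume b: "b \<in> P.Iv u"
      show "ip f (al b) \<ge> 0" using al(1) b f(2) by (auto simp: P.simple_def)
      have bP: "b \<in> PM p (Mv u)" "ip p (act u b) < 0" using b by (auto simp: P.Iv_def)
      have "act u b \<in> Phi" "act u b \<in> Mv u"
        using P.M_act[OF uc _ ] P.PM_D[OF bP(1)] Phi_act uc by auto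
      moreover have "act u b \<notin> PM p (Mv u)" using bP(2) by (simp add: PM_def)
      ultimately have "- act u b \<in> PM p (Mv u)" using P.neg_PM by blast
      then show "E x b \<ge> 0" using x(2) bP(1) by blast
    qed
    finally show ?thesis .
  qed
  then show ?thesis using Mv_V[OF x(1)] by (simp add: Cs_def)
qed

end

section \<open>The lattice property\<close>

text \<open>The roots are ordered by the angle of their projections to the plane spanned by \<open>kx\<close> and
  \<open>ky\<close>; \<open>cr\<close> is the corresponding area form.\<close>

locale nc_plane = refl_coxeter +
  fixes kx ky assumes kx: "kx \<in> V" and ky: "ky \<in> V"
    and proj_nz: "r \<in> Phi \<Longrightarrow> ip kx r \<noteq> 0 \<or> ip ky r \<noteq> 0"
    and E_nonneg: "r \<in> Phi \<Longrightarrow> s \<in> Phi \<Longrightarrow> ip kx s * ip ky r - ip ky s * ip kx r > 0 \<Longrightarrow> E r s \<ge> 0"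
    and E_zero: "r \<in> Phi \<Longrightarrow> s \<in> Phi \<Longrightarrow> ip kx s * ip ky r - ip ky s * ip kx r = 0 \<Longrightarrow>
       s \<noteq> r \<Longrightarrow> s \<noteq> - r \<Longrightarrow> E r s = 0"
begin

definition "cr r s = ip kx s * ip ky r - ip ky s * ip kx r"
text \<open>A half plane of directions without a root projection on its boundary; it cuts out a
  positive system in which the roots are ordered by angle.\<close>

definition "window p \<longleftrightarrow> (\<exists>a b. p = a *\<^sub>R kx + b *\<^sub>R ky) \<and> (\<forall>r\<in>Phi. ip p r \<noteq> 0)"

lemma window_V: "window p \<Longrightarrow> p \<in> V" using kx ky by (auto simp: window_def V_intros)

lemma cr_swap: "cr s r = - cr r s" by (simp add: cr_def)
lemma cr_minus: "cr (- r) s = - cr r s" "cr r (- s) = - cr r s" by (simp_all add: cr_def ip_simps)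

text \<open>The three-term relation of a plane. It replaces all reasoning about angles: with
  positive values of \<open>p\<close> it makes \<open>cr\<close> behave like an order inside a
  window.\<close>

lemma pluecker: "window p \<Longrightarrow> ip p s * cr r q = ip p q * cr r s + ip p r * cr s q"
  by (auto simp: window_def cr_def ip_simps algebra_simps)

text \<open>Negating \<open>r\<close> turns the later root \<open>s\<close> into an earlier one, so
  \<open>E_nonneg\<close> yields the opposite sign against the order.\<close>

lemma E_le_0: assumes "r \<in> Phi" "s \<in> Phi" "cr r s \<ge> 0" "s \<noteq> r" "s \<noteq> - r" shows "E s r \<le> 0"
proof (cases "cr r s = 0")
  case True
  then have "cr s r = 0" using cr_swap[of s r] by simp
  moreover have "r \<noteq> - s" using assms(5) by (metis minus_minus)
  ultimately show ?thesis using E_zero[of s r] assms by (auto simp: cr_def)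
next
  case False
  then have "cr s (- r) > 0" using assms(3) cr_swap[of s r] by (simp add: cr_minus)
  then have "E s (- r) \<ge> 0" using E_nonneg[of s "- r"] assms Phi_uminus by (simp add: cr_def)
  then show ?thesis by (simp add: E_simps)
qed

lemma E_ge_0: assumes "r \<in> Phi" "s \<in> Phi" "cr r s \<ge> 0" "s \<noteq> - r" shows "E r s \<ge> 0"
  using E_nonneg[of r s] E_zero[of r s] E_self[of r] assms by (cases "cr r s = 0"; cases "s = r") (auto simp: cr_def)

lemma PM_neq_minus: "r \<in> PM p M \<Longrightarrow> s \<in> PM p N \<Longrightarrow> s \<noteq> - r"
  by (auto simp: PM_def ip_simps)

text \<open>Projecting a root away from the last root \<open>q\<close> of the window does not leave
  the positive cone of the smaller subspace. By \<open>in_cone_by_injectives\<close> this is tested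
  on the injectives \<open>i\<close>, each paired by Serre duality with a projective
  \<open>j\<close>.\<close>

lemma cone_step_root:
  assumes u: "u \<in> NCs" and p: "window p" and t: "isroot t q" "q \<in> PM p (Mv u)"
    and last: "\<And>r. r \<in> PM p (Mv u) \<Longrightarrow> cr r q \<ge> 0" and r: "r \<in> PM p (Mv u)"
  shows "r - E q r *\<^sub>R q \<in> Cs (PM p (Mv (t \<otimes> u)))"
proof (cases "r = q")
  case True
  then show ?thesis using E_self[of q] PhiI[OF t(1)] by (simp add: Cs_def V_0 ip_simps)
next
  case False
  note R = rootD[OF t(1)]
  have qM: "q \<in> Mv u" "q \<in> Phi" "ip p q > 0" using t by (auto simp: PM_def)
  have rM: "r \<in> Mv u" "r \<in> Phi" "ip p r > 0" using r by (auto simp: PM_def)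
  note M' = Mv_down[OF u t(1) qM(1)] and u' = NCs_down[OF u t(1) qM(1)]
  define r' where "r' = r - E q r *\<^sub>R q"
  have r'M: "r' \<in> Mv (t \<otimes> u)"
  proof -
    have "r' \<in> Mv u" unfolding r'_def using rM qM Mv_subspace by (intro subspace_diff subspace_scale) auto
    moreover have "E q r' = 0" using E_self[OF qM(2)] by (simp add: r'_def E_simps)
    ultimately show ?thesis using M' by simp
  qed
  have qr: "E q r \<le> 0" using E_le_0[OF rM(2) qM(2) last[OF r]] False PM_neq_minus[OF r t(2)] by auto
  show ?thesis unfolding r'_def[symmetric]
  proof (rule in_cone_by_injectives[OF u'])
    fix i assume i: "i \<in> PM p (Mv (t \<otimes> u))" "- act (t \<otimes> u) i \<in> PM p (Mv (t \<otimes> u))"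
    define j where "j = - act (t \<otimes> u) i"
    have iM: "i \<in> Mv (t \<otimes> u)" "i \<in> Phi" "ip p i > 0" "i \<in> V" "E q i = 0" "i \<in> PM p (Mv u)"
      using i(1) M' Phi_V by (auto simp: PM_def)
    have jM: "j \<in> Mv (t \<otimes> u)" "j \<in> Phi" "ip p j > 0" "j \<in> PM p (Mv u)"
      using i(2) M' by (auto simp: PM_def j_def)
    have ser: "E y i = E j y" if y: "y \<in> Mv (t \<otimes> u)" for y
      using serre[OF u' iM(1) y] E_minus[of "act (t \<otimes> u) i" y] act_V[OF NCs_carrier[OF u'] iM(4)]
      by (simp add: j_def)
    \<comment> \<open>Two expressions for the tested number: \<open>E q i = 0\<close> gives the
      first, Serre duality the second. The first settles the case that \<open>r\<close> comes before
      \<open>i\<close>, the second that \<open>j\<close> comes before \<open>r\<close>.\<close>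
    have e1: "E r' i = E r i" using iM(5) rM qM Phi_V by (simp add: r'_def E_simps V_scale)
    have e2: "E r' i = E j r - E q r * E j q" using ser[OF r'M] by (simp add: r'_def E_simps)
    show "E r' i \<ge> 0"
    proof (cases "cr r i \<ge> 0")
      case True
      then show ?thesis using e1 E_ge_0[OF rM(2) iM(2)] PM_neq_minus[OF r iM(6)] by simp
    next
      case ri: False
      show ?thesis
      proof (cases "cr j r \<ge> 0")
        case True
        then have "E j r \<ge> 0" using E_ge_0[OF jM(2) rM(2)] PM_neq_minus[OF jM(4) r] by simp
        moreover have "E j q \<ge> 0" using E_ge_0[OF jM(2) qM(2)] last[OF jM(4)] PM_neq_minus[OF jM(4) t(2)] by simp
        ultimately show ?thesis using e2 mult_nonpos_nonneg[OF qr, of "E j q"] by linarith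
      next
        case False
        \<comment> \<open>In the remaining case \<open>i\<close> comes strictly before
          \<open>j\<close>, which makes \<open>E j i\<close> nonpositive, while Serre duality makes
          it equal to \<open>E i i = 1\<close>.\<close>
        have "cr i r > 0" "cr r j > 0" using ri False cr_swap[of i r] cr_swap[of r j] by auto
        then have "ip p r * cr i j > 0" using pluecker[OF p, of r i j] iM(3) jM(3) by (simp add: add_pos_pos)
        then have ij: "cr i j > 0" using rM(3) by (simp add: zero_less_mult_iff)
        have "E j i = 1" using ser[OF iM(1)] E_self[OF iM(2)] by simp
        moreover have "j \<noteq> i" using ij by (auto simp: cr_def)
        then have "E j i \<le> 0" using E_le_0[OF iM(2) jM(2)] ij PM_neq_minus[OF iM(6) jM(4)] by simp
        ultimately show ?thesis by simp
      qed
    qed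
  qed (use window_V[OF p] p r'M in \<open>auto simp: window_def\<close>)
qed

lemma cone_step:
  assumes u: "u \<in> NCs" and p: "window p" and t: "isroot t q" "q \<in> PM p (Mv u)"
    and last: "\<And>r. r \<in> PM p (Mv u) \<Longrightarrow> cr r q \<ge> 0" and x: "x \<in> Cs (PM p (Mv u))"
  shows "x - E q x *\<^sub>R q \<in> Cs (PM p (Mv (t \<otimes> u)))"
proof -
  note R = rootD[OF t(1)]
  have xV: "x \<in> V" using x by (simp add: Cs_def)
  have "ip f (x - E q x *\<^sub>R q) \<ge> 0" if f: "f \<in> V" "\<forall>r\<in>PM p (Mv (t \<otimes> u)). ip f r \<ge> 0" for f
  proof -
    \<comment> \<open>The image of \<open>f\<close> under the transpose of the projection along
      \<open>q\<close>.\<close>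
    define g where "g = f - ip f q *\<^sub>R Ai q"
    have gV: "g \<in> V" unfolding g_def using f Ai(1)[OF R(3)] by (simp add: V_intros)
    have g: "ip g y = ip f (y - E q y *\<^sub>R q)" for y by (simp add: g_def ip_simps E_def)
    have "ip g x \<ge> 0"
    proof (rule Cs_D[OF x gV])
      fix r assume r: "r \<in> PM p (Mv u)"
      have "r - E q r *\<^sub>R q \<in> Cs (PM p (Mv (t \<otimes> u)))" by (rule cone_step_root[OF u p t last r])
      from Cs_D[OF this f(1)] f(2) have "ip f (r - E q r *\<^sub>R q) \<ge> 0" by blast
      then show "ip g r \<ge> 0" by (simp only: g)
    qed
    then show ?thesis by (simp only: g)
  qed
  then show ?thesis using xV R by (simp add: Cs_def V_intros)
qed

text \<open>\<open>D\<close> is a set of roots that are last simultaneously, hence parallel and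
  mutually \<open>E\<close>-orthogonal. If \<open>E q x \<le> 0\<close> on \<open>D\<close>, then
  \<open>x\<close> lies in the cone obtained by negating \<open>D\<close>; the members of
  \<open>D\<close> are stripped off one by one without disturbing the numbers for the
  others.\<close>

lemma block_step:
  assumes "finite D" "u \<in> NCs" "window p" "D \<subseteq> PM p (Mv u)" "x \<in> Cs (PM p (Mv u))"
    and "\<And>q r. q \<in> D \<Longrightarrow> r \<in> PM p (Mv u) \<Longrightarrow> cr r q \<ge> 0"
    and "\<And>q. q \<in> D \<Longrightarrow> E q x \<le> 0" and "f \<in> V"
    and "\<And>r. r \<in> PM p (Mv u) \<Longrightarrow> r \<notin> D \<Longrightarrow> ip f r \<ge> 0" and "\<And>q. q \<in> D \<Longrightarrow> ip f q \<le> 0"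
  shows "ip f x \<ge> 0"
  using assms
proof (induction D arbitrary: u x rule: finite_induct)
  case empty
  show ?case by (rule Cs_D[OF empty.prems(4,7)]) (use empty.prems(8) in simp)
next
  case (insert q D)
  note P = insert.prems
  have q: "q \<in> PM p (Mv u)" using P(3) by simp
  then have qM: "q \<in> Phi" "q \<in> Mv u" "q \<in> V" using Phi_V by (auto simp: PM_def)
  define t where "t = rt q"
  have t: "isroot t q" using isroot_rt qM(1) by (simp add: t_def)
  note M' = Mv_down[OF P(1) t qM(2)] and u' = NCs_down[OF P(1) t qM(2)]
  define x' where "x' = x - E q x *\<^sub>R q"
  have x': "x' \<in> Cs (PM p (Mv (t \<otimes> u)))"
    unfolding x'_def by (rule cone_step[OF P(1,2) t q _ P(4)]) (use P(5) in simp)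
  have PMsub: "PM p (Mv (t \<otimes> u)) \<subseteq> PM p (Mv u)" using M' by (auto simp: PM_def)
  have E0: "E q d = 0 \<and> E d q = 0" if d: "d \<in> D" for d
  proof -
    have dP: "d \<in> PM p (Mv u)" "d \<in> Phi" "d \<noteq> q" using d P(3) insert.hyps by (auto simp: PM_def)
    have "cr d q \<ge> 0" "cr q d \<ge> 0" using P(5)[of q d] P(5)[of d q] dP q d by auto
    then have "cr d q = 0" "cr q d = 0" using cr_swap[of d q] by auto
    then show ?thesis using E_zero[of q d] E_zero[of d q] qM dP PM_neq_minus[OF q dP(1)] PM_neq_minus[OF dP(1) q]
      by (auto simp: cr_def)
  qed
  have "ip f x' \<ge> 0"
  proof (rule insert.IH[OF u' P(2) _ x'])
    show "D \<subseteq> PM p (Mv (t \<otimes> u))"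
      using P(3) E0 M' by (auto simp: PM_def)
    show "cr r d \<ge> 0" if "d \<in> D" "r \<in> PM p (Mv (t \<otimes> u))" for d r
      using P(5)[of d r] that PMsub by blast
    show "E d x' \<le> 0" if "d \<in> D" for d
      using P(6)[of d] E0[OF that] that by (simp add: x'_def E_simps)
    show "ip f r \<ge> 0" if r: "r \<in> PM p (Mv (t \<otimes> u))" "r \<notin> D" for r
    proof -
      have "E q r = 0" using r(1) M' by (auto simp: PM_def)
      then have "r \<noteq> q" using E_self[OF qM(1)] by auto
      then show ?thesis using P(8)[of r] r PMsub by auto
    qed
    show "ip f d \<le> 0" if "d \<in> D" for d using P(9)[of d] that by simp
  qed (rule P(7))
  moreover have "E q x * ip f q \<ge> 0" using P(6)[of q] P(9)[of q] by (simp add: mult_nonpos_nonpos)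
  ultimately show ?case by (simp add: x'_def ip_simps)
qed

end

text \<open>Makes precise that a half plane may be tilted slightly without crossing any of finitely
  many roots.\<close>

lemma finite_small_pos:
  fixes a b :: "'x \<Rightarrow> real"
  assumes "finite X" and "\<And>r. r \<in> X \<Longrightarrow> a r > 0"
  shows "\<exists>d>0. \<forall>r\<in>X. d * b r < a r"
  using assms
proof (induction X rule: finite_induct)
  case empty
  show ?case by (rule exI[of _ 1]) simp
next
  case (insert x X)
  then obtain d where d: "d > 0" "\<forall>r\<in>X. d * b r < a r" by auto
  define e where "e = min d (a x / (2 * (\<bar>b x\<bar> + 1)))"
  have ax: "a x > 0" using insert.prems by simp
  have e0: "e > 0" using d ax by (simp add: e_def)
  have "e * b r < a r" if r: "r \<in> insert x X" for r
  proof (cases "r = x")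
    case True
    have "e * b x \<le> e * \<bar>b x\<bar>" using e0 by simp
    also have "\<dots> \<le> a x / (2 * (\<bar>b x\<bar> + 1)) * \<bar>b x\<bar>" by (intro mult_right_mono) (auto simp: e_def)
    also have "\<dots> < a x"
    proof -
      have "a x * \<bar>b x\<bar> < a x * (2 * (\<bar>b x\<bar> + 1))" using ax by simp
      then show ?thesis by (simp add: field_simps)
    qed
    finally show ?thesis using True by simp
  next
    case False
    then have rX: "r \<in> X" using r by simp
    show ?thesis
    proof (cases "b r \<le> 0")
      case True
      have "e * b r \<le> 0" using True e0 by (simp add: mult_le_0_iff)
      then show ?thesis using insert.prems[of r] rX by simp
    next
      case False
      have "e * b r \<le> d * b r" using False by (intro mult_right_mono) (auto simp: e_def)
      then show ?thesis using d(2) rX by fastforce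
    qed
  qed
  then show ?case using e0 by blast
qed

lemma (in refl_coxeter) NC_simps: "carrier (NC G S c) = NCs" "le (NC G S c) = abs_le G S" "eq (NC G S c) = (=)"
  unfolding NC_def NCs_def by (auto simp: abs_le_def L_one)

section \<open>Sweeping the windows; meets and joins\<close>

context nc_plane
begin

lemma last_root_exists:
  assumes p: "window p" and ne: "\<exists>r\<in>Phi. ip p r > 0"
  shows "\<exists>q\<in>Phi. ip p q > 0 \<and> (\<forall>r\<in>Phi. ip p r > 0 \<longrightarrow> cr r q \<ge> 0)"
proof -
  define X where "X = {r \<in> Phi. ip p r > 0}"
  have fX: "finite X" using finite_Phi by (simp add: X_def)
  have "\<exists>q\<in>Y. \<forall>r\<in>Y. cr r q \<ge> 0" if "finite Y" "Y \<noteq> {}" "Y \<subseteq> X" for Y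
    using that
  proof (induction Y rule: finite_ne_induct)
    case (singleton x) then show ?case by (simp add: cr_def)
  next
    case (insert x F)
    then obtain q where q: "q \<in> F" "\<forall>r\<in>F. cr r q \<ge> 0" by auto
    show ?case
    proof (cases "cr x q \<ge> 0")
      case True then show ?thesis using q by auto
    next
      case False
      then have qx: "cr q x > 0" using cr_swap[of q x] by simp
      have "cr r x \<ge> 0" if r: "r \<in> F" for r
      proof -
        have pos: "ip p r > 0" "ip p q > 0" "ip p x > 0" using insert.prems r q(1) by (auto simp: X_def)
        have "ip p q * cr r x = ip p x * cr r q + ip p r * cr q x" by (rule pluecker[OF p])
        also have "\<dots> \<ge> 0" using pos q(2) r qx by simp
        finally show ?thesis using pos(2) by (simp add: zero_le_mult_iff)
      qed
      then show ?thesis by (auto simp: cr_def)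
    qed
  qed
  from this[of X] fX ne show ?thesis by (auto simp: X_def)
qed

text \<open>Turn the window just past its last direction: \<open>p'\<close> is the functional
  \<open>cr _ q\<close> minus a small multiple of \<open>p\<close>. Only the roots parallel to
  \<open>q\<close> leave, and their negatives enter.\<close>

lemma previous_window:
  assumes p: "window p" and q: "q \<in> Phi" "ip p q > 0" "\<And>r. r \<in> Phi \<Longrightarrow> ip p r > 0 \<Longrightarrow> cr r q \<ge> 0"
  shows "\<exists>p'. window p' \<and> (\<forall>r\<in>Phi. ip p r > 0 \<longrightarrow> (ip p' r > 0 \<longleftrightarrow> cr r q \<noteq> 0))"
proof -
  define X where "X = {r \<in> Phi. ip p r > 0 \<and> cr r q \<noteq> 0}"
  have "finite X" using finite_Phi by (simp add: X_def)
  moreover have "cr r q > 0" if "r \<in> X" for r using q(3)[of r] that by (auto simp: X_def)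
  ultimately obtain d where d: "d > 0" "\<forall>r\<in>X. d * ip p r < cr r q"
    using finite_small_pos[of X "\<lambda>r. cr r q" "ip p"] by auto
  obtain a b where ab: "p = a *\<^sub>R kx + b *\<^sub>R ky" using p by (auto simp: window_def)
  define p' where "p' = (- ip ky q - d * a) *\<^sub>R kx + (ip kx q - d * b) *\<^sub>R ky"
  have p'r: "ip p' r = cr r q - d * ip p r" for r
    by (simp add: p'_def ab cr_def ip_simps algebra_simps)
  have pos: "ip p' r > 0 \<longleftrightarrow> cr r q \<noteq> 0" and nz: "ip p' r \<noteq> 0" if r: "r \<in> Phi" "ip p r > 0" for r
  proof -
    have "d * ip p r > 0" using d r by simp
    then have "cr r q = 0 \<Longrightarrow> ip p' r < 0" by (simp add: p'r)
    moreover have "cr r q \<noteq> 0 \<Longrightarrow> ip p' r > 0" using d(2) r by (simp add: p'r X_def)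
    ultimately show "ip p' r > 0 \<longleftrightarrow> cr r q \<noteq> 0" "ip p' r \<noteq> 0" by (cases "cr r q = 0"; force)+
  qed
  have "ip p' r \<noteq> 0" if r: "r \<in> Phi" for r
  proof (cases "ip p r > 0")
    case False
    then have "ip p (- r) > 0" using p r by (force simp: window_def ip_simps)
    then show ?thesis using nz[OF Phi_uminus[OF r]] by (simp add: ip_simps)
  qed (use nz r in blast)
  then have "window p'" unfolding window_def p'_def by blast
  then show ?thesis using pos by blast
qed

text \<open>The functional \<open>cr _ q\<close> vanishes on the direction of \<open>q\<close>
  itself; the small multiple of the scalar product \<open>g\<close> with \<open>q\<close> decides
  the sign there.\<close>

lemma window_ending_at:
  assumes q: "q \<in> Phi"
  shows "\<exists>p. window p \<and> ip p q > 0 \<and> (\<forall>r\<in>Phi. ip p r > 0 \<longrightarrow> cr r q \<ge> 0)"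
proof -
  define g where "g r = ip kx q * ip kx r + ip ky q * ip ky r" for r
  define X where "X = {r \<in> Phi. cr r q > 0}"
  have "finite X" using finite_Phi by (simp add: X_def)
  then have "\<exists>d>0. \<forall>r\<in>X. d * (- g r) < cr r q" by (rule finite_small_pos) (simp add: X_def)
  then obtain d where d: "d > 0" "\<forall>r\<in>X. d * (- g r) < cr r q" by (elim exE conjE)
  define p where "p = (- ip ky q + d * ip kx q) *\<^sub>R kx + (ip kx q + d * ip ky q) *\<^sub>R ky"
  have pr: "ip p r = cr r q + d * g r" for r by (simp add: p_def cr_def g_def ip_simps algebra_simps)
  have gq: "g q > 0"
  proof -
    have "g q = (ip kx q)\<^sup>2 + (ip ky q)\<^sup>2" by (simp add: g_def power2_eq_square)
    then show ?thesis using proj_nz[OF q] by (simp add: sum_power2_gt_zero_iff)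
  qed
  have pos: "ip p r > 0" if "r \<in> Phi" "cr r q > 0" for r using d(2) that by (auto simp: pr X_def)
  have neg: "ip p r < 0" if "r \<in> Phi" "cr r q < 0" for r
    using pos[OF Phi_uminus[OF that(1)]] that(2) by (simp add: cr_minus ip_simps)
  have zero: "ip p r \<noteq> 0" if r: "r \<in> Phi" "cr r q = 0" for r
  proof
    assume "ip p r = 0"
    then have g0: "g r = 0" using r d by (simp add: pr)
    have e: "ip kx q * ip ky r = ip ky q * ip kx r" using r(2) by (simp add: cr_def)
    have "g q * ip kx r = ip kx q * (ip kx q * ip kx r) + ip ky q * (ip ky q * ip kx r)"
      by (simp add: g_def algebra_simps)
    also have "\<dots> = ip kx q * g r" by (simp flip: e) (simp add: g_def algebra_simps)
    finally have "ip kx r = 0" using g0 gq by simp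
    have "g q * ip ky r = ip kx q * (ip kx q * ip ky r) + ip ky q * (ip ky q * ip ky r)"
      by (simp add: g_def algebra_simps)
    also have "\<dots> = ip ky q * g r" by (simp add: e) (simp add: g_def algebra_simps)
    finally have "ip ky r = 0" using g0 gq by simp
    then show False using \<open>ip kx r = 0\<close> proj_nz[OF r(1)] by simp
  qed
  have nz: "\<forall>r\<in>Phi. ip p r \<noteq> 0"
  proof
    fix r assume "r \<in> Phi"
    then show "ip p r \<noteq> 0" using pos[of r] neg[of r] zero[of r] by linarith
  qed
  have "window p" unfolding window_def using nz p_def by blast
  moreover have "cr q q = 0" by (simp add: cr_def)
  then have "ip p q > 0" using gq d by (simp add: pr)
  moreover have "\<forall>r\<in>Phi. ip p r > 0 \<longrightarrow> cr r q \<ge> 0" using neg by force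
  ultimately show ?thesis by blast
qed

text \<open>A cone on which \<open>p\<close> is positive is pointed. Any functional \<open>f\<close>
  is absorbed by passing to \<open>p - d f\<close> with small \<open>d\<close>.\<close>

lemma Cs_opposite: 
  assumes p: "p \<in> V" and x: "x \<in> Cs X" "x \<in> Cs Y" and fX: "finite X" and pos: "\<And>r. r \<in> X \<Longrightarrow> ip p r > 0"
    and Y: "\<And>r. r \<in> Y \<Longrightarrow> - r \<in> X"
  shows "x = 0"
proof -
  have xV: "x \<in> V" using x by (simp add: Cs_def)
  have le: "ip f x \<le> 0" if f: "f \<in> V" for f
  proof -
    obtain d where d: "d > 0" "\<forall>r\<in>X. d * ip f r < ip p r"
      using finite_small_pos[OF fX, of "ip p" "ip f"] pos by blast
    have nn: "ip (p - d *\<^sub>R f) r \<ge> 0" if "r \<in> X" for r using d that by (auto simp: ip_simps less_imp_le)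
    have gV: "p - d *\<^sub>R f \<in> V" "- (p - d *\<^sub>R f) \<in> V" "- p \<in> V" using p f by (auto intro: V_intros)
    have "ip (p - d *\<^sub>R f) x \<ge> 0" by (rule Cs_D[OF x(1) gV(1) nn])
    moreover have "ip (- p) x \<ge> 0"
    proof (rule Cs_D[OF x(2) gV(3)])
      fix r assume "r \<in> Y"
      then have "ip p (- r) > 0" using pos Y by blast
      then show "ip (- p) r \<ge> 0" by (simp add: ip_simps)
    qed
    ultimately have "d * ip f x \<le> 0" by (simp add: ip_simps)
    then show ?thesis using d(1) by (simp add: mult_le_0_iff)
  qed
  have "ip x x \<le> 0" using le[OF xV] .
  then show ?thesis using ip_pos[OF xV] by force
qed

text \<open>The dual form of the claim that \<open>x\<close> lies in the span of the common roots.
  The window is swept backwards. A common root \<open>s\<close> in the last block with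
  \<open>E s x > 0\<close> is projected away, which lowers \<open>L u1\<close>; if there is none,
  the whole block is negated and \<open>x\<close> stays in both cones. After half a turn
  \<open>x\<close> lies in opposite cones and is 0.\<close>

lemma cones_intersect:
  assumes "u1 \<in> NCs" "u2 \<in> NCs" "window p" "x \<in> Cs (PM p (Mv u1))" "x \<in> Cs (PM p (Mv u2))"
    and "f \<in> V" "\<And>r. r \<in> Phi \<Longrightarrow> r \<in> Mv u1 \<Longrightarrow> r \<in> Mv u2 \<Longrightarrow> ip f r = 0"
  shows "ip f x = 0"
  using assms
proof (induction "L u1" arbitrary: u1 u2 p x rule: less_induct)
  case less
  note IH = less.hyps and u1 = less.prems(1) and u2 = less.prems(2) and f = less.prems(6) and fz = less.prems(7)
  define p0 where "p0 = p"
  have p0: "window p0" "x \<in> Cs (PM p0 (Mv u1))" using less.prems by (auto simp: p0_def)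
  \<comment> \<open>Invariant of the sweep: those roots of the current window that belong to the
    initial one form a final segment of it, so the block removed next still belongs to the initial
    window.\<close>
  define up where "up p \<longleftrightarrow> (\<forall>r\<in>Phi. \<forall>s\<in>Phi. ip p r > 0 \<longrightarrow> ip p s > 0 \<longrightarrow> ip p0 r > 0 \<longrightarrow> cr r s \<ge> 0 \<longrightarrow> ip p0 s > 0)" for p
  \<comment> \<open>The roots of the initial window not yet swept; each turn removes the last
    block.\<close>
  define N where "N p = {r \<in> Phi. ip p r > 0 \<and> ip p0 r > 0}" for p
  have fN: "finite (N p)" for p using finite_Phi by (simp add: N_def)
  have "up p" by (auto simp: up_def p0_def)
  have main: "ip f x = 0" if "window p'" "up p'" "x \<in> Cs (PM p' (Mv u1))" "x \<in> Cs (PM p' (Mv u2))" for p'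
    using that
  proof (induction "card (N p')" arbitrary: p' rule: less_induct)
    case (less p)
    note p = less.prems(1) and upp = less.prems(2) and x1 = less.prems(3) and x2 = less.prems(4)
    show ?case
    proof (cases "N p = {}")
      case True
      have "x = 0"
      proof (rule Cs_opposite[OF window_V[OF p] x1 p0(2) finite_PM])
        fix r assume r: "r \<in> PM p0 (Mv u1)"
        then have rP: "r \<in> Phi" "- r \<in> Phi" "- r \<in> Mv u1" "ip p0 r > 0"
          using Phi_uminus subspace_neg[OF Mv_subspace] by (auto simp: PM_def)
        then have "\<not> ip p r > 0" using True by (auto simp: N_def)
        then have "ip p (- r) > 0" using p rP(1) by (force simp: window_def ip_simps)
        then show "- r \<in> PM p (Mv u1)" using rP by (simp add: PM_def)
      qed (auto simp: PM_def)
      then show ?thesis by (simp add: ip_simps)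
    next
      case False
      then obtain r0 where r0: "r0 \<in> Phi" "ip p r0 > 0" "ip p0 r0 > 0" by (auto simp: N_def)
      have "\<exists>q\<in>Phi. ip p q > 0 \<and> (\<forall>r\<in>Phi. ip p r > 0 \<longrightarrow> cr r q \<ge> 0)"
      proof (rule last_root_exists[OF p])
        show "\<exists>r\<in>Phi. ip p r > 0" using r0(1,2) by (rule_tac x = r0 in bexI)
      qed
      then obtain q where q': "q \<in> Phi" "ip p q > 0" "\<forall>r\<in>Phi. ip p r > 0 \<longrightarrow> cr r q \<ge> 0"
        by blast
      have q: "q \<in> Phi" "ip p q > 0" "\<And>r. r \<in> Phi \<Longrightarrow> ip p r > 0 \<Longrightarrow> cr r q \<ge> 0"
        using q' by simp_all
      have q0: "ip p0 q > 0"
        by (rule upp[unfolded up_def, rule_format, OF r0(1) q(1) r0(2) q(2) r0(3) q(3)[OF r0(1,2)]])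
      define B where "B = {r \<in> Phi. ip p r > 0 \<and> cr r q = 0}"
      have Blast: "cr r s \<ge> 0" if s: "s \<in> B" and r: "r \<in> Phi" "ip p r > 0" for r s
      proof -
        have sB: "s \<in> Phi" "ip p s > 0" "cr s q = 0" "cr q s = 0" using s cr_swap[of q s] by (auto simp: B_def)
        have "ip p q * cr r s = ip p s * cr r q + ip p r * cr q s" by (rule pluecker[OF p])
        also have "\<dots> \<ge> 0" using sB q(3)[OF r] by simp
        finally show ?thesis using q(2) by (simp add: zero_le_mult_iff)
      qed
      show ?thesis
      proof (cases "\<exists>s\<in>B. s \<in> Mv u1 \<and> s \<in> Mv u2 \<and> E s x > 0")
        case True
        then obtain s where s: "s \<in> B" "s \<in> Mv u1" "s \<in> Mv u2" "E s x > 0" by blast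
        have sP: "s \<in> Phi" "ip p s > 0" using s by (auto simp: B_def)
        define t where "t = rt s"
        have t: "isroot t s" using isroot_rt sP by (simp add: t_def)
        have s1: "s \<in> PM p (Mv u1)" "s \<in> PM p (Mv u2)" using s sP by (auto simp: PM_def)
        have "ip f (x - E s x *\<^sub>R s) = 0"
        proof (rule IH[of "t \<otimes> u1" "t \<otimes> u2" p])
          show "L (t \<otimes> u1) < L u1" using L_mult_root_iff[OF t NCs_carrier[OF u1]] s by simp
          show "t \<otimes> u1 \<in> NCs" "t \<otimes> u2 \<in> NCs" using NCs_down u1 u2 t s by auto
          show "x - E s x *\<^sub>R s \<in> Cs (PM p (Mv (t \<otimes> u1)))"
            by (rule cone_step[OF u1 p t s1(1) _ x1]) (use Blast[OF s(1)] in \<open>auto simp: PM_def\<close>)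
          show "x - E s x *\<^sub>R s \<in> Cs (PM p (Mv (t \<otimes> u2)))"
            by (rule cone_step[OF u2 p t s1(2) _ x2]) (use Blast[OF s(1)] in \<open>auto simp: PM_def\<close>)
          show "ip f r = 0" if "r \<in> Phi" "r \<in> Mv (t \<otimes> u1)" "r \<in> Mv (t \<otimes> u2)" for r
            using fz that Mv_down[OF u1 t s(2)] Mv_down[OF u2 t s(3)] by auto
        qed (use p f in auto)
        moreover have "ip f s = 0" using fz sP s by blast
        ultimately show ?thesis by (simp add: ip_simps)
      next
        case False
        obtain p' where p': "window p'" "\<forall>r\<in>Phi. ip p r > 0 \<longrightarrow> (ip p' r > 0 \<longleftrightarrow> cr r q \<noteq> 0)"
          using previous_window[OF p q] by blast
        \<comment> \<open>If a block root \<open>s\<close> is missing from one of the two moved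
          spaces, \<open>E s\<close> is nonpositive on all roots of its cone, because they come
          before \<open>s\<close> and none equals \<open>s\<close>. So only common roots can have
          \<open>E s x > 0\<close>.\<close>
        have Ele: "E s x \<le> 0" if s: "s \<in> B" "s \<in> Mv v \<or> s \<in> Mv w" "x \<in> Cs (PM p (Mv v))" "x \<in> Cs (PM p (Mv w))"
          "\<not> (s \<in> Mv v \<and> s \<in> Mv w \<and> E s x > 0)" for s v w
        proof -
          have sP: "s \<in> Phi" "ip p s > 0" "s \<in> V" using s(1) Phi_V by (auto simp: B_def)
          have *: "E s x \<le> 0" if "s \<notin> Mv v" "x \<in> Cs (PM p (Mv v))" for v
          proof -
            have "ip (- Ai s) x \<ge> 0"
            proof (rule Cs_D[OF that(2)])
              show "- Ai s \<in> V" using Ai(1)[OF sP(3)] by (rule V_minus)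
              fix r assume r: "r \<in> PM p (Mv v)"
              then have rP: "r \<in> Phi" "ip p r > 0" "s \<noteq> r" using that(1) by (auto simp: PM_def)
              moreover have "s \<noteq> - r" using rP sP by (auto simp: ip_simps)
              ultimately have "E s r \<le> 0" using E_le_0[OF rP(1) sP(1) Blast[OF s(1) rP(1,2)]] by blast
              then show "ip (- Ai s) r \<ge> 0" by (simp add: E_def ip_simps)
            qed
            then show ?thesis by (simp add: E_def ip_simps)
          qed
          show ?thesis using *[of v] *[of w] s(3-5) by fastforce
        qed
        \<comment> \<open>Membership in the turned window: the block \<open>B\<close> is replaced by
          its negatives, all else stays.\<close>
        have flip: "r \<in> PM p' M \<longleftrightarrow> (r \<in> PM p M \<and> r \<notin> B) \<or> (- r \<in> PM p M \<and> - r \<in> B)"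
          if M: "M = Mv w" for r M w
        proof (cases "r \<in> Phi \<and> r \<in> M")
          case rM: True
          have mM: "- r \<in> Phi" "- r \<in> M" using rM Phi_uminus M subspace_neg[OF Mv_subspace] by auto
          show ?thesis
          proof (cases "ip p r > 0")
            case True
            then have "\<not> ip p (- r) > 0" by (simp add: ip_simps)
            then show ?thesis using rM True p'(2) by (auto simp: PM_def B_def)
          next
            case False
            then have a: "ip p (- r) > 0" using p rM by (force simp: window_def ip_simps)
            then have "ip p' (- r) > 0 \<longleftrightarrow> cr (- r) q \<noteq> 0" using p'(2) mM(1) by blast
            moreover have "ip p' r \<noteq> 0" using p'(1) rM by (auto simp: window_def)
            ultimately have "ip p' r > 0 \<longleftrightarrow> cr (- r) q = 0" by (auto simp: ip_simps)
            then show ?thesis using rM mM a False by (auto simp: PM_def B_def)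
          qed
        next
          case False
          then show ?thesis using M subspace_neg[OF Mv_subspace, of "- r" w] Phi_uminus[of "- r"] by (auto simp: PM_def)
        qed
        have step: "x \<in> Cs (PM p' (Mv v))"
          if v: "v \<in> NCs" "x \<in> Cs (PM p (Mv v))" "\<And>s. s \<in> B \<Longrightarrow> s \<in> Mv v \<Longrightarrow> E s x \<le> 0" for v
        proof -
          define D where "D = B \<inter> PM p (Mv v)"
          have "ip g x \<ge> 0" if g: "g \<in> V" "\<forall>r\<in>PM p' (Mv v). ip g r \<ge> 0" for g
          proof (rule block_step[of D v p x g])
            show "finite D" using finite_PM by (simp add: D_def)
            show "D \<subseteq> PM p (Mv v)" by (simp add: D_def)
            show "cr r s \<ge> 0" if "s \<in> D" "r \<in> PM p (Mv v)" for s r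
              using Blast[of s r] that by (auto simp: D_def PM_def)
            show "E s x \<le> 0" if "s \<in> D" for s using v(3) that by (auto simp: D_def PM_def)
            show "ip g r \<ge> 0" if "r \<in> PM p (Mv v)" "r \<notin> D" for r
              using g(2) flip[OF refl, of r v] that by (auto simp: D_def)
            show "ip g s \<le> 0" if "s \<in> D" for s
            proof -
              have "- s \<in> PM p' (Mv v)" using flip[OF refl, of "- s" v] that by (auto simp: D_def)
              then have "ip g (- s) \<ge> 0" using g(2) by blast
              then show ?thesis by (simp add: ip_simps)
            qed
          qed (use v p g in auto)
          then show ?thesis using v(2) by (simp add: Cs_def)
        qed
        have x1': "x \<in> Cs (PM p' (Mv u1))"
          by (rule step[OF u1 x1]) (use Ele[of _ u1 u2] x1 x2 False in blast)
        have x2': "x \<in> Cs (PM p' (Mv u2))"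
          by (rule step[OF u2 x2]) (use Ele[of _ u1 u2] x1 x2 False in blast)
        have sgn: "ip p r > 0 \<and> cr r q \<noteq> 0 \<or> ip p (- r) > 0 \<and> cr r q = 0" if r: "r \<in> Phi" "ip p' r > 0" for r
        proof (cases "ip p r > 0")
          case True then show ?thesis using p'(2) r by blast
        next
          case False
          then have a: "ip p (- r) > 0" using p r(1) by (force simp: window_def ip_simps)
          then have "ip p' (- r) > 0 \<longleftrightarrow> cr (- r) q \<noteq> 0" using p'(2) Phi_uminus[OF r(1)] by blast
          then show ?thesis using a r(2) by (auto simp: ip_simps cr_minus)
        qed
        have B0: "ip p0 s > 0" if s: "s \<in> B" for s
        proof -
          have sB: "s \<in> Phi" "ip p s > 0" "cr q s = 0" using s cr_swap[of q s] by (auto simp: B_def)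
          show ?thesis
            by (rule upp[unfolded up_def, rule_format, OF q(1) sB(1) q(2) sB(2) q0]) (simp add: sB)
        qed
        have inB: "- r \<in> B" if "r \<in> Phi" "ip p (- r) > 0" "cr r q = 0" for r
          using that Phi_uminus by (simp add: B_def cr_minus)
        have np0: "\<not> ip p0 r > 0" if "r \<in> Phi" "ip p (- r) > 0" "cr r q = 0" for r
          using B0[OF inB[OF that]] by (simp add: ip_simps)
        have "up p'"
          unfolding up_def
        proof (intro ballI impI)
          fix r s assume a: "r \<in> Phi" "s \<in> Phi" "ip p' r > 0" "ip p' s > 0" "ip p0 r > 0" "cr r s \<ge> 0"
          have r: "ip p r > 0" "cr r q \<noteq> 0" using sgn[OF a(1,3)] np0[OF a(1)] a(5) by auto
          then have rq: "cr r q > 0" using q(3)[OF a(1) r(1)] by simp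
          show "ip p0 s > 0"
          proof (cases "ip p s > 0")
            case True
            show ?thesis by (rule upp[unfolded up_def, rule_format, OF a(1,2) r(1) True a(5,6)])
          next
            case False
            then have s: "ip p (- s) > 0" "cr s q = 0" using sgn[OF a(2,4)] by auto
            have "ip p q * cr r (- s) = ip p (- s) * cr r q + ip p r * cr q (- s)" by (rule pluecker[OF p])
            moreover have "cr q (- s) = 0" using s(2) cr_swap[of q s] by (simp add: cr_minus)
            moreover have "ip p (- s) * cr r q > 0" using s rq by simp
            ultimately have "ip p q * cr r (- s) > 0" by simp
            then have "cr r (- s) > 0" using q(2) by (simp add: zero_less_mult_iff)
            then show ?thesis using a(6) by (simp add: cr_minus)
          qed
        qed
        moreover have "card (N p') < card (N p)"
        proof (rule psubset_card_mono[OF fN], rule psubsetI)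
          show "N p' \<subseteq> N p" using sgn np0 by (auto simp: N_def)
          have "q \<in> N p" using q q0 by (simp add: N_def)
          moreover have "q \<notin> N p'" using p'(2) q by (auto simp: N_def cr_def)
          ultimately show "N p' \<noteq> N p" by blast
        qed
        ultimately show ?thesis using less.hyps[OF _ p'(1) _ x1' x2'] by blast
      qed
    qed
  qed
  show ?case using main[of p] less.prems \<open>up p\<close> by blast
qed

text \<open>Descend on both sides by the reflection of a common root \<open>q\<close>, take the meet
  there, and adjoin \<open>q\<close> again. A common root projected away from \<open>q\<close> lies
  in both smaller cones, so by \<open>cones_intersect\<close> in the moved space of the smaller
  meet.\<close>

theorem NCs_meet:
  assumes "u1 \<in> NCs" "u2 \<in> NCs"
  shows "\<exists>u\<in>NCs. Mv u \<subseteq> Mv u1 \<and> Mv u \<subseteq> Mv u2 \<and> Phi \<inter> Mv u1 \<inter> Mv u2 \<subseteq> Mv u"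
  using assms
proof (induction "L u1" arbitrary: u1 u2 rule: less_induct)
  case less
  note u1 = less.prems(1) and u2 = less.prems(2)
  show ?case
  proof (cases "Phi \<inter> Mv u1 \<inter> Mv u2 = {}")
    case True
    have "Mv \<one> \<subseteq> Mv u1" "Mv \<one> \<subseteq> Mv u2" using subspace_0[OF Mv_subspace] by (auto simp: Mv_one)
    then show ?thesis using one_NCs True by blast
  next
    case False
    then obtain q where q: "q \<in> Phi" "q \<in> Mv u1" "q \<in> Mv u2" by blast
    have qV: "q \<in> V" using Phi_V q by blast
    define t where "t = rt q"
    have t: "isroot t q" using isroot_rt q by (simp add: t_def)
    note M1 = Mv_down[OF u1 t q(2)] and M2 = Mv_down[OF u2 t q(3)]
    have lt: "L (t \<otimes> u1) < L u1" using L_mult_root_iff[OF t NCs_carrier[OF u1]] q by simp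
    have n1: "t \<otimes> u1 \<in> NCs" and n2: "t \<otimes> u2 \<in> NCs" using NCs_down u1 u2 t q by auto
    obtain u' where u': "u' \<in> NCs" "Mv u' \<subseteq> Mv (t \<otimes> u1)" "Mv u' \<subseteq> Mv (t \<otimes> u2)"
      "Phi \<inter> Mv (t \<otimes> u1) \<inter> Mv (t \<otimes> u2) \<subseteq> Mv u'"
      using less.hyps[OF lt n1 n2] by blast
    have "E q y = 0" if "y \<in> Mv u'" for y using that u'(2) M1 by auto
    note I = NCs_insert[OF u'(1) t this]
    have dec: "y - E q y *\<^sub>R q \<in> Mv u'" if "y \<in> Mv (t \<otimes> u')" for y
    proof -
      have "y - E q y *\<^sub>R q \<in> Mv (t \<otimes> u')" using that I(2) Mv_subspace by (intro subspace_diff subspace_scale) auto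
      then show ?thesis using I(3) E_self[OF q(1)] by (simp add: E_simps)
    qed
    have sub: "Mv (t \<otimes> u') \<subseteq> Mv v" if v: "Mv u' \<subseteq> Mv v" "q \<in> Mv v" for v
    proof
      fix y assume "y \<in> Mv (t \<otimes> u')"
      then have "(y - E q y *\<^sub>R q) + E q y *\<^sub>R q \<in> Mv v"
        using dec v Mv_subspace by (intro subspace_add subspace_scale) auto
      then show "y \<in> Mv v" by simp
    qed
    \<comment> \<open>\<open>cone_step_root\<close> requires \<open>q\<close> to be last; a window
      that ends at \<open>q\<close> serves \<open>u1\<close> and \<open>u2\<close> at once.\<close>
    obtain p where p: "window p" "ip p q > 0" "\<forall>r\<in>Phi. ip p r > 0 \<longrightarrow> cr r q \<ge> 0"
      using window_ending_at[OF q(1)] by blast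
    have qP: "q \<in> PM p (Mv u1)" "q \<in> PM p (Mv u2)" using p q by (auto simp: PM_def)
    have pos: "r \<in> Mv (t \<otimes> u')" if r: "r \<in> Phi" "r \<in> Mv u1" "r \<in> Mv u2" "ip p r > 0" for r
    proof -
      have rV: "r \<in> V" using Phi_V r by blast
      define x where "x = r - E q r *\<^sub>R q"
      have xV: "x \<in> V" using rV qV by (simp add: x_def V_intros)
      have x1: "x \<in> Cs (PM p (Mv (t \<otimes> u1)))"
        unfolding x_def by (rule cone_step_root[OF u1 p(1) t qP(1)]) (use p(3) r in \<open>auto simp: PM_def\<close>)
      have x2: "x \<in> Cs (PM p (Mv (t \<otimes> u2)))"
        unfolding x_def by (rule cone_step_root[OF u2 p(1) t qP(2)]) (use p(3) r in \<open>auto simp: PM_def\<close>)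
      have "x \<in> Mv u'"
      proof -
        have "ip x f = 0" if f: "f \<in> Fx u'" for f
        proof -
          have fV: "f \<in> V" using f by (simp add: Fx_def)
          have "ip f x = 0"
          proof (rule cones_intersect[OF n1 n2 p(1) x1 x2 fV])
            fix s assume "s \<in> Phi" "s \<in> Mv (t \<otimes> u1)" "s \<in> Mv (t \<otimes> u2)"
            then have "s \<in> Mv u'" using u'(4) by blast
            then show "ip f s = 0" using Fx_iff_perp[OF NCs_carrier[OF u'(1)] fV] f by blast
          qed
          then show ?thesis using ip_sym[of x f] by simp
        qed
        then show ?thesis using xV by (simp add: Mv_def)
      qed
      then have "x \<in> Mv (t \<otimes> u')" using I(3) by blast
      then have "x + E q r *\<^sub>R q \<in> Mv (t \<otimes> u')" using I(2) Mv_subspace by (intro subspace_add subspace_scale) auto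
      then show ?thesis by (simp add: x_def)
    qed
    have "r \<in> Mv (t \<otimes> u')" if r: "r \<in> Phi" "r \<in> Mv u1" "r \<in> Mv u2" for r
    proof (cases "ip p r > 0")
      case False
      then have a: "ip p (- r) > 0" using p(1) r(1) by (force simp: window_def ip_simps)
      have "- r \<in> Mv (t \<otimes> u')" using pos[OF Phi_uminus[OF r(1)] _ _ a] r subspace_neg[OF Mv_subspace] by blast
      then show ?thesis using subspace_neg[OF Mv_subspace, of "- r" "t \<otimes> u'"] by simp
    qed (use pos r in blast)
    moreover have "Mv (t \<otimes> u') \<subseteq> Mv u1" "Mv (t \<otimes> u') \<subseteq> Mv u2" using sub u' M1 M2 q by auto
    ultimately show ?thesis using I(1) by blast
  qed
qed

text \<open>Take an upper bound of minimal length. Its meet with any other upper bound is again an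
  upper bound, since a reflection lies below an element iff its root is moved; by minimality the
  meet is the chosen bound itself.\<close>

lemma join_exists:
  assumes A: "A \<subseteq> T"
  shows "\<exists>u. least (NC G S c) u (Upper (NC G S c) A)"
proof -
  let ?U = "Upper (NC G S c) A"
  have AN: "t \<in> NCs" if t: "t \<in> A" for t
  proof -
    have tT: "t \<in> T" using A t by blast
    obtain r where r: "isroot t r" using root_exists[OF tT] by blast
    have "abs_le G S t c" using abs_le_root_iff[OF r c_in] rootD(3)[OF r] Mv_c by simp
    then show ?thesis using T_carrier[OF tT] by (simp add: NCs_def)
  qed
  have U: "u \<in> ?U \<longleftrightarrow> u \<in> NCs \<and> (\<forall>t\<in>A. abs_le G S t u)" for u
    using AN by (auto simp: Upper_def NC_simps)
  have cU: "c \<in> ?U" using AN c_NCs by (auto simp: U NCs_def)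
  define u where "u = arg_min L (\<lambda>u. u \<in> ?U)"
  have u: "u \<in> ?U" "\<And>v. v \<in> ?U \<Longrightarrow> L u \<le> L v"
    unfolding u_def using arg_min_nat_lemma[of "\<lambda>u. u \<in> ?U" c L] cU by auto
  have "abs_le G S u v" if v: "v \<in> ?U" for v
  proof -
    have uN: "u \<in> NCs" and vN: "v \<in> NCs" using u(1) v U by auto
    obtain m where m: "m \<in> NCs" "Mv m \<subseteq> Mv u" "Mv m \<subseteq> Mv v" "Phi \<inter> Mv u \<inter> Mv v \<subseteq> Mv m"
      using NCs_meet[OF uN vN] by blast
    have "abs_le G S t m" if t: "t \<in> A" for t
    proof -
      obtain r where r: "isroot t r" using root_exists A t by blast
      have "abs_le G S t u" "abs_le G S t v" using u(1) v t U by simp_all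
      then have "r \<in> Mv u" "r \<in> Mv v"
        using abs_le_root_iff[OF r NCs_carrier[OF uN]] abs_le_root_iff[OF r NCs_carrier[OF vN]] by simp_all
      then have "r \<in> Mv m" using m(4) PhiI[OF r] by blast
      then show ?thesis using abs_le_root_iff[OF r NCs_carrier[OF m(1)]] by simp
    qed
    then have "m \<in> ?U" using m(1) U by blast
    then have le: "L u \<le> L m" using u(2) by blast
    have mu: "abs_le G S m u" using NCs_le[OF m(1) uN m(2)] .
    then have "L (u \<otimes> inv m) = 0" using le by (simp add: abs_le_def)
    then have "u \<otimes> inv m = \<one>" using L_zero NCs_carrier[OF uN] NCs_carrier[OF m(1)] by simp
    then have "u \<otimes> inv m \<otimes> m = m" using NCs_carrier[OF m(1)] by simp
    then have "u = m" using NCs_carrier[OF uN] NCs_carrier[OF m(1)] by (simp add: m_assoc)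
    then show ?thesis using NCs_le[OF m(1) vN m(3)] by simp
  qed
  then have "least (NC G S c) u ?U"
    using u(1) unfolding least_def by (auto simp: NC_simps Upper_def)
  then show ?thesis by blast
qed

end

section \<open>Roots in the Coxeter plane\<close>

lemma independent_if_spanning_card:
  fixes B :: "'v::real_vector set"
  assumes "V \<subseteq> span B" "finite B" "card B \<le> dim V"
  shows "independent B"
proof
  assume "dependent B"
  then obtain a where a: "a \<in> B" "a \<in> span (B - {a})" using dependent_def by blast
  have "span B = span (insert a (B - {a}))" using a(1) by (simp add: insert_absorb)
  also have "\<dots> = span (B - {a})" using a(2) by (rule span_redundant)
  finally have "V \<subseteq> span (B - {a})" using assms(1) by simp
  then have "dim V \<le> card (B - {a})" using assms(2) by (intro dim_le_card) auto
  moreover have "card (B - {a}) < card B" using a(1) assms(2) by (rule card_Diff1_less[rotated])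
  ultimately show False using assms(3) by simp
qed

text \<open>\<open>kx\<close> and \<open>ky\<close> are the real and imaginary parts of a regular
  eigenvector whose eigenvalue has angle exactly \<open>2 pi / h\<close>. \<open>card_T\<close> is
  the degree count on which everything here rests.\<close>

locale coxeter_plane = refl_coxeter +
  fixes kx ky and h :: nat
  assumes kx: "kx \<in> V" and ky: "ky \<in> V" and h2: "h \<ge> 2"
    and proj_nz: "r \<in> Phi \<Longrightarrow> ip kx r \<noteq> 0 \<or> ip ky r \<noteq> 0"
    and rot_x: "x \<in> V \<Longrightarrow> ip kx (act c x) = cos (2 * pi / h) * ip kx x + sin (2 * pi / h) * ip ky x"
    and rot_y: "x \<in> V \<Longrightarrow> ip ky (act c x) = - sin (2 * pi / h) * ip kx x + cos (2 * pi / h) * ip ky x"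
    and card_T: "2 * card (reflections G S) \<le> dim V * h"
begin

definition "th = 2 * pi / real h"
text \<open>The projection to the plane as a complex number, with the sign of the imaginary part
  chosen so that \<open>c\<close> multiplies by \<open>cis th\<close>.\<close>

definition "kap x = Complex (ip kx x) (- ip ky x)"
definition "xr r s = ip kx s * ip ky r - ip ky s * ip kx r"
definition "gr r s = ip kx r * ip kx s + ip ky r * ip ky s"

lemma th: "0 < th" "th \<le> pi" "real h * th = 2 * pi"
  using h2 by (auto simp: th_def field_simps)

lemma kap_c: "x \<in> V \<Longrightarrow> kap (act c x) = cis th * kap x"
  by (simp add: kap_def rot_x rot_y complex_eq_iff th_def)

lemma kap_inv: assumes "x \<in> V" shows "kap x = cis th * kap (act (inv c) x)"
  using kap_c[of "act (inv c) x"] assms c_in by (simp add: act_V act_act_inv)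

lemma kap_inv': assumes "x \<in> V" shows "kap (act (inv c) x) = cis (- th) * kap x"
  unfolding kap_inv[OF assms] by (simp add: cis_mult flip: mult.assoc)

lemma kap_pow: "x \<in> V \<Longrightarrow> kap (act (c [^] k) x) = cis (k * th) * kap x" for k :: nat
proof (induction k)
  case (Suc k)
  have "c [^] Suc k = c \<otimes> c [^] k" using c_in nat_pow_Suc2 by metis
  then have "kap (act (c [^] Suc k) x) = cis th * (cis (k * th) * kap x)"
    using Suc c_in by (simp add: act_mult kap_c act_V)
  also have "\<dots> = cis (Suc k * th) * kap x" by (simp add: cis_mult distrib_right flip: mult.assoc)
  finally show ?case .
qed (simp add: act_one)

definition "wind a b \<longleftrightarrow> (\<forall>r\<in>Phi. ip (a *\<^sub>R kx + b *\<^sub>R ky) r \<noteq> 0)"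
text \<open>The positive roots that rotation by \<open>- th\<close> throws out of the half plane,
  that is, the inversions of \<open>inv c\<close>; they fill the first sector of angle
  \<open>th\<close>.\<close>

definition "first a b = {r \<in> Phi. ip (a *\<^sub>R kx + b *\<^sub>R ky) r > 0 \<and> ip (a *\<^sub>R kx + b *\<^sub>R ky) (act (inv c) r) < 0}"

lemma sector: assumes "r \<in> first a b"
  shows "\<exists>q z. q > 0 \<and> 0 < z \<and> z < th \<and> \<i> * kap r * Complex a b = of_real q * cis z"
proof -
  define w where "w = \<i> * kap r * Complex a b"
  have rV: "r \<in> V" using assms Phi_V by (simp add: first_def)
  have *: "Im (\<i> * kap x * Complex a b) = ip (a *\<^sub>R kx + b *\<^sub>R ky) x" for x
    by (simp add: kap_def ip_simps)
  have w0: "Im w > 0" unfolding w_def * using assms by (simp add: first_def)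
  have w1: "Im (cis (- th) * w) < 0"
  proof -
    have "cis (- th) * w = \<i> * kap (act (inv c) r) * Complex a b"
      using rV by (simp add: w_def kap_inv' mult.assoc mult.left_commute)
    then have "Im (cis (- th) * w) = ip (a *\<^sub>R kx + b *\<^sub>R ky) (act (inv c) r)" using * by simp
    then show ?thesis using assms by (simp add: first_def)
  qed
  define q z where "q = cmod w" and "z = Arg w"
  have q0: "q > 0" using w0 by (auto simp: q_def)
  have wq: "w = of_real q * cis z" using rcis_cmod_Arg[of w] by (simp add: q_def z_def rcis_def)
  have z: "- pi < z" "z \<le> pi" using Arg_bounded[of w] by (auto simp: z_def)
  have "sin z > 0" using w0 q0 by (simp add: wq zero_less_mult_iff)
  then have z0: "0 < z" using z sin_le_zero[of "z + 2 * pi"] by (cases "z \<ge> 0") (auto simp: not_le less_eq_real_def)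
  have "cis (- th) * w = of_real q * cis (z - th)" by (simp add: wq cis_mult mult.left_commute)
  then have "q * sin (z - th) < 0" using w1 by simp
  then have s: "sin (z - th) < 0" using q0 by (simp add: mult_less_0_iff)
  have "z < th"
  proof (rule ccontr)
    assume "\<not> z < th"
    then have "sin (z - th) \<ge> 0" using z th by (intro sin_ge_zero) auto
    then show False using s by simp
  qed
  then show ?thesis using q0 z0 wq w_def by metis
qed

text \<open>The \<open>h\<close> rotated copies of the sector under the powers of \<open>c\<close>
  are disjoint sets of roots, and there are at most \<open>dim V * h\<close> roots.\<close>

lemma card_first: "card (first a b) \<le> dim V"
proof -
  have fF: "finite (first a b)" using finite_Phi by (simp add: first_def)
  let ?f = "\<lambda>(k, r). act (c [^] (k::nat)) r"
  have inj: "inj_on ?f ({..<h} \<times> first a b)"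
  proof (rule inj_onI, clarify)
    fix k r l s assume a: "k < h" "l < h" "r \<in> first a b" "s \<in> first a b" "act (c [^] k) r = act (c [^] l) s"
    have V: "r \<in> V" "s \<in> V" using a Phi_V by (auto simp: first_def)
    obtain q z where q: "q > 0" "0 < z" "z < th" "\<i> * kap r * Complex a b = of_real q * cis z"
      using sector[OF a(3)] by blast
    obtain q' z' where q': "q' > 0" "0 < z'" "z' < th" "\<i> * kap s * Complex a b = of_real q' * cis z'"
      using sector[OF a(4)] by blast
    have "cis (k * th) * kap r = cis (l * th) * kap s" using a(5) kap_pow V by metis
    then have "cis (k * th) * (\<i> * kap r * Complex a b) = cis (l * th) * (\<i> * kap s * Complex a b)"
      by (metis (no_types, lifting) mult.assoc mult.left_commute)
    then have e: "of_real q * cis (k * th + z) = of_real q' * cis (l * th + z')"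
      unfolding q(4) q'(4) by (simp add: cis_mult mult.left_commute)
    then have "cmod (of_real q * cis (k * th + z)) = cmod (of_real q' * cis (l * th + z'))" by simp
    then have "q = q'" using q(1) q'(1) by (simp add: norm_mult)
    then have "cis (k * th + z) = cis (l * th + z')" using e q(1) by simp
    then obtain n where n: "k * th + z = l * th + z' + 2 * pi * of_int n"
      using sin_cos_eq_iff[of "k * th + z" "l * th + z'"] by (auto simp: complex_eq_iff)
    have b1: "0 < k * th + z" "0 < l * th + z'" using q q' th by (auto intro!: add_nonneg_pos)
    have b2: "k * th + z < 2 * pi" "l * th + z' < 2 * pi"
    proof -
      have "(k + 1) * th \<le> h * th" "(l + 1) * th \<le> h * th" using a(1,2) th(1) by (intro mult_right_mono; simp)+
      then show "k * th + z < 2 * pi" "l * th + z' < 2 * pi" using q q' th(3) by (simp_all add: distrib_right)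
    qed
    have "2 * pi * of_int n < 2 * pi * 1" "2 * pi * (- 1) < 2 * pi * of_int n" using n b1 b2 by linarith+
    then have "real_of_int n < 1" "- 1 < real_of_int n"
      using mult_less_cancel_left_pos[of "2 * pi"] pi_gt_zero by (metis mult_pos_pos zero_less_numeral)+
    then have "n = 0" by linarith
    then have kz: "(real k - real l) * th = z' - z" using n by (simp add: algebra_simps)
    have "\<bar>real k - real l\<bar> * th = \<bar>(real k - real l) * th\<bar>" using th(1) by (simp add: abs_mult)
    also have "\<dots> < th" unfolding kz using q q' by (simp add: abs_less_iff)
    finally have "\<bar>real k - real l\<bar> * th < 1 * th" by simp
    then have "\<bar>real k - real l\<bar> < 1" using th(1) by simp
    then have kl: "k = l" by linarith
    then have "act (inv (c [^] k)) (act (c [^] k) r) = act (inv (c [^] k)) (act (c [^] k) s)" using a(5) by simp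
    then show "k = l \<and> r = s" using kl c_in by (simp add: act_inv_act)
  qed
  have sub: "?f ` ({..<h} \<times> first a b) \<subseteq> Phi" using Phi_act c_in by (auto simp: first_def)
  have "h * card (first a b) = card (?f ` ({..<h} \<times> first a b))"
    using card_image[OF inj] fF by simp
  also have "\<dots> \<le> card Phi" using sub finite_Phi by (rule card_mono[rotated])
  also have "\<dots> \<le> dim V * h" using finite_card_Phi card_T by linarith
  finally show ?thesis using h2 by simp
qed

text \<open>\<open>inversion_expansion\<close> for \<open>inv c\<close> writes
  \<open>f - c f\<close> in terms of the sector. As \<open>1 - c\<close> is onto, the sector spans
  \<open>V\<close>, so by \<open>card_first\<close> it is a basis. The simple roots occurring in the
  expansion form the basis dual to it under \<open>E\<close>, so \<open>E r\<close> reads off simple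
  coordinates.\<close>

lemma sector_basis:
  assumes w: "wind a b"
  shows "independent (first a b)"
    and "\<And>r s. r \<in> first a b \<Longrightarrow> s \<in> Phi \<Longrightarrow> ip (a *\<^sub>R kx + b *\<^sub>R ky) s > 0 \<Longrightarrow> E r s \<ge> 0"
proof -
  define p where "p = a *\<^sub>R kx + b *\<^sub>R ky"
  interpret P: posys G S V act ip p V
    by unfold_locales (use w kx ky V_subspace in \<open>auto simp: wind_def p_def V_intros\<close>)
  define F where "F = first a b"
  have fF: "finite F" using finite_Phi by (simp add: F_def first_def)
  have FI: "P.Iv (inv c) = F"
    unfolding P.Iv_def F_def first_def PM_def p_def[symmetric] using Phi_V by auto
  have FV: "r \<in> V" "r \<in> Phi" if "r \<in> F" for r using that Phi_V by (auto simp: F_def first_def)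
  obtain al where al: "\<forall>r\<in>F. P.simple (al r)"
    "\<forall>f\<in>V. f - act (inv (inv c)) f = (\<Sum>r\<in>F. ip f (al r) *\<^sub>R r)"
    using P.inversion_expansion[of "inv c"] c_in Mv_V unfolding FI by blast
  have id: "f - act c f = (\<Sum>r\<in>F. ip f (al r) *\<^sub>R r)" if "f \<in> V" for f
    using al(2) that c_in by simp
  have "V \<subseteq> span F"
  proof
    fix y assume y: "y \<in> V"
    have "y = (\<Sum>r\<in>F. ip (Ai y) (al r) *\<^sub>R r)" using id[OF Ai(1)[OF y]] Ai(2)[OF y] by simp
    also have "\<dots> \<in> span F" by (intro span_sum span_scale span_base)
    finally show "y \<in> span F" .
  qed
  then have ind: "independent F" using fF card_first by (intro independent_if_spanning_card) (auto simp: F_def)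
  then show "independent (first a b)" by (simp add: F_def)
  have alV: "al r \<in> V" if "r \<in> F" for r using al(1) that P.PM_D by (auto simp: P.simple_def)
  have dual: "E r (al s) = (if r = s then 1 else 0)" if r: "r \<in> F" and s: "s \<in> F" for r s
  proof -
    have "r = (\<Sum>s\<in>F. E r (al s) *\<^sub>R s)"
      using id[OF Ai(1)[OF FV(1)[OF r]]] Ai(2)[OF FV(1)[OF r]] by (simp add: E_def)
    moreover have "r = (\<Sum>s\<in>F. (if r = s then 1 else 0) *\<^sub>R s)"
      using r fF by (simp add: if_distrib[of "\<lambda>x. x *\<^sub>R _"] cong: if_cong)
    ultimately have "(\<Sum>s\<in>F. (E r (al s) - (if r = s then 1 else 0)) *\<^sub>R s) = 0"
      by (simp add: scaleR_diff_left sum_subtractf)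
    then have "E r (al s) - (if r = s then 1 else 0) = 0"
      using ind[unfolded independent_explicit_finite_subsets, rule_format, OF subset_refl fF,
          of "\<lambda>s. E r (al s) - (if r = s then 1 else 0)"] s by simp
    then show ?thesis by simp
  qed
  have expand: "x = (\<Sum>r\<in>F. E r x *\<^sub>R al r)" if x: "x \<in> V" for x
  proof (rule ip_ext[OF x])
    show "(\<Sum>r\<in>F. E r x *\<^sub>R al r) \<in> V" using alV by (intro V_sum V_scale)
    fix f assume f: "f \<in> V"
    have "f = Ai (\<Sum>r\<in>F. ip f (al r) *\<^sub>R r)" using Ai_eq[OF f] id[OF f] by simp
    also have "\<dots> = (\<Sum>r\<in>F. ip f (al r) *\<^sub>R Ai r)" using FV by (simp add: Ai_sum V_scale Ai_scale)
    finally have "ip f x = ip (\<Sum>r\<in>F. ip f (al r) *\<^sub>R Ai r) x" by simp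
    also have "\<dots> = ip f (\<Sum>r\<in>F. E r x *\<^sub>R al r)"
      by (simp add: ip_sum ip_sum_right ip_simps E_def mult.commute)
    finally show "ip f x = ip f (\<Sum>r\<in>F. E r x *\<^sub>R al r)" .
  qed
  \<comment> \<open>A simple root \<open>d\<close> outside the dual basis is excluded: split its
    expansion into the positive part \<open>y\<close> and the rest \<open>z\<close>. Obtuseness
    forces \<open>ip y y \<le> 0\<close>, so \<open>y = 0\<close>, and then
    \<open>ip p d \<le> 0\<close>.\<close>
  have simple_E: "E r d \<ge> 0" if r: "r \<in> F" and d: "P.simple d" for r d
  proof (cases "d \<in> al ` F")
    case True then show ?thesis using dual r by auto
  next
    case False
    have dP: "d \<in> V" "ip p d > 0" using d P.PM_D by (auto simp: P.simple_def)
    define X where "X = {r \<in> F. E r d > 0}"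
    define y z where "y = (\<Sum>r\<in>X. E r d *\<^sub>R al r)" and "z = (\<Sum>r\<in>F-X. E r d *\<^sub>R al r)"
    have XF: "X \<subseteq> F" by (auto simp: X_def)
    have yV: "y \<in> V" and zV: "z \<in> V" using alV XF by (auto simp: y_def z_def intro!: V_sum V_scale)
    have dyz: "d = y + z" using expand[OF dP(1)] sum.subset_diff[OF XF fF, of "\<lambda>r. E r d *\<^sub>R al r"]
      by (simp add: y_def z_def ac_simps)
    have dy: "ip d y \<le> 0"
    proof -
      have "ip d (al r) \<le> 0" if "r \<in> F" for r
        using P.simple_obtuse[OF d] al(1) that False by blast
      then have "(\<Sum>r\<in>X. E r d * ip d (al r)) \<le> 0"
        by (intro sum_nonpos mult_nonneg_nonpos) (auto simp: X_def)
      then show ?thesis by (simp add: y_def ip_sum_right ip_simps)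
    qed
    have zy: "ip z y \<ge> 0"
    proof -
      have "ip z y = (\<Sum>r\<in>F-X. \<Sum>s\<in>X. E r d * (E s d * ip (al r) (al s)))"
        by (simp add: y_def z_def ip_sum ip_sum_right ip_simps sum_distrib_left)
          (subst sum.swap, simp add: mult.left_commute)
      also have "\<dots> \<ge> 0"
      proof (intro sum_nonneg)
        fix r s assume rs: "r \<in> F - X" "s \<in> X"
        have rF: "r \<in> F" "s \<in> F" "r \<noteq> s" using rs XF by auto
        have "al r \<noteq> al s" using dual[of r r] dual[of r s] rF by auto
        then have "ip (al r) (al s) \<le> 0" using P.simple_obtuse al(1) rF by blast
        moreover have "E r d \<le> 0" "E s d \<ge> 0" using rs by (auto simp: X_def)
        ultimately show "0 \<le> E r d * (E s d * ip (al r) (al s))"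
          by (intro mult_nonpos_nonpos mult_nonneg_nonpos)
      qed
      finally show ?thesis .
    qed
    have "ip d y = ip y y + ip z y" by (simp add: dyz ip_simps)
    then have "ip y y \<le> 0" using dy zy by linarith
    then have "y = 0" using ip_pos[OF yV] by force
    then have "ip p d = ip p z" using arg_cong[OF dyz, of "ip p"] by simp
    also have "\<dots> = (\<Sum>r\<in>F-X. E r d * ip p (al r))" by (simp add: z_def ip_sum_right ip_simps)
    also have "\<dots> \<le> 0"
    proof (intro sum_nonpos mult_nonpos_nonneg)
      fix r assume "r \<in> F - X"
      then show "E r d \<le> 0" "ip p (al r) \<ge> 0" using al(1) P.PM_D by (auto simp: X_def P.simple_def less_imp_le)
    qed
    finally show ?thesis using dP(2) by simp
  qed
  fix r s assume r: "r \<in> first a b" and s: "s \<in> Phi" "ip (a *\<^sub>R kx + b *\<^sub>R ky) s > 0"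
  have "s \<in> PM p V" using s Phi_V by (simp add: PM_def p_def)
  then obtain k al' where k: "\<forall>b\<in>P.Iv (rt s). k b \<ge> 0 \<and> P.simple (al' b)"
    "s = (\<Sum>b\<in>P.Iv (rt s). k b *\<^sub>R al' b)"
    using P.positive_combination by blast
  have "E r s = (\<Sum>b\<in>P.Iv (rt s). k b * E r (al' b))"
    by (subst k(2)) (simp add: E_def ip_sum_right ip_simps)
  also have "\<dots> \<ge> 0" using k(1) simple_E r by (intro sum_nonneg mult_nonneg_nonneg) (auto simp: F_def)
  finally show "E r s \<ge> 0" .
qed

lemma gr_self: "r \<in> Phi \<Longrightarrow> gr r r > 0"
  using proj_nz[of r] sum_power2_gt_zero_iff[of "ip kx r" "ip ky r"] by (simp add: gr_def power2_eq_square)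

lemma parallel: assumes "r \<in> Phi" "xr r s = 0"
  shows "ip kx s = gr r s / gr r r * ip kx r" "ip ky s = gr r s / gr r r * ip ky r"
proof -
  have e: "ip kx s * ip ky r = ip ky s * ip kx r" using assms(2) by (simp add: xr_def)
  have "gr r r * ip kx s = ip kx r * (ip kx r * ip kx s) + ip ky r * (ip kx s * ip ky r)"
    by (simp add: gr_def algebra_simps)
  also have "\<dots> = gr r s * ip kx r" unfolding e by (simp add: gr_def algebra_simps)
  finally show "ip kx s = gr r s / gr r r * ip kx r" using gr_self[OF assms(1)] by (simp add: field_simps)
  have "gr r r * ip ky s = ip kx r * (ip ky s * ip kx r) + ip ky r * (ip ky r * ip ky s)"
    by (simp add: gr_def algebra_simps)
  also have "\<dots> = gr r s * ip ky r" unfolding e[symmetric] by (simp add: gr_def algebra_simps)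
  finally show "ip ky s = gr r s / gr r r * ip ky r" using gr_self[OF assms(1)] by (simp add: field_simps)
qed

text \<open>The half plane begins just before the direction of \<open>r\<close>: it is given by
  \<open>xr r\<close> tilted slightly by \<open>gr r\<close>. All roots on the ray of
  \<open>r\<close> then lie in its first sector.\<close>

lemma start_window:
  assumes r: "r \<in> Phi"
  shows "\<exists>a b. wind a b \<and> (\<forall>s\<in>Phi. xr r s > 0 \<longrightarrow> ip (a *\<^sub>R kx + b *\<^sub>R ky) s > 0) \<and>
    (\<forall>s\<in>Phi. xr r s = 0 \<longrightarrow> gr r s > 0 \<longrightarrow> s \<in> first a b) \<and>
    (\<forall>s\<in>Phi. xr r s = 0 \<longrightarrow> gr r s \<noteq> 0)"
proof -
  define X where "X = {s \<in> Phi. xr r s > 0}"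
  have "finite X" using finite_Phi by (simp add: X_def)
  then have "\<exists>d>0. \<forall>s\<in>X. d * (- gr r s) < xr r s" by (rule finite_small_pos) (simp add: X_def)
  then obtain d where d: "d > 0" "\<forall>s\<in>X. d * (- gr r s) < xr r s" by blast
  define a b where "a = ip ky r + d * ip kx r" and "b = - ip kx r + d * ip ky r"
  have pr: "ip (a *\<^sub>R kx + b *\<^sub>R ky) s = xr r s + d * gr r s" for s
    by (simp add: a_def b_def xr_def gr_def ip_simps algebra_simps)
  have pos: "xr r s + d * gr r s > 0" if "s \<in> Phi" "xr r s > 0" for s using d(2) that by (auto simp: X_def)
  have neg: "xr r s + d * gr r s < 0" if "s \<in> Phi" "xr r s < 0" for s
    using pos[OF Phi_uminus[OF that(1)]] that(2) by (simp add: xr_def gr_def ip_simps algebra_simps)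
  have gnz: "gr r s \<noteq> 0" if s: "s \<in> Phi" "xr r s = 0" for s
    using parallel[OF r s(2)] proj_nz[OF s(1)] by auto
  have wnd: "wind a b" unfolding wind_def pr
  proof
    fix s assume s: "s \<in> Phi"
    show "xr r s + d * gr r s \<noteq> 0" using pos[OF s] neg[OF s] gnz[OF s] d(1) by (cases "xr r s" "0::real" rule: linorder_cases) auto
  qed
  have ic: "ip (a *\<^sub>R kx + b *\<^sub>R ky) (act (inv c) r) < 0"
  proof -
    have rV: "r \<in> V" and iP: "act (inv c) r \<in> Phi" using r Phi_V Phi_act c_in by auto
    have k: "kap (act (inv c) r) = cis (- th) * kap r" using kap_inv'[OF rV] .
    have kx': "ip kx (act (inv c) r) = cos th * ip kx r - sin th * ip ky r"
      using arg_cong[OF k, of Re] by (simp add: kap_def)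
    have ky': "ip ky (act (inv c) r) = sin th * ip kx r + cos th * ip ky r"
      using arg_cong[OF k, of Im] by (simp add: kap_def)
    have x: "xr r (act (inv c) r) = - sin th * gr r r" by (simp add: xr_def gr_def kx' ky' algebra_simps)
    have g: "gr r (act (inv c) r) = cos th * gr r r" by (simp add: gr_def kx' ky' algebra_simps)
    show ?thesis
    \<comment> \<open>For \<open>h = 2\<close> the rotation is a half turn, \<open>sin th\<close>
      vanishes, and the tilt decides the sign.\<close>
    proof (cases "th = pi")
      case True
      then show ?thesis unfolding pr x g using d(1) gr_self[OF r] by simp
    next
      case False
      then have "sin th > 0" using th by (intro sin_gt_zero) auto
      then have "xr r (act (inv c) r) < 0" using gr_self[OF r] by (simp add: x)
      then show ?thesis unfolding pr using neg[OF iP] by simp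
    qed
  qed
  have "s \<in> first a b" if s: "s \<in> Phi" "xr r s = 0" "gr r s > 0" for s
  proof -
    define l where "l = gr r s / gr r r"
    have l0: "l > 0" using s gr_self[OF r] by (simp add: l_def)
    have sV: "s \<in> V" "r \<in> V" using s r Phi_V by auto
    have "kap s = of_real l * kap r" using parallel[OF r s(2)] by (simp add: kap_def complex_eq_iff l_def)
    then have "kap (act (inv c) s) = of_real l * kap (act (inv c) r)" using kap_inv' sV by simp
    then have "ip kx (act (inv c) s) = l * ip kx (act (inv c) r)" "ip ky (act (inv c) s) = l * ip ky (act (inv c) r)"
      by (auto simp: kap_def complex_eq_iff)
    then have "ip (a *\<^sub>R kx + b *\<^sub>R ky) (act (inv c) s) = l * ip (a *\<^sub>R kx + b *\<^sub>R ky) (act (inv c) r)"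
      by (simp add: ip_simps algebra_simps)
    then have "ip (a *\<^sub>R kx + b *\<^sub>R ky) (act (inv c) s) < 0" using ic l0 by (simp add: mult_pos_neg)
    moreover have "ip (a *\<^sub>R kx + b *\<^sub>R ky) s > 0" unfolding pr using s d(1) by simp
    ultimately show ?thesis using s(1) by (simp add: first_def)
  qed
  then show ?thesis using wnd pos gnz pr by (intro exI[of _ a] exI[of _ b]) simp
qed

lemma E_nonneg: assumes r: "r \<in> Phi" "s \<in> Phi" "xr r s > 0" shows "E r s \<ge> 0"
proof -
  obtain a b where ab: "wind a b" "\<forall>s\<in>Phi. xr r s > 0 \<longrightarrow> ip (a *\<^sub>R kx + b *\<^sub>R ky) s > 0"
    "\<forall>s\<in>Phi. xr r s = 0 \<longrightarrow> gr r s > 0 \<longrightarrow> s \<in> first a b"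
    using start_window[OF r(1)] by blast
  have "r \<in> first a b" using ab(3) r(1) gr_self[OF r(1)] by (simp add: xr_def)
  then show ?thesis using sector_basis(2)[OF ab(1)] ab(2) r by blast
qed

text \<open>Up to sign, all roots parallel to \<open>r\<close> lie in one sector, which is
  independent. If \<open>q\<close> were not orthogonal to \<open>r\<close>, its reflection in
  \<open>r\<close> would be a third such root in the span of \<open>r\<close> and \<open>q\<close>.
  Hence \<open>E r q + E q r = 0\<close>, and both terms are nonnegative.\<close>

lemma E_zero: assumes r: "r \<in> Phi" "s \<in> Phi" "xr r s = 0" "s \<noteq> r" "s \<noteq> - r" shows "E r s = 0"
proof -
  obtain a b where ab: "wind a b"
    "\<forall>s\<in>Phi. xr r s = 0 \<longrightarrow> gr r s > 0 \<longrightarrow> s \<in> first a b" "\<forall>s\<in>Phi. xr r s = 0 \<longrightarrow> gr r s \<noteq> 0"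
    using start_window[OF r(1)] by blast
  have rF: "r \<in> first a b" using ab(2) r(1) gr_self[OF r(1)] by (simp add: xr_def)
  have pm: "\<exists>e. (e = 1 \<or> e = -1) \<and> e *\<^sub>R q \<in> first a b" if q: "q \<in> Phi" "xr r q = 0" for q
  proof (cases "gr r q > 0")
    case True
    then show ?thesis using ab(2) q by (intro exI[of _ 1]) simp
  next
    case False
    then have "gr r (- q) > 0" using ab(3) q by (force simp: gr_def ip_simps)
    moreover have "xr r (- q) = 0" using q(2) by (simp add: xr_def ip_simps)
    ultimately show ?thesis using ab(2) Phi_uminus[OF q(1)] by (intro exI[of _ "-1"]) simp
  qed
  obtain e where e: "e = 1 \<or> e = -1" "e *\<^sub>R s \<in> first a b" using pm[OF r(2,3)] by blast
  define q where "q = e *\<^sub>R s"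
  have qF: "q \<in> first a b" and qP: "q \<in> Phi" using e by (auto simp: q_def first_def)
  have qne: "q \<noteq> r" "q \<noteq> - r" using e(1) r(4,5) by (auto simp: q_def)
  have V: "r \<in> V" "q \<in> V" using r(1) qP Phi_V by auto
  have xq: "xr r q = 0" using r(3) by (simp add: q_def xr_def ip_simps algebra_simps)
  have ind: "independent (first a b)" using sector_basis(1)[OF ab(1)] .
  have "ip q r = 0"
  proof (rule ccontr)
    assume k: "ip q r \<noteq> 0"
    define k where "k = ip q r"
    define v where "v = act (rt r) q"
    have v: "v = q - k *\<^sub>R r" using rt_act[OF r(1) V(2)] by (simp add: v_def k_def)
    have vP: "v \<in> Phi" using Phi_act qP rt_carrier r(1) by (simp add: v_def)
    have "xr r v = 0" using xq by (simp add: v xr_def ip_simps algebra_simps)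
    then obtain e' where e': "e' = 1 \<or> e' = -1" "e' *\<^sub>R v \<in> first a b" using pm[OF vP] by blast
    define w where "w = e' *\<^sub>R v"
    have rr: "act (rt r) r = - r" using root_neg[OF isroot_rt[OF r(1)]] .
    have qv: "q = act (rt r) v" using rt_act2[OF r(1)] by (simp add: v_def)
    have "w \<noteq> r"
    proof
      assume "w = r"
      then have "v = r \<or> v = - r" using e'(1) by (auto simp: w_def)
      then have "q = - r \<or> q = r" using qv rr rt_carrier[OF r(1)] by (auto simp: act_simps)
      then show False using qne by blast
    qed
    moreover have "w \<noteq> q"
    proof
      assume wq: "w = q"
      have "v \<noteq> q" using k Phi_nonzero[OF r(1)] by (simp add: v k_def)
      then have "v = - q" using wq e'(1) by (auto simp: w_def)
      then have 2: "2 *\<^sub>R q = k *\<^sub>R r" by (simp add: v scaleR_2 algebra_simps)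
      then have "ip (2 *\<^sub>R q) q = ip (k *\<^sub>R r) q" by simp
      then have "k * k = 4" using Phi_norm[OF qP] ip_sym[of r q] by (simp add: ip_simps k_def)
      then have "(k - 2) * (k + 2) = 0" by (simp add: algebra_simps)
      then have "k = 2 \<or> k = -2" by auto
      then have "2 *\<^sub>R q = 2 *\<^sub>R r \<or> 2 *\<^sub>R q = 2 *\<^sub>R (- r)" using 2 by auto
      then have "q = r \<or> q = - r" using scaleR_left_imp_eq[of 2 q r] scaleR_left_imp_eq[of 2 q "- r"] by linarith
      then show False using qne by blast
    qed
    moreover have "w \<in> span {r, q}"
      unfolding w_def v by (intro span_scale span_diff span_base) auto
    ultimately have "w \<in> span (first a b - {w})"
      using rF qF span_mono[of "{r, q}" "first a b - {w}"] by blast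
    then have "dependent (first a b)" using e'(2) unfolding dependent_def w_def by blast
    then show False using ind by blast
  qed
  then have "E r q + E q r = 0" using E_sum_swap[OF V] ip_sym[of q r] by simp
  moreover have "E r q \<ge> 0" "E q r \<ge> 0" using sector_basis(2)[OF ab(1)] rF qF by (auto simp: first_def)
  ultimately have "E r q = 0" by linarith
  then show ?thesis using e(1) by (auto simp: q_def E_simps)
qed

sublocale nc_plane
  by unfold_locales (use kx ky proj_nz E_nonneg E_zero in \<open>auto simp: xr_def\<close>)

end

section \<open>Conjugation of roots of unity\<close>

definition ev :: "int poly \<Rightarrow> complex \<Rightarrow> complex"
  where "ev P z = (\<Sum>i\<le>degree P. of_int (coeff P i) * z ^ i)"

lemma ev_eq: assumes "degree P \<le> n" shows "ev P z = (\<Sum>i\<le>n. of_int (coeff P i) * z ^ i)"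
  unfolding ev_def by (rule sum.mono_neutral_left) (use assms in \<open>auto simp: coeff_eq_0\<close>)

lemma ev_0: "ev 0 z = 0" by (simp add: ev_def)

lemma ev_pCons: "ev (pCons a P) z = of_int a + z * ev P z"
proof -
  have "ev (pCons a P) z = (\<Sum>i\<le>Suc (degree P). of_int (coeff (pCons a P) i) * z ^ i)"
    by (rule ev_eq) (rule degree_pCons_le)
  also have "\<dots> = of_int a + (\<Sum>i\<le>degree P. of_int (coeff P i) * z ^ Suc i)"
    by (subst sum.atMost_Suc_shift) simp
  finally show ?thesis by (simp add: ev_def sum_distrib_left mult.left_commute)
qed

lemma ev_add: "ev (P + Q) z = ev P z + ev Q z"
proof (induction P arbitrary: Q)
  case 0 then show ?case by (simp add: ev_0)
next
  case (pCons a P)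
  obtain b Q' where Q: "Q = pCons b Q'" by (rule pCons_cases)
  show ?case unfolding Q by (simp add: ev_pCons pCons algebra_simps)
qed

lemma ev_smult: "ev (smult a P) z = of_int a * ev P z"
  by (induction P) (auto simp: ev_0 ev_pCons algebra_simps)

lemma ev_mult: "ev (P * Q) z = ev P z * ev Q z"
  by (induction P) (auto simp: ev_0 ev_pCons ev_add ev_smult algebra_simps)

lemma ev_minus: "ev (- P) z = - ev P z" using ev_smult[of "-1" P z] by simp
lemma ev_diff: "ev (P - Q) z = ev P z - ev Q z" using ev_add[of P "- Q" z] by (simp add: ev_minus)
lemma ev_const: "ev [:a:] z = of_int a" by (simp add: ev_pCons ev_0)
lemma ev_1: "ev 1 z = 1" using ev_const[of 1 z] by (simp add: one_pCons)
lemma ev_power: "ev (P ^ n) z = ev P z ^ n" by (induction n) (auto simp: ev_1 ev_mult)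
lemma ev_monom: "ev (monom 1 k) z = z ^ k"
  by (induction k) (auto simp: ev_1 ev_0 monom_Suc ev_pCons monom_0 ev_const)
lemma ev_pcompose: "ev (pcompose P Q) z = ev P (ev Q z)"
  by (induction P) (auto simp: ev_0 ev_pCons pcompose_pCons ev_add ev_mult ev_const)

lemma smult_sum_right: "smult a (\<Sum>i\<in>A. f i) = (\<Sum>i\<in>A. smult a (f i))"
  by (induction A rule: infinite_finite_induct) (auto simp: smult_add_right)

lemma prime_dvd_add_power:
  fixes a b :: "int poly"
  assumes p: "prime p"
  shows "\<exists>c. (a + b) ^ p = a ^ p + b ^ p + smult (int p) c"
proof -
  have p0: "p > 0" using p prime_gt_0_nat by blast
  define t where "t k = of_nat (p choose k) * a ^ k * b ^ (p - k)" for k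
  have "(a + b) ^ p = (\<Sum>k\<le>p. t k)" unfolding t_def by (rule binomial_ring)
  also have "{..p} = insert 0 (insert p {1..<p})" using p0 by auto
  also have "(\<Sum>k\<in>insert 0 (insert p {1..<p}). t k) = t 0 + (t p + (\<Sum>k\<in>{1..<p}. t k))" using p0 by simp
  also have "t 0 = b ^ p" by (simp add: t_def)
  also have "t p = a ^ p" by (simp add: t_def)
  also have "(\<Sum>k\<in>{1..<p}. t k) = smult (int p) (\<Sum>k\<in>{1..<p}. of_nat ((p choose k) div p) * a ^ k * b ^ (p - k))"
  proof -
    have "t k = smult (int p) (of_nat ((p choose k) div p) * a ^ k * b ^ (p - k))" if k: "k \<in> {1..<p}" for k
    proof -
      have "p dvd (p choose k)" using k p by (intro dvd_choose_prime) auto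
      then have "p choose k = p * ((p choose k) div p)" by simp
      then have "(of_nat (p choose k) :: int poly) = of_nat p * of_nat ((p choose k) div p)" by (metis of_nat_mult)
      moreover have "of_nat p * x = smult (int p) x" for x :: "int poly" by (simp add: of_nat_poly)
      ultimately show ?thesis unfolding t_def by (metis mult.assoc)
    qed
    then have "(\<Sum>k\<in>{1..<p}. t k) = (\<Sum>k\<in>{1..<p}. smult (int p) (of_nat ((p choose k) div p) * a ^ k * b ^ (p - k)))"
      by (intro sum.cong refl) auto
    then show ?thesis by (simp only: smult_sum_right)
  qed
  finally have "(a + b) ^ p = a ^ p + b ^ p + smult (int p) (\<Sum>k\<in>{1..<p}. of_nat ((p choose k) div p) * a ^ k * b ^ (p - k))"
    by (simp only: add_ac)
  then show ?thesis by (rule exI)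
qed

text \<open>The congruence \<open>f(x^p) = f(x)^p\<close> modulo \<open>p\<close>, obtained
  coefficient by coefficient from the binomial theorem.\<close>

lemma frobenius_int_poly:
  fixes f :: "int poly"
  assumes p: "prime p"
  shows "\<exists>g. pcompose f (monom 1 p) = f ^ p + smult (int p) g"
proof (induction f)
  case 0
  show ?case using prime_gt_0_nat[OF p] by (intro exI[of _ 0]) simp
next
  case (pCons a f)
  then obtain g where g: "pcompose f (monom 1 p) = f ^ p + smult (int p) g" by blast
  obtain c where c: "([:a:] + monom 1 1 * f) ^ p = [:a:] ^ p + (monom 1 1 * f) ^ p + smult (int p) c"
    using prime_dvd_add_power[OF p] by blast
  \<comment> \<open>Fermat's little theorem, from the same binomial congruence applied to constant
    polynomials.\<close>
  have "[a ^ p = a] (mod int p)"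
  proof -
    have "int p dvd a ^ p - a"
    proof (induction a rule: int_induct[where k = 0])
      case base then show ?case using prime_gt_0_nat[OF p] by (simp add: zero_power)
    next
      case (step1 i)
      obtain c where "([:i:] + [:1:]) ^ p = [:i:] ^ p + [:1:] ^ p + smult (int p) c" using prime_dvd_add_power[OF p] by blast
      then have "poly (([:i:] + [:1:]) ^ p) 0 = poly ([:i:] ^ p + [:1:] ^ p + smult (int p) c) 0" by (simp only:)
      then have e: "(i + 1) ^ p - (i + 1) = (i ^ p - i) + int p * poly c 0" by simp
      show ?case unfolding e by (rule dvd_add[OF step1(2)]) simp
    next
      case (step2 i)
      obtain c where "([:i - 1:] + [:1:]) ^ p = [:i - 1:] ^ p + [:1:] ^ p + smult (int p) c" using prime_dvd_add_power[OF p] by blast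
      then have "poly (([:i - 1:] + [:1:]) ^ p) 0 = poly ([:i - 1:] ^ p + [:1:] ^ p + smult (int p) c) 0" by (simp only:)
      then have e: "(i - 1) ^ p - (i - 1) = (i ^ p - i) - int p * poly c 0" by simp
      show ?case unfolding e by (rule dvd_diff[OF step2(2)]) simp
    qed
    then show ?thesis by (simp add: cong_iff_dvd_diff)
  qed
  then obtain d where d: "a ^ p - a = int p * d" by (auto simp: cong_iff_dvd_diff)
  have "pcompose (pCons a f) (monom 1 p) = [:a:] + monom 1 p * (f ^ p + smult (int p) g)" by (simp add: pcompose_pCons g)
  also have "\<dots> = ([:a:] + monom 1 1 * f) ^ p + smult (int p) (monom 1 p * g - c - [:d:])"
  proof -
    have e1: "[:a:] ^ p = [:a:] + smult (int p) [:d:]" using d by (simp add: poly_const_pow)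
    have e2: "(monom 1 1 * f) ^ p = monom 1 p * f ^ p" by (simp add: power_mult_distrib monom_power)
    have aux: "A + (W + Z) = A + X + W + Y + (Z - Y - X)" for A W X Y Z :: "int poly" by simp
    show ?thesis unfolding c e1 e2 distrib_left mult_smult_right smult_diff_right by (rule aux)
  qed
  also have "[:a:] + monom 1 1 * f = pCons a f" by (simp add: monom_Suc monom_0 One_nat_def)
  finally show ?case by blast
qed

text \<open>Add to \<open>j\<close> the product of \<open>L\<close> with all small primes not
  dividing \<open>j\<close>. A small prime dividing the sum would have to divide exactly one of the
  two summands.\<close>

lemma coprime_shift_avoiding_primes:
  fixes j L A :: nat
  assumes "coprime j L"
  shows "\<exists>n\<ge>j. [n = j] (mod L) \<and> (\<forall>q. prime q \<longrightarrow> q dvd n \<longrightarrow> q > A)"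
proof -
  define X where "X = {q. prime q \<and> q \<le> A \<and> \<not> q dvd j}"
  have fX: "finite X" by (rule finite_subset[of _ "{..A}"]) (auto simp: X_def)
  define n where "n = j + L * \<Prod>X"
  have "q > A" if q: "prime q" "q dvd n" for q
  proof (rule ccontr)
    assume "\<not> q > A"
    then have qA: "q \<le> A" by simp
    show False
    proof (cases "q dvd j")
      case True
      then have "q dvd L * \<Prod>X" using q(2) by (simp add: n_def dvd_add_right_iff)
      moreover have "\<not> q dvd L" using True assms q(1) by (metis coprime_common_divisor not_prime_unit)
      ultimately have "q dvd \<Prod>X" using q(1) prime_dvd_mult_iff by blast
      then obtain r where "r \<in> X" "q dvd r" using prime_dvd_prod_iff[OF fX q(1), of id] by auto
      then have "q = r" using q(1) by (auto simp: X_def primes_dvd_imp_eq)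
      then show False using \<open>r \<in> X\<close> True by (simp add: X_def)
    next
      case False
      then have "q \<in> X" using q(1) qA by (simp add: X_def)
      then have "q dvd \<Prod>X" using fX by (simp add: dvd_prodI[where f = id, simplified])
      then have "q dvd L * \<Prod>X" by simp
      then have "q dvd j" using q(2) by (simp add: n_def dvd_add_left_iff)
      then show False using False by simp
    qed
  qed
  moreover have "[n = j] (mod L)" by (simp add: n_def cong_def)
  ultimately show ?thesis by (intro exI[of _ n]) (auto simp: n_def)
qed

lemma power_cong: fixes e :: complex assumes "e ^ L = 1" "[n = m] (mod L)" shows "e ^ n = e ^ m"
proof -
  have "e ^ k = e ^ (k mod L)" for k
  proof -
    have "e ^ k = e ^ (L * (k div L) + k mod L)" by simp
    also have "\<dots> = e ^ (k mod L)" by (simp only: power_add power_mult assms(1) power_one mult_1)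
    finally show ?thesis .
  qed
  then show ?thesis using assms(2) unfolding cong_def by metis
qed

text \<open>Landau's proof: if \<open>f\<close> has minimal degree among the integer polynomials vanishing at \<open>e\<close>, then
  \<open>f(e^p) = p g(e)\<close> for a prime \<open>p\<close>; as \<open>f(e^p)\<close> takes only finitely many values, the
  coefficients of its reduction modulo \<open>f\<close> vanish once \<open>p\<close> is large.\<close>

lemma conjugate_root_of_unity:
  fixes e :: complex
  assumes e: "e ^ L = 1" "L > 0" and P: "ev P e = 0" and j: "coprime j L" "j > 0"
  shows "ev P (e ^ j) = 0"
proof -
  define Z where "Z Q \<longleftrightarrow> Q \<noteq> 0 \<and> ev Q e = 0" for Q
  define f where "f = arg_min degree Z"
  have "Z (monom 1 L - 1)"
  proof -
    have "coeff (monom 1 L - 1 :: int poly) L = 1" using e(2) by simp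
    then have "(monom 1 L - 1 :: int poly) \<noteq> 0" by (metis coeff_0 zero_neq_one)
    then show ?thesis using e by (simp add: Z_def ev_diff ev_monom ev_1)
  qed
  then have f: "Z f" "\<And>Q. Z Q \<Longrightarrow> degree f \<le> degree Q"
    unfolding f_def using arg_min_nat_lemma[of Z "monom 1 L - 1" degree] by auto
  define l where "l = lead_coeff f"
  have l0: "l \<noteq> 0" and f0: "f \<noteq> 0" and fe: "ev f e = 0" using f(1) by (auto simp: l_def Z_def)
  have small: "Q = 0" if "Q = 0 \<or> degree Q < degree f" "ev Q e = 0" for Q
    using f(2)[of Q] that unfolding Z_def by (metis linorder_not_less)
  \<comment> \<open>Pseudo-division: \<open>f\<close> need not be monic, so a power of its leading
    coefficient \<open>l\<close> appears.\<close>
  have div: "\<exists>k q r. smult (l ^ k) Q = f * q + r \<and> (r = 0 \<or> degree r < degree f)" for Q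
  proof -
    obtain q r where qr: "pseudo_divmod Q f = (q, r)" by force
    show ?thesis using pseudo_divmod[OF f0 qr] unfolding l_def by blast
  qed
  have vanish: "ev Q y = 0" if Q: "ev Q e = 0" and y: "ev f y = 0" for Q y
  proof -
    obtain k q r where kqr: "smult (l ^ k) Q = f * q + r" "r = 0 \<or> degree r < degree f" using div by blast
    have "ev r e = 0" using arg_cong[OF kqr(1), of "\<lambda>x. ev x e"] Q fe by (simp add: ev_smult ev_add ev_mult)
    then have "r = 0" using small kqr(2) by blast
    then have "of_int (l ^ k) * ev Q y = 0" using arg_cong[OF kqr(1), of "\<lambda>x. ev x y"] y by (simp add: ev_smult ev_add ev_mult)
    then show ?thesis using l0 by simp
  qed
  have "\<forall>r. \<exists>t. smult (l ^ fst t) (pcompose f (monom 1 r)) = f * fst (snd t) + snd (snd t) \<and>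
      (snd (snd t) = 0 \<or> degree (snd (snd t)) < degree f)"
  proof
    fix r
    obtain k q s where "smult (l ^ k) (pcompose f (monom 1 r)) = f * q + s" "s = 0 \<or> degree s < degree f" using div by blast
    then show "\<exists>t. smult (l ^ fst t) (pcompose f (monom 1 r)) = f * fst (snd t) + snd (snd t) \<and>
      (snd (snd t) = 0 \<or> degree (snd (snd t)) < degree f)" by (intro exI[of _ "(k, q, s)"]) simp
  qed
  then obtain t where t: "\<forall>r. smult (l ^ fst (t r)) (pcompose f (monom 1 r)) = f * fst (snd (t r)) + snd (snd (t r)) \<and>
      (snd (snd (t r)) = 0 \<or> degree (snd (snd (t r))) < degree f)" by (rule choice[THEN exE])
  define K q R where "K r = fst (t r)" and "q r = fst (snd (t r))" and "R r = snd (snd (t r))" for r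
  have KR: "smult (l ^ K r) (pcompose f (monom 1 r)) = f * q r + R r \<and> (R r = 0 \<or> degree (R r) < degree f)" for r
    using t by (simp add: K_def q_def R_def)
  \<comment> \<open>\<open>e ^ p\<close> depends only on \<open>p\<close> modulo \<open>L\<close>,
    so finitely many remainders \<open>R r\<close> occur. \<open>A\<close> bounds all their
    coefficients and also \<open>l\<close>; a prime beyond it divides neither \<open>l\<close> nor a
    nonzero coefficient.\<close>
  define A where "A = (\<Sum>r<L. \<Sum>i\<le>degree f. \<bar>coeff (R r) i\<bar>) + \<bar>l\<bar>"
  have A1: "\<bar>coeff (R r) i\<bar> \<le> A" if r: "r < L" for r i
  proof (cases "i \<le> degree f")
    case True
    have "\<bar>coeff (R r) i\<bar> \<le> (\<Sum>i\<le>degree f. \<bar>coeff (R r) i\<bar>)" using True by (intro member_le_sum) auto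
    also have "\<dots> \<le> (\<Sum>r<L. \<Sum>i\<le>degree f. \<bar>coeff (R r) i\<bar>)"
      using r by (intro member_le_sum[where f = "\<lambda>r. \<Sum>i\<le>degree f. \<bar>coeff (R r) i\<bar>"]) (auto intro: sum_nonneg)
    finally show ?thesis by (simp add: A_def)
  next
    case False
    then have "coeff (R r) i = 0" using KR[of r] by (cases "R r = 0") (auto intro: coeff_eq_0)
    moreover have "A \<ge> 0" unfolding A_def by (intro add_nonneg_nonneg sum_nonneg) auto
    ultimately show ?thesis by simp
  qed
  have lA: "\<bar>l\<bar> \<le> A" unfolding A_def by (intro add_increasing sum_nonneg) auto
  have prime_step: "ev Q (e ^ p) = 0" if p: "prime p" "int p > A" and Q: "ev Q e = 0" for Q p
  proof -
    define r where "r = p mod L"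
    have rL: "r < L" using e(2) by (simp add: r_def)
    have er: "e ^ p = e ^ r" by (rule power_cong[OF e(1)]) (simp only: r_def cong_def mod_mod_trivial)
    obtain g where g: "pcompose f (monom 1 p) = f ^ p + smult (int p) g" using frobenius_int_poly[OF p(1)] by blast
    obtain k q' g' where g': "smult (l ^ k) g = f * q' + g'" "g' = 0 \<or> degree g' < degree f" using div by blast
    have "ev f (e ^ p) = of_int (int p) * ev g e"
      using arg_cong[OF g, of "\<lambda>x. ev x e"] fe prime_gt_0_nat[OF p(1)]
      by (simp add: ev_pcompose ev_monom ev_add ev_smult ev_power)
    moreover have "ev (R r) e = of_int (l ^ K r) * ev f (e ^ p)"
      using arg_cong[OF conjunct1[OF KR[of r]], of "\<lambda>x. ev x e"] fe er by (simp add: ev_smult ev_add ev_mult ev_pcompose ev_monom)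
    moreover have "ev g' e = of_int (l ^ k) * ev g e"
      using arg_cong[OF g'(1), of "\<lambda>x. ev x e"] fe by (simp add: ev_smult ev_add ev_mult)
    ultimately have "ev (smult (l ^ k) (R r) - smult (l ^ K r * int p) g') e = 0"
      by (simp add: ev_diff ev_smult)
    moreover have "smult (l ^ k) (R r) - smult (l ^ K r * int p) g' = 0 \<or>
        degree (smult (l ^ k) (R r) - smult (l ^ K r * int p) g') < degree f"
    proof (cases "degree f = 0")
      case True
      then have "R r = 0" "g' = 0" using KR[of r] g'(2) by auto
      then show ?thesis by simp
    next
      case False
      then have "degree (R r) < degree f" "degree g' < degree f" using KR[of r] g'(2) by auto
      then show ?thesis
        by (intro disjI2 degree_diff_less) (auto intro: le_less_trans[OF degree_smult_le])
    qed
    ultimately have "smult (l ^ k) (R r) - smult (l ^ K r * int p) g' = 0" using small by blast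
    then have eq: "l ^ k * coeff (R r) i = int p * (l ^ K r * coeff g' i)" for i
      by (metis (no_types, lifting) coeff_smult eq_iff_diff_eq_0 mult.assoc mult.left_commute)
    have pl: "\<not> int p dvd l" using l0 lA p(2) by (metis abs_ge_zero dvd_imp_le_int linorder_not_le order_trans abs_of_nat less_le_trans)
    have "coeff (R r) i = 0" for i
    proof (rule ccontr)
      assume nz: "coeff (R r) i \<noteq> 0"
      have "int p dvd l ^ k * coeff (R r) i" using eq[of i] by simp
      then have "int p dvd l ^ k \<or> int p dvd coeff (R r) i" using p(1) by (simp add: prime_dvd_mult_iff)
      moreover have "\<not> int p dvd l ^ k" using pl p(1) prime_dvd_power[of "int p" l k] by auto
      ultimately have "int p \<le> \<bar>coeff (R r) i\<bar>" using nz by (metis abs_of_nat dvd_imp_le_int)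
      then show False using A1[OF rL, of i] p(2) by simp
    qed
    then have "R r = 0" by (simp add: poly_eq_iff)
    then have "of_int (l ^ K r) * ev f (e ^ p) = 0" using \<open>ev (R r) e = of_int (l ^ K r) * ev f (e ^ p)\<close> by (simp add: ev_0)
    then have "ev f (e ^ p) = 0" using l0 by simp
    then show ?thesis using vanish[OF Q] by blast
  qed
  \<comment> \<open>Exponents whose prime factors are all large are treated one prime at a time,
    replacing \<open>Q(x)\<close> by \<open>Q(x^p)\<close>.\<close>
  have comp: "ev Q (e ^ n) = 0" if n: "n > 0" "\<forall>q. prime q \<longrightarrow> q dvd n \<longrightarrow> int q > A" and Q: "ev Q e = 0" for n Q
    using n Q
  proof (induction n arbitrary: Q rule: less_induct)
    case (less n)
    show ?case
    proof (cases "n = 1")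
      case False
      then obtain p where p: "prime p" "p dvd n" using prime_factor_nat by blast
      then obtain m where m: "n = p * m" by blast
      have pA: "int p > A" using less.prems(2) p by blast
      have m0: "0 < m" "m < n" using m less.prems(1) prime_gt_1_nat[OF p(1)] by auto
      define Q' where "Q' = pcompose Q (monom 1 p)"
      have Q': "ev Q' y = ev Q (y ^ p)" for y by (simp add: Q'_def ev_pcompose ev_monom)
      have "ev Q' e = 0" using prime_step[OF p(1) pA less.prems(3)] by (simp add: Q')
      then have "ev Q' (e ^ m) = 0" using less.IH[OF m0(2,1)] less.prems(2) m by auto
      then show ?thesis by (simp add: Q' m mult.commute flip: power_mult)
    qed (use less.prems in simp)
  qed
  obtain n where n: "n \<ge> j" "[n = j] (mod L)" "\<forall>q. prime q \<longrightarrow> q dvd n \<longrightarrow> q > nat A"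
    using coprime_shift_avoiding_primes[OF j(1)] by blast
  have "ev P (e ^ n) = 0" by (rule comp) (use n j P in \<open>auto simp: nat_less_iff\<close>)
  then show ?thesis using power_cong[OF e(1) n(2)] by simp
qed

text \<open>A family of conjugates: one integer polynomial gives all values \<open>a j\<close> by
  evaluation at the powers of \<open>e\<close>.\<close>

definition "cyc e a \<longleftrightarrow> (\<exists>P. \<forall>j::nat. a j = ev P (e ^ j))"

lemma cyc_add: "cyc e a \<Longrightarrow> cyc e b \<Longrightarrow> cyc e (\<lambda>j. a j + b j)" unfolding cyc_def by (metis ev_add)
lemma cyc_mult: "cyc e a \<Longrightarrow> cyc e b \<Longrightarrow> cyc e (\<lambda>j. a j * b j)" unfolding cyc_def by (metis ev_mult)
lemma cyc_int: "cyc e (\<lambda>j. of_int k)" unfolding cyc_def by (metis ev_const)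
lemma cyc_minus: "cyc e a \<Longrightarrow> cyc e (\<lambda>j. - a j)" unfolding cyc_def by (metis ev_minus)
lemma cyc_diff: "cyc e a \<Longrightarrow> cyc e b \<Longrightarrow> cyc e (\<lambda>j. a j - b j)" unfolding cyc_def by (metis ev_diff)
lemma cyc_0: "cyc e (\<lambda>j. 0)" using cyc_int[of e 0] by simp
lemma cyc_1: "cyc e (\<lambda>j. 1)" using cyc_int[of e 1] by simp
lemma cyc_sum: "(\<And>i. i \<in> A \<Longrightarrow> cyc e (\<lambda>j. a i j)) \<Longrightarrow> cyc e (\<lambda>j. \<Sum>i\<in>A. a i j)"
  by (induction A rule: infinite_finite_induct) (auto simp: cyc_0 intro: cyc_add)
lemma cyc_root: "cyc e (\<lambda>j. (e ^ j) ^ k)" unfolding cyc_def by (metis ev_monom)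

text \<open>Both directions conjugate, the second one by an inverse of \<open>j\<close> modulo
  \<open>L\<close>.\<close>

lemma cyc_zero_iff:
  assumes "cyc e a" "e ^ L = 1" "L > 0" "coprime j L" "j > 0"
  shows "a j = 0 \<longleftrightarrow> a 1 = 0"
proof -
  obtain P where P: "\<And>j. a j = ev P (e ^ j)" using assms(1) by (auto simp: cyc_def)
  show ?thesis
  proof
    assume "a 1 = 0" then show "a j = 0" using conjugate_root_of_unity[OF assms(2,3) _ assms(4,5), of P] by (simp add: P)
  next
    assume a: "a j = 0"
    obtain i where i: "[j * i = 1] (mod L)" using cong_solve_coprime_nat[OF assms(4)] by auto
    define i' where "i' = i + L"
    have i': "[j * i' = 1] (mod L)" using i by (simp add: i'_def cong_def distrib_left)
    have ip: "i' > 0" using assms(3) by (simp add: i'_def)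
    have ic: "coprime i' L" using i' by (metis coprime_iff_invertible_nat mult.commute One_nat_def)
    define Q where "Q = pcompose P (monom 1 j)"
    have Q: "ev Q y = ev P (y ^ j)" for y by (simp add: Q_def ev_pcompose ev_monom)
    have "ev Q e = 0" using a by (simp add: P Q)
    then have "ev Q (e ^ i') = 0" using conjugate_root_of_unity[OF assms(2,3) _ ic ip] by blast
    moreover have "(e ^ i') ^ j = e ^ 1" using power_cong[OF assms(2) i'] by (simp add: mult.commute flip: power_mult)
    ultimately show "a 1 = 0" by (simp add: P Q)
  qed
qed

section \<open>Conjugate representations\<close>

definition cycv :: "complex \<Rightarrow> (nat \<Rightarrow> 'a \<Rightarrow> complex) \<Rightarrow> bool"
  where "cycv e x \<longleftrightarrow> (\<forall>t. cyc e (\<lambda>j. x j t))"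

text \<open>All orders divide the order of the group, so one root of unity serves every pair. The
  factor 2 makes the entries integral, and the inverse root is written as the power
  \<open>2 M - 1\<close> because polynomials offer no negative exponents.\<close>

lemma (in coxeter_rep) jform_cyc:
  assumes st: "s \<in> S" "t \<in> S"
  shows "cyc (cis (pi / Coset.order G)) (\<lambda>j. complex_of_real (2 * jform G j s t))"
proof -
  define M where "M = Coset.order G"
  define e where "e = cis (pi / M)"
  have M0: "M > 0" using finite_carrier order_gt_0_iff_finite by (simp add: M_def)
  obtain q where q: "M = ord (s \<otimes> t) * q"
    using ord_dvd_group_order[of "s \<otimes> t"] st S_carrier by (auto simp: M_def)
  have m0: "ord (s \<otimes> t) > 0" "q > 0" using q M0 by auto
  have pq: "(e ^ j) ^ q = cis (j * pi / ord (s \<otimes> t))" for j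
  proof -
    have "real (j * q) * (pi / M) = j * pi / ord (s \<otimes> t)" unfolding q using m0 by (simp add: field_simps)
    then have "cis (pi / M) ^ (j * q) = cis (j * pi / ord (s \<otimes> t))" unfolding DeMoivre by (rule arg_cong)
    then show ?thesis unfolding e_def power_mult .
  qed
  have e2: "e ^ (2 * M) = 1" unfolding e_def DeMoivre using M0 by simp
  have "(e ^ j) ^ (q * (2 * M - 1)) = cis (- (j * pi / ord (s \<otimes> t)))" for j
  proof -
    have "q * (2 * M - 1) + q = q * (2 * M)" using M0 by (cases M) (auto simp: algebra_simps)
    then have "(e ^ j) ^ (q * (2 * M - 1)) * (e ^ j) ^ q = (e ^ j) ^ (q * (2 * M))"
      by (simp only: power_add[symmetric])
    also have "\<dots> = (e ^ (2 * M)) ^ (j * q)" by (simp only: power_mult[symmetric] mult_ac)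
    finally have "(e ^ j) ^ (q * (2 * M - 1)) * cis (j * pi / ord (s \<otimes> t)) = 1" unfolding pq e2 by simp
    then show ?thesis by (metis cis_inverse inverse_unique mult.commute)
  qed
  then have eq: "complex_of_real (2 * jform G j s t) = - ((e ^ j) ^ q + (e ^ j) ^ (q * (2 * M - 1)))" for j
    unfolding pq jform_def by (simp add: complex_eq_iff)
  show ?thesis unfolding eq M_def[symmetric] e_def[symmetric] by (intro cyc_minus cyc_add cyc_root)
qed

lemma (in coxeter_rep) gact_cyc:
  assumes w: "w \<in> carrier G" and x: "cycv (cis (pi / Coset.order G)) x"
  shows "cycv (cis (pi / Coset.order G)) (\<lambda>j. gact G (jform G j) S w (x j))"
proof -
  let ?e = "cis (pi / Coset.order G)"
  have s: "cycv ?e (\<lambda>j. sact (jform G j) S s (x j))" if s: "s \<in> S" and x: "cycv ?e x" for s x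
    unfolding cycv_def
  proof
    fix t
    have sp: "sact (jform G j) S s (x j) t =
        x j t - (if t = s then (\<Sum>u\<in>S. complex_of_real (2 * jform G j s u) * x j u) else 0)" for j
      by (simp add: sact_def lform_def sum_distrib_left mult_ac)
    have "cyc ?e (\<lambda>j. \<Sum>u\<in>S. complex_of_real (2 * jform G j s u) * x j u)"
      using x unfolding cycv_def by (intro cyc_sum cyc_mult jform_cyc s) auto
    moreover have "cyc ?e (\<lambda>j. x j t)" using x unfolding cycv_def by blast
    ultimately show "cyc ?e (\<lambda>j. sact (jform G j) S s (x j) t)"
      unfolding sp by (cases "t = s") (auto intro: cyc_diff)
  qed
  have "ws \<in> lists S \<Longrightarrow> cycv ?e (\<lambda>j. wact (jform G j) S ws (x j))" for ws
    by (induction ws) (auto simp: wact_def x intro: s)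
  then show ?thesis unfolding gact_def using some_word(1)[OF w] by blast
qed

lemma (in coxeter_rep) al_cyc: "cyc (cis (pi / Coset.order G)) (\<lambda>j. gact G (jform G j) S w (al s) u)"
  if "w \<in> carrier G" for w s u
proof -
  have "cycv (cis (pi / Coset.order G)) (\<lambda>j. al s)" unfolding cycv_def al_def by (auto simp: cyc_0 cyc_1)
  from gact_cyc[OF that this] show ?thesis unfolding cycv_def by blast
qed

text \<open>The tool for carrying facts to the conjugate representation: an integer relation between
  group elements holds there as soon as it holds in the geometric one. A fact is transferred by
  rewriting it as such a relation.\<close>

lemma (in coxeter_rep) transfer_relation:
  assumes j: "coprime j (2 * Coset.order G)" "j > 0" and g: "\<And>i. i \<in> A \<Longrightarrow> g i \<in> carrier G"
    and rel: "\<And>s u. s \<in> S \<Longrightarrow> (\<Sum>i\<in>A. of_int (b i) * gact G (jform G 1) S (g i) (al s) u) = (0 :: complex)"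
    and x: "x \<in> geom_space S"
  shows "(\<Sum>i\<in>A. of_int (b i) * act (g i) x u) = (0 :: complex)"
proof -
  have M0: "Coset.order G > 0" using finite_carrier order_gt_0_iff_finite by simp
  then have e2: "cis (pi / Coset.order G) ^ (2 * Coset.order G) = 1" unfolding DeMoivre by simp
  have 0: "(\<Sum>i\<in>A. of_int (b i) * act (g i) (al s) u) = (0 :: complex)" if s: "s \<in> S" for s
  proof -
    have "cyc (cis (pi / Coset.order G)) (\<lambda>j. \<Sum>i\<in>A. of_int (b i) * gact G (jform G j) S (g i) (al s) u)"
      by (intro cyc_sum cyc_mult cyc_int al_cyc g)
    from cyc_zero_iff[OF this e2 _ j] show ?thesis using rel[OF s] M0 by simp
  qed
  have "(\<Sum>i\<in>A. of_int (b i) * act (g i) x u) = (\<Sum>i\<in>A. \<Sum>s\<in>S. x s * (of_int (b i) * act (g i) (al s) u))"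
    by (intro sum.cong refl) (subst gact_expand[OF finite_S x], simp add: sum_distrib_left mult_ac)
  also have "\<dots> = (\<Sum>s\<in>S. x s * (\<Sum>i\<in>A. of_int (b i) * act (g i) (al s) u))"
    by (subst sum.swap) (simp add: sum_distrib_left)
  also have "\<dots> = 0" using 0 by simp
  finally show ?thesis .
qed

text \<open>Up to a factor the projector to the eigenspace of \<open>z\<close>; the exponent
  \<open>(h - 1) * i\<close> stands for \<open>- i\<close> modulo \<open>h\<close>.\<close>

lemma (in coxeter_rep) cyclic_sum_eigenvector:
  fixes x :: "'a \<Rightarrow> complex"
  assumes w: "w \<in> carrier G" "w [^] h = \<one>" and z: "z ^ h = 1" "h > 0"
  shows "act w (\<lambda>u. \<Sum>i<h. z ^ ((h - 1) * i) * act (w [^] i) x u) = (\<lambda>u. z * (\<Sum>i<h. z ^ ((h - 1) * i) * act (w [^] i) x u))"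
proof -
  define g where "g i = (\<lambda>u. z ^ ((h - 1) * i) * act (w [^] i) x u)" for i :: nat
  have step: "act w (g i) = (\<lambda>u. z * g (Suc i) u)" for i
  proof -
    have "act w (act (w [^] i) x) = act (w [^] Suc i) x"
      using act_mult[OF w(1), of "w [^] i" x] w(1) by (simp only: nat_pow_closed nat_pow_Suc2)
    moreover have "z * z ^ ((h - 1) * Suc i) = z ^ ((h - 1) * i)"
    proof -
      have "Suc ((h - 1) * Suc i) = h + (h - 1) * i" using z(2) by (cases h) auto
      then have "z * z ^ ((h - 1) * Suc i) = z ^ h * z ^ ((h - 1) * i)" by (metis power_Suc power_add)
      then show ?thesis using z(1) by simp
    qed
    ultimately show ?thesis unfolding g_def gact_mult_scalar by (simp add: mult.assoc[symmetric])
  qed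
  have gh: "g h = g 0"
  proof -
    have "z ^ ((h - 1) * h) = 1" using z(1) by (metis mult.commute power_mult power_one)
    then show ?thesis using w(2) by (simp add: g_def)
  qed
  have s: "(\<lambda>u. \<Sum>i<h. z ^ ((h - 1) * i) * act (w [^] i) x u) = (\<Sum>i<h. g i)"
    by (rule ext) (simp add: g_def sum_fun_apply)
  have "(\<Sum>i<h. g (Suc i)) + g 0 = (\<Sum>i<h. g i) + g h" by (metis add.commute sum.lessThan_Suc sum.lessThan_Suc_shift)
  then have "(\<Sum>i<h. g (Suc i)) = (\<Sum>i<h. g i)" using gh by simp
  moreover have "act w (\<Sum>i<h. g i) = (\<lambda>u. z * (\<Sum>i<h. g (Suc i)) u)"
    unfolding gact_sum step by (rule ext) (simp add: sum_fun_apply sum_distrib_left)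
  ultimately have "act w (\<Sum>i<h. g i) = (\<lambda>u. z * (\<Sum>i<h. g i) u)" by simp
  then show ?thesis unfolding s[symmetric] .
qed

lemma (in coxeter_rep) cyclic_sum_fixed:
  fixes x :: "'a \<Rightarrow> complex" and h :: nat
  assumes w: "w \<in> carrier G" "w [^] h = \<one>" "h > 0"
  shows "act w (\<lambda>u. \<Sum>i<h. act (w [^] i) x u) = (\<lambda>u. \<Sum>i<h. act (w [^] i) x u)"
  using cyclic_sum_eigenvector[OF w(1,2) _ w(3), of 1 x] by simp

lemma (in coxeter_rep) act_pow_fixed: assumes "w \<in> carrier G" "act w x = x" shows "act (w [^] (i::nat)) x = (x :: 'a \<Rightarrow> complex)"
  by (induction i) (use assms in \<open>simp_all add: act_one act_mult\<close>)

lemma (in geom_rep) steinberg_complex: assumes w: "w \<in> carrier G" "w \<noteq> \<one>"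
  shows "\<exists>t\<in>reflections G S. \<forall>x\<in>geom_space S. act w x = x \<longrightarrow> act t x = (x :: 'a \<Rightarrow> complex)"
proof -
  obtain t where t: "t \<in> reflections G S" "\<And>x. x \<in> geom_space S \<Longrightarrow> act w x = x \<Longrightarrow> act t x = (x :: 'a \<Rightarrow> real)"
    using steinberg_geom[OF w] by blast
  have "act t x = x" if x: "x \<in> geom_space S" "act w x = x" for x :: "'a \<Rightarrow> complex"
  proof -
    have g: "(\<lambda>s. Re (x s)) \<in> geom_space S" "(\<lambda>s. Im (x s)) \<in> geom_space S" using x by (auto simp: geom_space_def)
    have "act w (\<lambda>s. Re (x s)) = (\<lambda>s. Re (x s))" by (rule ext) (simp only: gact_Re[symmetric] x(2))
    then have 1: "act t (\<lambda>s. Re (x s)) = (\<lambda>s. Re (x s))" by (rule t(2)[OF g(1)])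
    have "act w (\<lambda>s. Im (x s)) = (\<lambda>s. Im (x s))" by (rule ext) (simp only: gact_Im[symmetric] x(2))
    then have 2: "act t (\<lambda>s. Im (x s)) = (\<lambda>s. Im (x s))" by (rule t(2)[OF g(2)])
    show ?thesis by (rule ext, rule complex_eqI) (simp_all only: gact_Re gact_Im 1 2)
  qed
  then show ?thesis using t(1) by blast
qed

lemma (in coxeter_rep) reflection_carrier: "t \<in> reflections G S \<Longrightarrow> t \<in> carrier G"
  using S_carrier by (auto simp: reflections_def)

text \<open>That \<open>t\<close> fixes everything fixed by \<open>w\<close> means
  \<open>t N = N\<close> for the sum \<open>N\<close> of the powers of \<open>w\<close>. This is an
  integer relation and passes to the conjugate.\<close>

lemma (in coxeter_rep) steinberg_conjugate:
  assumes j: "coprime j (2 * Coset.order G)" "j > 0" and w: "w \<in> carrier G" "w \<noteq> \<one>"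
  shows "\<exists>t\<in>reflections G S. \<forall>x\<in>geom_space S. act w x = x \<longrightarrow> act t x = (x :: 'a \<Rightarrow> real)"
proof -
  interpret V1: geom_rep G S 1 by unfold_locales (auto simp: finite_carrier)
  obtain t where t: "t \<in> reflections G S" "\<And>x. x \<in> geom_space S \<Longrightarrow> V1.act w x = x \<Longrightarrow> V1.act t x = (x :: 'a \<Rightarrow> complex)"
    using V1.steinberg_complex[OF w] by blast
  have tc: "t \<in> carrier G" by (rule reflection_carrier[OF t(1)])
  define m where "m = ord w"
  have m: "m > 0" "w [^] m = \<one>" using ord_pos'[OF w(1)] pow_ord_eq_1[OF w(1)] by (simp_all add: m_def)
  \<comment> \<open>The boolean index separates the two sides of \<open>t N = N\<close>, with
    coefficients 1 and -1.\<close>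
  define A where "A = (UNIV :: bool set) \<times> {..<m}"
  define g where "g = (\<lambda>(k, i). if k then t \<otimes> w [^] i else w [^] (i::nat))"
  define b :: "bool \<times> nat \<Rightarrow> int" where "b = (\<lambda>(k, i). if k then 1 else - 1)"
  have gA: "g i \<in> carrier G" for i using tc w by (auto simp: g_def split: prod.split)
  have split: "(\<Sum>i\<in>A. of_int (b i) * F (g i)) = (\<Sum>i<m. F (t \<otimes> w [^] i)) - (\<Sum>i<m. F (w [^] i))" for F :: "'a \<Rightarrow> complex"
    unfolding A_def g_def b_def by (simp add: sum.cartesian_product' UNIV_bool sum_negf)
  have rel: "(\<Sum>i\<in>A. of_int (b i) * V1.act (g i) (al s) u) = (0 :: complex)" if s: "s \<in> S" for s u
  proof -
    define y where "y = (\<lambda>u. \<Sum>i<m. V1.act (w [^] i) (al s) u :: complex)"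
    have ys: "y = (\<Sum>i<m. V1.act (w [^] i) (al s))" by (rule ext) (simp add: y_def sum_fun_apply)
    have "V1.act w y = y" unfolding y_def by (rule V1.cyclic_sum_fixed[OF w(1) m(2,1)])
    moreover have "y \<in> geom_space S" unfolding ys using w(1)
      by (intro subspace_sum[OF geom_space_subspace] V1.act_geom al_geom[OF s]) auto
    ultimately have ty: "V1.act t y = y" using t(2) by blast
    have "V1.act t y = (\<lambda>u. \<Sum>i<m. V1.act (t \<otimes> w [^] i) (al s) u)"
      unfolding ys gact_sum using tc w(1) by (intro ext) (simp only: sum_fun_apply V1.act_mult[OF tc nat_pow_closed[OF w(1)]])
    from fun_cong[OF trans[OF this[symmetric] ty], of u]
    show ?thesis unfolding split[of "\<lambda>k. V1.act k (al s) u"] y_def by (rule iffD2[OF right_minus_eq])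
  qed
  have "act t x = x" if x: "x \<in> geom_space S" "act w x = x" for x :: "'a \<Rightarrow> real"
  proof -
    have ex: "emb x \<in> geom_space S" "act w (emb x) = emb x" using x by (simp_all add: geom_space_def gact_emb)
    have "act t (emb x) u = emb x u" for u
    proof -
      have p: "act (w [^] i) (emb x) = emb x" for i :: nat by (rule act_pow_fixed[OF w(1) ex(2)])
      have "(\<Sum>i\<in>A. of_int (b i) * act (g i) (emb x) u) = 0" by (rule transfer_relation[OF j gA rel ex(1)])
      then have "(\<Sum>i<m. act (t \<otimes> w [^] i) (emb x) u) - (\<Sum>i<m. act (w [^] i) (emb x) u) = 0"
        using split[of "\<lambda>k. act k (emb x) u"] by simp
      moreover have "act (t \<otimes> w [^] i) (emb x) = act t (emb x)" for i :: nat
        using act_mult[OF tc nat_pow_closed[OF w(1)], of i "emb x"] unfolding p .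
      ultimately have "of_nat m * act t (emb x) u - of_nat m * emb x u = 0" unfolding p by simp
      then show ?thesis using m(1) by (simp add: right_diff_distrib[symmetric])
    qed
    then have "act t (emb x) = emb x" by (rule ext)
    then show ?thesis unfolding gact_emb emb_inject .
  qed
  then show ?thesis using t(1) by blast
qed

text \<open>Writing \<open>z = cis (2 pi k / h)\<close>, the exponent \<open>j\<close> has to invert
  \<open>k\<close> modulo \<open>h\<close>, but it must also be coprime to \<open>2 M\<close> in
  order to define a conjugation of the larger cyclotomic field.\<close>

lemma primitive_root_conjugate:
  fixes z :: complex
  assumes z: "\<And>k. z ^ k = 1 \<longleftrightarrow> h dvd k" and h: "h > 0" and hM: "h dvd M" and M: "M > 0"
  shows "\<exists>m j. z = cis (pi / M) ^ m \<and> coprime j (2 * M) \<and> j > 0 \<and> (cis (pi / M) ^ j) ^ m = cis (2 * pi / h)"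
proof -
  have "z ^ h = 1" using z[of h] by simp
  then have "z \<in> (\<lambda>k. cis (2 * pi * real k / real h)) ` {..<h}"
    using bij_betw_imp_surj_on[OF bij_betw_roots_unity[OF h]] by simp
  then obtain k where k: "z = cis (2 * pi * real k / real h)" by blast
  obtain q where q: "M = h * q" using hM by blast
  have q0: "q > 0" using q M by auto
  have co: "coprime k h"
  proof (rule ccontr)
    assume nc: "\<not> coprime k h"
    define g where "g = gcd k h"
    have g: "g \<noteq> 1" "g > 0" using nc h by (simp_all add: g_def coprime_iff_gcd_eq_1)
    obtain k' h' where kh: "k = g * k'" "h = g * h'" unfolding g_def by (meson dvdE gcd_dvd1 gcd_dvd2)
    have h': "h' > 0" "h' < h" using kh(2) h g by auto
    have "real h' * (2 * pi * real k / real h) = 2 * pi * real k'" using kh g h h' by (simp add: field_simps)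
    then have "z ^ h' = cis (2 * pi * real k')" unfolding k DeMoivre by (rule arg_cong)
    also have "\<dots> = 1" using cis_multiple_2pi[of "real k'"] by simp
    finally have "h dvd h'" using z[of h'] by simp
    then show False using h' by (auto dest: dvd_imp_le)
  qed
  obtain i where i: "[k * i = 1] (mod h)" using cong_solve_coprime_nat[OF co] by auto
  have "coprime i h"
  proof -
    have "coprime (k * i) h" using i by (metis cong_imp_coprime cong_sym coprime_1_left)
    then show ?thesis by simp
  qed
  \<comment> \<open>An inverse of \<open>k\<close> is coprime only to \<open>h\<close>; it is moved
    within its residue class until all its prime factors exceed \<open>2 M\<close>.\<close>
  then obtain j where j: "j \<ge> i" "[j = i] (mod h)" "\<And>p. prime p \<Longrightarrow> p dvd j \<Longrightarrow> p > 2 * M"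
    using coprime_shift_avoiding_primes[of i h "2 * M"] by blast
  have cj: "coprime j (2 * M)"
  proof (rule ccontr)
    assume "\<not> coprime j (2 * M)"
    then obtain p where "prime p" "p dvd j" "p dvd 2 * M" using prime_factor_nat[of "gcd j (2 * M)"] by (auto simp: coprime_iff_gcd_eq_1)
    then show False using j(3)[of p] dvd_imp_le[of p "2 * M"] M by auto
  qed
  have j0: "j > 0" using cj M by (cases "j = 0") auto
  have "[k * j = 1] (mod h)" using i cong_scalar_left[OF j(2), of k] cong_trans by blast
  then obtain a where a: "int (k * j) = 1 + int h * a"
    by (metis cong_iff_lin cong_int_iff cong_sym of_nat_1)
  define m where "m = 2 * q * k"
  have 1: "z = cis (pi / M) ^ m"
  proof -
    have "real m * (pi / M) = 2 * pi * real k / real h" unfolding m_def q using q0 h by (simp add: field_simps)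
    then show ?thesis unfolding k DeMoivre by (rule arg_cong[OF sym])
  qed
  have 2: "(cis (pi / M) ^ j) ^ m = cis (2 * pi / h)"
  proof -
    have kj: "real (k * j) = 1 + real h * of_int a" by (metis a of_int_1 of_int_add of_int_mult of_int_of_nat_eq)
    have "real (j * m) * (pi / M) = 2 * pi * real (k * j) / real h" unfolding m_def q using q0 h by (simp add: field_simps)
    also have "\<dots> = 2 * pi / h + 2 * pi * of_int a" unfolding kj using h by (simp add: field_simps)
    finally have "cis (pi / M) ^ (j * m) = cis (2 * pi / h + 2 * pi * of_int a)" unfolding DeMoivre by (rule arg_cong)
    then have "(cis (pi / M) ^ j) ^ m = cis (2 * pi / h + 2 * pi * of_int a)" unfolding power_mult .
    also have "\<dots> = cis (2 * pi / h) * cis (2 * pi * of_int a)" by (rule cis_mult[symmetric])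
    finally show ?thesis by (simp add: cis_multiple_2pi)
  qed
  show ?thesis using 1 2 cj j0 by blast
qed

section \<open>Transfer of the Coxeter element to the conjugate representation\<close>

context springer
begin

lemma fix_c_real: assumes "x \<in> geom_space S" "act c x = (x :: 'a \<Rightarrow> real)" shows "x = 0"
proof -
  have "emb x = (\<lambda>s. 0)" using assms by (intro fix_c) (simp_all add: geom_space_def gact_emb)
  then show ?thesis by (auto simp: fun_eq_iff)
qed

sublocale R: refl_coxeter G S "geom_space S" act aip c
proof -
  interpret R: refl_rep G S "geom_space S" act aip by (rule refl_rep_aip[OF steinberg_geom])
  show "refl_coxeter G S (geom_space S) act aip c"
  proof unfold_locales
    show "R.Fx c = {0}" using fix_c_real R.V_0 gact_zero[of G B S c] by (auto simp: R.Fx_def)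
  qed (rule c_in)
qed

lemma h_pos: "h > 0" using h_ge_2 by simp

lemma c_h: "c [^] h = \<one>" using pow_ord_eq_1[OF c_in] ord_c by simp

text \<open>\<open>v\<close> need not have cyclotomic coordinates, so it cannot be conjugated
  directly. Its eigenspace is a line, onto which some simple root projects nontrivially, and that
  projection has cyclotomic coordinates.\<close>

lemma exists_cyclic_sum: "\<exists>s\<in>S. \<exists>a. a \<noteq> 0 \<and> (\<lambda>u. \<Sum>i<h. z ^ ((h - 1) * i) * act (c [^] i) (al s) u) = (\<lambda>u. a * v u)"
proof -
  define P where "P x = (\<lambda>u. \<Sum>i<h. z ^ ((h - 1) * i) * act (c [^] i) x u)" for x :: "'a \<Rightarrow> complex"
  have zh: "z ^ h = 1" using z_pow[of h] by (simp only: dvd_refl)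
  have Pg: "P x \<in> geom_space S" if "x \<in> geom_space S" for x
    using act_geom[OF nat_pow_closed[OF c_in] that] by (simp add: P_def geom_space_def)
  have Pv: "\<exists>a. P x = (\<lambda>u. a * v u)" if "x \<in> geom_space S" for x
    by (rule eigenspace[OF Pg[OF that]]) (unfold P_def, rule cyclic_sum_eigenvector[OF c_in c_h zh h_pos])
  have "P v = (\<lambda>u. of_nat h * v u)"
  proof
    fix u
    have "z ^ ((h - 1) * i) * (z ^ i * v u) = v u" for i
    proof -
      have "(h - 1) * i + i = h * i" using h_pos by (cases h) auto
      then have "z ^ ((h - 1) * i) * z ^ i = (z ^ h) ^ i" by (metis power_add power_mult)
      then show ?thesis using zh by (simp add: mult.assoc[symmetric])
    qed
    then have "(\<Sum>i<h. z ^ ((h - 1) * i) * (z ^ i * v u)) = (\<Sum>i<h. v u)" by (intro sum.cong refl)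
    then show "P v u = of_nat h * v u" unfolding P_def act_pow by simp
  qed
  moreover have "P v u = (\<Sum>s\<in>S. v s * P (al s) u)" for u
  proof -
    have "P v u = (\<Sum>i<h. \<Sum>s\<in>S. v s * (z ^ ((h - 1) * i) * act (c [^] i) (al s) u))"
      unfolding P_def by (intro sum.cong refl) (subst gact_expand[OF finite_S v_geom], simp add: sum_distrib_left mult_ac)
    then show ?thesis unfolding P_def by (subst (asm) sum.swap) (simp add: sum_distrib_left)
  qed
  moreover obtain u where "v u \<noteq> 0" using v_nz by auto
  ultimately have "(\<Sum>s\<in>S. v s * P (al s) u) \<noteq> 0" using h_pos by (metis mult_eq_0_iff of_nat_eq_0_iff less_numeral_extra(3))
  then obtain s where s: "s \<in> S" "P (al s) u \<noteq> 0" by (metis (no_types, lifting) mult_zero_right sum.neutral)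
  obtain a where a: "P (al s) = (\<lambda>u. a * v u)" using Pv[OF al_geom[OF s(1)]] by blast
  then have "a \<noteq> 0" using s(2) by auto
  then show ?thesis using s(1) a unfolding P_def by blast
qed

text \<open>The conjugate representation belongs to the same group and the same set of reflections,
  hence yields the same absolute order and the same \<open>NC G S c\<close>. So the joins found
  there are the required ones.\<close>

theorem join_exists: assumes A: "A \<subseteq> reflections G S"
  shows "\<exists>u. least (NC G S c) u (Upper (NC G S c) A)"
proof -
  define M where "M = Coset.order G"
  have M0: "M > 0" using finite_carrier order_gt_0_iff_finite by (simp add: M_def)
  have hM: "h dvd M" using ord_dvd_group_order[OF c_in] ord_c by (simp add: M_def)
  define e where "e = cis (pi / M)"
  obtain m k where mk: "z = e ^ m" "coprime k (2 * M)" "k > 0" "(e ^ k) ^ m = cis (2 * pi / h)"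
    using primitive_root_conjugate[OF z_pow h_pos hM M0] unfolding e_def by blast
  have e2: "e ^ (2 * M) = 1" unfolding e_def DeMoivre using M0 by simp
  interpret K: coxeter_rep G S k
  proof unfold_locales
    show "finite (carrier G)" by (rule finite_carrier)
    show "odd k" using mk(2) by (metis coprime_common_divisor dvd_triv_left odd_one)
    fix s t assume "s \<in> S" "t \<in> S"
    then have "ord (s \<otimes> t) dvd 2 * M" using ord_dvd_group_order[of "s \<otimes> t"] S_carrier by (auto simp: M_def)
    then show "coprime k (ord (s \<otimes> t))" by (rule coprime_divisors[OF dvd_refl _ mk(2)])
  qed
  note kM = mk(2,3)[unfolded M_def]
  interpret Q: refl_rep G S "geom_space S" K.act K.aip
    by (rule K.refl_rep_aip[OF K.steinberg_conjugate[OF kM]])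
  have B1: "jform G 1 = B" by (simp only: j1)
  \<comment> \<open>In the geometric representation the powers of \<open>c\<close> sum to 0, since
    their sum projects to fixed vectors; this integer relation is transferred.\<close>
  have Kfix: "x = 0" if x: "x \<in> geom_space S" "K.act c x = x" for x :: "'a \<Rightarrow> real"
  proof -
    have ex: "emb x \<in> geom_space S" "K.act c (emb x) = emb x" using x by (simp_all add: geom_space_def gact_emb)
    have rel: "(\<Sum>i<h. of_int 1 * gact G (jform G 1) S (c [^] i) (al s) u) = (0 :: complex)" if s: "s \<in> S" for s u
    proof -
      have "(\<lambda>u. \<Sum>i<h. act (c [^] i) (al s) u) = (\<lambda>u. 0 :: complex)"
      proof (rule fix_c)
        show "(\<lambda>u. \<Sum>i<h. act (c [^] i) (al s) u :: complex) \<in> geom_space S"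
        proof -
          have "act (c [^] i) (al s :: 'a \<Rightarrow> complex) u = 0" if "u \<notin> S" for i :: nat and u
            using act_geom[OF nat_pow_closed[OF c_in] al_geom[OF s], of i] that unfolding geom_space_def by blast
          then show ?thesis by (simp add: geom_space_def)
        qed
        show "act c (\<lambda>u. \<Sum>i<h. act (c [^] i) (al s) u :: complex) = (\<lambda>u. \<Sum>i<h. act (c [^] i) (al s) u)"
          by (rule cyclic_sum_fixed[OF c_in c_h h_pos])
      qed
      from fun_cong[OF this, of u] show ?thesis unfolding B1 by simp
    qed
    have "emb x u = 0" for u
    proof -
      have "(\<Sum>i<h. of_int 1 * K.act (c [^] i) (emb x) u) = 0"
        by (rule K.transfer_relation[OF kM nat_pow_closed[OF c_in] rel ex(1)])
      then show ?thesis using h_pos unfolding K.act_pow_fixed[OF c_in ex(2)] by simp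
    qed
    then show ?thesis by (auto simp: fun_eq_iff)
  qed
  interpret Q: refl_coxeter G S "geom_space S" K.act K.aip c
  proof unfold_locales
    show "Q.Fx c = {0}" using Kfix Q.V_0 gact_zero[of G K.B S c] by (auto simp: Q.Fx_def)
  qed (rule c_in)
  obtain s a where sa: "s \<in> S" "a \<noteq> 0" "(\<lambda>u. \<Sum>i<h. z ^ ((h - 1) * i) * act (c [^] i) (al s) u) = (\<lambda>u. a * v u)"
    using exists_cyclic_sum by blast
  \<comment> \<open>The eigenvector as a family: \<open>vf 1\<close> is a multiple of
    \<open>v\<close>, and \<open>vf k\<close> is its conjugate with eigenvalue
    \<open>cis (2 * pi / h)\<close>.\<close>
  define vf where "vf j = (\<lambda>u. \<Sum>i<h. ((e ^ j) ^ m) ^ ((h - 1) * i) * gact G (jform G j) S (c [^] i) (al s) u)" for j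
  have vf1: "vf 1 = (\<lambda>u. a * v u)" unfolding vf_def B1 using sa(3) mk(1) by simp
  have pw: "((e ^ j) ^ m) ^ l = (e ^ j) ^ (m * l)" for j l by (rule power_mult[symmetric])
  have vfc: "cycv e vf"
    unfolding cycv_def vf_def pw
    by (intro allI cyc_sum cyc_mult cyc_root al_cyc[folded M_def, folded e_def] nat_pow_closed c_in)
  define y where "y = vf k"
  define th where "th = 2 * pi / h"
  have yg: "y \<in> geom_space S"
  proof -
    have "K.act (c [^] i) (al s :: 'a \<Rightarrow> complex) u = 0" if "u \<notin> S" for i :: nat and u
      using K.act_geom[OF nat_pow_closed[OF c_in] al_geom[OF sa(1)], of i] that unfolding geom_space_def by blast
    then show ?thesis by (simp add: y_def vf_def geom_space_def)
  qed
  have cy: "K.act c y = (\<lambda>u. cis th * y u)"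
  proof -
    have "cis th ^ h = 1" unfolding th_def DeMoivre using h_pos by simp
    from K.cyclic_sum_eigenvector[OF c_in c_h this h_pos, of "al s"]
    show ?thesis unfolding y_def vf_def mk(4) th_def[symmetric] .
  qed
  \<comment> \<open>The coordinates of \<open>t\<close> applied to \<open>vf j\<close>, minus
    \<open>vf j\<close>, form a family of conjugates. They vanish for \<open>j = k\<close> only if
    they do for \<open>j = 1\<close>, where regularity of \<open>v\<close> forbids it.\<close>
  have reg: "K.act t y \<noteq> y" if t: "t \<in> reflections G S" for t
  proof
    assume ty: "K.act t y = y"
    have tc: "t \<in> carrier G" by (rule reflection_carrier[OF t])
    have "cycv e (\<lambda>j. gact G (jform G j) S t (vf j))"
      unfolding e_def M_def by (rule gact_cyc[OF tc vfc[unfolded e_def M_def]])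
    then have cy: "cyc e (\<lambda>j. gact G (jform G j) S t (vf j) u - vf j u)" for u using vfc unfolding cycv_def by (intro cyc_diff) auto
    have "gact G (jform G 1) S t (vf 1) u - vf 1 u = 0" for u
      using cyc_zero_iff[OF cy e2 _ mk(2,3), of u] M0 fun_cong[OF ty, of u] by (simp add: y_def)
    then have "act t (\<lambda>u. a * v u) = (\<lambda>u. a * v u)" unfolding vf1 B1 by (intro ext) simp
    then have "a * act t v u = a * v u" for u unfolding gact_mult_scalar by (rule fun_cong)
    then have "act t v = v" using sa(2) by (intro ext) simp
    then show False using v_regular[OF t] by blast
  qed
  define kx ky where "kx = (\<lambda>u. Re (y u))" and "ky = (\<lambda>u. Im (y u))"
  have kg: "kx \<in> geom_space S" "ky \<in> geom_space S" using yg by (auto simp: kx_def ky_def geom_space_def)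
  have ckx: "K.act c kx = cos th *\<^sub>R kx - sin th *\<^sub>R ky"
    unfolding kx_def ky_def by (rule ext) (simp only: gact_Re[symmetric] cy, simp)
  have cky: "K.act c ky = sin th *\<^sub>R kx + cos th *\<^sub>R ky"
    unfolding kx_def ky_def by (rule ext) (simp only: gact_Im[symmetric] cy, simp)
  have sc: "sin th * sin th + cos th * cos th = 1" using sin_cos_squared_add[of th] by (simp add: power2_eq_square)
  have rot: "C *\<^sub>R (C *\<^sub>R kx - D *\<^sub>R ky) + D *\<^sub>R (D *\<^sub>R kx + C *\<^sub>R ky) = (D * D + C * C) *\<^sub>R kx"
    "- D *\<^sub>R (C *\<^sub>R kx - D *\<^sub>R ky) + C *\<^sub>R (D *\<^sub>R kx + C *\<^sub>R ky) = (D * D + C * C) *\<^sub>R ky" for C D :: real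
    by (auto simp: fun_eq_iff algebra_simps)
  \<comment> \<open>The inverse rotation: with it, invariance of the inner product moves
    \<open>c\<close> from \<open>x\<close> to \<open>kx\<close>.\<close>
  have ix: "K.act c (cos th *\<^sub>R kx + sin th *\<^sub>R ky) = kx"
    unfolding gact_add gact_scaleR ckx cky rot sc by (rule scaleR_one)
  have iy: "K.act c (- sin th *\<^sub>R kx + cos th *\<^sub>R ky) = ky"
    unfolding gact_add gact_scaleR ckx cky rot sc by (rule scaleR_one)
  interpret Q: coxeter_plane G S "geom_space S" K.act K.aip c kx ky h
  proof unfold_locales
    show "kx \<in> geom_space S" "ky \<in> geom_space S" by (rule kg)+
    show "2 \<le> h" by (rule h_ge_2)
    show "K.aip kx r \<noteq> 0 \<or> K.aip ky r \<noteq> 0" if r: "r \<in> Q.Phi" for r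
    proof (rule ccontr)
      assume z: "\<not> (K.aip kx r \<noteq> 0 \<or> K.aip ky r \<noteq> 0)"
      obtain t where t: "Q.isroot t r" using r unfolding Q.Phi_def by blast
      have "K.act t kx = kx" "K.act t ky = ky" using Q.rootD(5)[OF t kg(1)] Q.rootD(5)[OF t kg(2)] z by simp_all
      then have "K.act t y = y" unfolding kx_def ky_def
        by (intro ext complex_eqI) (simp_all only: gact_Re gact_Im)
      then show False using reg[OF Q.rootD(1)[OF t]] by blast
    qed
    show "K.aip kx (K.act c x) = cos (2 * pi / h) * K.aip kx x + sin (2 * pi / h) * K.aip ky x"
      if "x \<in> geom_space S" for x
      using K.aip_act[OF c_in, of "cos th *\<^sub>R kx + sin th *\<^sub>R ky" x]
      unfolding ix th_def[symmetric] by (simp only: Q.ip_add Q.ip_scale)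
    show "K.aip ky (K.act c x) = - sin (2 * pi / h) * K.aip kx x + cos (2 * pi / h) * K.aip ky x"
      if "x \<in> geom_space S" for x
      using K.aip_act[OF c_in, of "- sin th *\<^sub>R kx + cos th *\<^sub>R ky" x]
      unfolding iy th_def[symmetric] by (simp only: Q.ip_add Q.ip_scale)
    show "2 * card (reflections G S) \<le> dim (geom_space S :: ('a \<Rightarrow> real) set) * h"
      unfolding dim_geom_space[OF finite_S] by (rule card_reflections_bound)
  qed
  show ?thesis by (rule Q.join_exists[OF A])
qed

end

section \<open>The Coxeter pop-tsack torsing operator\<close>

context springer
begin

lemma reflection_NCs: assumes t: "t \<in> reflections G S" shows "t \<in> R.NCs"
proof -
  obtain r where r: "R.isroot t r" using R.root_exists[OF t] by blast
  have "abs_le G S t c" using R.abs_le_root_iff[OF r c_in] R.rootD(3)[OF r] R.Mv_c by simp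
  then show ?thesis using R.T_carrier[OF t] by (simp add: R.NCs_def)
qed

text \<open>The join is picked by choice among the least upper bounds, so existence is what gives it
  its properties.\<close>

lemma nc_proj_least: "least (NC G S c) (nc_proj G S w c) (Upper (NC G S c) {t \<in> reflections G S. abs_le G S t w})"
  unfolding nc_proj_def Lattice.sup_def by (rule someI_ex[OF join_exists]) blast

lemma nc_proj_NCs: "nc_proj G S w c \<in> R.NCs"
  using nc_proj_least[of w] by (simp add: least_def Upper_def R.NC_simps)

lemma nc_proj_carrier: "nc_proj G S w c \<in> carrier G"
  by (rule R.NCs_carrier[OF nc_proj_NCs])

lemma nc_proj_upper: assumes "t \<in> reflections G S" "abs_le G S t w" shows "abs_le G S t (nc_proj G S w c)"
proof -
  have "nc_proj G S w c \<in> Upper (NC G S c) {t \<in> reflections G S. abs_le G S t w}"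
    using nc_proj_least[of w] by (simp add: least_def)
  then show ?thesis using assms reflection_NCs[OF assms(1)] by (simp add: Upper_def R.NC_simps)
qed

lemma nc_proj_le: assumes "u \<in> R.NCs" "\<And>t. t \<in> reflections G S \<Longrightarrow> abs_le G S t w \<Longrightarrow> abs_le G S t u"
  shows "abs_le G S (nc_proj G S w c) u"
proof -
  have "u \<in> Upper (NC G S c) {t \<in> reflections G S. abs_le G S t w}"
    using assms by (auto simp: Upper_def R.NC_simps)
  then show ?thesis using nc_proj_least[of w] by (simp add: least_def R.NC_simps)
qed

lemma Fx_nc_proj: assumes w: "w \<in> carrier G" shows "R.Fx (nc_proj G S w c) \<subseteq> R.Fx w"
proof
  fix x assume x: "x \<in> R.Fx (nc_proj G S w c)"
  show "x \<in> R.Fx w"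
  proof (rule R.Fx_eq_perp_reflections[OF w])
    show "x \<in> geom_space S" using x by (simp add: R.Fx_def)
    fix t r assume r: "R.isroot t r" "r \<in> R.Mv w"
    have "abs_le G S t w" using R.abs_le_root_iff[OF r(1) w] r(2) by simp
    then have "abs_le G S t (nc_proj G S w c)" by (rule nc_proj_upper[OF R.rootD(1)[OF r(1)]])
    then have "r \<in> R.Mv (nc_proj G S w c)" using R.abs_le_root_iff[OF r(1) nc_proj_carrier] by simp
    then have "aip r x = 0" using x by (simp add: R.Mv_def)
    then show "aip x r = 0" by (simp only: R.ip_sym)
  qed
qed

lemma abs_le_of_Fx: assumes "p \<in> carrier G" "w \<in> carrier G" "R.Fx p \<subseteq> R.Fx w" "t \<in> reflections G S" "abs_le G S t w"
  shows "abs_le G S t p"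
proof -
  obtain r where r: "R.isroot t r" using R.root_exists[OF assms(4)] by blast
  have "r \<in> R.Mv w" using R.abs_le_root_iff[OF r assms(2)] assms(5) by simp
  then have "r \<in> R.Mv p" using assms(3) by (auto simp: R.Mv_def)
  then show ?thesis using R.abs_le_root_iff[OF r assms(1)] by simp
qed

lemma abs_le_conj: assumes g: "g \<in> carrier G" and u: "u \<in> carrier G" and w: "w \<in> carrier G" and le: "abs_le G S u w"
  shows "abs_le G S (g \<otimes> u \<otimes> inv g) (g \<otimes> w \<otimes> inv g)"
proof -
  have "(g \<otimes> w \<otimes> inv g) \<otimes> inv (g \<otimes> u \<otimes> inv g) = g \<otimes> (w \<otimes> inv u) \<otimes> inv g"
  proof -
    have "inv (g \<otimes> u \<otimes> inv g) = g \<otimes> (inv u \<otimes> inv g)" using g u by (simp add: inv_mult_group m_assoc)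
    moreover have "inv g \<otimes> (g \<otimes> (inv u \<otimes> inv g)) = inv u \<otimes> inv g"
      using g u by (simp add: m_assoc[symmetric])
    ultimately show ?thesis using g u w by (simp add: m_assoc)
  qed
  then show ?thesis using le R.L_conj[OF g u] R.L_conj[OF g w] R.L_conj[OF g, of "w \<otimes> inv u"] u w
    by (simp add: abs_le_def)
qed

lemma abs_le_same_length: assumes "u \<in> carrier G" "w \<in> carrier G" "abs_le G S u w" "abs_length G S u = abs_length G S w"
  shows "w = u"
proof -
  have "abs_length G S (w \<otimes> inv u) = 0" using assms(3,4) by (simp add: abs_le_def)
  then have "w \<otimes> inv u = \<one>" using R.L_zero assms(1,2) by simp
  then have "w \<otimes> inv u \<otimes> u = \<one> \<otimes> u" by simp
  then show ?thesis using assms(1,2) by (simp add: m_assoc)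
qed

text \<open>Conjugation by \<open>c\<close> preserves the noncrossing elements and, as
  \<open>c\<close> commutes with \<open>w\<close>, the reflections below \<open>w\<close>. So the
  conjugate of the projection is another upper bound, of the same length.\<close>

lemma nc_proj_commute: assumes w: "w \<in> carrier G" and wc: "c \<otimes> w = w \<otimes> c"
  shows "c \<otimes> nc_proj G S w c = nc_proj G S w c \<otimes> c"
proof -
  let ?p = "nc_proj G S w c"
  have p: "?p \<in> carrier G" by (rule nc_proj_carrier)
  define q where "q = c \<otimes> ?p \<otimes> inv c"
  have q: "q \<in> carrier G" using p c_in by (simp add: q_def)
  have c_conj: "c \<otimes> c \<otimes> inv c = c" using c_in by (simp add: m_assoc)
  have w_conj: "inv c \<otimes> w \<otimes> inv (inv c) = w"
  proof -
    have "inv c \<otimes> (w \<otimes> c) = w" unfolding wc[symmetric] using c_in w by (simp add: m_assoc[symmetric])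
    then show ?thesis using c_in w by (simp add: m_assoc)
  qed
  have "abs_le G S ?p c" using nc_proj_NCs by (simp add: R.NCs_def)
  then have "abs_le G S q c" using abs_le_conj[OF c_in p c_in] unfolding q_def c_conj by blast
  then have qN: "q \<in> R.NCs" using q by (simp add: R.NCs_def)
  have "abs_le G S ?p q"
  proof (rule nc_proj_le[OF qN])
    fix t assume t: "t \<in> reflections G S" "abs_le G S t w"
    have tc: "t \<in> carrier G" by (rule R.T_carrier[OF t(1)])
    define t' where "t' = inv c \<otimes> t \<otimes> inv (inv c)"
    have t'T: "t' \<in> reflections G S" unfolding t'_def by (rule R.T_conj[OF inv_closed[OF c_in] t(1)])
    have "abs_le G S t' w"
      using abs_le_conj[OF inv_closed[OF c_in] tc w t(2)] unfolding t'_def w_conj .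
    then have "abs_le G S t' ?p" by (rule nc_proj_upper[OF t'T])
    then have "abs_le G S (c \<otimes> t' \<otimes> inv c) q"
      unfolding q_def by (rule abs_le_conj[OF c_in R.T_carrier[OF t'T] p])
    moreover have "c \<otimes> t' \<otimes> inv c = t"
    proof -
      have "c \<otimes> (inv c \<otimes> t \<otimes> c) = t \<otimes> c" using c_in tc by (simp add: m_assoc[symmetric])
      then show ?thesis unfolding t'_def using c_in tc by (simp add: m_assoc)
    qed
    ultimately show "abs_le G S t q" by simp
  qed
  moreover have "abs_length G S ?p = abs_length G S q" unfolding q_def by (rule R.L_conj[OF c_in p, symmetric])
  ultimately have "q = ?p" by (rule abs_le_same_length[OF p q])
  then have "c \<otimes> ?p \<otimes> inv c \<otimes> c = ?p \<otimes> c" unfolding q_def by simp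
  then show ?thesis using c_in p by (simp add: m_assoc)
qed

text \<open>The projection commutes with \<open>c\<close>, so it scales \<open>v\<close>; below \<open>c\<close> it can only agree with \<open>c\<close> there.\<close>

lemma nc_proj_eq_c: assumes w: "w \<in> carrier G" and wc: "c \<otimes> w = w \<otimes> c" and w1: "w \<noteq> \<one>"
  shows "nc_proj G S w c = c"
proof -
  define p where "p = nc_proj G S w c"
  have p: "p \<in> carrier G" "p \<in> R.NCs" unfolding p_def by (rule nc_proj_carrier, rule nc_proj_NCs)
  have "act c (act p v) = act p (act c v)"
    using nc_proj_commute[OF w wc] act_mult[OF c_in p(1), of v] act_mult[OF p(1) c_in, of v] by (simp add: p_def)
  then have "act c (act p v) = (\<lambda>s. z * act p v s)" unfolding c_v gact_mult_scalar .
  then obtain a where a: "act p v = (\<lambda>s. a * v s)" using eigenspace[OF act_geom[OF p(1) v_geom]] by blast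
  have "a \<noteq> 1"
  proof
    assume "a = 1"
    then have "p = \<one>" using stabilizer[OF p(1)] a by simp
    then have "R.Fx \<one> \<subseteq> R.Fx w" using Fx_nc_proj[OF w] by (simp add: p_def)
    then have "act w x = x" if "x \<in> geom_space S" for x :: "'a \<Rightarrow> real"
      using that act_one_real[of x] by (auto simp: R.Fx_def)
    then have "w = \<one>" by (rule R.faithful[OF w])
    then show False using w1 by simp
  qed
  have actRe: "act g (\<lambda>s. Re (b * v s)) = (\<lambda>s. Re (b * (m * v s)))" if "act g v = (\<lambda>s. m * v s)" for g b m
    by (rule ext) (simp only: gact_Re[symmetric] gact_mult_scalar that)
  have geomRe: "(\<lambda>s. Re (b * v s)) \<in> geom_space S" for b using v_geom by (simp add: geom_space_def)
  \<comment> \<open>Since \<open>a \<noteq> 1\<close>, the vector \<open>b v\<close> is the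
    displacement under \<open>p\<close> of \<open>b v / (a - 1)\<close>; the moved space is real, so
    real parts are taken.\<close>
  have inMv: "(\<lambda>s. Re (b * v s)) \<in> R.Mv p" for b
  proof -
    define x where "x = (\<lambda>s. Re ((b * inverse (a - 1)) * v s))"
    have "act p x = (\<lambda>s. Re (b * inverse (a - 1) * (a * v s)))" unfolding x_def by (rule actRe[OF a])
    moreover have "Re (b * inverse (a - 1) * (a * v s)) - Re (b * inverse (a - 1) * v s) = Re (b * v s)" for s
    proof -
      have "b * inverse (a - 1) * (a * v s) - b * inverse (a - 1) * v s = b * (inverse (a - 1) * (a - 1)) * v s"
        by (simp add: algebra_simps)
      then have "b * inverse (a - 1) * (a * v s) - b * inverse (a - 1) * v s = b * v s" using \<open>a \<noteq> 1\<close> by simp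
      from arg_cong[OF this, of Re] show ?thesis unfolding minus_complex.simps .
    qed
    ultimately have "(\<lambda>s. Re (b * v s)) = act p x - x" unfolding x_def by (simp add: fun_eq_iff)
    moreover have "x \<in> geom_space S" unfolding x_def by (rule geomRe)
    ultimately show ?thesis unfolding R.Mv_iff[OF p(1)] by blast
  qed
  \<comment> \<open>As \<open>p\<close> lies below \<open>c\<close> and moves the displacement in
    question, the two agree on the real part of \<open>b v\<close>. The choices 1 and
    \<open>- \<i>\<close> of \<open>b\<close> recover the complex equation
    \<open>a v = z v\<close>.\<close>
  have re: "Re (b * (a * v s)) = Re (b * (z * v s))" for b s
  proof -
    let ?x = "\<lambda>s. Re (b * v s)"
    have "act c ?x - ?x = (\<lambda>s. Re ((b * (z - 1)) * v s))"
      unfolding actRe[OF c_v] by (rule ext) (simp add: algebra_simps)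
    then have "act c ?x - ?x \<in> R.Mv p" using inMv[of "b * (z - 1)"] by simp
    then have "act p ?x = act c ?x" using R.NCs_agree[OF p(2)] geomRe[of b] unfolding R.agree_def by blast
    then have "(\<lambda>s. Re (b * (a * v s))) = (\<lambda>s. Re (b * (z * v s)))" unfolding actRe[OF a] actRe[OF c_v] .
    then show ?thesis by (rule fun_cong)
  qed
  have "a * v s = z * v s" for s using re[of 1 s] re[of "- \<i>" s] by (intro complex_eqI) simp_all
  then have "act p v = act c v" unfolding a c_v by (rule ext)
  then have "act (inv c) (act p v) = act (inv c) (act c v)" by simp
  then have "act (inv c \<otimes> p) v = act (inv c \<otimes> c) v" using c_in p(1) by (simp only: act_mult inv_closed)
  then have "act (inv c \<otimes> p) v = v" using c_in by (simp add: act_one)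
  then have "inv c \<otimes> p = \<one>" using stabilizer[of "inv c \<otimes> p"] c_in p(1) by simp
  then have "c \<otimes> (inv c \<otimes> p) = c" using c_in by simp
  then have "p = c" using c_in p(1) by (simp add: m_assoc[symmetric])
  then show ?thesis by (simp add: p_def)
qed

lemma nc_proj_one: "nc_proj G S \<one> c = \<one>"
proof -
  have "abs_le G S (nc_proj G S \<one> c) \<one>" by (rule nc_proj_le[OF R.one_NCs])
  then have "abs_length G S (nc_proj G S \<one> c) = 0" by (simp add: abs_le_def R.L_one)
  then show ?thesis by (rule R.L_zero[OF nc_proj_carrier])
qed

section \<open>Iterates and preimages\<close>

lemma pow_ne_one: assumes "1 \<le> i" "i < h" shows "inv (c [^] i) \<noteq> \<one>"
proof
  assume "inv (c [^] i) = \<one>"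
  then have "c [^] i = \<one>" using c_in by (simp add: inv_eq_1_iff)
  then have "h dvd i" using pow_eq_id c_in ord_c by simp
  then show False using assms by (auto dest: dvd_imp_le)
qed

lemma inv_pow_commute: "c \<otimes> inv (c [^] i) = inv (c [^] i) \<otimes> c" for i :: nat
proof -
  have "c [^] i \<otimes> c = c \<otimes> c [^] i" using c_in by (simp add: nat_pow_Suc2[symmetric])
  then have "inv (c [^] i) \<otimes> (c [^] i \<otimes> c) \<otimes> inv (c [^] i) = inv (c [^] i) \<otimes> (c \<otimes> c [^] i) \<otimes> inv (c [^] i)" by simp
  moreover have "inv (c [^] i) \<otimes> (c [^] i \<otimes> c) = c" using c_in by (simp add: m_assoc[symmetric])
  ultimately show ?thesis using c_in by (simp add: m_assoc)
qed

lemma nc_proj_pow: assumes "1 \<le> i" "i < h" shows "nc_proj G S (inv (c [^] i)) c = c"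
  by (rule nc_proj_eq_c[OF _ inv_pow_commute pow_ne_one[OF assms]]) (use c_in in simp)

lemma Pop_pow: assumes "1 \<le> i" "i < h" shows "Pop G S (inv (c [^] i)) c = inv (c [^] Suc i)"
proof -
  have "inv (c [^] Suc i) = inv (c [^] i) \<otimes> inv c"
    using c_in by (simp only: nat_pow_Suc2 inv_mult_group nat_pow_closed)
  then show ?thesis by (simp add: Pop_def nc_proj_pow[OF assms])
qed

lemma Pop_one: "Pop G S \<one> c = \<one>" by (simp add: Pop_def nc_proj_one)

lemma Pop_preimage: assumes w: "w \<in> carrier G" and i: "1 \<le> i" "i < h" and eq: "Pop G S w c = inv (c [^] i)"
  shows "w = inv (c [^] (i - 1)) \<and> i \<noteq> 1"
proof -
  define p where "p = nc_proj G S w c"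
  define g where "g = inv (c [^] i)"
  have gc: "g \<in> carrier G" using c_in by (simp add: g_def)
  have p: "p \<in> carrier G" "p \<in> R.NCs" unfolding p_def by (rule nc_proj_carrier, rule nc_proj_NCs)
  have "w \<otimes> inv p = g" using eq by (simp add: Pop_def p_def g_def)
  then have "w \<otimes> inv p \<otimes> p = g \<otimes> p" by simp
  then have wg: "w = g \<otimes> p" using w p(1) by (simp add: m_assoc)
  have "R.Fx p \<subseteq> R.Fx g"
  proof
    fix x assume x: "x \<in> R.Fx p"
    then have "x \<in> R.Fx w" using Fx_nc_proj[OF w] by (auto simp: p_def)
    then have "act g (act p x) = x" using act_mult_real[OF gc p(1), of x] by (simp add: R.Fx_def wg)
    then show "x \<in> R.Fx g" using x by (simp add: R.Fx_def)
  qed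
  then have "abs_le G S (nc_proj G S g c) p" using abs_le_of_Fx[OF p(1) gc] by (intro nc_proj_le[OF p(2)])
  then have "abs_le G S c p" unfolding g_def nc_proj_pow[OF i] .
  moreover have "abs_le G S p c" using p(2) by (simp add: R.NCs_def)
  ultimately have pc: "p = c" using R.abs_le_antisym[OF p(1) c_in] by blast
  have Suc_i: "Suc (i - 1) = i" using i by simp
  have "c [^] i = c [^] (i - 1) \<otimes> c" using nat_pow_Suc[of c "i - 1"] unfolding Suc_i .
  then have "g = inv c \<otimes> inv (c [^] (i - 1))" unfolding g_def using c_in by (simp add: inv_mult_group)
  then have "w = inv c \<otimes> (inv (c [^] (i - 1)) \<otimes> c)" unfolding wg pc using c_in by (simp add: m_assoc)
  then have w_eq: "w = inv (c [^] (i - 1))"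
    unfolding inv_pow_commute[symmetric] using c_in by (simp add: m_assoc[symmetric])
  \<comment> \<open>For \<open>i = 1\<close> the only candidate is the identity, which the operator
    fixes; hence \<open>inv c\<close> has no preimage.\<close>
  have "i \<noteq> 1"
  proof
    assume "i = 1"
    then have "w = \<one>" using w_eq by simp
    then have "inv (c [^] i) = \<one>" using eq Pop_one by simp
    then show False using pow_ne_one[OF i] by blast
  qed
  then show ?thesis using w_eq by blast
qed

lemma Pop_iterate: "((\<lambda>w. Pop G S w c) ^^ k) (inv c) = (if Suc k < h then inv (c [^] Suc k) else \<one>)"
proof (induction k)
  case 0
  show ?case using h_ge_2 c_in by simp
next
  case (Suc k)
  show ?case
  proof (cases "Suc k < h")
    case True
    then have "((\<lambda>w. Pop G S w c) ^^ Suc k) (inv c) = inv (c [^] Suc (Suc k))" using Suc Pop_pow[of "Suc k"] by simp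
    moreover have "inv (c [^] h) = \<one>" by (simp add: c_h)
    moreover have "Suc (Suc k) < h \<or> Suc (Suc k) = h" using True by linarith
    ultimately show ?thesis by (metis less_irrefl)
  next
    case False
    then show ?thesis using Suc Pop_one by simp
  qed
qed

lemma neg_int_pow: "c [^] (- int i) = inv (c [^] i)"
  using c_in by (simp add: int_pow_neg int_pow_int)

theorem Pop_orbit:
  "forward_orbit (\<lambda>w. Pop G S w c) (inv c) = {c [^] (- int i) | i. 1 \<le> i \<and> i \<le> h - 1} \<union> {\<one>}"
proof -
  have "forward_orbit (\<lambda>w. Pop G S w c) (inv c) = {if Suc k < h then inv (c [^] Suc k) else \<one> | k. True}"
    unfolding forward_orbit_def Pop_iterate ..
  also have "\<dots> = {inv (c [^] i) | i. 1 \<le> i \<and> i \<le> h - 1} \<union> {\<one>}"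
  proof (intro equalityI subsetI)
    fix x assume "x \<in> {if Suc k < h then inv (c [^] Suc k) else \<one> | k. True}"
    then obtain k where k: "x = (if Suc k < h then inv (c [^] Suc k) else \<one>)" by blast
    show "x \<in> {inv (c [^] i) | i. 1 \<le> i \<and> i \<le> h - 1} \<union> {\<one>}"
    proof (cases "Suc k < h")
      case True
      then have "x = inv (c [^] Suc k)" using k by (simp only: if_True)
      moreover have "1 \<le> Suc k" "Suc k \<le> h - 1" using True by linarith+
      ultimately show ?thesis by blast
    qed (simp add: k)
  next
    fix x assume "x \<in> {inv (c [^] i) | i. 1 \<le> i \<and> i \<le> h - 1} \<union> {\<one>}"
    then consider i where "x = inv (c [^] i)" "1 \<le> i" "i \<le> h - 1" | "x = \<one>" by blast
    then show "x \<in> {if Suc k < h then inv (c [^] Suc k) else \<one> | k. True}"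
    proof cases
      case 1
      then have "Suc (i - 1) = i" "Suc (i - 1) < h" using h_pos by linarith+
      then have "x = (if Suc (i - 1) < h then inv (c [^] Suc (i - 1)) else \<one>)" using 1(1) by (simp only: if_True)
      then show ?thesis by blast
    next
      case 2
      then have "x = (if Suc h < h then inv (c [^] Suc h) else \<one>)" by simp
      then show ?thesis by blast
    qed
  qed
  finally show ?thesis unfolding neg_int_pow .
qed

theorem Pop_no_preimage: "{w \<in> carrier G. Pop G S w c = inv c} = {}"
proof -
  have "Pop G S w c \<noteq> inv c" if w: "w \<in> carrier G" for w
    using Pop_preimage[OF w, of 1] h_ge_2 c_in by auto
  then show ?thesis by blast
qed

theorem Pop_unique_preimage: assumes i: "2 \<le> i" "i \<le> h - 1"
  shows "{w \<in> carrier G. Pop G S w c = c [^] (- int i)} = {c [^] (- int (i - 1))}"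
proof -
  have "Suc (i - 1) = i" "1 \<le> i - 1" "i - 1 < h" "1 \<le> i" "i < h" using i h_ge_2 by linarith+
  then have "Pop G S (inv (c [^] (i - 1))) c = inv (c [^] i)" using Pop_pow[of "i - 1"] by simp
  moreover have "w = inv (c [^] (i - 1))" if "w \<in> carrier G" "Pop G S w c = inv (c [^] i)" for w
    using Pop_preimage[OF that(1) \<open>1 \<le> i\<close> \<open>i < h\<close> that(2)] by blast
  ultimately show ?thesis unfolding neg_int_pow using c_in by auto
qed

end

theorem theorem4p10:
  fixes G (structure) and S :: "'a set" and h :: nat and c :: 'a
  assumes "finite_irreducible_coxeter_system G S"
    and "is_coxeter_number G S h"
    and "coxeter_element G S h c"
  shows "forward_orbit (\<lambda>w. Pop G S w c) (inv c) =
           {c [^] (- int i) | i. 1 \<le> i \<and> i \<le> h - 1} \<union> {\<one>} \<and>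
         {w \<in> carrier G. Pop G S w c = inv c} = {} \<and>
         (\<forall>i. 2 \<le> i \<and> i \<le> h - 1 \<longrightarrow>
           {w \<in> carrier G. Pop G S w c = c [^] (- int i)} = {c [^] (- int (i - 1))})"
proof -
  interpret F: finite_irreducible_coxeter_system G S by (rule assms(1))
  interpret P: geom_rep G S 1 by unfold_locales (auto simp: F.finite_group)
  obtain f d where fd: "basic_invariants G S f d" "h = Max (d ` {..<card S})"
    using assms(2) unfolding is_coxeter_number_def by blast
  have c: "c \<in> carrier G" "group.ord G c = h" using assms(3) by (auto simp: coxeter_element_def regular_element_def)
  obtain v :: "'a \<Rightarrow> complex" and z where v: "v \<in> geom_space S" "v \<noteq> (\<lambda>_. 0)" "geom_action G S c v = (\<lambda>s. z * v s)"
    "\<And>t. t \<in> reflections G S \<Longrightarrow> v \<notin> reflecting_hyperplane G S t"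
    using assms(3) unfolding coxeter_element_def regular_element_def by blast
  interpret X: springer G S 1 f d h c v z
  proof unfold_locales
    show "S \<noteq> {}" by (rule F.rank_pos)
    show "(s, t) \<in> (diagram_edges G S)\<^sup>*" if "s \<in> S" "t \<in> S" for s t by (rule F.diagram_connected[OF that])
    show "gact G (jform G 1) S t v \<noteq> v" if "t \<in> reflections G S" for t
      using v(4)[OF that] v(1) by (simp only: reflecting_hyperplane_def geom_action_eq_gact mem_Collect_eq) blast
  qed (fact fd c v(1,2) v(3)[unfolded geom_action_eq_gact])+
  show ?thesis
    using X.Pop_orbit X.Pop_no_preimage X.Pop_unique_preimage by blast
qed

end
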